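(* Fix $\delta,\lambda,L_0,A_0\in\mathbb{R}$ with $\lambda>0$ and $L_0>0$. Let $\gamma\in H^2_{imm}([0,2\pi];\mathbb{R}^2)$ be parametrized proportional to arc length (i.e. $|\partial_x\gamma|=L(\gamma)/(2\pi)$ on $[0,2\pi]$) with $\int_0^{2\pi}\gamma\,\mathrm{d}x=0$, and let $\eta\in H^1_{per}([0,2\pi];\mathbb{R}^2)$. Suppose that $(\gamma,\eta)$ is (i) a critical point of $E_{LM}$ subject to the constraints $A(\gamma)=A_0$ and $S(\eta)=0$, or (ii) a critical point of $E$ subject to the constraints $L(\gamma)=L_0$, $A(\gamma)=A_0$ and $S(\eta)=0$, where $A_0\in[-L_0^2/(4\pi),L_0^2/(4\pi)]$ and the curvature $\kappa$ of $\gamma$ is not constant. Let $\psi^*\in H^{-1}_{per}([0,2\pi])$ be the Lagrange multiplier associated with the constraint $S(\eta)=0$. Then $\gamma,\eta\in C^\infty_{per}([0,2\pi];\mathbb{R}^2)$, and $\psi^*=\psi_0^*+\partial_s\psi_1^*$ with $\psi_0^*,\psi_1^*\in C^\infty_{per}([0,2\pi])$. For every $k\in\mathbb{N}$ there exists a constant $C_k=C_k(\|\gamma\|_{H^2},\|\eta\|_{H^1},\|\psi^*\|_{H^{-1}})$ (which may also depend on the fixed data $\delta,\lambda,L_0,A_0$) with $$\|\gamma\|_{W^{k+2,\infty}}+\|\eta\|_{W^{k+1,\infty}}+\|\psi_0^*\|_{W^{k,\infty}}+\|\psi_1^*\|_{W^{k,\infty}}\le C_k(\|\gamma\|_{H^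2},\|\eta\|_{H^1},\|\psi^*\|_{H^{-1}}).$$
   Context: Let $\langle\cdot,\cdot\rangle$ be the Euclidean inner product on $\mathbb{R}^2$ and $J$ the counterclockwise rotation by $\pi/2$. For $k\in\mathbb{N}=\{1,2,\dots\}$, $H^k_{per}([0,2\pi];\mathbb{R}^m)$ is the set of $f\in H^k([0,2\pi];\mathbb{R}^m)$ with $\partial_x^\ell f(0)=\partial_x^\ell f(2\pi)$ for $\ell=0,\dots,k-1$; $H^k_{per}([0,2\pi])$ denotes the case $m=1$, and $H^{-1}_{per}([0,2\pi])$ is the dual of $H^1_{per}([0,2\pi])$. $C^\infty_{per}$ is the set of smooth functions on $[0,2\pi]$ with $\partial_x^\ell f(0)=\partial_x^\ell f(2\pi)$ for all $\ell\ge0$. $H^2_{imm}([0,2\pi];\mathbb{R}^2)$ is the set (open in $H^2_{per}$) of $\gamma\in H^2_{per}([0,2\pi];\mathbb{R}^2)$ with $\partial_x\gamma(x)\neq0$ for all $x$. For $\gamma\in H^2_{imm}$: $\partial_s=|\partial_x\gamma|^{-1}\partial_x$, $\tau=\partial_s\gamma$, $\nu=J\tau$, the curvature $\kappa$ is defined by $\partial_s\tau=\kappa\nu$, $\int_\gamma f\,\mathrm{d}s=\int_0^{2\pi}f|\partial_x\gamma|\,\mathrm{d}x$, $L(\gamma)=\int_\gamma1\,\mathrm{d}s$, and $A(\gamma)=-\frac12\int_0^{2\pi}\langle\gamma,J\partial_x\gamma\rangle\,\mathrm{d}x$ is the signed enclosed area. For $\eta\in H^1_{per}([0,2\pi];\mathbb{R}^2)$: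 $\operatorname{div}_\gamma\eta=\langle\partial_s\eta,\tau\rangle$, $\nabla_\gamma\eta=\partial_s\eta\otimes\tau$ (so $|\nabla_\gamma\eta|=|\partial_s\eta|$), and $S(\eta)=|\eta|^2-1\in H^1_{per}([0,2\pi])$, so that $S'(\eta)[\psi]=2\langle\eta,\psi\rangle$. The energies are $$E(\gamma,\eta)=\frac12\int_\gamma(\kappa+\delta\operatorname{div}_\gamma\eta)^2\,\mathrm{d}s+\frac\lambda2\int_\gamma|\nabla_\gamma\eta|^2\,\mathrm{d}s,\qquad E_{LM}(\gamma,\eta)=E(\gamma,\eta)+L(\gamma).$$ Writing $\partial_\gamma,\partial_\eta$ for the partial derivatives, $(\gamma,\eta)$ is a critical point of $E_{LM}$ subject to $A(\gamma)=A_0$, $S(\eta)=0$ if it satisfies these constraints and there are Lagrange multipliers $a\in\mathbb{R}$, $\psi^*\in H^{-1}_{per}([0,2\pi])$ such that for all $\varphi\in H^2_{per}([0,2\pi];\mathbb{R}^2)$, $\psi\in H^1_{per}([0,2\pi];\mathbb{R}^2)$ $$\partial_\gamma E_{LM}(\gamma,\eta)[\varphi]+\partial_\eta E_{LM}(\gamma,\eta)[\psi]+a\,A'(\gamma)[\varphi]+\langle\psi^*,S'(\eta)[\psi]\rangle=0.$$ It is a critical point of $E$ subject to $L(\gamma)=L_0$, $A(\gamma)=A_0$, $S(\eta)=0$ if it satisfies these constraints and the same identity holds with $E$ in place of $E_{LM}$ and with an additional term $\ell\,L'(\gamma)[\varphi]$ on the left, for some $\ell\in\mathbb{R}$. The functional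 $\psi_0^*+\partial_s\psi_1^*$ acts on $f\in H^1_{per}([0,2\pi])$ by $\int_\gamma(\psi_0^*f-\psi_1^*\partial_sf)\,\mathrm{d}s$. *)

theory Defs
  imports "HOL-Analysis.Analysis" "HOL-Probability.Essential_Supremum"
begin

text \<open>
  Functions on the interval from 0 to 2 pi are represented by total functions on the reals whose
  values outside the interval are irrelevant: every notion below depends only on the restriction
  to the interval.
\<close>

abbreviation dom_I :: "real set"
  where "dom_I \<equiv> {0..2 * pi}"

abbreviation leb_I :: "real measure"
  where "leb_I \<equiv> lebesgue_on dom_I"


subsection \<open>Sobolev spaces on the interval\<close>

definition L2_fun :: "(real \<Rightarrow> 'a::euclidean_space) \<Rightarrow> bool"
  where "L2_fun f \<longleftrightarrow> f \<in> borel_measurable leb_I \<and> integrable leb_I (\<lambda>x. (norm (f x))\<^sup>2)"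

text \<open>
  Continuously differentiable functions with compact support in the open interval, together with
  their derivative. (As in Brezis' book, one derivative suffices for the test functions; infinitely
  differentiable ones lead to the same weak derivative.)
\<close>

definition test_fun :: "(real \<Rightarrow> real) \<Rightarrow> (real \<Rightarrow> real) \<Rightarrow> bool"
  where "test_fun \<phi> \<phi>' \<longleftrightarrow>
    (\<forall>x. (\<phi> has_real_derivative \<phi>' x) (at x)) \<and> continuous_on UNIV \<phi>' \<and>
    (\<exists>a b. 0 < a \<and> a \<le> b \<and> b < 2 * pi \<and> (\<forall>x. x \<notin> {a..b} \<longrightarrow> \<phi> x = 0))"

definition has_weak_deriv :: "(real \<Rightarrow> 'a::euclidean_space) \<Rightarrow> (real \<Rightarrow> 'a) \<Rightarrow> bool"
  where "has_weak_deriv f g \<longleftrightarrow> integrable leb_I f \<and> integrable leb_I g \<and>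
    (\<forall>\<phi> \<phi>'. test_fun \<phi> \<phi>' \<longrightarrow>
      (LINT x|leb_I. \<phi>' x *\<^sub>R f x) = - (LINT x|leb_I. \<phi> x *\<^sub>R g x))"

text \<open>
  The weak derivative is unique up to null sets. If it has a representative that is continuous on
  the closed interval, then such a representative is chosen (it is unique on the interval), so that
  point values such as those of the first derivative of an \<open>H\<^sup>2\<close> function are meaningful.
\<close>

definition wderiv :: "(real \<Rightarrow> 'a::euclidean_space) \<Rightarrow> real \<Rightarrow> 'a"
  where "wderiv f = (SOME g. has_weak_deriv f g \<and>
    ((\<exists>h. has_weak_deriv f h \<and> continuous_on dom_I h) \<longrightarrow> continuous_on dom_I g))"

primrec sobolev_H :: "nat \<Rightarrow> (real \<Rightarrow> 'a::euclidean_space) set"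
  where
    "sobolev_H 0 = {f. L2_fun f}"
  | "sobolev_H (Suc k) = {f. L2_fun f \<and> (\<exists>g. has_weak_deriv f g \<and> g \<in> sobolev_H k)}"

text \<open>
  Used for \<open>k \<ge> 1\<close> only; continuity of \<open>f\<close> selects the continuous representative, and
  the derivatives of order \<open>1, \<dots>, k - 1\<close> are the continuous representatives by the choice
  made in \<open>wderiv\<close>.
\<close>

definition H_per :: "nat \<Rightarrow> (real \<Rightarrow> 'a::euclidean_space) set"
  where "H_per k = {f \<in> sobolev_H k. continuous_on dom_I f \<and>
    (\<forall>l<k. (wderiv ^^ l) f 0 = (wderiv ^^ l) f (2 * pi))}"

definition H_norm :: "nat \<Rightarrow> (real \<Rightarrow> 'a::euclidean_space) \<Rightarrow> real"
  where "H_norm k f = sqrt (\<Sum>l\<le>k. LINT x|leb_I. (norm ((wderiv ^^ l) f x))\<^sup>2)"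

definition W_inf_norm :: "nat \<Rightarrow> (real \<Rightarrow> 'a::euclidean_space) \<Rightarrow> ereal"
  where "W_inf_norm k f = (\<Sum>l\<le>k. esssup leb_I (\<lambda>x. ereal (norm ((wderiv ^^ l) f x))))"

definition H_neg1_per :: "((real \<Rightarrow> real) \<Rightarrow> real) set"
  where "H_neg1_per = {\<Psi>.
    (\<forall>f\<in>H_per 1. \<forall>g\<in>H_per 1. \<Psi> (\<lambda>x. f x + g x) = \<Psi> f + \<Psi> g) \<and>
    (\<forall>c. \<forall>f\<in>H_per 1. \<Psi> (\<lambda>x. c * f x) = c * \<Psi> f) \<and>
    (\<exists>C. \<forall>f\<in>H_per 1. \<bar>\<Psi> f\<bar> \<le> C * H_norm 1 f)}"

definition H_neg1_norm :: "((real \<Rightarrow> real) \<Rightarrow> real) \<Rightarrow> real"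
  where "H_neg1_norm \<Psi> = (SUP f\<in>{f \<in> H_per 1. H_norm 1 f \<le> 1}. \<bar>\<Psi> f\<bar>)"

text \<open>Classical derivative on the closed interval, one-sided at the end points.\<close>

definition cderiv :: "(real \<Rightarrow> 'a::euclidean_space) \<Rightarrow> real \<Rightarrow> 'a"
  where "cderiv f x = vector_derivative f (at x within dom_I)"

definition C_inf_per :: "(real \<Rightarrow> 'a::euclidean_space) set"
  where "C_inf_per = {f. \<forall>n.
    (\<forall>x\<in>dom_I. (cderiv ^^ n) f differentiable (at x within dom_I)) \<and>
    (cderiv ^^ n) f 0 = (cderiv ^^ n) f (2 * pi)}"


subsection \<open>Geometry of curves\<close>

definition rotJ :: "real^2 \<Rightarrow> real^2"
  where "rotJ v = vector [- (v $ 2), v $ 1]"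

definition H2_imm :: "(real \<Rightarrow> real^2) set"
  where "H2_imm = {\<gamma> \<in> H_per 2. \<forall>x\<in>dom_I. wderiv \<gamma> x \<noteq> 0}"

definition dds :: "(real \<Rightarrow> real^2) \<Rightarrow> (real \<Rightarrow> 'a::euclidean_space) \<Rightarrow> real \<Rightarrow> 'a"
  where "dds \<gamma> f x = (1 / norm (wderiv \<gamma> x)) *\<^sub>R wderiv f x"

definition tangent :: "(real \<Rightarrow> real^2) \<Rightarrow> real \<Rightarrow> real^2"
  where "tangent \<gamma> = dds \<gamma> \<gamma>"

definition normal_vec :: "(real \<Rightarrow> real^2) \<Rightarrow> real \<Rightarrow> real^2"
  where "normal_vec \<gamma> x = rotJ (tangent \<gamma> x)"

text \<open>
  The tangent has unit length, so its arc length derivative is a multiple of the unit normal almost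
  everywhere; the coefficient is the following inner product.
\<close>

definition curvature :: "(real \<Rightarrow> real^2) \<Rightarrow> real \<Rightarrow> real"
  where "curvature \<gamma> x = dds \<gamma> (tangent \<gamma>) x \<bullet> normal_vec \<gamma> x"

definition line_int :: "(real \<Rightarrow> real^2) \<Rightarrow> (real \<Rightarrow> real) \<Rightarrow> real"
  where "line_int \<gamma> f = (LINT x|leb_I. f x * norm (wderiv \<gamma> x))"

definition curve_length :: "(real \<Rightarrow> real^2) \<Rightarrow> real"
  where "curve_length \<gamma> = line_int \<gamma> (\<lambda>_. 1)"

definition signed_area :: "(real \<Rightarrow> real^2) \<Rightarrow> real"
  where "signed_area \<gamma> = - (1 / 2) * (LINT x|leb_I. \<gamma> x \<bullet> rotJ (wderiv \<gamma> x))"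

definition div_along :: "(real \<Rightarrow> real^2) \<Rightarrow> (real \<Rightarrow> real^2) \<Rightarrow> real \<Rightarrow> real"
  where "div_along \<gamma> \<eta> x = dds \<gamma> \<eta> x \<bullet> tangent \<gamma> x"

text \<open>The norm of the type of 2 x 2 matrices is the Frobenius norm.\<close>

definition grad_along :: "(real \<Rightarrow> real^2) \<Rightarrow> (real \<Rightarrow> real^2) \<Rightarrow> real \<Rightarrow> real^2^2"
  where "grad_along \<gamma> \<eta> x = (\<chi> i j. dds \<gamma> \<eta> x $ i * tangent \<gamma> x $ j)"


subsection \<open>Energies and critical points\<close>

definition energy :: "real \<Rightarrow> real \<Rightarrow> (real \<Rightarrow> real^2) \<Rightarrow> (real \<Rightarrow> real^2) \<Rightarrow> real"
  where "energy \<delta> lam \<gamma> \<eta> =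
    1 / 2 * line_int \<gamma> (\<lambda>x. (curvature \<gamma> x + \<delta> * div_along \<gamma> \<eta> x)\<^sup>2) +
    lam / 2 * line_int \<gamma> (\<lambda>x. (norm (grad_along \<gamma> \<eta> x))\<^sup>2)"

definition energy_LM :: "real \<Rightarrow> real \<Rightarrow> (real \<Rightarrow> real^2) \<Rightarrow> (real \<Rightarrow> real^2) \<Rightarrow> real"
  where "energy_LM \<delta> lam \<gamma> \<eta> = energy \<delta> lam \<gamma> \<eta> + curve_length \<gamma>"

text \<open>Derivative of a functional at \<open>u\<close> in direction \<open>h\<close>.\<close>

definition dir_deriv :: "((real \<Rightarrow> real^2) \<Rightarrow> real) \<Rightarrow> (real \<Rightarrow> real^2) \<Rightarrow> (real \<Rightarrow> real^2) \<Rightarrow> real"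
  where "dir_deriv F u h = deriv (\<lambda>t::real. F (\<lambda>x. u x + t *\<^sub>R h x)) 0"

definition S_constr :: "(real \<Rightarrow> real^2) \<Rightarrow> real \<Rightarrow> real"
  where "S_constr \<eta> x = (norm (\<eta> x))\<^sup>2 - 1"

definition S_deriv :: "(real \<Rightarrow> real^2) \<Rightarrow> (real \<Rightarrow> real^2) \<Rightarrow> real \<Rightarrow> real"
  where "S_deriv \<eta> \<psi> x = 2 * (\<eta> x \<bullet> \<psi> x)"

text \<open>
  In both definitions \<open>\<Psi>\<close> is the multiplier of the constraint \<open>S(\<eta>) = 0\<close>, and
  \<open>a\<close>, \<open>l\<close> are those of the area and the length.
\<close>

definition critical_LM ::
    "real \<Rightarrow> real \<Rightarrow> real \<Rightarrow> (real \<Rightarrow> real^2) \<Rightarrow> (real \<Rightarrow> real^2) \<Rightarrow> ((real \<Rightarrow> real) \<Rightarrow> real) \<Rightarrow> bool"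
  where "critical_LM \<delta> lam A0 \<gamma> \<eta> \<Psi> \<longleftrightarrow>
    signed_area \<gamma> = A0 \<and> (\<forall>x\<in>dom_I. S_constr \<eta> x = 0) \<and> \<Psi> \<in> H_neg1_per \<and>
    (\<exists>a::real. \<forall>\<phi>\<in>H_per 2. \<forall>\<psi>\<in>H_per 1.
      dir_deriv (\<lambda>g. energy_LM \<delta> lam g \<eta>) \<gamma> \<phi> + dir_deriv (energy_LM \<delta> lam \<gamma>) \<eta> \<psi> +
      a * dir_deriv signed_area \<gamma> \<phi> + \<Psi> (S_deriv \<eta> \<psi>) = 0)"

definition critical_length ::
    "real \<Rightarrow> real \<Rightarrow> real \<Rightarrow> real \<Rightarrow> (real \<Rightarrow> real^2) \<Rightarrow> (real \<Rightarrow> real^2) \<Rightarrow> ((real \<Rightarrow> real) \<Rightarrow> real) \<Rightarrow> bool"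
  where "critical_length \<delta> lam L0 A0 \<gamma> \<eta> \<Psi> \<longleftrightarrow>
    curve_length \<gamma> = L0 \<and> signed_area \<gamma> = A0 \<and> (\<forall>x\<in>dom_I. S_constr \<eta> x = 0) \<and>
    \<Psi> \<in> H_neg1_per \<and>
    (\<exists>(a::real) (l::real). \<forall>\<phi>\<in>H_per 2. \<forall>\<psi>\<in>H_per 1.
      dir_deriv (\<lambda>g. energy \<delta> lam g \<eta>) \<gamma> \<phi> + dir_deriv (energy \<delta> lam \<gamma>) \<eta> \<psi> +
      l * dir_deriv curve_length \<gamma> \<phi> + a * dir_deriv signed_area \<gamma> \<phi> +
      \<Psi> (S_deriv \<eta> \<psi>) = 0)"

text \<open>The functional \<open>\<psi>\<^sub>0\<^sup>* + \<partial>\<^sub>s \<psi>\<^sub>1\<^sup>*\<close>.\<close>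

definition dual_repr ::
    "(real \<Rightarrow> real^2) \<Rightarrow> (real \<Rightarrow> real) \<Rightarrow> (real \<Rightarrow> real) \<Rightarrow> (real \<Rightarrow> real) \<Rightarrow> real"
  where "dual_repr \<gamma> \<psi>0 \<psi>1 f = line_int \<gamma> (\<lambda>x. \<psi>0 x * f x - \<psi>1 x * dds \<gamma> f x)"

end

theory Submission
  imports Defs "HOL-Real_Asymp.Real_Asymp"
begin

text \<open>
  Let \<open>w = \<kappa> + \<delta> div \<eta>\<close> and \<open>\<sigma> = \<langle>\<partial>\<^sub>s\<eta>, J\<eta>\<rangle>\<close>. Testing the equation for the curve with variations of
  prescribed derivative makes it a weak first order equation for \<open>w\<nu>\<close>; testing the equation for the
  director with multiples of \<open>J\<eta>\<close> removes \<open>\<psi>\<^sup>*\<close>. The components give a polynomial system of ordinary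
  differential equations for \<open>(\<gamma>, \<tau>, \<eta>, w, u)\<close> with \<open>u = \<lambda>\<sigma> + \<delta>w\<langle>J\<eta>,\<tau>\<rangle>\<close>, together with the first
  integral \<open>w\<^sup>2/2 + \<lambda>\<sigma>\<^sup>2/2 = \<ell> + a\<langle>J\<gamma>,\<tau>\<rangle> + \<langle>K,\<tau>\<rangle>\<close>. Hence the solutions are smooth, and since \<open>\<ell>\<close>
  does not occur in the system, all derivatives are controlled by the norms of \<open>\<gamma>\<close>, \<open>\<eta>\<close> and by \<open>|a|\<close>.

  Put \<open>h = \<langle>J\<gamma>,\<tau>\<rangle>\<close>, \<open>q = \<langle>\<gamma>,\<tau>\<rangle>\<close>, and let \<open>R\<close> be the mean of \<open>h\<close>, which is determined by area and
  length. Multiplying the first integral by \<open>h\<close> bounds \<open>|a|\<close> if \<open>\<ell> = 1\<close>, and also if \<open>R = 0\<close>, where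
  \<open>\<ell>\<close> is bounded. In the length constrained case with \<open>R \<noteq> 0\<close>, a large \<open>|a|\<close> forces \<open>h\<close> close to \<open>R\<close>
  and \<open>q\<close> close to \<open>0\<close>; then the turning number equals the winding number around the origin, the total
  curvature is exactly that of a circle, and with \<open>c = L/(2\<pi>)\<close>
  \<open>\<integral>|\<gamma>|\<^sup>2 + c\<^sup>4\<integral>\<kappa>\<^sup>2 - 2\<pi>R\<^sup>2 - 2\<pi>c\<^sup>4/R\<^sup>2 = \<integral>(h - R)\<^sup>2 + \<integral>q\<^sup>2 + c\<^sup>4\<integral>(\<kappa> - 1/R)\<^sup>2\<close>.
  The left hand side is determined by the \<open>H\<^sup>2\<close> norm of \<open>\<gamma>\<close> and the data, is positive unless the
  curvature is constant, and the right hand side is small for large \<open>|a|\<close>. So \<open>|a|\<close> is bounded.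
\<close>

section \<open>Absolutely continuous functions\<close>

text \<open>The obstacle under a length constraint is the circle. On a circle about the origin the
  first variations of length and area are proportional, so \<open>l\<close> and \<open>a\<close> can
  be traded against each other with \<open>l + a * R\<close> fixed, and no bound on \<open>a\<close>
  can hold. A large multiplier forces the curve close to such a circle, and the constant may depend
  on the curve only through norms, so closeness must be measured by a quantity that the norms
  determine. The natural squared distance contains the total curvature, which they do not determine.
  Multiplied by \<open>c\<close>, however, it is a multiple of \<open>2 * pi\<close>, hence locked
  to its circle value once the curve is near enough, and then the distance is fixed by the data. The
  small quantities have to be estimated without losing the factor \<open>\<bar>a\<bar>\<close>: the
  estimate for \<open>hh - R\<close> gains from its own small sup norm, and this gain is passed on
  to \<open>qq\<close> and from there to the curvature. All integrations by parts rest on absolutely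
  continuous functions, encoded as a function together with a density.\<close>

definition ac :: "(real \<Rightarrow> 'a::euclidean_space) \<Rightarrow> (real \<Rightarrow> 'a) \<Rightarrow> bool"
  where "ac f g \<longleftrightarrow> integrable leb_I g \<and> (\<forall>x\<in>dom_I. f x = f 0 + integral {0..x} g)"

lemma integrable_on_subI:
  fixes g :: "real \<Rightarrow> 'a::euclidean_space"
  assumes "integrable leb_I g" "0 \<le> x" "y \<le> 2 * pi"
  shows "g integrable_on {x..y}"
proof -
  have "integrable (lebesgue_on {x..y}) g"
    using assms by (intro integrable_subinterval[OF assms(1)]) auto
  then show ?thesis by (rule integrable_on_lebesgue_on) auto
qed

lemma LINT_eq_integral:
  fixes g :: "real \<Rightarrow> 'a::euclidean_space"
  assumes "integrable leb_I g"
  shows "(LINT x|leb_I. g x) = integral dom_I g"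
  using assms by (rule lebesgue_integral_eq_integral) auto

lemma ac_integrable: "ac f g \<Longrightarrow> integrable leb_I g"
  by (simp add: ac_def)

lemma ac_eq:
  assumes "ac f g" "0 \<le> x" "x \<le> 2 * pi"
  shows "f x = f 0 + integral {0..x} g"
proof -
  have "\<forall>x\<in>dom_I. f x = f 0 + integral {0..x} g" using assms(1) unfolding ac_def by (rule conjunct2)
  then show ?thesis by (rule bspec) (use assms(2,3) in simp)
qed

lemma acI:
  assumes "integrable leb_I g" "\<And>x. 0 \<le> x \<Longrightarrow> x \<le> 2 * pi \<Longrightarrow> f x = f 0 + integral {0..x} g"
  shows "ac f g"
  unfolding ac_def
proof (intro conjI ballI)
  fix x assume "x \<in> dom_I"
  then have "0 \<le> x" "x \<le> 2 * pi" by simp_all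
  then show "f x = f 0 + integral {0..x} g" by (rule assms(2))
qed (rule assms(1))

lemma ac_diff:
  assumes "ac f g" "0 \<le> x" "x \<le> y" "y \<le> 2 * pi"
  shows "f y - f x = integral {x..y} g"
proof -
  have "integral {0..x} g + integral {x..y} g = integral {0..y} g"
    using assms(2-4) ac_integrable[OF assms(1)]
    by (intro Henstock_Kurzweil_Integration.integral_combine integrable_on_subI) auto
  moreover have "f x = f 0 + integral {0..x} g" "f y = f 0 + integral {0..y} g"
    by (rule ac_eq[OF assms(1)]; use assms in simp)+
  ultimately show ?thesis by (metis add_diff_cancel_left add_diff_cancel_left')
qed

lemma ac_total: "ac f g \<Longrightarrow> f (2 * pi) - f 0 = (LINT x|leb_I. g x)"
  using ac_diff[of f g 0 "2 * pi"] by (simp add: ac_integrable LINT_eq_integral)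

lemma ac_continuous: "ac f g \<Longrightarrow> continuous_on dom_I f"
proof -
  assume a: "ac f g"
  have "continuous_on dom_I (\<lambda>x. f 0 + integral {0..x} g)"
    using ac_integrable[OF a]
    by (intro continuous_intros indefinite_integral_continuous_1 integrable_on_subI) auto
  moreover have "continuous_on dom_I f = continuous_on dom_I (\<lambda>x. f 0 + integral {0..x} g)"
    by (rule continuous_on_cong[OF refl]) (rule ac_eq[OF a]; simp)
  ultimately show ?thesis by simp
qed

lemma cont_integrable: "continuous_on dom_I (f :: real \<Rightarrow> 'a::euclidean_space) \<Longrightarrow> integrable leb_I f"
  by (rule continuous_imp_integrable_real)

lemma cont_measurable: "continuous_on dom_I (f :: real \<Rightarrow> 'a::euclidean_space) \<Longrightarrow> f \<in> borel_measurable leb_I"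
  by (rule borel_measurable_integrable[OF cont_integrable])

lemma cont_bound:
  fixes f :: "real \<Rightarrow> 'a::euclidean_space"
  assumes "continuous_on dom_I f"
  obtains B where "B > 0" "\<And>x. x \<in> dom_I \<Longrightarrow> norm (f x) \<le> B"
proof -
  have "compact (f ` dom_I)" using assms by (intro compact_continuous_image) auto
  then have "bounded (f ` dom_I)" by (rule compact_imp_bounded)
  then show ?thesis using that unfolding bounded_pos by blast
qed

lemma ac_C1:
  assumes "\<And>x. x \<in> dom_I \<Longrightarrow> (f has_vector_derivative g x) (at x within dom_I)"
    and "continuous_on dom_I g"
  shows "ac f g"
  unfolding ac_def
proof (intro conjI ballI)
  show "integrable leb_I g" using assms(2) by (rule cont_integrable)
  fix x assume x: "x \<in> dom_I"
  have "(g has_integral (f x - f 0)) {0..x}"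
    using x by (intro fundamental_theorem_of_calculus)
      (auto intro: has_vector_derivative_within_subset[OF assms(1)])
  then show "f x = f 0 + integral {0..x} g"
    by (simp add: integral_unique)
qed

lemma ac_vderiv:
  assumes "ac f g" "continuous_on dom_I g" "x \<in> dom_I"
  shows "(f has_vector_derivative g x) (at x within dom_I)"
proof (rule has_vector_derivative_transform[OF assms(3)])
  fix u assume "u \<in> dom_I"
  then show "f u = f 0 + integral {0..u} g" by (intro ac_eq[OF assms(1)]) simp_all
next
  have "((\<lambda>u. f 0 + integral {0..u} g) has_vector_derivative 0 + g x) (at x within dom_I)"
    using assms(2,3) by (intro has_vector_derivative_add integral_has_vector_derivative) auto
  then show "((\<lambda>u. f 0 + integral {0..u} g) has_vector_derivative g x) (at x within dom_I)"
    by simp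
qed

lemma ac_const: "ac (\<lambda>x. k) (\<lambda>x. 0)"
  by (rule ac_C1) auto

lemma ac_add:
  assumes "ac f f'" "ac g g'" shows "ac (\<lambda>x. f x + g x) (\<lambda>x. f' x + g' x)"
proof (rule acI)
  show "integrable leb_I (\<lambda>x. f' x + g' x)" using assms by (simp add: ac_integrable)
  fix x :: real assume x: "0 \<le> x" "x \<le> 2 * pi"
  have "integral {0..x} (\<lambda>x. f' x + g' x) = integral {0..x} f' + integral {0..x} g'"
    using ac_integrable[OF assms(1)] ac_integrable[OF assms(2)] x
    by (intro Henstock_Kurzweil_Integration.integral_add integrable_on_subI) auto
  then show "f x + g x = f 0 + g 0 + integral {0..x} (\<lambda>x. f' x + g' x)"
    by (simp add: ac_eq[OF assms(1) x] ac_eq[OF assms(2) x])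
qed

lemma ac_linear:
  assumes "bounded_linear L" "ac f f'" shows "ac (\<lambda>x. L (f x)) (\<lambda>x. L (f' x))"
proof (rule acI)
  interpret bounded_linear L by (rule assms(1))
  show "integrable leb_I (\<lambda>x. L (f' x))"
    by (rule integrable_bounded_linear[OF assms(1) ac_integrable[OF assms(2)]])
  fix x :: real assume x: "0 \<le> x" "x \<le> 2 * pi"
  have "integral {0..x} (\<lambda>x. L (f' x)) = L (integral {0..x} f')"
    using x integral_linear[OF integrable_on_subI[OF ac_integrable[OF assms(2)]] assms(1), of 0 x]
    by (simp add: o_def)
  then show "L (f x) = L (f 0) + integral {0..x} (\<lambda>x. L (f' x))"
    by (subst ac_eq[OF assms(2) x]) (simp add: add)
qed

lemma ac_cong:
  assumes "ac f g" "\<And>x. x \<in> dom_I \<Longrightarrow> f x = F x" "AE x in leb_I. g x = G x" "G \<in> borel_measurable leb_I"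
  shows "ac F G"
proof -
  have G: "integrable leb_I G"
    using assms by (intro integrable_cong_AE_imp[of leb_I g G]) (auto intro: ac_integrable)
  have "AE x in lebesgue. x \<in> dom_I \<longrightarrow> g x = G x"
    using assms(3) by (subst (asm) AE_restrict_space_iff) auto
  then obtain N where N: "negligible N" "\<And>x. x \<in> dom_I \<Longrightarrow> x \<notin> N \<Longrightarrow> g x = G x"
    by (auto simp: negligible_iff_null_sets eventually_ae_filter subset_iff)
  show ?thesis
  proof (rule acI[OF G])
    fix x :: real assume x: "0 \<le> x" "x \<le> 2 * pi"
    have "integral {0..x} g = integral {0..x} G"
      using x N by (intro integral_spike[of N]) auto
    then show "F x = F 0 + integral {0..x} G"
      using ac_eq[OF assms(1) x] assms(2)[of x] assms(2)[of 0] x by simp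
  qed
qed

text \<open>A telescoping sum over a fine partition gives
  \<open>norm (H x - H 0) \<le> \<epsilon> * (m x - m 0)\<close> for every
  \<open>\<epsilon>\<close>. In the product and chain rules \<open>H\<close> is the difference of
  the two sides of the claimed formula and \<open>m\<close> the integral of the norms of the
  densities, so both rules reduce to estimates on short intervals.\<close>

lemma const_of_small_increments:
  fixes H :: "real \<Rightarrow> 'a::real_normed_vector" and m :: "real \<Rightarrow> real"
  assumes small: "\<And>\<epsilon>. \<epsilon> > 0 \<Longrightarrow> \<exists>d>0. \<forall>x y. 0 \<le> x \<longrightarrow> x \<le> y \<longrightarrow> y \<le> b \<longrightarrow> y - x < d \<longrightarrow>
      norm (H y - H x) \<le> \<epsilon> * (m y - m x)"
    and x: "0 \<le> x" "x \<le> b"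
  shows "H x = H 0"
proof -
  have le: "norm (H x - H 0) \<le> \<epsilon> * (m x - m 0)" if \<epsilon>: "\<epsilon> > 0" for \<epsilon>
  proof -
    obtain d where d: "d > 0" "\<And>x y. 0 \<le> x \<Longrightarrow> x \<le> y \<Longrightarrow> y \<le> b \<Longrightarrow> y - x < d \<Longrightarrow>
      norm (H y - H x) \<le> \<epsilon> * (m y - m x)" using small[OF \<epsilon>] by metis
    obtain n :: nat where n: "x / d < real n" using reals_Archimedean2 by blast
    define n' where "n' = Suc n"
    have n': "x / real n' < d"
    proof -
      have "x < d * real n" using n d by (simp add: field_simps)
      also have "\<dots> \<le> d * real n'" using d by (simp add: n'_def)
      finally show ?thesis by (simp add: n'_def field_simps)
    qed
    define t where "t k = real k * x / real n'" for k
    have t_le: "t k \<le> x" if "k \<le> n'" for k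
    proof -
      have "real k * x \<le> real n' * x" using that x by (intro mult_right_mono) auto
      then show ?thesis unfolding t_def by (simp add: n'_def field_simps)
    qed
    have "norm (H (t k) - H 0) \<le> \<epsilon> * (m (t k) - m 0)" if "k \<le> n'" for k
      using that
    proof (induction k)
      case 0 then show ?case by (simp add: t_def)
    next
      case (Suc k)
      have step: "t (Suc k) - t k = x / real n'"
        unfolding t_def by (simp add: diff_divide_distrib[symmetric] algebra_simps)
      have "norm (H (t (Suc k)) - H (t k)) \<le> \<epsilon> * (m (t (Suc k)) - m (t k))"
      proof (rule d(2))
        show "0 \<le> t k" using x by (simp add: t_def)
        have "0 \<le> x / real n'" using x by simp
        then show "t k \<le> t (Suc k)" using step by linarith
        show "t (Suc k) \<le> b" using t_le[of "Suc k"] Suc x by linarith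
        show "t (Suc k) - t k < d" using step n' by simp
      qed
      moreover have "norm (H (t k) - H 0) \<le> \<epsilon> * (m (t k) - m 0)" using Suc by simp
      moreover have "norm (H (t (Suc k)) - H 0) \<le> norm (H (t (Suc k)) - H (t k)) + norm (H (t k) - H 0)"
        using norm_triangle_ineq[of "H (t (Suc k)) - H (t k)" "H (t k) - H 0"] by simp
      ultimately show ?case by (simp add: algebra_simps)
    qed
    from this[of n'] show ?thesis by (simp add: t_def n'_def)
  qed
  have "norm (H x - H 0) \<le> 0"
  proof (rule field_le_epsilon)
    fix e :: real assume e: "e > 0"
    have p: "e / (1 + \<bar>m x - m 0\<bar>) > 0" using e by simp
    have "norm (H x - H 0) \<le> e / (1 + \<bar>m x - m 0\<bar>) * (m x - m 0)" by (rule le[OF p])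
    also have "\<dots> \<le> e / (1 + \<bar>m x - m 0\<bar>) * (1 + \<bar>m x - m 0\<bar>)"
      using p by (intro mult_left_mono) auto
    also have "\<dots> = e" using e by simp
    finally show "norm (H x - H 0) \<le> 0 + e" by simp
  qed
  then show ?thesis by simp
qed

lemma integrable_bilinear_cont:
  fixes f :: "real \<Rightarrow> 'a::euclidean_space" and g :: "real \<Rightarrow> 'b::euclidean_space"
    and h :: "'a \<Rightarrow> 'b \<Rightarrow> 'c::euclidean_space"
  assumes "bounded_bilinear h" "continuous_on dom_I f" "integrable leb_I g"
  shows "integrable leb_I (\<lambda>x. h (f x) (g x))" "integrable leb_I (\<lambda>x. (\<lambda>u v. h v u) (g x) (f x))"
proof -
  obtain K where K: "\<And>a b. norm (h a b) \<le> norm a * norm b * K"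
    using bounded_bilinear.bounded[OF assms(1)] by blast
  obtain B where B: "B > 0" "\<And>x. x \<in> dom_I \<Longrightarrow> norm (f x) \<le> B"
    using cont_bound[OF assms(2)] by blast
  show 1: "integrable leb_I (\<lambda>x. h (f x) (g x))"
  proof (rule measurable_bounded_by_integrable_imp_lebesgue_integrable)
    show "(\<lambda>x. h (f x) (g x)) \<in> borel_measurable leb_I"
    proof (rule borel_measurable_bilinear[of h f dom_I g])
      show "bilinear h" using assms(1) by (simp add: bilinear_conv_bounded_bilinear)
      show "f \<in> borel_measurable leb_I" by (rule cont_measurable[OF assms(2)])
      show "g \<in> borel_measurable leb_I" by (rule borel_measurable_integrable[OF assms(3)])
    qed simp
    show "integrable leb_I (\<lambda>x. B * \<bar>K\<bar> * norm (g x))" using assms by auto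
    fix x assume "x \<in> dom_I"
    have "norm (h (f x) (g x)) \<le> norm (f x) * norm (g x) * K" by (rule K)
    also have "\<dots> \<le> norm (f x) * norm (g x) * \<bar>K\<bar>" by (intro mult_left_mono) auto
    also have "\<dots> \<le> B * norm (g x) * \<bar>K\<bar>" using B \<open>x \<in> dom_I\<close> by (intro mult_right_mono) auto
    finally show "norm (h (f x) (g x)) \<le> B * \<bar>K\<bar> * norm (g x)" by (simp add: mult_ac)
  qed auto
  then show "integrable leb_I (\<lambda>x. (\<lambda>u v. h v u) (g x) (f x))" by simp
qed

lemma uniform_cont:
  fixes f :: "real \<Rightarrow> 'a::euclidean_space"
  assumes "continuous_on dom_I f" "e > 0"
  obtains d where "d > 0" "\<And>x y. x \<in> dom_I \<Longrightarrow> y \<in> dom_I \<Longrightarrow> \<bar>y - x\<bar> < d \<Longrightarrow> norm (f y - f x) \<le> e"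
proof -
  have "uniformly_continuous_on dom_I f" using assms by (intro compact_uniformly_continuous) auto
  then show ?thesis using that assms(2) unfolding uniformly_continuous_on_def dist_norm real_norm_def
    by (metis less_imp_le)
qed

lemma norm_integral_le:
  fixes f :: "real \<Rightarrow> 'a::euclidean_space"
  assumes "integrable leb_I f" "integrable leb_I g" "0 \<le> x" "y \<le> 2 * pi"
    and "\<And>t. t \<in> {x..y} \<Longrightarrow> norm (f t) \<le> g t"
  shows "norm (integral {x..y} f) \<le> integral {x..y} g"
  using assms by (intro integral_norm_bound_integral integrable_on_subI) auto

text \<open>On a short interval the increment of the product is
  \<open>h (f y) (g y - g x) + h (f y - f x) (g x)\<close>, which is the integral of the claimed
  density with \<open>f\<close> and \<open>g\<close> frozen at end points. By uniform continuity,
  unfreezing them costs at most \<open>\<epsilon>\<close> times the integral of the norms of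
  \<open>f'\<close> and \<open>g'\<close>.\<close>

lemma ac_bilinear:
  fixes f :: "real \<Rightarrow> 'a::euclidean_space" and g :: "real \<Rightarrow> 'b::euclidean_space"
    and h :: "'a \<Rightarrow> 'b \<Rightarrow> 'c::euclidean_space"
  assumes h: "bounded_bilinear h" and f: "ac f f'" and g: "ac g g'"
  shows "ac (\<lambda>x. h (f x) (g x)) (\<lambda>x. h (f x) (g' x) + h (f' x) (g x))"
proof -
  interpret bounded_bilinear h by (rule h)
  let ?D = "\<lambda>x. h (f x) (g' x) + h (f' x) (g x)"
  note cf = ac_continuous[OF f] and cg = ac_continuous[OF g]
  note i = ac_integrable[OF f] ac_integrable[OF g]
  obtain K where K: "K > 0" "\<And>a b. norm (h a b) \<le> norm a * norm b * K" using pos_bounded by blast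
  have iD1: "integrable leb_I (\<lambda>x. h (f x) (g' x))"
    by (rule integrable_bilinear_cont(1)[OF h cf i(2)])
  have iD2: "integrable leb_I (\<lambda>x. h (f' x) (g x))"
    using integrable_bilinear_cont(2)[OF flip cg i(1)] by simp
  have iD: "integrable leb_I ?D" using iD1 iD2 by simp
  define m where "m x = integral {0..x} (\<lambda>t. K * (norm (f' t) + norm (g' t)))" for x
  have im: "integrable leb_I (\<lambda>t. K * (norm (f' t) + norm (g' t)))" using i by auto
  define H where "H x = h (f x) (g x) - integral {0..x} ?D" for x
  have "H x = H 0" if "x \<in> dom_I" for x
  proof (rule const_of_small_increments)
    fix \<epsilon> :: real assume e: "\<epsilon> > 0"
    obtain d1 where d1: "d1 > 0" "\<And>x y. x \<in> dom_I \<Longrightarrow> y \<in> dom_I \<Longrightarrow> \<bar>y - x\<bar> < d1 \<Longrightarrow> norm (f y - f x) \<le> \<epsilon>"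
      using uniform_cont[OF cf e] by metis
    obtain d2 where d2: "d2 > 0" "\<And>x y. x \<in> dom_I \<Longrightarrow> y \<in> dom_I \<Longrightarrow> \<bar>y - x\<bar> < d2 \<Longrightarrow> norm (g y - g x) \<le> \<epsilon>"
      using uniform_cont[OF cg e] by metis
    show "\<exists>d>0. \<forall>x y. 0 \<le> x \<longrightarrow> x \<le> y \<longrightarrow> y \<le> 2 * pi \<longrightarrow> y - x < d \<longrightarrow> norm (H y - H x) \<le> \<epsilon> * (m y - m x)"
    proof (intro exI[of _ "min d1 d2"] conjI allI impI)
      fix x y assume xy: "0 \<le> x" "x \<le> y" "y \<le> 2 * pi" "y - x < min d1 d2"
      have c1: "integral {0..y} ?D - integral {0..x} ?D = integral {x..y} ?D"
        using Henstock_Kurzweil_Integration.integral_combine[of 0 x y ?D] integrable_on_subI[OF iD, of 0 y] xy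
        by (simp add: algebra_simps)
      have c2: "m y - m x = integral {x..y} (\<lambda>t. K * (norm (f' t) + norm (g' t)))"
        unfolding m_def
        using Henstock_Kurzweil_Integration.integral_combine[OF _ _ integrable_on_subI[OF im, of 0 y], of x] xy
        by (simp add: algebra_simps)
      have ig1: "integrable leb_I (\<lambda>t. h (f y - f t) (g' t))"
        using iD1 i(2) by (simp add: diff_left integrable_bilinear_cont(1)[OF h _ i(2)])
      have ig2: "integrable leb_I (\<lambda>t. h (f' t) (g x - g t))"
        using iD2 i(1) integrable_bilinear_cont(2)[OF flip, of "\<lambda>_. g x" f'] by (simp add: diff_right)
      have "h (f y) (g y) - h (f x) (g x) = h (f y) (g y - g x) + h (f y - f x) (g x)"
        by (simp add: diff_left diff_right)
      also have "\<dots> = integral {x..y} (\<lambda>t. h (f y) (g' t)) + integral {x..y} (\<lambda>t. h (f' t) (g x))"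
        using ac_diff[OF f xy(1-3)] ac_diff[OF g xy(1-3)] integrable_on_subI[OF i(1) xy(1) xy(3)]
          integrable_on_subI[OF i(2) xy(1) xy(3)]
          integral_linear[OF _ bounded_linear_right, of g' "{x..y}" "f y"]
          integral_linear[OF _ bounded_linear_left, of f' "{x..y}" "g x"]
        by (simp add: o_def)
      also have "\<dots> - integral {x..y} ?D = integral {x..y} (\<lambda>t. h (f y - f t) (g' t) + h (f' t) (g x - g t))"
      proof -
        have k: "(\<lambda>t. h (f y) (g' t)) integrable_on {x..y}" "(\<lambda>t. h (f' t) (g x)) integrable_on {x..y}"
          using integrable_on_subI[OF i(1) xy(1) xy(3)] integrable_on_subI[OF i(2) xy(1) xy(3)]
          integrable_linear[OF _ bounded_linear_right, of g' "{x..y}" "f y"]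
          integrable_linear[OF _ bounded_linear_left, of f' "{x..y}" "g x"]
          by (simp_all add: o_def)
        have "integral {x..y} (\<lambda>t. h (f y) (g' t)) + integral {x..y} (\<lambda>t. h (f' t) (g x)) - integral {x..y} ?D
          = integral {x..y} (\<lambda>t. (h (f y) (g' t) + h (f' t) (g x)) - ?D t)"
          using k integrable_on_subI[OF iD xy(1) xy(3)]
          by (simp add: Henstock_Kurzweil_Integration.integral_add Henstock_Kurzweil_Integration.integral_diff integrable_add)
        also have "\<dots> = integral {x..y} (\<lambda>t. h (f y - f t) (g' t) + h (f' t) (g x - g t))"
          by (intro arg_cong[of _ _ "integral {x..y}"] ext) (simp add: diff_left diff_right)
        finally show ?thesis .
      qed
      finally have "H y - H x = integral {x..y} (\<lambda>t. h (f y - f t) (g' t) + h (f' t) (g x - g t))"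
        unfolding H_def using c1 by (simp add: algebra_simps)
      also have "norm \<dots> \<le> integral {x..y} (\<lambda>t. \<epsilon> * (K * (norm (f' t) + norm (g' t))))"
      proof (rule norm_integral_le)
        fix t assume t: "t \<in> {x..y}"
        have "norm (h (f y - f t) (g' t)) \<le> norm (f y - f t) * norm (g' t) * K" by (rule K)
        also have "\<dots> \<le> \<epsilon> * norm (g' t) * K"
          using d1(2)[of t y] t xy K(1) by (intro mult_right_mono) auto
        finally have a: "norm (h (f y - f t) (g' t)) \<le> \<epsilon> * norm (g' t) * K" .
        have "norm (h (f' t) (g x - g t)) \<le> norm (f' t) * norm (g x - g t) * K" by (rule K)
        also have "\<dots> \<le> norm (f' t) * \<epsilon> * K"
          using d2(2)[of t x] t xy K(1) by (intro mult_right_mono mult_left_mono) auto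
        finally have b: "norm (h (f' t) (g x - g t)) \<le> norm (f' t) * \<epsilon> * K" .
        show "norm (h (f y - f t) (g' t) + h (f' t) (g x - g t)) \<le> \<epsilon> * (K * (norm (f' t) + norm (g' t)))"
          using norm_triangle_ineq[of "h (f y - f t) (g' t)" "h (f' t) (g x - g t)"] a b
          by (simp add: algebra_simps)
      qed (use ig1 ig2 im xy in auto)
      also have "\<dots> = \<epsilon> * (m y - m x)" by (simp add: c2)
      finally show "norm (H y - H x) \<le> \<epsilon> * (m y - m x)" .
    qed (use d1 d2 in auto)
  qed (use that in auto)
  note H = this
  show ?thesis
  proof (rule acI[OF iD])
    fix x :: real assume "0 \<le> x" "x \<le> 2 * pi"
    then have "H x = H 0" by (intro H) simp
    then show "h (f x) (g x) = h (f 0) (g 0) + integral {0..x} ?D"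
      unfolding H_def by (simp add: algebra_simps)
  qed
qed

text \<open>On a short interval \<open>\<Phi>\<close> is linearised at \<open>f x\<close> and its
  derivative frozen there. Only an interval \<open>{lo..hi}\<close> containing the range of
  \<open>f\<close> matters, so \<open>\<Phi>\<close> may be singular elsewhere, as
  \<open>1 / sqrt y\<close> is in \<open>ac_tangent\<close>.\<close>

lemma ac_chain:
  fixes f :: "real \<Rightarrow> real" and \<Phi> \<Phi>' :: "real \<Rightarrow> real"
  assumes f: "ac f f'" and r: "\<And>x. x \<in> dom_I \<Longrightarrow> f x \<in> {lo..hi}"
    and d: "\<And>y. y \<in> {lo..hi} \<Longrightarrow> (\<Phi> has_real_derivative \<Phi>' y) (at y within {lo..hi})"
    and c: "continuous_on {lo..hi} \<Phi>'"
  shows "ac (\<lambda>x. \<Phi> (f x)) (\<lambda>x. \<Phi>' (f x) * f' x)"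
proof -
  note cf = ac_continuous[OF f] and i = ac_integrable[OF f]
  have cD: "continuous_on dom_I (\<lambda>x. \<Phi>' (f x))"
    using r by (intro continuous_on_compose2[OF c cf]) auto
  have iD: "integrable leb_I (\<lambda>x. \<Phi>' (f x) * f' x)"
    using integrable_bilinear_cont(1)[OF bounded_bilinear_mult cD i] by simp
  \<comment> \<open>The factor 2 pays for two errors of size \<open>\<epsilon>\<close>: linearising
    \<open>\<Phi>\<close> and freezing \<open>\<Phi>'\<close> at \<open>f x\<close>.\<close>
  define m where "m x = integral {0..x} (\<lambda>t. 2 * \<bar>f' t\<bar>)" for x
  have im: "integrable leb_I (\<lambda>t. 2 * \<bar>f' t\<bar>)" using i by auto
  define H where "H x = \<Phi> (f x) - integral {0..x} (\<lambda>x. \<Phi>' (f x) * f' x)" for x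
  have "H x = H 0" if "x \<in> dom_I" for x
  proof (rule const_of_small_increments)
    fix \<epsilon> :: real assume e: "\<epsilon> > 0"
    have "uniformly_continuous_on {lo..hi} \<Phi>'" using c by (intro compact_uniformly_continuous) auto
    then obtain \<rho> where rho: "\<rho> > 0" "\<And>u v. u \<in> {lo..hi} \<Longrightarrow> v \<in> {lo..hi} \<Longrightarrow> \<bar>v - u\<bar> < \<rho> \<Longrightarrow> \<bar>\<Phi>' v - \<Phi>' u\<bar> < \<epsilon>"
      using e unfolding uniformly_continuous_on_def dist_real_def by metis
    obtain d1 where d1: "d1 > 0" "\<And>x y. x \<in> dom_I \<Longrightarrow> y \<in> dom_I \<Longrightarrow> \<bar>y - x\<bar> < d1 \<Longrightarrow> norm (f y - f x) \<le> \<rho> / 2"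
      using uniform_cont[OF cf, of "\<rho>/2"] rho by (metis half_gt_zero)
    have lin: "\<bar>\<Phi> v - \<Phi> u - \<Phi>' u * (v - u)\<bar> \<le> \<epsilon> * \<bar>v - u\<bar>"
      if uv: "u \<in> {lo..hi}" "v \<in> {lo..hi}" "\<bar>v - u\<bar> < \<rho>" for u v
    proof -
      have S: "closed_segment u v \<subseteq> {lo..hi}"
        using uv by (intro closed_segment_subset) (auto simp: convex_closed_interval)
      have "norm (\<Phi> v - \<Phi> u - (v - u) *\<^sub>R \<Phi>' u) \<le> norm (v - u) * \<epsilon>"
      proof (rule vector_differentiable_bound_linearization[where f' = \<Phi>' and ?x0.0 = u and S = "closed_segment u v"])
        fix z assume z: "z \<in> closed_segment u v"
        then have "(\<Phi> has_vector_derivative \<Phi>' z) (at z within {lo..hi})"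
          using S d[of z] by (auto simp: has_real_derivative_iff_has_vector_derivative)
        then show "(\<Phi> has_vector_derivative \<Phi>' z) (at z within closed_segment u v)"
          by (rule has_vector_derivative_within_subset[OF _ S])
        have "\<bar>z - u\<bar> \<le> \<bar>v - u\<bar>" using z by (auto simp: closed_segment_eq_real_ivl split: if_splits)
        then show "norm (\<Phi>' z - \<Phi>' u) \<le> \<epsilon>"
          using rho(2)[of u z] z S uv by auto
      qed auto
      then show ?thesis by (simp add: mult.commute)
    qed
    show "\<exists>d>0. \<forall>x y. 0 \<le> x \<longrightarrow> x \<le> y \<longrightarrow> y \<le> 2 * pi \<longrightarrow> y - x < d \<longrightarrow> norm (H y - H x) \<le> \<epsilon> * (m y - m x)"
    proof (intro exI[of _ d1] conjI allI impI)
      fix x y assume xy: "0 \<le> x" "x \<le> y" "y \<le> 2 * pi" "y - x < d1"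
      have c1: "integral {0..y} (\<lambda>x. \<Phi>' (f x) * f' x) - integral {0..x} (\<lambda>x. \<Phi>' (f x) * f' x)
          = integral {x..y} (\<lambda>x. \<Phi>' (f x) * f' x)"
        using Henstock_Kurzweil_Integration.integral_combine[OF _ _ integrable_on_subI[OF iD, of 0 y], of x] xy
        by (simp add: algebra_simps)
      have c2: "m y - m x = integral {x..y} (\<lambda>t. 2 * \<bar>f' t\<bar>)"
        unfolding m_def
        using Henstock_Kurzweil_Integration.integral_combine[OF _ _ integrable_on_subI[OF im, of 0 y], of x] xy
        by (simp add: algebra_simps)
      have fd: "f y - f x = integral {x..y} f'" by (rule ac_diff[OF f xy(1-3)])
      have small: "\<bar>f t - f x\<bar> < \<rho>" if "t \<in> {x..y}" for t
        using d1(2)[of x t] that xy rho by fastforce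
      have "\<bar>f y - f x\<bar> \<le> integral {x..y} (\<lambda>t. \<bar>f' t\<bar>)"
        unfolding fd using norm_integral_le[of f' "\<lambda>t. \<bar>f' t\<bar>" x y] i xy by auto
      then have fl: "\<epsilon> * \<bar>f y - f x\<bar> \<le> \<epsilon> * integral {x..y} (\<lambda>t. \<bar>f' t\<bar>)"
        using e by (intro mult_left_mono) auto
      have A: "\<bar>\<Phi> (f y) - \<Phi> (f x) - \<Phi>' (f x) * (f y - f x)\<bar> \<le> \<epsilon> * integral {x..y} (\<lambda>t. \<bar>f' t\<bar>)"
        using lin[OF r r, of x y] small[of y] xy fl by auto
      have "\<Phi>' (f x) * (f y - f x) - integral {x..y} (\<lambda>x. \<Phi>' (f x) * f' x)
          = integral {x..y} (\<lambda>t. (\<Phi>' (f x) - \<Phi>' (f t)) * f' t)"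
        unfolding fd left_diff_distrib
        using integrable_on_subI[OF i xy(1) xy(3)] integrable_on_subI[OF iD xy(1) xy(3)]
        by (subst Henstock_Kurzweil_Integration.integral_diff) (auto intro: integrable_on_mult_right)
      moreover have "norm (integral {x..y} (\<lambda>t. (\<Phi>' (f x) - \<Phi>' (f t)) * f' t)) \<le> integral {x..y} (\<lambda>t. \<epsilon> * \<bar>f' t\<bar>)"
      proof (rule norm_integral_le)
        fix t assume t: "t \<in> {x..y}"
        have "\<bar>\<Phi>' (f x) - \<Phi>' (f t)\<bar> \<le> \<epsilon>"
          using rho(2)[of "f t" "f x"] r[of t] r[of x] small[OF t] t xy by (auto simp: abs_minus_commute)
        then show "norm ((\<Phi>' (f x) - \<Phi>' (f t)) * f' t) \<le> \<epsilon> * \<bar>f' t\<bar>"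
          by (simp add: abs_mult mult_right_mono)
      next
        show "integrable leb_I (\<lambda>t. (\<Phi>' (f x) - \<Phi>' (f t)) * f' t)"
          using i iD by (simp add: left_diff_distrib)
      qed (use xy i in auto)
      ultimately have B: "\<bar>\<Phi>' (f x) * (f y - f x) - integral {x..y} (\<lambda>x. \<Phi>' (f x) * f' x)\<bar>
          \<le> \<epsilon> * integral {x..y} (\<lambda>t. \<bar>f' t\<bar>)" by simp
      show "norm (H y - H x) \<le> \<epsilon> * (m y - m x)"
        using A B c1 unfolding H_def c2 by simp
    qed (use d1 in auto)
  qed (use that in auto)
  note H = this
  show ?thesis
  proof (rule acI[OF iD])
    fix x :: real assume "0 \<le> x" "x \<le> 2 * pi"
    then have "H x = H 0" by (intro H) simp
    then show "\<Phi> (f x) = \<Phi> (f 0) + integral {0..x} (\<lambda>x. \<Phi>' (f x) * f' x)"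
      unfolding H_def by (simp add: algebra_simps)
  qed
qed

section \<open>Weak derivatives\<close>

lemma DERIV_max0_sq: "((\<lambda>y::real. (max 0 y)\<^sup>2) has_real_derivative 2 * max 0 y) (at y)"
proof -
  have q: "\<bar>(max 0 z)\<^sup>2 - (max 0 y)\<^sup>2 - 2 * max 0 y * (z - y)\<bar> \<le> (z - y)\<^sup>2" for z
  proof (cases "0 \<le> y"; cases "0 \<le> z")
    assume "0 \<le> y" "0 \<le> z"
    then have "(max 0 z)\<^sup>2 - (max 0 y)\<^sup>2 - 2 * max 0 y * (z - y) = (z - y)\<^sup>2"
      by (simp add: power2_eq_square algebra_simps)
    then show ?thesis by simp
  next
    assume yz: "0 \<le> y" "\<not> 0 \<le> z"
    then have "y * z \<le> 0" by (simp add: mult_nonneg_nonpos)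
    moreover have "0 \<le> y * y" "0 \<le> z * z" by simp_all
    moreover have "(max 0 z)\<^sup>2 - (max 0 y)\<^sup>2 - 2 * max 0 y * (z - y) = y * y - 2 * (y * z)"
      using yz by (simp add: power2_eq_square algebra_simps)
    moreover have "(z - y)\<^sup>2 = y * y - 2 * (y * z) + z * z"
      by (simp add: power2_eq_square algebra_simps)
    ultimately show ?thesis by linarith
  next
    assume yz: "\<not> 0 \<le> y" "0 \<le> z"
    then have "y * z \<le> 0" by (simp add: mult_nonpos_nonneg)
    moreover have "0 \<le> y * y" by simp
    ultimately show ?thesis using yz
      by (simp add: power2_eq_square algebra_simps)
  next
    assume "\<not> 0 \<le> y" "\<not> 0 \<le> z" then show ?thesis by simp
  qed
  show ?thesis unfolding has_field_derivative_iff
  proof (rule LIM_I)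
    fix r :: real assume r: "0 < r"
    show "\<exists>s>0. \<forall>z. z \<noteq> y \<and> norm (z - y) < s \<longrightarrow>
        norm (((max 0 z)\<^sup>2 - (max 0 y)\<^sup>2) / (z - y) - 2 * max 0 y) < r"
    proof (intro exI[of _ r] conjI allI impI r)
      fix z assume z: "z \<noteq> y \<and> norm (z - y) < r"
      have "((max 0 z)\<^sup>2 - (max 0 y)\<^sup>2) / (z - y) - 2 * max 0 y
          = ((max 0 z)\<^sup>2 - (max 0 y)\<^sup>2 - 2 * max 0 y * (z - y)) / (z - y)"
        using z by (simp add: field_simps)
      also have "\<bar>\<dots>\<bar> \<le> (z - y)\<^sup>2 / \<bar>z - y\<bar>"
        using q[of z] z by (simp add: abs_divide divide_right_mono)
      also have "(z - y)\<^sup>2 = \<bar>z - y\<bar> * \<bar>z - y\<bar>" by (simp add: power2_eq_square)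
      also have "\<dots> / \<bar>z - y\<bar> = \<bar>z - y\<bar>"
        by (rule nonzero_mult_div_cancel_right) (use z in simp)
      finally show "norm (((max 0 z)\<^sup>2 - (max 0 y)\<^sup>2) / (z - y) - 2 * max 0 y) < r"
        using z by simp
    qed
  qed
qed

text \<open>\<open>B\<close> is the square of the positive part of a parabola with zeros
  \<open>a\<close> and \<open>b\<close>, hence continuously differentiable, and
  \<open>n * B / (1 + n * B)\<close> tends to 1 where \<open>B > 0\<close> and stays 0 elsewhere.
  This gives test functions with values between 0 and 1 that converge to the indicator of the open
  interval.\<close>

definition bump :: "real \<Rightarrow> real \<Rightarrow> nat \<Rightarrow> real \<Rightarrow> real"
  where "bump a b n x = (let B = (max 0 ((x - a) * (b - x)))\<^sup>2 in n * B / (1 + n * B))"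

lemma bump_test:
  assumes "0 < a" "a \<le> b" "b < 2 * pi"
  shows "\<exists>\<phi>'. test_fun (bump a b n) \<phi>'"
proof -
  define B where "B x = (max 0 ((x - a) * (b - x)))\<^sup>2" for x
  define B' where "B' x = 2 * max 0 ((x - a) * (b - x)) * (b - x - (x - a))" for x
  have pos: "1 + real n * B x > 0" for x by (simp add: B_def add_pos_nonneg)
  have dB: "(B has_real_derivative B' x) (at x)" for x
  proof -
    have "((\<lambda>x. (x - a) * (b - x)) has_real_derivative (b - x - (x - a))) (at x)"
      by (auto intro!: derivative_eq_intros simp: algebra_simps)
    from DERIV_chain2[OF DERIV_max0_sq this] show ?thesis by (simp add: B_def[abs_def] B'_def)
  qed
  have "(bump a b n has_real_derivative n * B' x / (1 + n * B x)\<^sup>2) (at x)" for x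
  proof -
    have "((\<lambda>x. n * B x / (1 + n * B x)) has_real_derivative
        ((n * B' x) * (1 + n * B x) - n * B x * (n * B' x)) / ((1 + n * B x) * (1 + n * B x))) (at x)"
      using pos[of x] by (intro DERIV_divide) (auto intro!: derivative_eq_intros dB)
    moreover have "bump a b n = (\<lambda>x. n * B x / (1 + n * B x))" by (simp add: bump_def B_def fun_eq_iff Let_def)
    ultimately show ?thesis by (simp add: algebra_simps power2_eq_square)
  qed
  moreover have "continuous_on UNIV (\<lambda>x. n * B' x / (1 + n * B x)\<^sup>2)"
  proof -
    have "1 + real n * B x \<noteq> 0" for x using pos[of x] by simp
    then show ?thesis unfolding B'_def B_def by (intro continuous_intros) (auto simp: B_def)
  qed
  moreover have "bump a b n x = 0" if "x \<notin> {a..b}" for x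
  proof -
    have "(x - a) * (b - x) \<le> 0" using that assms
      by (cases "x < a") (auto intro: mult_nonpos_nonneg mult_nonneg_nonpos)
    then show ?thesis by (simp add: bump_def max_def)
  qed
  ultimately show ?thesis unfolding test_fun_def using assms
    by (intro exI[of _ "\<lambda>x. n * B' x / (1 + n * B x)\<^sup>2"] conjI exI[of _ a] exI[of _ b]) auto
qed

lemma bump_bounds: "0 \<le> bump a b n x" "bump a b n x \<le> 1"
  by (simp_all add: bump_def Let_def divide_le_eq_1 add_nonneg_pos add_pos_nonneg)

lemma bump_lim: "a \<le> b \<Longrightarrow> (\<lambda>n. bump a b n x) \<longlonglongrightarrow> indicator {a<..<b} x"
proof (cases "x \<in> {a<..<b}")
  case True
  define B where "B = (max 0 ((x - a) * (b - x)))\<^sup>2"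
  have B: "B > 0" using True by (auto simp: B_def)
  have "(\<lambda>n. real n * B / (1 + real n * B)) \<longlonglongrightarrow> 1" using B by real_asymp
  then show ?thesis using True by (simp add: bump_def B_def Let_def)
next
  case False
  assume "a \<le> b"
  then have "(x - a) * (b - x) \<le> 0" using False
    by (cases "x \<le> a") (auto intro: mult_nonpos_nonneg mult_nonneg_nonpos)
  then show ?thesis using False by (simp add: bump_def max_def)
qed

lemma test_fun_cont: "test_fun \<phi> \<phi>' \<Longrightarrow> continuous_on S \<phi>" "test_fun \<phi> \<phi>' \<Longrightarrow> continuous_on S \<phi>'"
proof -
  assume a: "test_fun \<phi> \<phi>'"
  then show "continuous_on S \<phi>'" unfolding test_fun_def by (meson continuous_on_subset subset_UNIV)
  show "continuous_on S \<phi>" using a unfolding test_fun_def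
    by (meson DERIV_isCont continuous_at_imp_continuous_on)
qed

lemma test_fun_measurable: "test_fun \<phi> \<phi>' \<Longrightarrow> \<phi> \<in> borel_measurable leb_I"
  by (intro cont_measurable test_fun_cont)

text \<open>Dominated convergence passes from test functions to indicators of intervals compactly
  inside the domain, exhaustion to all open intervals, the pi-lambda theorem to Borel sets, and a
  null set correction to Lebesgue sets. A density whose integral over every measurable set vanishes
  is zero.\<close>

lemma AE_zero_of_test:
  fixes u :: "real \<Rightarrow> real"
  assumes u: "integrable leb_I u"
    and test: "\<And>\<phi> \<phi>'. test_fun \<phi> \<phi>' \<Longrightarrow> (LINT x|leb_I. \<phi> x * u x) = 0"
  shows "AE x in leb_I. u x = 0"
proof -
  have ind: "integrable leb_I (\<lambda>x. indicator A x * u x)" if "A \<in> sets borel" for A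
  proof -
    have "A \<inter> dom_I \<in> sets leb_I" using that unfolding sets_restrict_space by (intro image_eqI[of _ _ A]) auto
    then have "integrable leb_I (\<lambda>x. indicator (A \<inter> dom_I) x *\<^sub>R u x)"
      by (rule integrable_mult_indicator[OF _ u])
    then show ?thesis
      by (rule Bochner_Integration.integrable_cong[THEN iffD1, OF refl, rotated]) (auto simp: indicator_def)
  qed
  have 1: "(LINT x|leb_I. indicator {a<..<b} x * u x) = 0" if ab: "0 < a" "a \<le> b" "b < 2 * pi" for a b
  proof -
    obtain \<phi>' where \<phi>': "\<And>n. test_fun (bump a b n) (\<phi>' n)" using bump_test[OF ab] by metis
    have "(\<lambda>n. LINT x|leb_I. bump a b n x * u x) \<longlonglongrightarrow> (LINT x|leb_I. indicator {a<..<b} x * u x)"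
    proof (rule integral_dominated_convergence[where w = "\<lambda>x. \<bar>u x\<bar>"])
      show "(\<lambda>x. bump a b i x * u x) \<in> borel_measurable leb_I" for i
        using test_fun_measurable[OF \<phi>'] u by (intro borel_measurable_times) auto
      show "AE x in leb_I. (\<lambda>i. bump a b i x * u x) \<longlonglongrightarrow> indicator {a<..<b} x * u x"
        using bump_lim[OF ab(2)] by (intro AE_I2 tendsto_mult) auto
      show "AE x in leb_I. norm (bump a b i x * u x) \<le> \<bar>u x\<bar>" for i
        using bump_bounds[of a b i] by (intro AE_I2) (auto simp: abs_mult intro!: mult_left_le_one_le)
      show "(\<lambda>x. indicator {a<..<b} x * u x) \<in> borel_measurable leb_I"
        by (rule borel_measurable_integrable[OF ind]) simp
    qed (use u in auto)
    moreover have "(LINT x|leb_I. bump a b n x * u x) = 0" for n by (rule test[OF \<phi>'])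
    ultimately show ?thesis by (simp add: LIMSEQ_const_iff)
  qed
  have 2: "(LINT x|leb_I. indicator {a<..<b} x * u x) = 0" for a b
  proof (cases "max a 0 < min b (2 * pi)")
    case True
    \<comment> \<open>Compact subintervals that exhaust the intersection of \<open>{a<..<b}\<close>
      with the open domain. The shift by 3 keeps each margin below half the length, so that
      \<open>p n \<le> q n\<close> holds already for \<open>n = 0\<close>.\<close>
    define p where "p n = max a 0 + (min b (2*pi) - max a 0) / (real n + 3)" for n
    define q where "q n = min b (2*pi) - (min b (2*pi) - max a 0) / (real n + 3)" for n
    define D where "D = min b (2*pi) - max a 0"
    have D: "D > 0" using True by (simp add: D_def)
    have Dm: "min b (2*pi) = max a 0 + D" by (simp add: D_def)
    have pq': "p n = max a 0 + D / (real n + 3)" "q n = min b (2*pi) - D / (real n + 3)" for n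
      by (simp_all add: p_def q_def D_def)
    have pq: "0 < p n" "p n \<le> q n" "q n < 2 * pi" for n
    proof -
      have d: "D / (real n + 3) > 0" "D / (real n + 3) \<le> D / 2" using D by (auto simp: field_simps)
      then show "0 < p n" "q n < 2 * pi" unfolding p_def q_def D_def[symmetric] by linarith+
      show "p n \<le> q n" using d(2) Dm pq'[of n] by linarith
    qed
    have "(\<lambda>n. LINT x|leb_I. indicator {p n<..<q n} x * u x) \<longlonglongrightarrow> (LINT x|leb_I. indicator {a<..<b} x * u x)"
    proof (rule integral_dominated_convergence[where w = "\<lambda>x. \<bar>u x\<bar>"])
      show "AE x in leb_I. (\<lambda>i. indicator {p i<..<q i} x * u x) \<longlonglongrightarrow> indicator {a<..<b} x * u x"
      proof -
        have "AE x in lebesgue. x \<noteq> 0 \<and> x \<noteq> 2 * pi"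
        proof -
          have "AE x in lborel. x \<noteq> 0 \<and> x \<noteq> 2 * pi"
            by (intro AE_conjI AE_lborel_singleton)
          then show ?thesis by (rule AE_completion)
        qed
        then have "AE x in leb_I. x \<noteq> 0 \<and> x \<noteq> 2 * pi"
          by (subst AE_restrict_space_iff) auto
        moreover have "AE x in leb_I. x \<in> dom_I" by (intro AE_I2) simp
        ultimately show ?thesis
        proof eventually_elim
          case (elim x)
          have "eventually (\<lambda>i. indicator {p i<..<q i} x = (indicator {a<..<b} x :: real)) sequentially"
          proof (cases "x \<in> {a<..<b}")
            case True
            then have x: "max a 0 < x" "x < min b (2*pi)" using elim by auto
            have "(\<lambda>n. max a 0 + D / (real n + 3)) \<longlonglongrightarrow> max a 0" by real_asymp
            then have "eventually (\<lambda>n. p n < x) sequentially"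
              unfolding p_def D_def[symmetric] using x(1) by (rule order_tendstoD)
            moreover have "(\<lambda>n. min b (2*pi) - D / (real n + 3)) \<longlonglongrightarrow> min b (2*pi)" by real_asymp
            then have "eventually (\<lambda>n. x < q n) sequentially"
              unfolding q_def D_def[symmetric] using x(2) by (rule order_tendstoD)
            ultimately show ?thesis by eventually_elim (use True in auto)
          next
            case False
            have "x \<notin> {p i<..<q i}" for i
            proof -
              have "D / (real i + 3) > 0" using D by simp
              then show ?thesis using False unfolding p_def q_def D_def[symmetric] by auto
            qed
            then show ?thesis using False by simp
          qed
          then show ?case by (intro tendsto_mult tendsto_eventually tendsto_const)
        qed
      qed
      show "(\<lambda>x. indicator {p i<..<q i} x * u x) \<in> borel_measurable leb_I" for i
        by (rule borel_measurable_integrable[OF ind]) simp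
      show "(\<lambda>x. indicator {a<..<b} x * u x) \<in> borel_measurable leb_I"
        by (rule borel_measurable_integrable[OF ind]) simp
      show "AE x in leb_I. norm (indicator {p i<..<q i} x * u x) \<le> \<bar>u x\<bar>" for i
        by (intro AE_I2) (auto simp: indicator_def)
    qed (use u in auto)
    then show ?thesis using 1[OF pq] by (simp add: LIMSEQ_const_iff)
  next
    case False
    have "(LINT x|leb_I. indicator {a<..<b} x * u x) = (LINT x|leb_I. 0)"
      using False by (intro Bochner_Integration.integral_cong) (auto simp: indicator_def)
    then show ?thesis by simp
  qed
  have 3: "(LINT x|leb_I. indicator A x * u x) = 0" if A: "A \<in> sets borel" for A
  proof -
    have "Int_stable (range (\<lambda>(a, b). box a (b::real)))"
      by (auto simp: Int_stable_def box_Int_box)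
    moreover have "(range (\<lambda>(a, b). box a (b::real))) \<subseteq> Pow UNIV"
      by auto
    moreover have "A \<in> sigma_sets UNIV (range (\<lambda>(a, b). box a b))"
       using A unfolding borel_eq_box by (simp del: box_real)
    ultimately show ?thesis
    proof (induction rule: sigma_sets_induct_disjoint)
      case (basic A) then show ?case using 2 by (auto simp: box_real)
    next
      case empty then show ?case by simp
    next
      case (compl A)
      then have A: "A \<in> sets borel" by (simp add: borel_eq_box del: box_real)
      \<comment> \<open>Complements require the total integral to vanish; this is the case of an
        open interval containing the domain, as \<open>2 * pi < 8\<close>.\<close>
      have "(LINT x|leb_I. u x) = (LINT x|leb_I. indicator {-1<..<8} x * u x)"
        using pi_less_4 by (intro Bochner_Integration.integral_cong) (auto simp: indicator_def)
      moreover have "(LINT x|leb_I. indicator (UNIV - A) x * u x) = (LINT x|leb_I. u x - indicator A x * u x)"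
        by (intro Bochner_Integration.integral_cong) (auto simp: indicator_def)
      ultimately show ?case
        using 2[of "-1" 8] compl.IH u ind[OF A] by (simp add: Bochner_Integration.integral_diff)
    next
      case (union F)
      then have F: "\<And>i. F i \<in> sets borel" by (auto simp: borel_eq_box subset_eq simp del: box_real)
      let ?G = "\<lambda>i. F i \<inter> dom_I"
      have G: "?G i \<in> sets leb_I" for i using F[of i] unfolding sets_restrict_space by (intro image_eqI[of _ _ "F i"]) auto
      have eq: "(LINT x:S \<inter> dom_I|leb_I. u x) = (LINT x|leb_I. indicator S x * u x)" for S
        unfolding set_lebesgue_integral_def
        by (intro Bochner_Integration.integral_cong) (auto simp: indicator_def)
      have "(LINT x:(\<Union>i. ?G i)|leb_I. u x) = (\<Sum>i. (LINT x:?G i|leb_I. u x))"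
      proof (rule lebesgue_integral_countable_add)
        show "set_integrable leb_I (\<Union>i. ?G i) u" unfolding set_integrable_def
          by (intro integrable_mult_indicator u sets.countable_UN) (use G in blast)
      qed (use G union.hyps in \<open>auto simp: disjoint_family_on_def\<close>)
      also have "\<dots> = 0" using union.IH by (simp add: eq)
      also have "(\<Union>i. ?G i) = (\<Union>i. F i) \<inter> dom_I" by auto
      finally show ?case by (simp add: eq)
    qed
  qed
  have "finite_measure leb_I" by (rule finite_measure_lebesgue_on) auto
  then interpret finite_measure leb_I .
  show ?thesis
  proof (rule density_zero[OF u])
    fix A assume "A \<in> sets leb_I"
    then have A: "A \<in> sets lebesgue" "A \<subseteq> dom_I" by (auto simp: sets_restrict_space_iff)
    obtain S N N' where S: "A = S \<union> N" "N \<subseteq> N'" "N' \<in> null_sets lborel" "S \<in> sets lborel"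
      using sets_completionE[OF A(1)] by metis
    have "AE x in lborel. x \<notin> N'" using S(3) by (rule AE_not_in)
    then have "AE x in lebesgue. x \<notin> N'" by (rule AE_completion)
    then have "AE x in leb_I. x \<notin> N'" by (subst AE_restrict_space_iff) auto
    then have ae: "AE x in leb_I. indicator A x *\<^sub>R u x = indicator S x * u x"
      by eventually_elim (use S in \<open>auto simp: indicator_def\<close>)
    have "set_lebesgue_integral leb_I A u = (LINT x|leb_I. indicator S x * u x)"
      unfolding set_lebesgue_integral_def
    proof (rule integral_cong_AE)
      show "(\<lambda>x. indicator A x *\<^sub>R u x) \<in> borel_measurable leb_I"
        using \<open>A \<in> sets leb_I\<close> u by (intro borel_measurable_integrable integrable_mult_indicator)
      show "(\<lambda>x. indicator S x * u x) \<in> borel_measurable leb_I"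
        using S(4) by (intro borel_measurable_integrable[OF ind]) simp
    qed (rule ae)
    also have "\<dots> = 0" using S(4) by (intro 3) simp
    finally show "set_lebesgue_integral leb_I A u = 0" .
  qed
qed

section \<open>Weakly differentiable functions as absolutely continuous ones\<close>

lemma test_fun_ac: "test_fun \<phi> \<phi>' \<Longrightarrow> ac \<phi> \<phi>'"
proof (rule ac_C1)
  fix x assume "test_fun \<phi> \<phi>'"
  then have "(\<phi> has_real_derivative \<phi>' x) (at x)" unfolding test_fun_def by blast
  then show "(\<phi> has_vector_derivative \<phi>' x) (at x within dom_I)"
    by (simp add: has_real_derivative_iff_has_vector_derivative has_vector_derivative_at_within)
qed (rule test_fun_cont)

lemma test_fun_ends: "test_fun \<phi> \<phi>' \<Longrightarrow> \<phi> 0 = 0" "test_fun \<phi> \<phi>' \<Longrightarrow> \<phi> (2 * pi) = 0"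
  unfolding test_fun_def by force+

lemma ac_imp_weak:
  assumes "ac F g"
  shows "has_weak_deriv F g"
  unfolding has_weak_deriv_def
proof (intro conjI allI impI)
  note i = ac_integrable[OF assms] and c = ac_continuous[OF assms]
  show "integrable leb_I F" using c by (rule cont_integrable)
  show "integrable leb_I g" by (rule i)
  fix \<phi> \<phi>' assume t: "test_fun \<phi> \<phi>'"
  have i1: "integrable leb_I (\<lambda>x. \<phi> x *\<^sub>R g x)"
    by (rule integrable_bilinear_cont(1)[OF bounded_bilinear_scaleR test_fun_cont(1)[OF t] i])
  have i2: "integrable leb_I (\<lambda>x. \<phi>' x *\<^sub>R F x)"
    by (intro cont_integrable continuous_intros c test_fun_cont[OF t])
  have "(LINT x|leb_I. \<phi> x *\<^sub>R g x + \<phi>' x *\<^sub>R F x) = 0"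
    using ac_total[OF ac_bilinear[OF bounded_bilinear_scaleR test_fun_ac[OF t] assms]]
    by (simp add: test_fun_ends[OF t])
  then show "(LINT x|leb_I. \<phi>' x *\<^sub>R F x) = - (LINT x|leb_I. \<phi> x *\<^sub>R g x)"
    using i1 i2 by (simp add: Bochner_Integration.integral_add eq_neg_iff_add_eq_0 add.commute)
qed

lemma integrable_test_times:
  fixes f :: "real \<Rightarrow> 'a::euclidean_space"
  assumes "test_fun \<phi> \<phi>'" "integrable leb_I f"
  shows "integrable leb_I (\<lambda>x. \<phi> x *\<^sub>R f x)" "integrable leb_I (\<lambda>x. \<phi>' x *\<^sub>R f x)"
  using assms by (auto intro: integrable_bilinear_cont(1)[OF bounded_bilinear_scaleR test_fun_cont(1)]
    integrable_bilinear_cont(1)[OF bounded_bilinear_scaleR test_fun_cont(2)])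

lemma weakD:
  "has_weak_deriv f g \<Longrightarrow> test_fun \<phi> \<phi>' \<Longrightarrow>
    (LINT x|leb_I. \<phi>' x *\<^sub>R f x) = - (LINT x|leb_I. \<phi> x *\<^sub>R g x)"
  unfolding has_weak_deriv_def by blast

lemma weak_inner:
  assumes "has_weak_deriv f g" shows "has_weak_deriv (\<lambda>x. f x \<bullet> b) (\<lambda>x. g x \<bullet> b)"
  unfolding has_weak_deriv_def
proof (intro conjI allI impI)
  have i: "integrable leb_I f" "integrable leb_I g" using assms by (auto simp: has_weak_deriv_def)
  then show "integrable leb_I (\<lambda>x. f x \<bullet> b)" "integrable leb_I (\<lambda>x. g x \<bullet> b)" by auto
  fix \<phi> \<phi>' assume t: "test_fun \<phi> \<phi>'"
  have "(LINT x|leb_I. \<phi>' x *\<^sub>R f x) \<bullet> b = - (LINT x|leb_I. \<phi> x *\<^sub>R g x) \<bullet> b"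
    using weakD[OF assms t] by simp
  then show "(LINT x|leb_I. \<phi>' x *\<^sub>R (f x \<bullet> b)) = - (LINT x|leb_I. \<phi> x *\<^sub>R (g x \<bullet> b))"
    using integrable_test_times[OF t i(1)] integrable_test_times[OF t i(2)]
    by (simp add: integral_inner_left[symmetric])
qed

text \<open>Du Bois-Reymond: subtracting from a test function its integral times a normalised bump
  leaves a function \<open>\<theta>\<close> of integral zero, whose primitive is again a test
  function. Hence \<open>f\<close> integrates against every test function like the constant
  \<open>k\<close>, its mean with weight \<open>\<omega>\<close>.\<close>

lemma weak_const:
  fixes f :: "real \<Rightarrow> real"
  assumes f: "integrable leb_I f"
    and test: "\<And>\<phi> \<phi>'. test_fun \<phi> \<phi>' \<Longrightarrow> (LINT x|leb_I. \<phi>' x * f x) = 0"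
  shows "\<exists>k. AE x in leb_I. f x = k"
proof -
  define \<omega> where "\<omega> = bump 1 2 1"
  obtain \<omega>' where \<omega>: "test_fun \<omega> \<omega>'" using bump_test[of 1 2 1] pi_gt3 unfolding \<omega>_def by auto
  define c0 where "c0 = (LINT x|leb_I. \<omega> x)"
  have i\<omega>: "integrable leb_I \<omega>" by (intro cont_integrable test_fun_cont[OF \<omega>])
  have \<omega>pos: "0 \<le> \<omega> x" for x by (simp add: \<omega>_def bump_bounds)
  \<comment> \<open>A nonnegative continuous function with integral zero would vanish at
    \<open>3 / 2\<close>, the midpoint of the support of \<open>\<omega>\<close>, where the bump is
    positive.\<close>
  have c0: "c0 \<noteq> 0"
  proof
    assume "c0 = 0"
    have "integral dom_I \<omega> = 0" using \<open>c0 = 0\<close> LINT_eq_integral[OF i\<omega>] by (simp add: c0_def)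
    moreover have "(\<omega> has_integral integral dom_I \<omega>) dom_I"
      by (intro integrable_integral integrable_continuous_interval test_fun_cont[OF \<omega>])
    ultimately have "\<omega> (3/2) = 0"
      using pi_gt3 \<omega>pos
      by (intro has_integral_0_cbox_imp_0[of 0 "2 * pi" \<omega>]) (auto intro!: test_fun_cont[OF \<omega>])
    then show False by (simp add: \<omega>_def bump_def Let_def power2_eq_square)
  qed
  define k where "k = (LINT x|leb_I. \<omega> x * f x) / c0"
  have "AE x in leb_I. f x - k = 0"
  proof (rule AE_zero_of_test)
    show "integrable leb_I (\<lambda>x. f x - k)" using f by auto
    fix \<phi> \<phi>' assume t: "test_fun \<phi> \<phi>'"
    have i\<phi>: "integrable leb_I \<phi>" by (intro cont_integrable test_fun_cont[OF t])
    define I\<phi> where "I\<phi> = (LINT x|leb_I. \<phi> x)"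
    define \<theta> where "\<theta> x = \<phi> x - I\<phi> / c0 * \<omega> x" for x
    have \<theta>c: "continuous_on S \<theta>" for S unfolding \<theta>_def
      by (intro continuous_intros test_fun_cont[OF t] test_fun_cont[OF \<omega>])
    have \<theta>0: "integral dom_I \<theta> = 0"
    proof -
      have "(LINT x|leb_I. \<theta> x) = I\<phi> - I\<phi> / c0 * c0"
        unfolding \<theta>_def using i\<phi> i\<omega> by (simp add: I\<phi>_def c0_def)
      then show ?thesis using c0 LINT_eq_integral[OF cont_integrable[OF \<theta>c]] by simp
    qed
    obtain a1 b1 where ab1: "0 < a1" "a1 \<le> b1" "b1 < 2 * pi" "\<And>x. x \<notin> {a1..b1} \<Longrightarrow> \<phi> x = 0"
      using t unfolding test_fun_def by metis
    obtain a2 b2 where ab2: "0 < a2" "a2 \<le> b2" "b2 < 2 * pi" "\<And>x. x \<notin> {a2..b2} \<Longrightarrow> \<omega> x = 0"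
      using \<omega> unfolding test_fun_def by metis
    define a b where "a = min a1 a2" and "b = max b1 b2"
    have ab: "0 < a" "a \<le> b" "b < 2 * pi" "\<And>x. x \<notin> {a..b} \<Longrightarrow> \<theta> x = 0"
    proof -
      show "0 < a" "a \<le> b" "b < 2 * pi" using ab1 ab2 by (auto simp: a_def b_def)
      fix x assume "x \<notin> {a..b}"
      then have "x \<notin> {a1..b1}" "x \<notin> {a2..b2}" by (auto simp: a_def b_def)
      then show "\<theta> x = 0" using ab1(4)[of x] ab2(4)[of x] by (simp add: \<theta>_def)
    qed
    define \<Theta> where "\<Theta> x = integral {0..x} \<theta>" for x
    have low: "\<Theta> x = 0" if "x < a" for x
    proof -
      have "integral {0..x} \<theta> = integral {0..x} (\<lambda>_. 0)"
        using that ab by (intro Henstock_Kurzweil_Integration.integral_cong) auto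
      then show ?thesis by (simp add: \<Theta>_def)
    qed
    have "integral {0..b} \<theta> + integral {b..y} \<theta> = integral {0..y} \<theta>" if "y \<ge> b" for y
      using that ab by (intro Henstock_Kurzweil_Integration.integral_combine integrable_continuous_interval \<theta>c) auto
    moreover have "integral {b..y} \<theta> = 0" for y
    proof -
      have "integral {b..y} \<theta> = integral {b..y} (\<lambda>_. 0)"
        using ab(4) by (intro integral_spike[of "{b}"]) auto
      then show ?thesis by simp
    qed
    ultimately have high0: "\<Theta> y = \<Theta> b" if "y \<ge> b" for y using that by (simp add: \<Theta>_def)
    have high: "\<Theta> y = 0" if "y \<ge> b" for y
      using high0[OF that] high0[of "2 * pi"] ab \<theta>0 by (simp add: \<Theta>_def)
    have "test_fun \<Theta> \<theta>"
      unfolding test_fun_def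
    proof (intro conjI allI)
      show "\<exists>a b. 0 < a \<and> a \<le> b \<and> b < 2 * pi \<and> (\<forall>x. x \<notin> {a..b} \<longrightarrow> \<Theta> x = 0)"
        using ab low high by (intro exI[of _ a] exI[of _ b]) auto
      fix x
      show "(\<Theta> has_real_derivative \<theta> x) (at x)"
      \<comment> \<open>Left of \<open>a\<close>, in particular for negative \<open>x\<close>, where
        \<open>{0..x}\<close> is empty, \<open>\<Theta>\<close> vanishes identically; this gives the
        two-sided derivative at points \<open>x \<le> 0\<close>.\<close>
      proof (cases "x > 0")
        case True
        have "((\<lambda>u. integral {0..u} \<theta>) has_vector_derivative \<theta> x) (at x within {0..x+1})"
          using True by (intro integral_has_vector_derivative \<theta>c) auto
        then have "((\<lambda>u. integral {0..u} \<theta>) has_real_derivative \<theta> x) (at x within {0<..<x+1})"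
          by (auto simp: has_real_derivative_iff_has_vector_derivative intro: has_vector_derivative_within_subset)
        moreover have "at x within {0<..<x+1} = at x" using True by (intro at_within_open) auto
        ultimately show ?thesis unfolding \<Theta>_def by simp
      next
        case False
        have "((\<lambda>_. 0) has_real_derivative 0) (at x)" by simp
        then have "(\<Theta> has_real_derivative 0) (at x)"
          by (rule has_field_derivative_transform_within_open[where S = "{..<a}"]) (use False ab low in auto)
        moreover have "\<theta> x = 0" using ab False by auto
        ultimately show ?thesis by simp
      qed
    qed (rule \<theta>c)
    then have "(LINT x|leb_I. \<theta> x * f x) = 0" by (rule test)
    moreover have "(LINT x|leb_I. \<theta> x * f x) = (LINT x|leb_I. \<phi> x * f x) - I\<phi> / c0 * (LINT x|leb_I. \<omega> x * f x)"
      using integrable_test_times[OF t f] integrable_test_times[OF \<omega> f]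
      by (simp add: \<theta>_def left_diff_distrib mult.assoc)
    ultimately have "(LINT x|leb_I. \<phi> x * f x) = I\<phi> * k" by (simp add: k_def)
    then show "(LINT x|leb_I. \<phi> x * (f x - k)) = 0"
      using integrable_test_times[OF t f] i\<phi> by (simp add: right_diff_distrib I\<phi>_def)
  qed
  then show ?thesis by auto
qed

lemma AE_Basis_eq:
  fixes f g :: "real \<Rightarrow> 'a::euclidean_space"
  assumes "\<And>b. b \<in> Basis \<Longrightarrow> AE x in M. f x \<bullet> b = g x \<bullet> b"
  shows "AE x in M. f x = g x"
proof -
  have "AE x in M. \<forall>b\<in>Basis. f x \<bullet> b = g x \<bullet> b"
    using assms by (intro AE_finite_allI) auto
  then show ?thesis by eventually_elim (auto intro: euclidean_eqI)
qed

lemma weak_unique: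
  assumes "has_weak_deriv f g" "has_weak_deriv f h"
  shows "AE x in leb_I. g x = h x"
proof (rule AE_Basis_eq)
  fix b :: 'a assume "b \<in> Basis"
  note w = weak_inner[OF assms(1), of b] weak_inner[OF assms(2), of b]
  have i: "integrable leb_I (\<lambda>x. g x \<bullet> b)" "integrable leb_I (\<lambda>x. h x \<bullet> b)"
    using w by (auto simp: has_weak_deriv_def)
  have "AE x in leb_I. g x \<bullet> b - h x \<bullet> b = 0"
  proof (rule AE_zero_of_test)
    fix \<phi> \<phi>' assume t: "test_fun \<phi> \<phi>'"
    have "- (LINT x|leb_I. \<phi> x *\<^sub>R (g x \<bullet> b)) = - (LINT x|leb_I. \<phi> x *\<^sub>R (h x \<bullet> b))"
      using weakD[OF w(1) t] weakD[OF w(2) t] by simp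
    then show "(LINT x|leb_I. \<phi> x * (g x \<bullet> b - h x \<bullet> b)) = 0"
      using integrable_test_times(1)[OF t i(1)] integrable_test_times(1)[OF t i(2)]
      by (simp add: right_diff_distrib)
  qed (use i in auto)
  then show "AE x in leb_I. g x \<bullet> b = h x \<bullet> b" by simp
qed

lemma weak_cong_AE:
  assumes "has_weak_deriv f g" "AE x in leb_I. f x = F x" "AE x in leb_I. g x = G x"
    "F \<in> borel_measurable leb_I" "G \<in> borel_measurable leb_I"
  shows "has_weak_deriv F G"
  unfolding has_weak_deriv_def
proof (intro conjI allI impI)
  have i: "integrable leb_I f" "integrable leb_I g" using assms by (auto simp: has_weak_deriv_def)
  show F: "integrable leb_I F" by (rule integrable_cong_AE_imp[OF i(1) assms(4)]) (use assms(2) in auto)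
  show G: "integrable leb_I G" by (rule integrable_cong_AE_imp[OF i(2) assms(5)]) (use assms(3) in auto)
  fix \<phi> \<phi>' assume t: "test_fun \<phi> \<phi>'"
  have "(LINT x|leb_I. \<phi>' x *\<^sub>R F x) = (LINT x|leb_I. \<phi>' x *\<^sub>R f x)"
    by (intro integral_cong_AE borel_measurable_integrable integrable_test_times[OF t] F i)
      (use assms(2) in auto)
  moreover have "(LINT x|leb_I. \<phi> x *\<^sub>R G x) = (LINT x|leb_I. \<phi> x *\<^sub>R g x)"
    by (intro integral_cong_AE borel_measurable_integrable integrable_test_times[OF t] G i)
      (use assms(3) in auto)
  ultimately show "(LINT x|leb_I. \<phi>' x *\<^sub>R F x) = - (LINT x|leb_I. \<phi> x *\<^sub>R G x)"
    using weakD[OF assms(1) t] by simp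
qed

text \<open>The difference of \<open>f\<close> and the primitive of \<open>g\<close> has zero weak
  derivative in every coordinate, hence is constant almost everywhere. This trades weak derivatives
  for integral formulas, to which the product and chain rules apply.\<close>

lemma weak_imp_ac:
  assumes "has_weak_deriv f g"
  obtains F where "ac F g" "AE x in leb_I. f x = F x"
proof -
  have i: "integrable leb_I f" "integrable leb_I g" using assms by (auto simp: has_weak_deriv_def)
  define G where "G x = integral {0..x} g" for x
  have G: "ac G g" using i by (intro acI) (auto simp: G_def)
  have iG: "integrable leb_I G" by (intro cont_integrable ac_continuous[OF G])
  have "\<exists>k. AE x in leb_I. f x \<bullet> b - G x \<bullet> b = k" for b
  proof (rule weak_const)
    note w = weak_inner[OF assms(1), of b] weak_inner[OF ac_imp_weak[OF G], of b]
    fix \<phi> \<phi>' assume t: "test_fun \<phi> \<phi>'"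
    have "(LINT x|leb_I. \<phi>' x *\<^sub>R (f x \<bullet> b)) = (LINT x|leb_I. \<phi>' x *\<^sub>R (G x \<bullet> b))"
      using weakD[OF w(1) t] weakD[OF w(2) t] by simp
    then show "(LINT x|leb_I. \<phi>' x * (f x \<bullet> b - G x \<bullet> b)) = 0"
      using integrable_test_times(2)[OF t, of "\<lambda>x. f x \<bullet> b"] integrable_test_times(2)[OF t, of "\<lambda>x. G x \<bullet> b"] i iG
      by (simp add: right_diff_distrib)
  qed (use i iG in auto)
  then obtain k where k: "\<And>b. AE x in leb_I. f x \<bullet> b - G x \<bullet> b = k b" by metis
  define K where "K = (\<Sum>b\<in>Basis. k b *\<^sub>R b)"
  have "AE x in leb_I. f x = K + G x"
  proof (rule AE_Basis_eq)
    fix b :: 'a assume b: "b \<in> Basis"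
    show "AE x in leb_I. f x \<bullet> b = (K + G x) \<bullet> b"
      using k[of b] by eventually_elim (use b in \<open>simp add: K_def inner_simps\<close>)
  qed
  moreover have "ac (\<lambda>x. K + G x) g" using ac_add[OF ac_const[of K] G] by simp
  ultimately show ?thesis by (rule that[rotated])
qed

lemma cont_AE_eq:
  fixes f g :: "real \<Rightarrow> 'a::euclidean_space"
  assumes "continuous_on dom_I f" "continuous_on dom_I g" "AE x in leb_I. f x = g x" "x \<in> dom_I"
  shows "f x = g x"
proof (rule ccontr)
  assume ne: "f x \<noteq> g x"
  have "AE x in lebesgue. x \<in> dom_I \<longrightarrow> f x = g x"
    using assms(3) by (subst (asm) AE_restrict_space_iff) auto
  then obtain N where N: "negligible N" "\<And>x. x \<in> dom_I \<Longrightarrow> x \<notin> N \<Longrightarrow> f x = g x"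
    by (auto simp: negligible_iff_null_sets eventually_ae_filter subset_iff)
  have "continuous_on dom_I (\<lambda>x. f x - g x)" using assms by (intro continuous_intros)
  then obtain d where d: "d > 0" "\<And>y. y \<in> dom_I \<Longrightarrow> \<bar>y - x\<bar> < d \<Longrightarrow> norm ((f y - g y) - (f x - g x)) < norm (f x - g x)"
    using ne assms(4) unfolding continuous_on_iff dist_norm real_norm_def
    by (metis right_minus_eq zero_less_norm_iff)
  define p where "p = max 0 (x - d)"
  define q where "q = min (2 * pi) (x + d)"
  have pq: "p < q" using d assms(4) by (auto simp: p_def q_def)
  have "{p<..<q} \<subseteq> N"
  proof
    fix y assume y: "y \<in> {p<..<q}"
    then have "y \<in> dom_I" "\<bar>y - x\<bar> < d" by (auto simp: p_def q_def)
    then have "f y \<noteq> g y" using d(2)[of y] by (auto simp: norm_minus_commute)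
    then show "y \<in> N" using N(2) \<open>y \<in> dom_I\<close> by blast
  qed
  then have "negligible {p<..<q}" using N(1) negligible_subset by blast
  then show False using pq open_not_negligible[of "{p<..<q}"] by auto
qed

lemma wderiv_spec:
  assumes "has_weak_deriv f g"
  shows "has_weak_deriv f (wderiv f)" "AE x in leb_I. wderiv f x = g x"
proof -
  have "\<exists>g. has_weak_deriv f g \<and> ((\<exists>h. has_weak_deriv f h \<and> continuous_on dom_I h) \<longrightarrow> continuous_on dom_I g)"
    using assms by blast
  from someI_ex[OF this] show "has_weak_deriv f (wderiv f)" unfolding wderiv_def by blast
  from weak_unique[OF this assms] show "AE x in leb_I. wderiv f x = g x" .
qed

lemma wderiv_cont:
  assumes "has_weak_deriv f g" "continuous_on dom_I g"
  shows "continuous_on dom_I (wderiv f)" "x \<in> dom_I \<Longrightarrow> wderiv f x = g x"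
proof -
  have "\<exists>g. has_weak_deriv f g \<and> ((\<exists>h. has_weak_deriv f h \<and> continuous_on dom_I h) \<longrightarrow> continuous_on dom_I g)"
    using assms by blast
  from someI_ex[OF this] assms show c: "continuous_on dom_I (wderiv f)" unfolding wderiv_def by blast
  show "x \<in> dom_I \<Longrightarrow> wderiv f x = g x" by (rule cont_AE_eq[OF c assms(2) wderiv_spec(2)[OF assms(1)]])
qed

section \<open>Sobolev functions\<close>

lemma L2_funI:
  assumes "f \<in> borel_measurable leb_I" "integrable leb_I (\<lambda>x. (norm (f x))\<^sup>2)"
  shows "L2_fun f" using assms by (simp add: L2_fun_def)

lemma L2_cont: "continuous_on dom_I f \<Longrightarrow> L2_fun f"
  by (intro L2_funI cont_measurable cont_integrable continuous_intros)

lemma L2_meas: "L2_fun f \<Longrightarrow> f \<in> borel_measurable leb_I"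
  by (simp add: L2_fun_def)

lemma integrable_leb_bound:
  fixes f :: "real \<Rightarrow> 'a::euclidean_space"
  assumes "f \<in> borel_measurable leb_I" "integrable leb_I g" "\<And>x. x \<in> dom_I \<Longrightarrow> norm (f x) \<le> g x"
  shows "integrable leb_I f"
  by (rule measurable_bounded_by_integrable_imp_lebesgue_integrable[OF assms(1,2)]) (use assms(3) in auto)

lemma measurable_bilin:
  fixes f :: "real \<Rightarrow> 'a::euclidean_space" and g :: "real \<Rightarrow> 'b::euclidean_space"
    and h :: "'a \<Rightarrow> 'b \<Rightarrow> 'c::euclidean_space"
  assumes "bounded_bilinear h" "f \<in> borel_measurable leb_I" "g \<in> borel_measurable leb_I"
  shows "(\<lambda>x. h (f x) (g x)) \<in> borel_measurable leb_I"
proof (rule borel_measurable_bilinear[of h f dom_I g])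
  show "bilinear h" using assms(1) by (simp add: bilinear_conv_bounded_bilinear)
qed (use assms in simp_all)

lemma L2_prod_integrable:
  fixes f :: "real \<Rightarrow> 'a::euclidean_space" and g :: "real \<Rightarrow> 'b::euclidean_space"
    and h :: "'a \<Rightarrow> 'b \<Rightarrow> 'c::euclidean_space"
  assumes "bounded_bilinear h" "L2_fun f" "L2_fun g"
  shows "integrable leb_I (\<lambda>x. h (f x) (g x))"
proof -
  obtain K where K: "K > 0" "\<And>a b. norm (h a b) \<le> norm a * norm b * K"
    using bounded_bilinear.pos_bounded[OF assms(1)] by blast
  show ?thesis
  proof (rule integrable_leb_bound)
    show "(\<lambda>x. h (f x) (g x)) \<in> borel_measurable leb_I"
      by (rule measurable_bilin[OF assms(1) L2_meas[OF assms(2)] L2_meas[OF assms(3)]])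
    show "integrable leb_I (\<lambda>x. K * ((norm (f x))\<^sup>2 + (norm (g x))\<^sup>2))"
      using assms by (intro Bochner_Integration.integrable_add integrable_mult_right) (simp_all add: L2_fun_def)
    fix x
    have "norm (h (f x) (g x)) \<le> norm (f x) * norm (g x) * K" by (rule K)
    also have "\<dots> \<le> ((norm (f x))\<^sup>2 + (norm (g x))\<^sup>2) * K"
    proof (rule mult_right_mono)
      have "0 \<le> (norm (f x) - norm (g x))\<^sup>2" by simp
      moreover have "0 \<le> (norm (f x))\<^sup>2" "0 \<le> (norm (g x))\<^sup>2" by simp_all
      ultimately show "norm (f x) * norm (g x) \<le> (norm (f x))\<^sup>2 + (norm (g x))\<^sup>2"
        unfolding power2_diff by linarith
    qed (use K in simp)
    finally show "norm (h (f x) (g x)) \<le> K * ((norm (f x))\<^sup>2 + (norm (g x))\<^sup>2)" by (simp add: mult.commute)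
  qed
qed

lemma L2_add:
  assumes "L2_fun f" "L2_fun g" shows "L2_fun (\<lambda>x. f x + g x)"
proof (rule L2_funI)
  show m: "(\<lambda>x. f x + g x) \<in> borel_measurable leb_I" using assms by (intro borel_measurable_add L2_meas)
  show "integrable leb_I (\<lambda>x. (norm (f x + g x))\<^sup>2)"
  proof (rule integrable_leb_bound)
    show "(\<lambda>x. (norm (f x + g x))\<^sup>2) \<in> borel_measurable leb_I"
      using m by measurable
    show "integrable leb_I (\<lambda>x. 2 * ((norm (f x))\<^sup>2 + (norm (g x))\<^sup>2))"
      using assms by (intro Bochner_Integration.integrable_add integrable_mult_right) (simp_all add: L2_fun_def)
    fix x
    have "(norm (f x + g x))\<^sup>2 \<le> (norm (f x) + norm (g x))\<^sup>2"
      by (intro power_mono norm_triangle_ineq norm_ge_zero)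
    also have "\<dots> \<le> 2 * ((norm (f x))\<^sup>2 + (norm (g x))\<^sup>2)"
      using sum_squares_bound[of "norm (f x)" "norm (g x)"] by (simp add: power2_sum)
    finally show "norm ((norm (f x + g x))\<^sup>2) \<le> 2 * ((norm (f x))\<^sup>2 + (norm (g x))\<^sup>2)" by simp
  qed
qed

lemma L2_bilin_cont:
  fixes f :: "real \<Rightarrow> 'a::euclidean_space" and g :: "real \<Rightarrow> 'b::euclidean_space"
    and h :: "'a \<Rightarrow> 'b \<Rightarrow> 'c::euclidean_space"
  assumes "bounded_bilinear h" "continuous_on dom_I f" "L2_fun g"
  shows "L2_fun (\<lambda>x. h (f x) (g x))"
proof (rule L2_funI)
  obtain K where K: "K > 0" "\<And>a b. norm (h a b) \<le> norm a * norm b * K"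
    using bounded_bilinear.pos_bounded[OF assms(1)] by blast
  obtain B where B: "B > 0" "\<And>x. x \<in> dom_I \<Longrightarrow> norm (f x) \<le> B"
    using cont_bound[OF assms(2)] by blast
  show m: "(\<lambda>x. h (f x) (g x)) \<in> borel_measurable leb_I"
    by (rule measurable_bilin[OF assms(1) cont_measurable[OF assms(2)] L2_meas[OF assms(3)]])
  show "integrable leb_I (\<lambda>x. (norm (h (f x) (g x)))\<^sup>2)"
  proof (rule integrable_leb_bound)
    show "(\<lambda>x. (norm (h (f x) (g x)))\<^sup>2) \<in> borel_measurable leb_I" using m by measurable
    show "integrable leb_I (\<lambda>x. (B * K)\<^sup>2 * (norm (g x))\<^sup>2)" using assms by (intro integrable_mult_right) (simp_all add: L2_fun_def)
    fix x assume "x \<in> dom_I"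
    have "norm (h (f x) (g x)) \<le> norm (f x) * norm (g x) * K" by (rule K)
    also have "\<dots> \<le> B * norm (g x) * K" using B \<open>x \<in> dom_I\<close> K by (intro mult_right_mono) auto
    finally have "(norm (h (f x) (g x)))\<^sup>2 \<le> (B * norm (g x) * K)\<^sup>2" by (intro power_mono) auto
    then show "norm ((norm (h (f x) (g x)))\<^sup>2) \<le> (B * K)\<^sup>2 * (norm (g x))\<^sup>2"
      by (simp add: power_mult_distrib mult_ac)
  qed
qed

lemma L2_scaleR: "L2_fun f \<Longrightarrow> L2_fun (\<lambda>x. k *\<^sub>R f x)"
  by (rule L2_bilin_cont[OF bounded_bilinear_scaleR]) auto

lemma L2_cong:
  assumes "L2_fun f" "AE x in leb_I. f x = g x" "g \<in> borel_measurable leb_I"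
  shows "L2_fun g"
proof (rule L2_funI[OF assms(3)])
  show "integrable leb_I (\<lambda>x. (norm (g x))\<^sup>2)"
    by (rule integrable_cong_AE_imp[of leb_I "\<lambda>x. (norm (f x))\<^sup>2"])
      (use assms in \<open>auto simp: L2_fun_def\<close>)
qed

lemma weak_meas: "has_weak_deriv f g \<Longrightarrow> g \<in> borel_measurable leb_I"
  unfolding has_weak_deriv_def by (blast intro: borel_measurable_integrable)

section \<open>Periodic Sobolev functions\<close>

lemma H_per1D:
  assumes "f \<in> H_per 1"
  shows "ac f (wderiv f)" "L2_fun (wderiv f)" "f 0 = f (2 * pi)" "continuous_on dom_I f"
proof -
  obtain g where g: "has_weak_deriv f g" "L2_fun g" using assms by (auto simp: H_per_def)
  show c: "continuous_on dom_I f" using assms by (simp add: H_per_def)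
  show "f 0 = f (2 * pi)" using assms by (simp add: H_per_def)
  have w: "has_weak_deriv f (wderiv f)" by (rule wderiv_spec(1)[OF g(1)])
  have m: "wderiv f \<in> borel_measurable leb_I" by (rule weak_meas[OF w])
  show "L2_fun (wderiv f)"
    by (rule L2_cong[OF g(2) _ m]) (use wderiv_spec(2)[OF g(1)] in auto)
  obtain F where F: "ac F (wderiv f)" "AE x in leb_I. f x = F x" by (rule weak_imp_ac[OF w])
  have "f x = F x" if "x \<in> dom_I" for x by (rule cont_AE_eq[OF c ac_continuous[OF F(1)] F(2) that])
  then show "ac f (wderiv f)" by (intro ac_cong[OF F(1) _ _ m]) auto
qed

lemma H_per1I:
  assumes "ac f g" "L2_fun g" "f 0 = f (2 * pi)" shows "f \<in> H_per 1"
  using assms ac_imp_weak[OF assms(1)] ac_continuous[OF assms(1)] L2_cont[OF ac_continuous[OF assms(1)]]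
  by (auto simp: H_per_def)

text \<open>\<open>sobolev_H\<close> provides some weak derivative \<open>g\<close>, which agrees
  almost everywhere with a continuous \<open>G\<close>. The choice made in \<open>wderiv\<close>
  then yields \<open>G\<close> itself on the interval, so that periodicity of the first derivative
  is a statement about point values of \<open>G\<close>.\<close>

lemma H_per2D:
  assumes "f \<in> H_per 2"
  shows "ac f (wderiv f)" "ac (wderiv f) (wderiv (wderiv f))" "L2_fun (wderiv (wderiv f))"
    "f 0 = f (2 * pi)" "wderiv f 0 = wderiv f (2 * pi)"
proof -
  obtain g h where g: "has_weak_deriv f g" "L2_fun g" "has_weak_deriv g h" "L2_fun h"
    using assms by (auto simp: H_per_def numeral_2_eq_2)
  have p: "(wderiv ^^ l) f 0 = (wderiv ^^ l) f (2 * pi)" if "l < 2" for l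
    using assms that by (simp add: H_per_def)
  have "f \<in> H_per 1" using assms g p[of 0] L2_cont[of f] by (auto simp: H_per_def)
  then show "ac f (wderiv f)" by (rule H_per1D)
  show "f 0 = f (2 * pi)" "wderiv f 0 = wderiv f (2 * pi)" using p[of 0] p[of 1] by simp_all
  obtain G where G: "ac G h" "AE x in leb_I. g x = G x" by (rule weak_imp_ac[OF g(3)])
  have if1: "integrable leb_I f" using g by (auto simp: has_weak_deriv_def)
  have fG: "has_weak_deriv f G"
    by (rule weak_cong_AE[OF g(1) _ G(2) borel_measurable_integrable[OF if1] cont_measurable[OF ac_continuous[OF G(1)]]]) simp
  have e: "wderiv f x = G x" if "x \<in> dom_I" for x
    by (rule wderiv_cont(2)[OF fG ac_continuous[OF G(1)] that])
  have a: "ac (wderiv f) h" by (rule ac_cong[OF G(1)]) (use e g in \<open>auto simp: L2_fun_def\<close>)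
  note w = wderiv_spec[OF ac_imp_weak[OF a]]
  have m: "wderiv (wderiv f) \<in> borel_measurable leb_I" by (rule weak_meas[OF w(1)])
  show "ac (wderiv f) (wderiv (wderiv f))" by (rule ac_cong[OF a _ _ m]) (use w(2) in auto)
  show "L2_fun (wderiv (wderiv f))" by (rule L2_cong[OF g(4) _ m]) (use w(2) in auto)
qed

lemma ac_wderiv_cont: "ac f g \<Longrightarrow> continuous_on dom_I g \<Longrightarrow> x \<in> dom_I \<Longrightarrow> wderiv f x = g x"
  by (intro wderiv_cont ac_imp_weak)

lemma ac_wderiv_AE: "ac f g \<Longrightarrow> AE x in leb_I. wderiv f x = g x"
  by (intro wderiv_spec ac_imp_weak)

lemma ac_wderiv_meas: "ac f g \<Longrightarrow> wderiv f \<in> borel_measurable leb_I"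
  by (rule weak_meas[OF wderiv_spec(1)[OF ac_imp_weak]])

lemma H_per2I:
  assumes "ac f g" "ac g h" "L2_fun h" "f 0 = f (2 * pi)" "g 0 = g (2 * pi)" shows "f \<in> H_per 2"
proof -
  have "(wderiv ^^ l) f 0 = (wderiv ^^ l) f (2 * pi)" if "l < 2" for l
  proof -
    have "l = 0 \<or> l = 1" using that by auto
    moreover have "wderiv f x = g x" if "x \<in> dom_I" for x
      by (rule ac_wderiv_cont[OF assms(1) ac_continuous[OF assms(2)] that])
    ultimately show ?thesis using assms(4,5) by auto
  qed
  moreover have "f \<in> sobolev_H 2"
    using assms(3) ac_imp_weak[OF assms(1)] ac_imp_weak[OF assms(2)]
      L2_cont[OF ac_continuous[OF assms(1)]] L2_cont[OF ac_continuous[OF assms(2)]]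
    by (auto simp: numeral_2_eq_2)
  ultimately show ?thesis using ac_continuous[OF assms(1)] by (auto simp: H_per_def)
qed

section \<open>First variations\<close>

lemma rotJ_nth [simp]: "rotJ v $ 1 = - (v $ 2)" "rotJ v $ 2 = v $ 1"
  by (simp_all add: rotJ_def)

lemma vec2_eq: "(x :: real^2) = y \<longleftrightarrow> x $ 1 = y $ 1 \<and> x $ 2 = y $ 2"
  by (simp add: vec_eq_iff forall_2)

lemma inner2: "(x :: real^2) \<bullet> y = x $ 1 * y $ 1 + x $ 2 * y $ 2"
  by (simp add: inner_vec_def sum_2)

lemma rotJ_bl: "bounded_linear rotJ"
proof -
  have "linear rotJ" by (rule linearI) (auto simp: vec2_eq)
  then show ?thesis by (simp add: linear_conv_bounded_linear)
qed

lemma rotJ_simps: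
  "rotJ (x + y) = rotJ x + rotJ y" "rotJ (k *\<^sub>R x) = k *\<^sub>R rotJ x" "rotJ (- x) = - rotJ x"
  "rotJ (x - y) = rotJ x - rotJ y" "rotJ (rotJ x) = - x" "rotJ 0 = 0"
  by (auto simp: vec2_eq)

lemma rotJ_inner [simp]:
  "rotJ x \<bullet> rotJ y = x \<bullet> y" "x \<bullet> rotJ x = 0" "rotJ x \<bullet> x = 0"
  by (auto simp: inner2)

lemma rotJ_swap: "x \<bullet> rotJ y = - (rotJ x \<bullet> y)"
  by (simp add: inner2)

lemma norm_rotJ [simp]: "norm (rotJ x) = norm x"
  by (simp add: norm_eq_sqrt_inner)

lemma frame_expand:
  assumes "norm t = 1" shows "v = (v \<bullet> t) *\<^sub>R t + (v \<bullet> rotJ t) *\<^sub>R rotJ t"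
proof -
  have "t $ 1 * t $ 1 + t $ 2 * t $ 2 = 1"
    using assms by (simp add: norm_eq_sqrt_inner inner2)
  then have "t $ 2 * t $ 2 = 1 - t $ 1 * t $ 1" by simp
  then show ?thesis by (simp add: vec2_eq inner2 algebra_simps) algebra
qed

lemma frame_inner:
  assumes "norm t = 1" shows "u \<bullet> v = (u \<bullet> t) * (v \<bullet> t) + (u \<bullet> rotJ t) * (v \<bullet> rotJ t)"
proof -
  have "t $ 1 * t $ 1 + t $ 2 * t $ 2 = 1"
    using assms by (simp add: norm_eq_sqrt_inner inner2)
  then show ?thesis unfolding inner2 rotJ_nth by algebra
qed

lemma continuous_rotJ [continuous_intros]:
  "continuous_on S f \<Longrightarrow> continuous_on S (\<lambda>x. rotJ (f x))"
  by (rule bounded_linear.continuous_on[OF rotJ_bl])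

lemma measurable_rotJ [measurable]: "rotJ \<in> borel_measurable borel"
  by (intro borel_measurable_continuous_onI continuous_intros)

lemma ac_rotJ: "ac f g \<Longrightarrow> ac (\<lambda>x. rotJ (f x)) (\<lambda>x. rotJ (g x))"
  by (rule ac_linear[OF rotJ_bl])

lemma ac_scaleR: "ac f f' \<Longrightarrow> ac g g' \<Longrightarrow> ac (\<lambda>x. f x *\<^sub>R g x) (\<lambda>x. f x *\<^sub>R g' x + f' x *\<^sub>R g x)"
  by (rule ac_bilinear[OF bounded_bilinear_scaleR])

lemma ac_inner: "ac f f' \<Longrightarrow> ac g g' \<Longrightarrow> ac (\<lambda>x. f x \<bullet> g x) (\<lambda>x. f x \<bullet> g' x + f' x \<bullet> g x)"
  by (rule ac_bilinear[OF bounded_bilinear_inner])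

lemma ac_cmult: "ac f f' \<Longrightarrow> ac (\<lambda>x. k *\<^sub>R f x) (\<lambda>x. k *\<^sub>R f' x)"
  by (rule ac_linear[OF bounded_linear_scaleR_right])

text \<open>By compactness \<open>g x \<bullet> g x\<close> stays in an interval
  \<open>{m..B}\<close> with \<open>m > 0\<close>, on which \<open>1 / sqrt y\<close> is
  continuously differentiable, so the chain and product rules apply.\<close>

lemma ac_tangent:
  fixes g h :: "real \<Rightarrow> real^2"
  assumes g: "ac g h" and nz: "\<And>x. x \<in> dom_I \<Longrightarrow> g x \<noteq> 0"
  shows "ac (\<lambda>x. (1 / norm (g x)) *\<^sub>R g x)
    (\<lambda>x. (1 / norm (g x)) *\<^sub>R h x - ((g x \<bullet> h x) / norm (g x) ^ 3) *\<^sub>R g x)"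
proof -
  let ?r = "\<lambda>x. g x \<bullet> g x"
  have c: "continuous_on dom_I g" by (rule ac_continuous[OF g])
  have r: "ac ?r (\<lambda>x. g x \<bullet> h x + h x \<bullet> g x)" by (rule ac_inner[OF g g])
  define R where "R = ?r ` dom_I"
  have cR: "compact R" unfolding R_def using c by (intro compact_continuous_image continuous_intros) auto
  have "R \<noteq> {}" by (simp add: R_def)
  from compact_attains_inf[OF cR this] obtain m where m: "m \<in> R" "\<And>y. y \<in> R \<Longrightarrow> m \<le> y"
    by blast
  have mpos: "m > 0" using m(1) nz by (auto simp: R_def)
  obtain B where B: "B > 0" "\<And>x. x \<in> dom_I \<Longrightarrow> norm (?r x) \<le> B"
    using cont_bound[OF continuous_on_inner[OF c c]] by blast
  have "ac (\<lambda>x. 1 / sqrt (?r x)) (\<lambda>x. (- 1 / (2 * sqrt (?r x) ^ 3)) * (g x \<bullet> h x + h x \<bullet> g x))"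
  proof (rule ac_chain[OF r, where lo = m and hi = B])
    fix x assume "x \<in> dom_I" then show "?r x \<in> {m..B}" using m(2)[of "?r x"] B(2)[of x] by (auto simp: R_def)
  next
    fix y assume "y \<in> {m..B}"
    then have y: "y > 0" using mpos by auto
    have "((\<lambda>y. 1 / sqrt y) has_real_derivative (- (inverse (sqrt y) / 2)) / (sqrt y * sqrt y)) (at y)"
      using y by (auto intro!: derivative_eq_intros)
    moreover have "(- (inverse (sqrt y) / 2)) / (sqrt y * sqrt y) = - 1 / (2 * sqrt y ^ 3)"
      by (simp add: field_simps power3_eq_cube)
    ultimately show "((\<lambda>y. 1 / sqrt y) has_real_derivative - 1 / (2 * sqrt y ^ 3)) (at y within {m..B})"
      by (metis has_field_derivative_at_within)
  next
    show "continuous_on {m..B} (\<lambda>y. - 1 / (2 * sqrt y ^ 3))"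
      using mpos by (intro continuous_intros) auto
  qed
  from ac_scaleR[OF this g] have
    "ac (\<lambda>x. (1 / sqrt (?r x)) *\<^sub>R g x) (\<lambda>x. (1 / sqrt (?r x)) *\<^sub>R h x +
      ((- 1 / (2 * sqrt (?r x) ^ 3)) * (g x \<bullet> h x + h x \<bullet> g x)) *\<^sub>R g x)" .
  moreover have "(- 1 / (2 * sqrt (?r x) ^ 3)) * (g x \<bullet> h x + h x \<bullet> g x) = - ((g x \<bullet> h x) / norm (g x) ^ 3)" for x
    by (simp add: norm_eq_sqrt_inner[symmetric] inner_commute field_simps)
  ultimately show ?thesis by (simp add: norm_eq_sqrt_inner[symmetric])
qed

lemma wderiv_cong: 
  assumes "ac f g" "\<And>x. x \<in> dom_I \<Longrightarrow> f x = F x"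
  shows "AE x in leb_I. wderiv F x = g x" "wderiv F \<in> borel_measurable leb_I"
proof -
  have "ac F g" by (rule ac_cong[OF assms]) (use borel_measurable_integrable[OF ac_integrable[OF assms(1)]] in auto)
  then show "AE x in leb_I. wderiv F x = g x" "wderiv F \<in> borel_measurable leb_I"
    by (rule ac_wderiv_AE ac_wderiv_meas)+
qed

text \<open>The derivative of the tangent has a part parallel to \<open>g\<close>, which disappears
  in the product with \<open>rotJ (g x)\<close>; what remains is the curvature formula for arbitrary
  speed. Equality is only almost everywhere since \<open>h\<close> is just a density of
  \<open>g\<close>.\<close>

lemma curvature_AE:
  fixes \<gamma> g h :: "real \<Rightarrow> real^2"
  assumes "ac \<gamma> g" "ac g h" and nz: "\<And>x. x \<in> dom_I \<Longrightarrow> g x \<noteq> 0"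
  shows "AE x in leb_I. curvature \<gamma> x = (h x \<bullet> rotJ (g x)) / norm (g x) ^ 3"
    and "curvature \<gamma> \<in> borel_measurable leb_I"
proof -
  have e: "wderiv \<gamma> x = g x" if "x \<in> dom_I" for x
    by (rule ac_wderiv_cont[OF assms(1) ac_continuous[OF assms(2)] that])
  have t: "(1 / norm (g x)) *\<^sub>R g x = tangent \<gamma> x" if "x \<in> dom_I" for x
    by (simp add: tangent_def dds_def e[OF that])
  have at: "ac (\<lambda>x. (1 / norm (g x)) *\<^sub>R g x)
    (\<lambda>x. (1 / norm (g x)) *\<^sub>R h x - ((g x \<bullet> h x) / norm (g x) ^ 3) *\<^sub>R g x)"
    by (rule ac_tangent[OF assms(2)]) (rule nz)
  have w: "AE x in leb_I. wderiv (tangent \<gamma>) x =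
      (1 / norm (g x)) *\<^sub>R h x - ((g x \<bullet> h x) / norm (g x) ^ 3) *\<^sub>R g x"
    "wderiv (tangent \<gamma>) \<in> borel_measurable leb_I"
    by (rule wderiv_cong[OF at t]; simp)+
  have "AE x in leb_I. x \<in> dom_I" by (intro AE_I2) simp
  then show "AE x in leb_I. curvature \<gamma> x = (h x \<bullet> rotJ (g x)) / norm (g x) ^ 3"
    using w(1)
  proof eventually_elim
    case (elim x)
    then show ?case unfolding curvature_def normal_vec_def t[OF elim(1), symmetric] dds_def[of \<gamma> "tangent \<gamma>"] e[OF elim(1)]
      by (simp add: rotJ_simps inner_diff_left power3_eq_cube)
  qed
  have mw: "wderiv \<gamma> \<in> borel_measurable leb_I" by (rule ac_wderiv_meas[OF assms(1)])
  note [measurable] = w(2) mw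
  show "curvature \<gamma> \<in> borel_measurable leb_I"
    unfolding curvature_def[abs_def] normal_vec_def tangent_def dds_def
    using w(2)[unfolded tangent_def dds_def] by measurable
qed

text \<open>The mean value inequality bounds the difference quotients by \<open>G\<close>, so
  dominated convergence applies along every null sequence.\<close>

lemma deriv_LINT:
  fixes F F' :: "real \<Rightarrow> real \<Rightarrow> real"
  assumes t0: "t0 > 0"
    and i: "\<And>t. \<bar>t\<bar> < t0 \<Longrightarrow> integrable leb_I (F t)"
    and d: "\<And>t x. \<bar>t\<bar> < t0 \<Longrightarrow> x \<in> dom_I \<Longrightarrow> ((\<lambda>t. F t x) has_real_derivative F' t x) (at t)"
    and b: "\<And>t x. \<bar>t\<bar> < t0 \<Longrightarrow> x \<in> dom_I \<Longrightarrow> \<bar>F' t x\<bar> \<le> G x"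
    and G: "integrable leb_I G" and m: "F' 0 \<in> borel_measurable leb_I"
  shows "((\<lambda>t. LINT x|leb_I. F t x) has_real_derivative (LINT x|leb_I. F' 0 x)) (at 0)"
proof -
  have lip: "\<bar>F t x - F 0 x\<bar> \<le> G x * \<bar>t\<bar>" if t: "\<bar>t\<bar> < t0" and x: "x \<in> dom_I" for t x
  proof -
    have "norm (F t x - F 0 x) \<le> G x * norm (t - 0)"
    proof (rule field_differentiable_bound[where S = "{-t0<..<t0}" and f' = "\<lambda>s. F' s x"])
      fix z assume "z \<in> {-t0<..<t0}"
      then have z: "\<bar>z\<bar> < t0" by auto
      show "((\<lambda>t. F t x) has_field_derivative F' z x) (at z within {-t0<..<t0})"
        by (rule has_field_derivative_at_within[OF d[OF z x]])
      show "norm (F' z x) \<le> G x" using b[OF z x] by simp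
    qed (use t t0 in auto)
    then show ?thesis by simp
  qed
  show ?thesis
    unfolding has_field_derivative_iff tendsto_at_iff_sequentially
  proof (intro allI impI)
    fix X :: "nat \<Rightarrow> real"
    assume X: "\<forall>i. X i \<in> UNIV - {0}" "X \<longlonglongrightarrow> 0"
    \<comment> \<open>Finitely many terms of \<open>X\<close> may lie outside the range of the
      bound; replacing them makes the domination valid for every index and leaves the limit
      unchanged.\<close>
    define Y where "Y n = (if \<bar>X n\<bar> < t0 then X n else t0 / 2)" for n
    have Y: "\<bar>Y n\<bar> < t0" "Y n \<noteq> 0" for n using X(1) t0 by (auto simp: Y_def)
    have "eventually (\<lambda>n. \<bar>X n\<bar> < t0) sequentially"
      using tendstoD[OF X(2) t0] by (simp add: dist_real_def)
    then have ev: "eventually (\<lambda>n. Y n = X n) sequentially" by eventually_elim (simp add: Y_def)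
    have Y0: "Y \<longlonglongrightarrow> 0" using X(2) ev by (simp add: filterlim_cong[OF refl refl ev])
    have "(\<lambda>n. LINT x|leb_I. (F (Y n) x - F 0 x) / Y n) \<longlonglongrightarrow> (LINT x|leb_I. F' 0 x)"
    proof (rule integral_dominated_convergence[OF m _ G])
      show "(\<lambda>x. (F (Y n) x - F 0 x) / Y n) \<in> borel_measurable leb_I" for n
        using i[OF Y(1)] i[of 0] t0 by auto
      show "AE x in leb_I. (\<lambda>n. (F (Y n) x - F 0 x) / Y n) \<longlonglongrightarrow> F' 0 x"
      proof (intro AE_I2)
        fix x assume "x \<in> space leb_I"
        then have "((\<lambda>t. F t x) has_real_derivative F' 0 x) (at 0)" using d[of 0 x] t0 by simp
        then have "((\<lambda>t. (F t x - F 0 x) / (t - 0)) \<longlongrightarrow> F' 0 x) (at 0)"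
          by (simp add: has_field_derivative_iff)
        then show "(\<lambda>n. (F (Y n) x - F 0 x) / Y n) \<longlonglongrightarrow> F' 0 x"
          unfolding tendsto_at_iff_sequentially using Y(2) Y0 by (force simp: o_def)
      qed
      show "AE x in leb_I. norm ((F (Y n) x - F 0 x) / Y n) \<le> G x" for n
        using lip[OF Y(1)] Y(2) by (intro AE_I2) (auto simp: divide_le_eq)
    qed
    moreover have "(LINT x|leb_I. (F (Y n) x - F 0 x) / Y n) = ((LINT x|leb_I. F (Y n) x) - (LINT x|leb_I. F 0 x)) / (Y n - 0)" for n
      using i[OF Y(1)] i[of 0] t0 by simp
    ultimately have "(\<lambda>n. ((LINT x|leb_I. F (Y n) x) - (LINT x|leb_I. F 0 x)) / (Y n - 0)) \<longlonglongrightarrow> (LINT x|leb_I. F' 0 x)"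
      by (simp only:)
    moreover have "eventually (\<lambda>n. ((LINT x|leb_I. F (Y n) x) - (LINT x|leb_I. F 0 x)) / (Y n - 0) =
        ((\<lambda>t. ((LINT x|leb_I. F t x) - (LINT x|leb_I. F 0 x)) / (t - 0)) \<circ> X) n) sequentially"
      using ev by eventually_elim simp
    ultimately show "((\<lambda>t. ((LINT x|leb_I. F t x) - (LINT x|leb_I. F 0 x)) / (t - 0)) \<circ> X) \<longlonglongrightarrow> (LINT x|leb_I. F' 0 x)"
      by (rule Lim_transform_eventually)
  qed
qed

section \<open>The energy as an integral of the derivatives in \<open>x\<close>\<close>

lemma L2_norm: "L2_fun f \<Longrightarrow> L2_fun (\<lambda>x. norm (f x))"
  by (auto simp: L2_fun_def)

lemma grad_along_norm:
  assumes "wderiv \<gamma> x \<noteq> 0"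
  shows "(norm (grad_along \<gamma> \<eta> x))\<^sup>2 = (norm (wderiv \<eta> x))\<^sup>2 / (norm (wderiv \<gamma> x))\<^sup>2"
proof -
  have t: "norm (tangent \<gamma> x) = 1" using assms by (simp add: tangent_def dds_def)
  have "(norm (grad_along \<gamma> \<eta> x))\<^sup>2 = grad_along \<gamma> \<eta> x \<bullet> grad_along \<gamma> \<eta> x"
    by (simp add: power2_norm_eq_inner)
  also have "\<dots> = (dds \<gamma> \<eta> x \<bullet> dds \<gamma> \<eta> x) * (tangent \<gamma> x \<bullet> tangent \<gamma> x)"
    by (simp add: grad_along_def inner_vec_def sum_2 algebra_simps)
  also have "\<dots> = (norm (dds \<gamma> \<eta> x))\<^sup>2" using t by (simp add: power2_norm_eq_inner[symmetric])
  finally show ?thesis by (simp add: dds_def power_mult_distrib power_divide)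
qed

text \<open>Density of the bending term with respect to \<open>x\<close>: \<open>X\<close> is
  \<open>\<gamma>'' \<bullet> rotJ \<gamma>'\<close>, \<open>Y\<close> is
  \<open>\<eta>' \<bullet> \<gamma>'\<close> and \<open>n\<close> is the speed. The speed is kept as
  a variable because a variation destroys the constant speed of the curve.\<close>

definition bend :: "real \<Rightarrow> real \<Rightarrow> real \<Rightarrow> real \<Rightarrow> real"
  where "bend \<delta> X Y n = (X / n ^ 3 + \<delta> * (Y / n\<^sup>2))\<^sup>2 * n"

lemma energy_repr:
  fixes \<gamma> g h \<eta> e :: "real \<Rightarrow> real^2"
  assumes \<gamma>: "ac \<gamma> g" "ac g h" and nz: "\<And>x. x \<in> dom_I \<Longrightarrow> g x \<noteq> 0" and \<eta>: "ac \<eta> e"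
  shows "energy \<delta> lam \<gamma> \<eta> =
    1 / 2 * (LINT x|leb_I. bend \<delta> (h x \<bullet> rotJ (g x)) (e x \<bullet> g x) (norm (g x))) +
    lam / 2 * (LINT x|leb_I. (norm (e x))\<^sup>2 / norm (g x))"
proof -
  have eq: "wderiv \<gamma> x = g x" if "x \<in> dom_I" for x
    by (rule ac_wderiv_cont[OF \<gamma>(1) ac_continuous[OF \<gamma>(2)] that])
  note k = curvature_AE[OF \<gamma> nz, simplified]
  have wd: "AE x in leb_I. wderiv \<eta> x = e x" by (rule ac_wderiv_AE[OF \<eta>])
  have dom: "AE x in leb_I. x \<in> dom_I" by (intro AE_I2) simp
  have mm: "wderiv \<gamma> \<in> borel_measurable leb_I" "wderiv \<eta> \<in> borel_measurable leb_I"
    "g \<in> borel_measurable leb_I" "h \<in> borel_measurable leb_I" "e \<in> borel_measurable leb_I"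
    "curvature \<gamma> \<in> borel_measurable leb_I"
    by (rule ac_wderiv_meas[OF \<gamma>(1)] ac_wderiv_meas[OF \<eta>] k(2)
      borel_measurable_integrable[OF ac_integrable[OF \<gamma>(1)]]
      borel_measurable_integrable[OF ac_integrable[OF \<gamma>(2)]]
      borel_measurable_integrable[OF ac_integrable[OF \<eta>]])+
  note [measurable] = mm
  have "line_int \<gamma> (\<lambda>x. (curvature \<gamma> x + \<delta> * div_along \<gamma> \<eta> x)\<^sup>2) =
      (LINT x|leb_I. bend \<delta> (h x \<bullet> rotJ (g x)) (e x \<bullet> g x) (norm (g x)))"
    unfolding line_int_def bend_def
  proof (rule integral_cong_AE)
    show "AE x in leb_I. (curvature \<gamma> x + \<delta> * div_along \<gamma> \<eta> x)\<^sup>2 * norm (wderiv \<gamma> x) =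
      ((h x \<bullet> rotJ (g x)) / norm (g x) ^ 3 + \<delta> * (e x \<bullet> g x / (norm (g x))\<^sup>2))\<^sup>2 * norm (g x)"
      using k(1) wd dom
      by eventually_elim (simp add: div_along_def tangent_def dds_def eq power2_eq_square)
  qed (unfold div_along_def tangent_def dds_def, measurable)
  moreover have "line_int \<gamma> (\<lambda>x. (norm (grad_along \<gamma> \<eta> x))\<^sup>2) = (LINT x|leb_I. (norm (e x))\<^sup>2 / norm (g x))"
  proof -
    have "line_int \<gamma> (\<lambda>x. (norm (grad_along \<gamma> \<eta> x))\<^sup>2) =
      (LINT x|leb_I. (norm (wderiv \<eta> x))\<^sup>2 / (norm (g x))\<^sup>2 * norm (g x))"
      unfolding line_int_def
      by (intro Bochner_Integration.integral_cong) (use nz in \<open>auto simp: grad_along_norm eq\<close>)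
    also have "\<dots> = (LINT x|leb_I. (norm (e x))\<^sup>2 / norm (g x))"
    proof (rule integral_cong_AE)
      show "AE x in leb_I. (norm (wderiv \<eta> x))\<^sup>2 / (norm (g x))\<^sup>2 * norm (g x) = (norm (e x))\<^sup>2 / norm (g x)"
        using wd dom by eventually_elim (simp add: power2_eq_square)
    qed measurable
    finally show ?thesis .
  qed
  ultimately show ?thesis by (simp add: energy_def)
qed

definition bend_deriv :: "real \<Rightarrow> real \<Rightarrow> real \<Rightarrow> real \<Rightarrow> real \<Rightarrow> real \<Rightarrow> real \<Rightarrow> real"
  where "bend_deriv \<delta> X Y n X' Y' n' =
    2 * (X / n ^ 3 + \<delta> * (Y / n\<^sup>2)) *
      (X' / n ^ 3 - 3 * X * n' / n ^ 4 + \<delta> * (Y' / n\<^sup>2 - 2 * Y * n' / n ^ 3)) * n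
    + (X / n ^ 3 + \<delta> * (Y / n\<^sup>2))\<^sup>2 * n'"

lemma DERIV_bend:
  fixes X Y n :: "real \<Rightarrow> real"
  assumes "(X has_real_derivative X') (at t)" "(Y has_real_derivative Y') (at t)"
    "(n has_real_derivative n') (at t)" "n t \<noteq> 0"
  shows "((\<lambda>t. bend \<delta> (X t) (Y t) (n t)) has_real_derivative bend_deriv \<delta> (X t) (Y t) (n t) X' Y' n') (at t)"
proof -
  have 1: "((\<lambda>t. X t / n t ^ 3) has_real_derivative (X' / n t ^ 3 - 3 * X t * n' / n t ^ 4)) (at t)"
    using assms(4) by (auto intro!: derivative_eq_intros assms(1,3) simp: field_simps eval_nat_numeral)
  have 2: "((\<lambda>t. Y t / (n t)\<^sup>2) has_real_derivative (Y' / (n t)\<^sup>2 - 2 * Y t * n' / n t ^ 3)) (at t)"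
    using assms(4) by (auto intro!: derivative_eq_intros assms(2,3) simp: field_simps eval_nat_numeral)
  show ?thesis unfolding bend_def bend_deriv_def
    by (rule derivative_eq_intros 1 2 assms refl)+ (simp add: algebra_simps)
qed

text \<open>Both functions grow quadratically in quantities of size \<open>b\<close> once the speed
  lies between \<open>c / 2\<close> and \<open>2 * c\<close>. With
  \<open>b = 1 + norm (h x) + norm (e x)\<close> the bound is the integrable majorant needed to
  differentiate the energy under the integral.\<close>

lemma bend_bounds:
  assumes K: "K \<ge> 0" and c: "c > 0"
  obtains K' where "K' \<ge> 0" "\<And>X Y n X' Y' n' b. \<bar>X\<bar> \<le> K * b \<Longrightarrow> \<bar>Y\<bar> \<le> K * b \<Longrightarrow> \<bar>X'\<bar> \<le> K * b \<Longrightarrow>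
    \<bar>Y'\<bar> \<le> K * b \<Longrightarrow> \<bar>n'\<bar> \<le> K \<Longrightarrow> c / 2 \<le> n \<Longrightarrow> n \<le> 2 * c \<Longrightarrow> b \<ge> 0 \<Longrightarrow>
    \<bar>bend \<delta> X Y n\<bar> \<le> K' * b\<^sup>2 \<and> \<bar>bend_deriv \<delta> X Y n X' Y' n'\<bar> \<le> K' * b\<^sup>2"
proof -
  define r where "r = 2 / c"
  define K1 where "K1 = K * r ^ 3 + \<bar>\<delta>\<bar> * (K * r\<^sup>2)"
  define K2 where "K2 = K * r ^ 3 + 3 * K * K * r ^ 4 + \<bar>\<delta>\<bar> * (K * r\<^sup>2 + 2 * K * K * r ^ 3)"
  define K' where "K' = K1\<^sup>2 * (2 * c) + (2 * K1 * K2 * (2 * c) + K1\<^sup>2 * K)"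
  have r: "r > 0" using c by (simp add: r_def)
  have pos: "K1 \<ge> 0" "K2 \<ge> 0" using K r by (simp_all add: K1_def K2_def)
  show ?thesis
  proof (rule that[of K'])
    show "K' \<ge> 0" using pos K c by (simp add: K'_def)
    fix X Y n X' Y' n' b :: real
    assume X: "\<bar>X\<bar> \<le> K * b" and Y: "\<bar>Y\<bar> \<le> K * b" and X': "\<bar>X'\<bar> \<le> K * b" and Y': "\<bar>Y'\<bar> \<le> K * b"
      and n': "\<bar>n'\<bar> \<le> K" and n: "c / 2 \<le> n" "n \<le> 2 * c" and b: "b \<ge> 0"
    have npos: "n > 0" using n c by linarith
    have inv: "1 / n \<le> r" using n c npos by (simp add: r_def field_simps)
    have dv: "\<bar>p / n ^ k\<bar> \<le> q * r ^ k" if "\<bar>p\<bar> \<le> q" for p q :: real and k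
    proof -
      have "\<bar>p / n ^ k\<bar> = \<bar>p\<bar> * (1 / n) ^ k" using npos by (simp add: abs_divide power_divide)
      also have "\<dots> \<le> q * r ^ k"
        using that inv npos by (intro mult_mono power_mono) auto
      finally show ?thesis .
    qed
    define W where "W = X / n ^ 3 + \<delta> * (Y / n\<^sup>2)"
    define V where "V = X' / n ^ 3 - 3 * X * n' / n ^ 4 + \<delta> * (Y' / n\<^sup>2 - 2 * Y * n' / n ^ 3)"
    have W: "\<bar>W\<bar> \<le> K1 * b"
    proof -
      have "\<bar>W\<bar> \<le> \<bar>X / n ^ 3\<bar> + \<bar>\<delta>\<bar> * \<bar>Y / n\<^sup>2\<bar>" unfolding W_def abs_mult[symmetric] by (rule abs_triangle_ineq)
      also have "\<dots> \<le> K * b * r ^ 3 + \<bar>\<delta>\<bar> * (K * b * r\<^sup>2)"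
        by (intro add_mono mult_left_mono dv X Y) auto
      finally show ?thesis by (simp add: K1_def algebra_simps)
    qed
    have Xn: "\<bar>3 * X * n'\<bar> \<le> 3 * (K * b) * K" unfolding abs_mult
      using X n' by (intro mult_mono) auto
    have Yn: "\<bar>2 * Y * n'\<bar> \<le> 2 * (K * b) * K" unfolding abs_mult
      using Y n' by (intro mult_mono) auto
    have V: "\<bar>V\<bar> \<le> K2 * b"
    proof -
      have "\<bar>V\<bar> \<le> \<bar>X' / n ^ 3\<bar> + \<bar>3 * X * n' / n ^ 4\<bar> + \<bar>\<delta>\<bar> * (\<bar>Y' / n\<^sup>2\<bar> + \<bar>2 * Y * n' / n ^ 3\<bar>)"
      proof -
        have "\<bar>\<delta> * (Y' / n\<^sup>2 - 2 * Y * n' / n ^ 3)\<bar> \<le> \<bar>\<delta>\<bar> * (\<bar>Y' / n\<^sup>2\<bar> + \<bar>2 * Y * n' / n ^ 3\<bar>)"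
          unfolding abs_mult by (intro mult_left_mono abs_triangle_ineq4) auto
        then show ?thesis unfolding V_def
          using abs_triangle_ineq4[of "X' / n ^ 3" "3 * X * n' / n ^ 4"]
            abs_triangle_ineq[of "X' / n ^ 3 - 3 * X * n' / n ^ 4" "\<delta> * (Y' / n\<^sup>2 - 2 * Y * n' / n ^ 3)"]
          by linarith
      qed
      also have "\<dots> \<le> K * b * r ^ 3 + 3 * (K * b) * K * r ^ 4 + \<bar>\<delta>\<bar> * (K * b * r\<^sup>2 + 2 * (K * b) * K * r ^ 3)"
        by (intro add_mono mult_left_mono dv X' Y' Xn Yn) auto
      finally show ?thesis by (simp add: K2_def algebra_simps)
    qed
    have W2: "W\<^sup>2 \<le> K1\<^sup>2 * b\<^sup>2"
      using power_mono[OF W, of 2] by (simp add: power_mult_distrib)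
    have A: "\<bar>bend \<delta> X Y n\<bar> \<le> K1\<^sup>2 * b\<^sup>2 * (2 * c)"
    proof -
      have "bend \<delta> X Y n = W\<^sup>2 * n" by (simp add: bend_def W_def)
      moreover have "W\<^sup>2 * n \<le> K1\<^sup>2 * b\<^sup>2 * (2 * c)" using W2 n npos by (intro mult_mono) auto
      ultimately show ?thesis using npos by simp
    qed
    have B: "\<bar>bend_deriv \<delta> X Y n X' Y' n'\<bar> \<le> 2 * (K1 * b) * (K2 * b) * (2 * c) + K1\<^sup>2 * b\<^sup>2 * K"
    proof -
      have "bend_deriv \<delta> X Y n X' Y' n' = 2 * W * V * n + W\<^sup>2 * n'" by (simp add: bend_deriv_def W_def V_def)
      also have "\<bar>\<dots>\<bar> \<le> \<bar>2 * W * V * n\<bar> + \<bar>W\<^sup>2 * n'\<bar>" by (rule abs_triangle_ineq)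
      also have "\<dots> \<le> 2 * (K1 * b) * (K2 * b) * (2 * c) + K1\<^sup>2 * b\<^sup>2 * K"
        unfolding abs_mult using W V W2 n npos n' pos b by (intro add_mono mult_mono) auto
      finally show ?thesis .
    qed
    have t1: "0 \<le> (2 * K1 * K2 * (2 * c) + K1\<^sup>2 * K) * b\<^sup>2" "0 \<le> K1\<^sup>2 * (2 * c) * b\<^sup>2"
      using pos c K by simp_all
    show "\<bar>bend \<delta> X Y n\<bar> \<le> K' * b\<^sup>2 \<and> \<bar>bend_deriv \<delta> X Y n X' Y' n'\<bar> \<le> K' * b\<^sup>2"
      using A B t1 unfolding K'_def by (simp add: algebra_simps power2_eq_square)
  qed
qed

section \<open>Variations of a curve of constant speed and of its director\<close>

lemma DERIV_norm_line:
  fixes g \<phi> :: "real^2"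
  assumes "g + t *\<^sub>R \<phi> \<noteq> 0"
  shows "((\<lambda>t. norm (g + t *\<^sub>R \<phi>)) has_real_derivative ((g + t *\<^sub>R \<phi>) \<bullet> \<phi>) / norm (g + t *\<^sub>R \<phi>)) (at t)"
proof -
  let ?p = "\<lambda>t. (g + t *\<^sub>R \<phi>) \<bullet> (g + t *\<^sub>R \<phi>)"
  have p: "?p = (\<lambda>t. g \<bullet> g + 2 * t * (g \<bullet> \<phi>) + t\<^sup>2 * (\<phi> \<bullet> \<phi>))"
    by (simp add: fun_eq_iff inner_add_left inner_add_right inner_commute power2_eq_square algebra_simps)
  have dp: "(?p has_real_derivative 2 * ((g + t *\<^sub>R \<phi>) \<bullet> \<phi>)) (at t)"
    unfolding p by (auto intro!: derivative_eq_intros simp: inner_add_left algebra_simps)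
  have "?p t > 0" using assms by simp
  from DERIV_chain2[OF DERIV_real_sqrt[OF this] dp]
  show ?thesis by (simp add: norm_eq_sqrt_inner[symmetric] field_simps)
qed

lemma DERIV_X_line:
  fixes g h p q :: "real^2"
  shows "((\<lambda>t. (h + t *\<^sub>R q) \<bullet> rotJ (g + t *\<^sub>R p)) has_real_derivative
    (q \<bullet> rotJ (g + t *\<^sub>R p) + (h + t *\<^sub>R q) \<bullet> rotJ p)) (at t)"
proof -
  have p: "(\<lambda>t. (h + t *\<^sub>R q) \<bullet> rotJ (g + t *\<^sub>R p)) =
     (\<lambda>t. h \<bullet> rotJ g + t * (q \<bullet> rotJ g + h \<bullet> rotJ p) + t\<^sup>2 * (q \<bullet> rotJ p))"
    by (simp add: fun_eq_iff inner_add_left inner_add_right rotJ_simps power2_eq_square algebra_simps)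
  show ?thesis unfolding p
    by (auto intro!: derivative_eq_intros simp: inner_add_left inner_add_right rotJ_simps algebra_simps)
qed

lemma DERIV_Y_line:
  fixes g e p :: "real^2"
  shows "((\<lambda>t. e \<bullet> (g + t *\<^sub>R p)) has_real_derivative e \<bullet> p) (at t)"
  by (auto intro!: derivative_eq_intros simp: inner_add_right)

locale arc_curve =
  fixes \<gamma> g h \<eta> e :: "real \<Rightarrow> real^2" and c \<delta> lam :: real
  assumes ac\<gamma>: "ac \<gamma> g" and acg: "ac g h" and L2h: "L2_fun h"
    and c0: "c > 0" and gc: "\<And>x. x \<in> dom_I \<Longrightarrow> norm (g x) = c"
    and ac\<eta>: "ac \<eta> e" and L2e: "L2_fun e"
    and \<gamma>per: "\<gamma> 0 = \<gamma> (2 * pi)"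
begin

lemma cont: "continuous_on dom_I \<gamma>" "continuous_on dom_I g" "continuous_on dom_I \<eta>"
  by (rule ac_continuous[OF ac\<gamma>] ac_continuous[OF acg] ac_continuous[OF ac\<eta>])+

lemma meas: "\<gamma> \<in> borel_measurable leb_I" "g \<in> borel_measurable leb_I" "h \<in> borel_measurable leb_I"
  "\<eta> \<in> borel_measurable leb_I" "e \<in> borel_measurable leb_I"
  by (rule cont_measurable[OF cont(1)] cont_measurable[OF cont(2)] cont_measurable[OF cont(3)]
      L2_meas[OF L2h] L2_meas[OF L2e])+

lemma g_nz: "x \<in> dom_I \<Longrightarrow> g x \<noteq> 0" using gc c0 by force

definition kap :: "real \<Rightarrow> real" where "kap x = (h x \<bullet> rotJ (g x)) / c ^ 3"
definition w :: "real \<Rightarrow> real" where "w x = kap x + \<delta> * ((e x \<bullet> g x) / c\<^sup>2)"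
text \<open>\<open>P\<close> and \<open>Q\<close> are the coefficients of \<open>\<phi>2\<close> and
  \<open>\<phi>1\<close> in the first variation of the energy. \<open>P\<close> is
  \<open>w / c\<close> times the unit normal. \<open>Q\<close> contains products of two square
  integrable functions, so at this stage it is known to be integrable and no more.\<close>

definition P :: "real \<Rightarrow> real^2" where "P x = (w x / c\<^sup>2) *\<^sub>R rotJ (g x)"
definition Q :: "real \<Rightarrow> real^2" where
  "Q x = - ((w x / c\<^sup>2) *\<^sub>R rotJ (h x)) + (\<delta> * w x / c) *\<^sub>R e x +
    (- (3 * w x * kap x / c) - 2 * \<delta> * w x * (e x \<bullet> g x) / c ^ 3 + (w x)\<^sup>2 / (2 * c)
      - lam * (norm (e x))\<^sup>2 / (2 * c ^ 3)) *\<^sub>R g x"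

lemma L2_kap: "L2_fun kap" 
proof -
  have "L2_fun (\<lambda>x. (1 / c ^ 3) *\<^sub>R (rotJ (g x) \<bullet> h x))"
    by (intro L2_scaleR L2_bilin_cont[OF bounded_bilinear_inner] continuous_intros cont L2h)
  then show ?thesis by (simp add: kap_def[abs_def] inner_commute)
qed

lemma L2_div: "L2_fun (\<lambda>x. (e x \<bullet> g x) / c\<^sup>2)"
proof -
  have "L2_fun (\<lambda>x. (1 / c\<^sup>2) *\<^sub>R (g x \<bullet> e x))"
    by (intro L2_scaleR L2_bilin_cont[OF bounded_bilinear_inner] continuous_intros cont L2e)
  then show ?thesis by (simp add: inner_commute)
qed

lemma L2_w: "L2_fun w"
proof -
  have "L2_fun (\<lambda>x. kap x + \<delta> *\<^sub>R ((e x \<bullet> g x) / c\<^sup>2))"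
    by (intro L2_add L2_kap L2_scaleR L2_div)
  then show ?thesis by (simp add: w_def[abs_def])
qed

end

locale arc_variation = arc_curve +
  fixes \<phi> \<phi>1 \<phi>2 :: "real \<Rightarrow> real^2"
  assumes ac\<phi>: "ac \<phi> \<phi>1" and ac\<phi>1: "ac \<phi>1 \<phi>2" and c\<phi>2: "continuous_on dom_I \<phi>2"
    and \<phi>per: "\<phi> 0 = \<phi> (2 * pi)"
begin

definition Bd :: real where
  "Bd = (SOME B. B > 0 \<and> (\<forall>x\<in>dom_I. norm (\<phi>1 x) \<le> B \<and> norm (\<phi>2 x) \<le> B))"

lemma Bd: "Bd > 0" "x \<in> dom_I \<Longrightarrow> norm (\<phi>1 x) \<le> Bd" "x \<in> dom_I \<Longrightarrow> norm (\<phi>2 x) \<le> Bd"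
proof -
  obtain B1 where "B1 > 0" "\<And>x. x \<in> dom_I \<Longrightarrow> norm (\<phi>1 x) \<le> B1"
    using cont_bound[OF ac_continuous[OF ac\<phi>1]] by blast
  moreover obtain B2 where "B2 > 0" "\<And>x. x \<in> dom_I \<Longrightarrow> norm (\<phi>2 x) \<le> B2"
    using cont_bound[OF c\<phi>2] by blast
  ultimately have "max B1 B2 > 0 \<and> (\<forall>x\<in>dom_I. norm (\<phi>1 x) \<le> max B1 B2 \<and> norm (\<phi>2 x) \<le> max B1 B2)"
    by (auto simp: le_max_iff_disj)
  from someI[of "\<lambda>B. B > 0 \<and> (\<forall>x\<in>dom_I. norm (\<phi>1 x) \<le> B \<and> norm (\<phi>2 x) \<le> B)", OF this]
  show "Bd > 0" "x \<in> dom_I \<Longrightarrow> norm (\<phi>1 x) \<le> Bd" "x \<in> dom_I \<Longrightarrow> norm (\<phi>2 x) \<le> Bd"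
    unfolding Bd_def by blast+
qed

text \<open>\<open>c / (2 * Bd)\<close> keeps the perturbation of \<open>g\<close> at most
  \<open>c / 2\<close>, so the perturbed curve stays immersed; the cap 1 bounds the perturbation of
  \<open>h\<close>.\<close>

definition t0 :: real where "t0 = min 1 (c / (2 * Bd))"

lemma t0: "t0 > 0" using Bd(1) c0 by (simp add: t0_def)

lemma t_bounds:
  assumes "\<bar>t\<bar> < t0" "x \<in> dom_I"
  shows "c / 2 \<le> norm (g x + t *\<^sub>R \<phi>1 x)" "norm (g x + t *\<^sub>R \<phi>1 x) \<le> 2 * c" "g x + t *\<^sub>R \<phi>1 x \<noteq> 0"
proof -
  have "norm (t *\<^sub>R \<phi>1 x) \<le> (c / (2 * Bd)) * Bd"
    unfolding norm_scaleR using assms Bd by (intro mult_mono) (auto simp: t0_def)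
  then have *: "norm (t *\<^sub>R \<phi>1 x) \<le> c / 2" using Bd(1) by simp
  show 1: "c / 2 \<le> norm (g x + t *\<^sub>R \<phi>1 x)" "norm (g x + t *\<^sub>R \<phi>1 x) \<le> 2 * c"
    using * gc[OF assms(2)] norm_triangle_ineq[of "g x" "t *\<^sub>R \<phi>1 x"] norm_diff_ineq[of "g x" "t *\<^sub>R \<phi>1 x"] c0
    by auto
  show "g x + t *\<^sub>R \<phi>1 x \<noteq> 0" using 1(1) c0 by force
qed

lemma meas\<phi>: "\<phi> \<in> borel_measurable leb_I" "\<phi>1 \<in> borel_measurable leb_I" "\<phi>2 \<in> borel_measurable leb_I"
  by (rule cont_measurable[OF ac_continuous[OF ac\<phi>]] cont_measurable[OF ac_continuous[OF ac\<phi>1]] cont_measurable[OF c\<phi>2])+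

lemma ac_pert: "ac (\<lambda>x. \<gamma> x + t *\<^sub>R \<phi> x) (\<lambda>x. g x + t *\<^sub>R \<phi>1 x)" "ac (\<lambda>x. g x + t *\<^sub>R \<phi>1 x) (\<lambda>x. h x + t *\<^sub>R \<phi>2 x)"
  by (intro ac_add ac_cmult ac\<gamma> acg ac\<phi> ac\<phi>1)+

abbreviation "nt t x \<equiv> norm (g x + t *\<^sub>R \<phi>1 x)"
abbreviation "nt' t x \<equiv> ((g x + t *\<^sub>R \<phi>1 x) \<bullet> \<phi>1 x) / norm (g x + t *\<^sub>R \<phi>1 x)"

lemma nt'_bound: "x \<in> dom_I \<Longrightarrow> \<bar>nt' t x\<bar> \<le> Bd"
proof -
  assume x: "x \<in> dom_I"
  have "\<bar>nt' t x\<bar> \<le> norm (\<phi>1 x)"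
  proof (cases "nt t x = 0")
    case False
    have "\<bar>(g x + t *\<^sub>R \<phi>1 x) \<bullet> \<phi>1 x\<bar> \<le> norm (g x + t *\<^sub>R \<phi>1 x) * norm (\<phi>1 x)" by (rule Cauchy_Schwarz_ineq2)
    then show ?thesis using False by (simp add: abs_divide divide_le_eq mult.commute)
  qed simp
  then show ?thesis using Bd(2)[OF x] by linarith
qed

lemma length_variation:
  "((\<lambda>t. curve_length (\<lambda>x. \<gamma> x + t *\<^sub>R \<phi> x)) has_real_derivative (LINT x|leb_I. (g x \<bullet> \<phi>1 x) / c)) (at 0)"
proof -
  note [measurable] = meas meas\<phi>
  have "((\<lambda>t. LINT x|leb_I. nt t x) has_real_derivative (LINT x|leb_I. nt' 0 x)) (at 0)"
  proof (rule deriv_LINT[OF t0, where G = "\<lambda>_. Bd"])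
    fix t assume "\<bar>t\<bar> < t0"
    show "integrable leb_I (nt t)"
      by (intro cont_integrable continuous_intros cont ac_continuous[OF ac\<phi>1])
  next
    fix t x assume "\<bar>t\<bar> < t0" "x \<in> dom_I"
    then show "((\<lambda>t. nt t x) has_real_derivative nt' t x) (at t)"
      by (intro DERIV_norm_line t_bounds(3))
    show "\<bar>nt' t x\<bar> \<le> Bd" by (rule nt'_bound) fact
  qed (auto intro!: cont_integrable)
  moreover have "(LINT x|leb_I. nt t x) = curve_length (\<lambda>x. \<gamma> x + t *\<^sub>R \<phi> x)" for t
    unfolding curve_length_def line_int_def
    using ac_wderiv_cont[OF ac_pert(1) ac_continuous[OF ac_pert(2)]]
    by (intro Bochner_Integration.integral_cong) auto
  moreover have "(LINT x|leb_I. nt' 0 x) = (LINT x|leb_I. (g x \<bullet> \<phi>1 x) / c)"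
    using gc by (intro Bochner_Integration.integral_cong) auto
  ultimately show ?thesis by simp
qed

text \<open>The area is quadratic in the curve, so its expansion in \<open>t\<close> is exact.
  Integration by parts over the period moves the derivative from \<open>\<gamma>\<close> to
  \<open>\<phi>\<close>, so that, as for length and energy, only derivatives of
  \<open>\<phi>\<close> are tested. This is what permits prescribing \<open>\<phi>1\<close>
  later.\<close>

lemma area_variation:
  "((\<lambda>t. signed_area (\<lambda>x. \<gamma> x + t *\<^sub>R \<phi> x)) has_real_derivative (LINT x|leb_I. rotJ (\<gamma> x) \<bullet> \<phi>1 x)) (at 0)"
proof -
  let ?A = "\<lambda>x. \<gamma> x \<bullet> rotJ (g x)" and ?B = "\<lambda>x. \<gamma> x \<bullet> rotJ (\<phi>1 x) + \<phi> x \<bullet> rotJ (g x)" and ?C = "\<lambda>x. \<phi> x \<bullet> rotJ (\<phi>1 x)"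
  note c = cont ac_continuous[OF ac\<phi>1] ac_continuous[OF ac\<phi>]
  have i: "integrable leb_I ?A" "integrable leb_I ?B" "integrable leb_I ?C"
    "integrable leb_I (\<lambda>x. \<gamma> x \<bullet> rotJ (\<phi>1 x))" "integrable leb_I (\<lambda>x. \<phi> x \<bullet> rotJ (g x))"
    by (intro cont_integrable continuous_intros c)+
  have "signed_area (\<lambda>x. \<gamma> x + t *\<^sub>R \<phi> x) = - (1/2) * ((LINT x|leb_I. ?A x) + t * (LINT x|leb_I. ?B x) + t\<^sup>2 * (LINT x|leb_I. ?C x))" for t
  proof -
    have "signed_area (\<lambda>x. \<gamma> x + t *\<^sub>R \<phi> x) = - (1/2) * (LINT x|leb_I. ?A x + t * ?B x + t\<^sup>2 * ?C x)"
      unfolding signed_area_def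
      using ac_wderiv_cont[OF ac_pert(1) ac_continuous[OF ac_pert(2)]]
      by (intro arg_cong[of _ _ "\<lambda>u. - (1/2) * u"] Bochner_Integration.integral_cong)
        (auto simp: inner_add_left inner_add_right rotJ_simps power2_eq_square algebra_simps)
    then show ?thesis using i by simp
  qed
  moreover have "((\<lambda>t. - (1/2) * ((LINT x|leb_I. ?A x) + t * (LINT x|leb_I. ?B x) + t\<^sup>2 * (LINT x|leb_I. ?C x)))
     has_real_derivative - (1/2) * (LINT x|leb_I. ?B x)) (at 0)"
    by (auto intro!: derivative_eq_intros)
  moreover have "- (1/2) * (LINT x|leb_I. ?B x) = (LINT x|leb_I. rotJ (\<gamma> x) \<bullet> \<phi>1 x)"
  proof -
    have "ac (\<lambda>x. \<gamma> x \<bullet> rotJ (\<phi> x)) (\<lambda>x. \<gamma> x \<bullet> rotJ (\<phi>1 x) + g x \<bullet> rotJ (\<phi> x))"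
      by (intro ac_inner ac\<gamma> ac_rotJ ac\<phi>)
    from ac_total[OF this] have "(LINT x|leb_I. \<gamma> x \<bullet> rotJ (\<phi>1 x) + g x \<bullet> rotJ (\<phi> x)) = 0"
      using \<gamma>per \<phi>per by simp
    moreover have "g x \<bullet> rotJ (\<phi> x) = - (\<phi> x \<bullet> rotJ (g x))" for x by (simp add: inner2)
    ultimately have "(LINT x|leb_I. \<gamma> x \<bullet> rotJ (\<phi>1 x)) - (LINT x|leb_I. \<phi> x \<bullet> rotJ (g x)) = 0"
      using i by simp
    moreover have "(LINT x|leb_I. ?B x) = (LINT x|leb_I. \<gamma> x \<bullet> rotJ (\<phi>1 x)) + (LINT x|leb_I. \<phi> x \<bullet> rotJ (g x))"
      using i by simp
    moreover have "\<gamma> x \<bullet> rotJ (\<phi>1 x) = - (rotJ (\<gamma> x) \<bullet> \<phi>1 x)" for x by (rule rotJ_swap)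
    ultimately show ?thesis by simp
  qed
  ultimately show ?thesis by simp
qed

text \<open>The second derivative \<open>h\<close> of the curve is only square integrable, so the
  majorant is a multiple of the square of \<open>1 + norm (h x) + norm (e x)\<close>. At
  \<open>t = 0\<close> the constant speed turns the differentiated integrand into \<open>P\<close>
  and \<open>Q\<close>.\<close>

lemma energy_variation:
  "integrable leb_I (\<lambda>x. P x \<bullet> \<phi>2 x + Q x \<bullet> \<phi>1 x)"
  "((\<lambda>t. energy \<delta> lam (\<lambda>x. \<gamma> x + t *\<^sub>R \<phi> x) \<eta>) has_real_derivative
    (LINT x|leb_I. P x \<bullet> \<phi>2 x + Q x \<bullet> \<phi>1 x)) (at 0)"
proof -
  note [measurable] = meas meas\<phi>
  let ?X = "\<lambda>t x. (h x + t *\<^sub>R \<phi>2 x) \<bullet> rotJ (g x + t *\<^sub>R \<phi>1 x)"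
  let ?X' = "\<lambda>t x. \<phi>2 x \<bullet> rotJ (g x + t *\<^sub>R \<phi>1 x) + (h x + t *\<^sub>R \<phi>2 x) \<bullet> rotJ (\<phi>1 x)"
  let ?Y = "\<lambda>t x. e x \<bullet> (g x + t *\<^sub>R \<phi>1 x)"
  let ?Y' = "\<lambda>t x. e x \<bullet> \<phi>1 x"
  let ?b = "\<lambda>x. 1 + norm (h x) + norm (e x)"
  \<comment> \<open>One constant for all quantities: up to the factor \<open>?b x\<close>, the three
    summands bound the products of the perturbed \<open>h\<close> with the perturbed
    \<open>g\<close>, of the perturbed \<open>h\<close> with \<open>\<phi>1\<close>, and of
    \<open>\<phi>2\<close> with the perturbed \<open>g\<close>.\<close>
  define K where "K = (1 + Bd) * (2 * c) + (1 + Bd) * Bd + Bd * (2 * c)"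
  have K0: "K \<ge> 0" using Bd(1) c0 by (simp add: K_def)
  obtain K' where K': "K' \<ge> 0" "\<And>X Y n X' Y' n' b. \<bar>X\<bar> \<le> K * b \<Longrightarrow> \<bar>Y\<bar> \<le> K * b \<Longrightarrow> \<bar>X'\<bar> \<le> K * b \<Longrightarrow>
    \<bar>Y'\<bar> \<le> K * b \<Longrightarrow> \<bar>n'\<bar> \<le> K \<Longrightarrow> c / 2 \<le> n \<Longrightarrow> n \<le> 2 * c \<Longrightarrow> b \<ge> 0 \<Longrightarrow>
    \<bar>bend \<delta> X Y n\<bar> \<le> K' * b\<^sup>2 \<and> \<bar>bend_deriv \<delta> X Y n X' Y' n'\<bar> \<le> K' * b\<^sup>2"
    using bend_bounds[OF K0 c0] by metis
  have ib: "integrable leb_I (\<lambda>x. K' * (?b x)\<^sup>2)"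
  proof -
    have "L2_fun (\<lambda>x. 1 + norm (h x) + norm (e x))"
      by (intro L2_add L2_cont[of "\<lambda>_. 1"] L2_norm L2h L2e continuous_on_const)
    then have "integrable leb_I (\<lambda>x. (?b x)\<^sup>2)" by (simp add: L2_fun_def)
    then show ?thesis by simp
  qed
  have bounds: "\<bar>bend \<delta> (?X t x) (?Y t x) (nt t x)\<bar> \<le> K' * (?b x)\<^sup>2 \<and>
     \<bar>bend_deriv \<delta> (?X t x) (?Y t x) (nt t x) (?X' t x) (?Y' t x) (nt' t x)\<bar> \<le> K' * (?b x)\<^sup>2"
    if t: "\<bar>t\<bar> < t0" and x: "x \<in> dom_I" for t x
  proof (rule K'(2))
    note n = t_bounds[OF t x] and B = Bd(1) Bd(2,3)[OF x]
    have t1: "\<bar>t\<bar> \<le> 1" using t by (simp add: t0_def)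
    have hb: "norm (h x + t *\<^sub>R \<phi>2 x) \<le> (1 + Bd) * ?b x"
    proof -
      have "norm (h x + t *\<^sub>R \<phi>2 x) \<le> norm (h x) + \<bar>t\<bar> * norm (\<phi>2 x)" by (rule norm_triangle_le) simp
      also have "\<dots> \<le> norm (h x) + 1 * Bd" using t1 B by (intro add_mono mult_mono) auto
      also have "\<dots> \<le> (1 + Bd) * ?b x" using B by (simp add: algebra_simps)
      finally show ?thesis .
    qed
    have b1: "?b x \<ge> 1" "norm (e x) \<le> ?b x" by simp_all
    have p: "0 \<le> (1 + Bd) * (2 * c) * ?b x" "0 \<le> (1 + Bd) * Bd * ?b x" "0 \<le> Bd * (2 * c) * ?b x"
      using B(1) c0 b1 by (auto intro!: mult_nonneg_nonneg)
    have Kb: "K * ?b x = (1 + Bd) * (2 * c) * ?b x + (1 + Bd) * Bd * ?b x + Bd * (2 * c) * ?b x"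
      by (simp add: K_def algebra_simps)
    have "\<bar>?X t x\<bar> \<le> norm (h x + t *\<^sub>R \<phi>2 x) * norm (rotJ (g x + t *\<^sub>R \<phi>1 x))" by (rule Cauchy_Schwarz_ineq2)
    also have "\<dots> \<le> (1 + Bd) * ?b x * (2 * c)" using hb n B c0 by (intro mult_mono) auto
    also have "\<dots> = (1 + Bd) * (2 * c) * ?b x" by (simp only: mult_ac)
    finally show "\<bar>?X t x\<bar> \<le> K * ?b x" using p Kb by linarith
    have "\<bar>\<phi>2 x \<bullet> rotJ (g x + t *\<^sub>R \<phi>1 x)\<bar> \<le> norm (\<phi>2 x) * norm (rotJ (g x + t *\<^sub>R \<phi>1 x))" by (rule Cauchy_Schwarz_ineq2)
    also have "\<dots> \<le> Bd * (2 * c)" using n B c0 by (intro mult_mono) auto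
    also have "\<dots> \<le> Bd * (2 * c) * ?b x" using b1 B c0 mult_left_mono[OF b1(1), of "Bd * (2 * c)"] by simp
    finally have x1: "\<bar>\<phi>2 x \<bullet> rotJ (g x + t *\<^sub>R \<phi>1 x)\<bar> \<le> Bd * (2 * c) * ?b x" .
    have "\<bar>(h x + t *\<^sub>R \<phi>2 x) \<bullet> rotJ (\<phi>1 x)\<bar> \<le> norm (h x + t *\<^sub>R \<phi>2 x) * norm (rotJ (\<phi>1 x))" by (rule Cauchy_Schwarz_ineq2)
    also have "\<dots> \<le> (1 + Bd) * ?b x * Bd" using hb B by (intro mult_mono) auto
    also have "\<dots> = (1 + Bd) * Bd * ?b x" by (simp only: mult_ac)
    finally have x2: "\<bar>(h x + t *\<^sub>R \<phi>2 x) \<bullet> rotJ (\<phi>1 x)\<bar> \<le> (1 + Bd) * Bd * ?b x" .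
    show "\<bar>?X' t x\<bar> \<le> K * ?b x" using x1 x2 p Kb by linarith
    have "\<bar>?Y t x\<bar> \<le> norm (e x) * nt t x" by (rule Cauchy_Schwarz_ineq2)
    also have "\<dots> \<le> ?b x * (2 * c)" using n b1 by (intro mult_mono) auto
    also have "\<dots> \<le> (1 + Bd) * (2 * c) * ?b x" using B(1) c0 b1 by (simp add: algebra_simps)
    finally show "\<bar>?Y t x\<bar> \<le> K * ?b x" using p Kb by linarith
    have "\<bar>?Y' t x\<bar> \<le> norm (e x) * norm (\<phi>1 x)" by (rule Cauchy_Schwarz_ineq2)
    also have "\<dots> \<le> ?b x * Bd" using B b1 by (intro mult_mono) auto
    also have "\<dots> \<le> (1 + Bd) * Bd * ?b x" using B(1) b1 by (simp add: algebra_simps)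
    finally show "\<bar>?Y' t x\<bar> \<le> K * ?b x" using p Kb by linarith
    have "Bd \<le> K" unfolding K_def using B(1) c0 by (simp add: algebra_simps)
    then show "\<bar>nt' t x\<bar> \<le> K" using nt'_bound[OF x, of t] by linarith
    show "c / 2 \<le> nt t x" "nt t x \<le> 2 * c" using n by auto
    show "0 \<le> ?b x" by simp
  qed
  let ?F' = "\<lambda>t x. bend_deriv \<delta> (?X t x) (?Y t x) (nt t x) (?X' t x) (?Y' t x) (nt' t x)"
  have m1: "?F' t \<in> borel_measurable leb_I" for t unfolding bend_deriv_def by measurable
  have 1: "((\<lambda>t. LINT x|leb_I. bend \<delta> (?X t x) (?Y t x) (nt t x)) has_real_derivative (LINT x|leb_I. ?F' 0 x)) (at 0)"
  proof (rule deriv_LINT[OF t0 _ _ _ ib m1])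
    fix t assume t: "\<bar>t\<bar> < t0"
    show "integrable leb_I (\<lambda>x. bend \<delta> (?X t x) (?Y t x) (nt t x))"
    proof (rule integrable_leb_bound[OF _ ib])
      show "(\<lambda>x. bend \<delta> (?X t x) (?Y t x) (nt t x)) \<in> borel_measurable leb_I" unfolding bend_def by measurable
      show "norm (bend \<delta> (?X t x) (?Y t x) (nt t x)) \<le> K' * (?b x)\<^sup>2" if "x \<in> dom_I" for x
        using bounds[OF t that] by simp
    qed
    fix x assume x: "x \<in> dom_I"
    show "((\<lambda>t. bend \<delta> (?X t x) (?Y t x) (nt t x)) has_real_derivative ?F' t x) (at t)"
      using t_bounds[OF t x] by (intro DERIV_bend DERIV_X_line DERIV_Y_line DERIV_norm_line) auto
    show "\<bar>?F' t x\<bar> \<le> K' * (?b x)\<^sup>2" using bounds[OF t x] by simp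
  qed
  let ?G = "\<lambda>t x. (norm (e x))\<^sup>2 / nt t x"
  let ?G' = "\<lambda>t x. - ((norm (e x))\<^sup>2 * nt' t x / (nt t x)\<^sup>2)"
  define r where "r = 2 / c"
  have inv: "1 / nt t x \<le> r" "1 / nt t x \<ge> 0" if "\<bar>t\<bar> < t0" "x \<in> dom_I" for t x
  proof -
    have n: "c / 2 \<le> nt t x" by (rule t_bounds[OF that])
    then have "nt t x > 0" using c0 by linarith
    then show "1 / nt t x \<le> r" "1 / nt t x \<ge> 0" using n c0 by (simp_all add: r_def field_simps)
  qed
  have r: "r > 0" using c0 by (simp add: r_def)
  have ie: "integrable leb_I (\<lambda>x. k * (norm (e x))\<^sup>2)" for k using L2e by (simp add: L2_fun_def)
  have 2: "((\<lambda>t. LINT x|leb_I. ?G t x) has_real_derivative (LINT x|leb_I. ?G' 0 x)) (at 0)"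
  proof (rule deriv_LINT[OF t0 _ _ _ ie[of "Bd * r\<^sup>2"]])
    fix t assume t: "\<bar>t\<bar> < t0"
    show "integrable leb_I (?G t)"
    proof (rule integrable_leb_bound[OF _ ie[of r]])
      fix x assume x: "x \<in> dom_I"
      have "(norm (e x))\<^sup>2 * (1 / nt t x) \<le> (norm (e x))\<^sup>2 * r" by (intro mult_left_mono inv t x) simp
      then show "norm (?G t x) \<le> r * (norm (e x))\<^sup>2" by (simp add: mult.commute)
    qed measurable
    fix x assume x: "x \<in> dom_I"
    have "nt t x \<noteq> 0" using t_bounds[OF t x] by simp
    then show "((\<lambda>t. ?G t x) has_real_derivative ?G' t x) (at t)"
      using t_bounds(3)[OF t x]
      by (auto intro!: derivative_eq_intros DERIV_norm_line simp: power2_eq_square field_simps)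
    have "\<bar>nt' t x\<bar> * (1 / nt t x)\<^sup>2 \<le> Bd * r\<^sup>2"
      using inv[OF t x] Bd(1) by (intro mult_mono power_mono nt'_bound x) auto
    then have "(norm (e x))\<^sup>2 * (\<bar>nt' t x\<bar> * (1 / nt t x)\<^sup>2) \<le> (norm (e x))\<^sup>2 * (Bd * r\<^sup>2)"
      by (rule mult_left_mono) simp
    then show "\<bar>?G' t x\<bar> \<le> Bd * r\<^sup>2 * (norm (e x))\<^sup>2"
      by (simp add: abs_mult power_divide mult_ac)
  next
    show "?G' 0 \<in> borel_measurable leb_I" by measurable
  qed
  have e: "energy \<delta> lam (\<lambda>x. \<gamma> x + t *\<^sub>R \<phi> x) \<eta> =
    1 / 2 * (LINT x|leb_I. bend \<delta> (?X t x) (?Y t x) (nt t x)) + lam / 2 * (LINT x|leb_I. ?G t x)" if "\<bar>t\<bar> < t0" for t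
    by (rule energy_repr[OF ac_pert _ ac\<eta>]) (rule t_bounds(3)[OF that])
  have 3: "((\<lambda>t. 1 / 2 * (LINT x|leb_I. bend \<delta> (?X t x) (?Y t x) (nt t x)) + lam / 2 * (LINT x|leb_I. ?G t x))
      has_real_derivative 1 / 2 * (LINT x|leb_I. ?F' 0 x) + lam / 2 * (LINT x|leb_I. ?G' 0 x)) (at 0)"
    by (intro DERIV_add DERIV_cmult 1 2)
  have 4: "((\<lambda>t. energy \<delta> lam (\<lambda>x. \<gamma> x + t *\<^sub>R \<phi> x) \<eta>)
      has_real_derivative 1 / 2 * (LINT x|leb_I. ?F' 0 x) + lam / 2 * (LINT x|leb_I. ?G' 0 x)) (at 0)"
    by (rule has_field_derivative_transform_within_open[OF 3, of "{-t0<..<t0}"])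
      (use t0 e in \<open>auto simp: abs_less_iff\<close>)
  have iF: "integrable leb_I (?F' 0)"
    by (rule integrable_leb_bound[OF m1 ib]) (use bounds[of 0] t0 in auto)
  have iG: "integrable leb_I (?G' 0)"
  proof (rule integrable_leb_bound[OF _ ie[of "Bd * r\<^sup>2"]])
    fix x assume x: "x \<in> dom_I"
    have "\<bar>nt' 0 x\<bar> * (1 / nt 0 x)\<^sup>2 \<le> Bd * r\<^sup>2"
      using inv[of 0 x] x Bd(1) t0 by (intro mult_mono power_mono nt'_bound x) auto
    then have "(norm (e x))\<^sup>2 * (\<bar>nt' 0 x\<bar> * (1 / nt 0 x)\<^sup>2) \<le> (norm (e x))\<^sup>2 * (Bd * r\<^sup>2)"
      by (rule mult_left_mono) simp
    then show "norm (?G' 0 x) \<le> Bd * r\<^sup>2 * (norm (e x))\<^sup>2"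
      by (simp add: abs_mult power_divide mult_ac)
  qed measurable
  have pt: "1 / 2 * ?F' 0 x + lam / 2 * ?G' 0 x = P x \<bullet> \<phi>2 x + Q x \<bullet> \<phi>1 x" if x: "x \<in> dom_I" for x
  proof -
    have n: "norm (g x) = c" by (rule gc[OF x])
    have h: "h x \<bullet> rotJ (\<phi>1 x) = - (rotJ (h x) \<bullet> \<phi>1 x)" by (rule rotJ_swap)
    have w: "(h x \<bullet> rotJ (g x)) / c ^ 3 + \<delta> * (e x \<bullet> g x / c\<^sup>2) = w x" by (simp add: w_def kap_def)
    have k: "h x \<bullet> rotJ (g x) = kap x * c ^ 3" using c0 by (simp add: kap_def)
    have g0: "g x + 0 *\<^sub>R \<phi>1 x = g x" "h x + 0 *\<^sub>R \<phi>2 x = h x" by simp_all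
    have F: "?F' 0 x = 2 * w x * ((\<phi>2 x \<bullet> rotJ (g x) - rotJ (h x) \<bullet> \<phi>1 x) / c ^ 3
       - 3 * (kap x * c ^ 3) * (g x \<bullet> \<phi>1 x / c) / c ^ 4
       + \<delta> * (e x \<bullet> \<phi>1 x / c\<^sup>2 - 2 * (e x \<bullet> g x) * (g x \<bullet> \<phi>1 x / c) / c ^ 3)) * c
       + (w x)\<^sup>2 * (g x \<bullet> \<phi>1 x / c)"
      unfolding bend_deriv_def g0 n w unfolding h k by simp
    have G: "?G' 0 x = - ((norm (e x))\<^sup>2 * (g x \<bullet> \<phi>1 x / c) / c\<^sup>2)" by (simp add: n)
    have R: "P x \<bullet> \<phi>2 x + Q x \<bullet> \<phi>1 x = (w x / c\<^sup>2) * (\<phi>2 x \<bullet> rotJ (g x)) - (w x / c\<^sup>2) * (rotJ (h x) \<bullet> \<phi>1 x)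
       + (\<delta> * w x / c) * (e x \<bullet> \<phi>1 x) + (- (3 * w x * kap x / c) - 2 * \<delta> * w x * (e x \<bullet> g x) / c ^ 3 + (w x)\<^sup>2 / (2 * c)
      - lam * (norm (e x))\<^sup>2 / (2 * c ^ 3)) * (g x \<bullet> \<phi>1 x)"
      unfolding P_def Q_def by (simp add: inner_add_left inner_add_right inner_diff_left inner_diff_right inner_commute)
    show ?thesis unfolding F G R using c0 by (simp add: field_simps eval_nat_numeral)
  qed
  have eqi: "(LINT x|leb_I. P x \<bullet> \<phi>2 x + Q x \<bullet> \<phi>1 x) = (LINT x|leb_I. 1 / 2 * ?F' 0 x + lam / 2 * ?G' 0 x)"
    using pt by (intro Bochner_Integration.integral_cong) auto
  have ii: "integrable leb_I (\<lambda>x. 1 / 2 * ?F' 0 x + lam / 2 * ?G' 0 x)" using iF iG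
    by (intro Bochner_Integration.integrable_add integrable_mult_right)
  show "integrable leb_I (\<lambda>x. P x \<bullet> \<phi>2 x + Q x \<bullet> \<phi>1 x)"
    by (rule Bochner_Integration.integrable_cong[THEN iffD1, OF refl _ ii]) (use pt in auto)
  have "1 / 2 * (LINT x|leb_I. ?F' 0 x) + lam / 2 * (LINT x|leb_I. ?G' 0 x) = (LINT x|leb_I. 1 / 2 * ?F' 0 x + lam / 2 * ?G' 0 x)"
  proof -
    have "integrable leb_I (\<lambda>x. 1 / 2 * ?F' 0 x)" "integrable leb_I (\<lambda>x. lam / 2 * ?G' 0 x)"
      by (rule integrable_mult_right, rule iF) (rule integrable_mult_right, rule iG)
    from Bochner_Integration.integral_add[OF this] show ?thesis
      by (simp only: integral_mult_right_zero)
  qed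
  with 4 eqi show "((\<lambda>t. energy \<delta> lam (\<lambda>x. \<gamma> x + t *\<^sub>R \<phi> x) \<eta>) has_real_derivative
    (LINT x|leb_I. P x \<bullet> \<phi>2 x + Q x \<bullet> \<phi>1 x)) (at 0)" by simp
qed

end

text \<open>For a fixed curve the energy is a quadratic polynomial in the director; the expansion in
  \<open>t\<close> is exact and the derivative is its linear coefficient.\<close>

lemma (in arc_curve) director_variation:
  assumes ac\<psi>: "ac \<psi> \<psi>1" and L2\<psi>: "L2_fun \<psi>1"
  shows "((\<lambda>t. energy \<delta> lam \<gamma> (\<lambda>x. \<eta> x + t *\<^sub>R \<psi> x)) has_real_derivative
    (LINT x|leb_I. \<delta> * w x * (\<psi>1 x \<bullet> g x) / c + lam * (e x \<bullet> \<psi>1 x) / c)) (at 0)"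
proof -
  define v where "v x = \<psi>1 x \<bullet> g x" for x
  have L2v: "L2_fun v"
    using L2_bilin_cont[OF bounded_bilinear_inner cont(2) L2\<psi>] by (simp add: v_def[abs_def] inner_commute)
  have i: "integrable leb_I (\<lambda>x. (w x)\<^sup>2)" "integrable leb_I (\<lambda>x. w x * v x)" "integrable leb_I (\<lambda>x. (v x)\<^sup>2)"
    "integrable leb_I (\<lambda>x. e x \<bullet> e x)" "integrable leb_I (\<lambda>x. e x \<bullet> \<psi>1 x)" "integrable leb_I (\<lambda>x. \<psi>1 x \<bullet> \<psi>1 x)"
    using L2_prod_integrable[OF bounded_bilinear_mult L2_w L2_w] L2_prod_integrable[OF bounded_bilinear_mult L2_w L2v]
      L2_prod_integrable[OF bounded_bilinear_mult L2v L2v]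
      L2_prod_integrable[OF bounded_bilinear_inner L2e L2e] L2_prod_integrable[OF bounded_bilinear_inner L2e L2\<psi>]
      L2_prod_integrable[OF bounded_bilinear_inner L2\<psi> L2\<psi>] by (simp_all add: power2_eq_square)
  have b: "bend \<delta> (h x \<bullet> rotJ (g x)) ((e x + t *\<^sub>R \<psi>1 x) \<bullet> g x) (norm (g x)) =
     c * (w x)\<^sup>2 + (2 * t * \<delta> / c) * (w x * v x) + (t\<^sup>2 * \<delta>\<^sup>2 / c ^ 3) * (v x)\<^sup>2" if "x \<in> dom_I" for t x
    using c0 by (simp add: bend_def gc[OF that] w_def kap_def v_def inner_add_left field_simps eval_nat_numeral)
  have d: "(norm (e x + t *\<^sub>R \<psi>1 x))\<^sup>2 / norm (g x) = (1 / c) * (e x \<bullet> e x) + (2 * t / c) * (e x \<bullet> \<psi>1 x) + (t\<^sup>2 / c) * (\<psi>1 x \<bullet> \<psi>1 x)"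
    if "x \<in> dom_I" for t x
  proof -
    have "(norm (e x + t *\<^sub>R \<psi>1 x))\<^sup>2 = e x \<bullet> e x + 2 * t * (e x \<bullet> \<psi>1 x) + t\<^sup>2 * (\<psi>1 x \<bullet> \<psi>1 x)"
      unfolding power2_norm_eq_inner
      by (simp add: inner_add_left inner_add_right inner_commute power2_eq_square algebra_simps)
    then show ?thesis by (simp add: gc[OF that] add_divide_distrib)
  qed
  have "energy \<delta> lam \<gamma> (\<lambda>x. \<eta> x + t *\<^sub>R \<psi> x) =
     1 / 2 * (c * (LINT x|leb_I. (w x)\<^sup>2) + (2 * t * \<delta> / c) * (LINT x|leb_I. w x * v x) + (t\<^sup>2 * \<delta>\<^sup>2 / c ^ 3) * (LINT x|leb_I. (v x)\<^sup>2))
     + lam / 2 * ((1 / c) * (LINT x|leb_I. e x \<bullet> e x) + (2 * t / c) * (LINT x|leb_I. e x \<bullet> \<psi>1 x) + (t\<^sup>2 / c) * (LINT x|leb_I. \<psi>1 x \<bullet> \<psi>1 x))" for t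
  proof -
    have "ac (\<lambda>x. \<eta> x + t *\<^sub>R \<psi> x) (\<lambda>x. e x + t *\<^sub>R \<psi>1 x)" by (intro ac_add ac\<eta> ac_cmult ac\<psi>)
    from energy_repr[OF ac\<gamma> acg _ this]
    have en: "energy \<delta> lam \<gamma> (\<lambda>x. \<eta> x + t *\<^sub>R \<psi> x) =
      1 / 2 * (LINT x|leb_I. bend \<delta> (h x \<bullet> rotJ (g x)) ((e x + t *\<^sub>R \<psi>1 x) \<bullet> g x) (norm (g x)))
      + lam / 2 * (LINT x|leb_I. (norm (e x + t *\<^sub>R \<psi>1 x))\<^sup>2 / norm (g x))"
      using g_nz by blast
    have "energy \<delta> lam \<gamma> (\<lambda>x. \<eta> x + t *\<^sub>R \<psi> x) =
      1 / 2 * (LINT x|leb_I. c * (w x)\<^sup>2 + (2 * t * \<delta> / c) * (w x * v x) + (t\<^sup>2 * \<delta>\<^sup>2 / c ^ 3) * (v x)\<^sup>2)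
      + lam / 2 * (LINT x|leb_I. (1 / c) * (e x \<bullet> e x) + (2 * t / c) * (e x \<bullet> \<psi>1 x) + (t\<^sup>2 / c) * (\<psi>1 x \<bullet> \<psi>1 x))"
    proof -
      have "(LINT x|leb_I. bend \<delta> (h x \<bullet> rotJ (g x)) ((e x + t *\<^sub>R \<psi>1 x) \<bullet> g x) (norm (g x))) =
         (LINT x|leb_I. c * (w x)\<^sup>2 + (2 * t * \<delta> / c) * (w x * v x) + (t\<^sup>2 * \<delta>\<^sup>2 / c ^ 3) * (v x)\<^sup>2)"
        by (rule Bochner_Integration.integral_cong[OF refl], rule b) simp
      moreover have "(LINT x|leb_I. (norm (e x + t *\<^sub>R \<psi>1 x))\<^sup>2 / norm (g x)) =
         (LINT x|leb_I. (1 / c) * (e x \<bullet> e x) + (2 * t / c) * (e x \<bullet> \<psi>1 x) + (t\<^sup>2 / c) * (\<psi>1 x \<bullet> \<psi>1 x))"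
        by (rule Bochner_Integration.integral_cong[OF refl], rule d) simp
      ultimately show ?thesis using en by (simp only:)
    qed
    then show ?thesis using i by simp
  qed
  moreover have "((\<lambda>t. 1 / 2 * (c * (LINT x|leb_I. (w x)\<^sup>2) + (2 * t * \<delta> / c) * (LINT x|leb_I. w x * v x) + (t\<^sup>2 * \<delta>\<^sup>2 / c ^ 3) * (LINT x|leb_I. (v x)\<^sup>2))
     + lam / 2 * ((1 / c) * (LINT x|leb_I. e x \<bullet> e x) + (2 * t / c) * (LINT x|leb_I. e x \<bullet> \<psi>1 x) + (t\<^sup>2 / c) * (LINT x|leb_I. \<psi>1 x \<bullet> \<psi>1 x)))
     has_real_derivative (\<delta> / c) * (LINT x|leb_I. w x * v x) + (lam / c) * (LINT x|leb_I. e x \<bullet> \<psi>1 x)) (at 0)"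
    using c0 by (auto intro!: derivative_eq_intros)
  moreover have "(LINT x|leb_I. \<delta> * w x * (\<psi>1 x \<bullet> g x) / c + lam * (e x \<bullet> \<psi>1 x) / c) =
     (\<delta> / c) * (LINT x|leb_I. w x * v x) + (lam / c) * (LINT x|leb_I. e x \<bullet> \<psi>1 x)"
  proof -
    have "(LINT x|leb_I. \<delta> * w x * (\<psi>1 x \<bullet> g x) / c + lam * (e x \<bullet> \<psi>1 x) / c) =
      (LINT x|leb_I. (\<delta> / c) * (w x * v x) + (lam / c) * (e x \<bullet> \<psi>1 x))"
      by (intro Bochner_Integration.integral_cong) (auto simp: v_def)
    then show ?thesis using i by simp
  qed
  ultimately show ?thesis by simp
qed

section \<open>The Euler-Lagrange system\<close>

text \<open>The tangent turns with curvature \<open>k\<close> and the director with \<open>S\<close>; \<open>W\<close> stands for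
  \<open>\<kappa> + \<delta> div \<eta>\<close> and \<open>U\<close> is the normal momentum of the director. The system is autonomous and
  polynomial in \<open>(\<gamma>, \<tau>, \<eta>, W, U)\<close>. The multiplier \<open>l\<close> of the length enters the first integral only,
  hence derivative bounds do not require a bound on it.\<close>

locale elastic_ode =
  fixes \<gamma> \<tau> \<eta> :: "real \<Rightarrow> real^2" and W U S k :: "real \<Rightarrow> real" and K :: "real^2"
    and c \<delta> lam a l :: real
  assumes c0: "c > 0" and lam0: "lam > 0"
    and D\<gamma>: "x \<in> dom_I \<Longrightarrow> (\<gamma> has_vector_derivative c *\<^sub>R \<tau> x) (at x within dom_I)"
    and D\<tau>: "x \<in> dom_I \<Longrightarrow> (\<tau> has_vector_derivative (c * k x) *\<^sub>R rotJ (\<tau> x)) (at x within dom_I)"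
    and D\<eta>: "x \<in> dom_I \<Longrightarrow> (\<eta> has_vector_derivative (c * S x) *\<^sub>R rotJ (\<eta> x)) (at x within dom_I)"
    and DW: "x \<in> dom_I \<Longrightarrow> (W has_vector_derivative
      c * (\<delta> * W x * S x * (\<eta> x \<bullet> \<tau> x) + a * (\<gamma> x \<bullet> \<tau> x) + K \<bullet> rotJ (\<tau> x))) (at x within dom_I)"
    and DU: "x \<in> dom_I \<Longrightarrow> (U has_vector_derivative
      - (c * \<delta> * W x * S x * (\<eta> x \<bullet> \<tau> x))) (at x within dom_I)"
    and k_eq: "x \<in> dom_I \<Longrightarrow> k x = W x - \<delta> * S x * (rotJ (\<eta> x) \<bullet> \<tau> x)"
    and S_eq: "x \<in> dom_I \<Longrightarrow> lam * S x = U x - \<delta> * W x * (rotJ (\<eta> x) \<bullet> \<tau> x)"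
    and per: "\<gamma> 0 = \<gamma> (2 * pi)" "\<tau> 0 = \<tau> (2 * pi)" "\<eta> 0 = \<eta> (2 * pi)"
      "W 0 = W (2 * pi)" "U 0 = U (2 * pi)"
    and \<tau>1: "x \<in> dom_I \<Longrightarrow> norm (\<tau> x) = 1" and \<eta>1: "x \<in> dom_I \<Longrightarrow> norm (\<eta> x) = 1"
    and mean0: "integral dom_I \<gamma> = 0"
    and first_integral: "x \<in> dom_I \<Longrightarrow>
      (W x)\<^sup>2 / 2 + lam * (S x)\<^sup>2 / 2 = l + a * (rotJ (\<gamma> x) \<bullet> \<tau> x) + K \<bullet> \<tau> x"
    and K_eq: "K = - (1 / (2 * pi)) *\<^sub>R integral dom_I
      (\<lambda>x. (- (3 / 2) * (W x)\<^sup>2 - lam / 2 * (S x)\<^sup>2) *\<^sub>R \<tau> x + (\<delta> * W x * S x) *\<^sub>R rotJ (\<eta> x))"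

text \<open>\<open>EL_director\<close> admits only directions with
  \<open>\<eta> x \<bullet> \<psi> x = 0\<close>, for which \<open>S_deriv\<close> vanishes: the
  multiplier of the pointwise constraint stays out of the system and is recovered afterwards. The
  coefficient \<open>l\<close> collects all multiples of the length variation.\<close>

locale arc_critical = arc_curve +
  fixes a l :: real
  assumes lam0: "lam > 0"
    and gper: "g 0 = g (2 * pi)" and \<eta>per: "\<eta> 0 = \<eta> (2 * pi)"
    and \<eta>1: "x \<in> dom_I \<Longrightarrow> norm (\<eta> x) = 1"
    and mean0: "(LINT x|leb_I. \<gamma> x) = 0"
    and EL_curve: "ac \<phi> \<phi>1 \<Longrightarrow> ac \<phi>1 \<phi>2 \<Longrightarrow> continuous_on dom_I \<phi>2 \<Longrightarrow> \<phi> 0 = \<phi> (2 * pi) \<Longrightarrow>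
      \<phi>1 0 = \<phi>1 (2 * pi) \<Longrightarrow> (LINT x|leb_I. P x \<bullet> \<phi>2 x + Q x \<bullet> \<phi>1 x) +
      l * (LINT x|leb_I. (g x \<bullet> \<phi>1 x) / c) + a * (LINT x|leb_I. rotJ (\<gamma> x) \<bullet> \<phi>1 x) = 0"
    and EL_director: "ac \<psi> \<psi>1 \<Longrightarrow> L2_fun \<psi>1 \<Longrightarrow> \<psi> 0 = \<psi> (2 * pi) \<Longrightarrow>
      (\<And>x. x \<in> dom_I \<Longrightarrow> \<eta> x \<bullet> \<psi> x = 0) \<Longrightarrow>
      (LINT x|leb_I. \<delta> * w x * (\<psi>1 x \<bullet> g x) / c + lam * (e x \<bullet> \<psi>1 x) / c) = 0"
begin

section \<open>Integrated Euler-Lagrange equations\<close>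

lemma L2_integrable: "L2_fun f \<Longrightarrow> integrable leb_I f" for f :: "real \<Rightarrow> 'a::euclidean_space"
  using L2_prod_integrable[OF bounded_bilinear_scaleR L2_cont[of "\<lambda>_. 1"], of f] by simp

lemma LINT_const: "(LINT x|leb_I. C) = (2 * pi) *\<^sub>R C" for C :: "'a::euclidean_space"
  unfolding LINT_eq_integral[OF cont_integrable[OF continuous_on_const]] by simp

lemma AE_dom: "AE x in leb_I. x \<in> dom_I" by (intro AE_I2) simp

lemma int_w: "integrable leb_I (\<lambda>x. w x *\<^sub>R f x)" if "L2_fun f" for f :: "real \<Rightarrow> 'a::euclidean_space"
  by (rule L2_prod_integrable[OF bounded_bilinear_scaleR L2_w that])

lemma int_P: "integrable leb_I P"
proof -
  have "integrable leb_I (\<lambda>x. (1 / c\<^sup>2) *\<^sub>R (w x *\<^sub>R rotJ (g x)))"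
    by (intro integrable_scaleR_right int_w L2_cont continuous_intros cont)
  then show ?thesis by (simp add: P_def[abs_def])
qed

lemma int_Q: "integrable leb_I Q"
proof -
  have iA: "integrable leb_I (\<lambda>x. (- 1 / c\<^sup>2) *\<^sub>R rotJ (w x *\<^sub>R h x))"
    by (intro integrable_scaleR_right integrable_bounded_linear[OF rotJ_bl] int_w L2h)
  have iB: "integrable leb_I (\<lambda>x. (\<delta> / c) *\<^sub>R (w x *\<^sub>R e x))"
    by (intro integrable_scaleR_right int_w L2e)
  have "integrable leb_I (\<lambda>x. (- 3 / c) *\<^sub>R (w x *\<^sub>R kap x) + (- 2 * \<delta> / c) *\<^sub>R (w x *\<^sub>R ((e x \<bullet> g x) / c\<^sup>2)) +
     (1 / (2 * c)) *\<^sub>R (w x *\<^sub>R w x) + (- lam / (2 * c ^ 3)) *\<^sub>R (norm (e x))\<^sup>2)"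
    using L2e by (intro Bochner_Integration.integrable_add integrable_scaleR_right int_w L2_kap L2_div L2_w)
      (simp add: L2_fun_def)
  from integrable_bilinear_cont(2)[OF bounded_bilinear.flip[OF bounded_bilinear_scaleR] cont(2) this]
  have iC: "integrable leb_I (\<lambda>x. ((- 3 / c) *\<^sub>R (w x *\<^sub>R kap x) + (- 2 * \<delta> / c) *\<^sub>R (w x *\<^sub>R ((e x \<bullet> g x) / c\<^sup>2)) +
     (1 / (2 * c)) *\<^sub>R (w x *\<^sub>R w x) + (- lam / (2 * c ^ 3)) *\<^sub>R (norm (e x))\<^sup>2) *\<^sub>R g x)" .
  have "Q = (\<lambda>x. ((- 1 / c\<^sup>2) *\<^sub>R rotJ (w x *\<^sub>R h x)) + (\<delta> / c) *\<^sub>R (w x *\<^sub>R e x) +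
    ((- 3 / c) *\<^sub>R (w x *\<^sub>R kap x) + (- 2 * \<delta> / c) *\<^sub>R (w x *\<^sub>R ((e x \<bullet> g x) / c\<^sup>2)) +
     (1 / (2 * c)) *\<^sub>R (w x *\<^sub>R w x) + (- lam / (2 * c ^ 3)) *\<^sub>R (norm (e x))\<^sup>2) *\<^sub>R g x)"
    using c0 by (simp add: fun_eq_iff Q_def rotJ_simps power2_eq_square power3_eq_cube)
  with iA iB iC show ?thesis by simp
qed

text \<open>\<open>K\<close> is the constant of integration in \<open>P' = M + K\<close>. Its value is dictated by periodicity of \<open>P\<close>,
  since \<open>\<gamma>\<close> and \<open>g\<close> have mean zero; this is what makes it bounded by the norms of \<open>\<gamma>\<close> and \<open>\<eta>\<close>.\<close>

definition K :: "real^2" where "K = - (1 / (2 * pi)) *\<^sub>R (LINT x|leb_I. Q x)"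
definition M :: "real \<Rightarrow> real^2" where "M x = Q x + (l / c) *\<^sub>R g x + a *\<^sub>R rotJ (\<gamma> x)"

lemma int_g: "integrable leb_I g" "integrable leb_I \<gamma>" "integrable leb_I (\<lambda>x. rotJ (\<gamma> x))"
  by (intro cont_integrable continuous_intros cont)+

lemma int_M: "integrable leb_I M"
  unfolding M_def[abs_def]
  by (intro Bochner_Integration.integrable_add int_Q integrable_scaleR_right int_g)

lemma LINT_M: "(LINT x|leb_I. M x) = - (2 * pi) *\<^sub>R K"
proof -
  have "(LINT x|leb_I. g x) = 0" using ac_total[OF ac\<gamma>] \<gamma>per by simp
  moreover have "(LINT x|leb_I. rotJ (\<gamma> x)) = 0"
    using integral_bounded_linear[OF rotJ_bl int_g(2)] mean0 by (simp add: rotJ_simps)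
  ultimately have "(LINT x|leb_I. M x) = (LINT x|leb_I. Q x)"
    unfolding M_def using int_Q int_g by simp
  then show ?thesis by (simp add: K_def)
qed

text \<open>The equation for the curve is tested with functions having derivative \<open>f - m\<close>, where \<open>m\<close>
  is the mean of a test function \<open>f\<close>.\<close>

lemma weak_P: "has_weak_deriv P (\<lambda>x. M x + K)"
  unfolding has_weak_deriv_def
proof (intro conjI allI impI)
  show "integrable leb_I P" by (rule int_P)
  have iK: "integrable leb_I (\<lambda>x. K)" by (intro cont_integrable) auto
  show iMK: "integrable leb_I (\<lambda>x. M x + K)" using int_M iK by (rule Bochner_Integration.integrable_add)
  fix f f' assume t: "test_fun f f'"
  define m where "m = (LINT x|leb_I. f x) / (2 * pi)"
  have fi: "integrable leb_I f" by (intro cont_integrable test_fun_cont[OF t])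
  show "(LINT x|leb_I. f' x *\<^sub>R P x) = - (LINT x|leb_I. f x *\<^sub>R (M x + K))"
  proof (rule euclidean_eqI)
    fix b :: "real^2" assume "b \<in> Basis"
    define \<phi> where "\<phi> x = integral {0..x} (\<lambda>x. f x - m) *\<^sub>R b" for x
    define \<phi>1 where "\<phi>1 x = (f x - m) *\<^sub>R b" for x
    define \<phi>2 where "\<phi>2 x = f' x *\<^sub>R b" for x
    have cm: "continuous_on dom_I (\<lambda>x. f x - m)" by (intro continuous_intros test_fun_cont[OF t])
    have acF: "ac (\<lambda>x. integral {0..x} (\<lambda>x. f x - m)) (\<lambda>x. f x - m)"
      by (rule acI) (auto intro!: cont_integrable cm)
    have 1: "ac \<phi> \<phi>1" unfolding \<phi>_def \<phi>1_def
      by (rule ac_linear[OF bounded_linear_scaleR_left acF])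
    have "ac (\<lambda>x. f x + - m) (\<lambda>x. f' x + 0)" by (intro ac_add test_fun_ac[OF t] ac_const)
    then have 2: "ac \<phi>1 \<phi>2" unfolding \<phi>1_def \<phi>2_def
      using ac_linear[OF bounded_linear_scaleR_left] by fastforce
    have 3: "continuous_on dom_I \<phi>2" unfolding \<phi>2_def by (intro continuous_intros test_fun_cont[OF t])
    have "(LINT x|leb_I. f x - m) = 0"
    proof -
      have "(LINT x|leb_I. m) = m * (2 * pi)" unfolding LINT_const by simp
      then show ?thesis using fi cont_integrable[of "\<lambda>_. m"] by (simp add: m_def)
    qed
    then have "integral dom_I (\<lambda>x. f x - m) = 0" using LINT_eq_integral[OF cont_integrable[OF cm]] by simp
    then have 4: "\<phi> 0 = \<phi> (2 * pi)" by (simp add: \<phi>_def)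
    have 5: "\<phi>1 0 = \<phi>1 (2 * pi)" by (simp add: \<phi>1_def test_fun_ends[OF t])
    from EL_curve[OF 1 2 3 4 5]
    have E: "(LINT x|leb_I. P x \<bullet> \<phi>2 x + Q x \<bullet> \<phi>1 x) +
      l * (LINT x|leb_I. (g x \<bullet> \<phi>1 x) / c) + a * (LINT x|leb_I. rotJ (\<gamma> x) \<bullet> \<phi>1 x) = 0" .
    have c1: "continuous_on dom_I \<phi>1" by (rule ac_continuous[OF 2])
    have i1: "integrable leb_I (\<lambda>x. P x \<bullet> \<phi>2 x)"
      using integrable_bilinear_cont(1)[OF bounded_bilinear_inner 3 int_P] by (simp add: inner_commute)
    have i2: "integrable leb_I (\<lambda>x. Q x \<bullet> \<phi>1 x)"
      using integrable_bilinear_cont(1)[OF bounded_bilinear_inner c1 int_Q] by (simp add: inner_commute)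
    have i3: "integrable leb_I (\<lambda>x. g x \<bullet> \<phi>1 x)" "integrable leb_I (\<lambda>x. rotJ (\<gamma> x) \<bullet> \<phi>1 x)"
      by (intro cont_integrable continuous_intros cont c1; use c0 in simp)+
    have "(LINT x|leb_I. P x \<bullet> \<phi>2 x + M x \<bullet> \<phi>1 x) =
      (LINT x|leb_I. (P x \<bullet> \<phi>2 x + Q x \<bullet> \<phi>1 x) + ((l / c) * (g x \<bullet> \<phi>1 x) + a * (rotJ (\<gamma> x) \<bullet> \<phi>1 x)))"
      by (intro Bochner_Integration.integral_cong) (auto simp: M_def inner_add_left)
    also have "\<dots> = ((LINT x|leb_I. P x \<bullet> \<phi>2 x) + (LINT x|leb_I. Q x \<bullet> \<phi>1 x)) +
        (l / c * (LINT x|leb_I. g x \<bullet> \<phi>1 x) + a * (LINT x|leb_I. rotJ (\<gamma> x) \<bullet> \<phi>1 x))"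
    proof -
      have j: "integrable leb_I (\<lambda>x. (l / c) * (g x \<bullet> \<phi>1 x))" "integrable leb_I (\<lambda>x. a * (rotJ (\<gamma> x) \<bullet> \<phi>1 x))"
        using i3 by (auto intro!: integrable_mult_right)
      show ?thesis
        by (simp only: Bochner_Integration.integral_add[OF Bochner_Integration.integrable_add[OF i1 i2] Bochner_Integration.integrable_add[OF j]]
          Bochner_Integration.integral_add[OF i1 i2] Bochner_Integration.integral_add[OF j] integral_mult_right_zero)
    qed
    also have "\<dots> = 0" using E i1 i2 by simp
    finally have E2: "(LINT x|leb_I. P x \<bullet> \<phi>2 x + M x \<bullet> \<phi>1 x) = 0" .
    define Pb where "Pb x = P x \<bullet> b" for x
    define Mb where "Mb x = M x \<bullet> b" for x
    have iP: "integrable leb_I Pb" and iM: "integrable leb_I Mb"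
      using int_P int_M by (auto simp: Pb_def[abs_def] Mb_def[abs_def])
    have iPf: "integrable leb_I (\<lambda>x. f' x * Pb x)" and iMf: "integrable leb_I (\<lambda>x. f x * Mb x)"
      using integrable_test_times[OF t iP] integrable_test_times[OF t iM] by simp_all
    have "(LINT x|leb_I. P x \<bullet> \<phi>2 x + M x \<bullet> \<phi>1 x) = (LINT x|leb_I. f' x * Pb x + (f x * Mb x - m * Mb x))"
      by (intro Bochner_Integration.integral_cong) (auto simp: \<phi>1_def \<phi>2_def Pb_def Mb_def algebra_simps)
    also have "\<dots> = (LINT x|leb_I. f' x * Pb x) + (LINT x|leb_I. f x * Mb x) - m * (LINT x|leb_I. Mb x)"
      using iPf iMf iM by simp
    also have "(LINT x|leb_I. Mb x) = - (2 * pi) * (K \<bullet> b)"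
      using integral_inner_left[OF int_M, of b] LINT_M by (simp add: Mb_def)
    finally have E3: "(LINT x|leb_I. f' x * Pb x) + (LINT x|leb_I. f x * Mb x) + (LINT x|leb_I. f x) * (K \<bullet> b) = 0"
      using E2 by (simp add: m_def)
    have "(LINT x|leb_I. f' x *\<^sub>R P x) \<bullet> b = (LINT x|leb_I. f' x * Pb x)"
      using integral_inner_left[OF integrable_test_times(2)[OF t int_P], of b] by (simp add: Pb_def)
    moreover have "(LINT x|leb_I. f x *\<^sub>R (M x + K)) \<bullet> b = (LINT x|leb_I. f x * Mb x + f x * (K \<bullet> b))"
      using integral_inner_left[OF integrable_test_times(1)[OF t iMK], of b] by (simp add: Mb_def inner_add_left distrib_left)
    moreover have "(LINT x|leb_I. f x * Mb x + f x * (K \<bullet> b)) = (LINT x|leb_I. f x * Mb x) + (LINT x|leb_I. f x) * (K \<bullet> b)"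
      using iMf fi by simp
    ultimately show "(LINT x|leb_I. f' x *\<^sub>R P x) \<bullet> b = (- (LINT x|leb_I. f x *\<^sub>R (M x + K))) \<bullet> b"
      using E3 by simp
  qed
qed

text \<open>\<open>B\<close> and \<open>Cc\<close> are the coefficients of \<open>f1\<close> and
  \<open>f\<close> when the director equation is tested with
  \<open>f x *\<^sub>R rotJ (\<eta> x)\<close>; the contribution of
  \<open>e x \<bullet> rotJ (e x)\<close> to \<open>Cc\<close> is zero. The continuous
  representative of \<open>B\<close> will be \<open>U\<close>.\<close>

definition B :: "real \<Rightarrow> real" where "B x = \<delta> * w x * (rotJ (\<eta> x) \<bullet> g x) / c + lam * (e x \<bullet> rotJ (\<eta> x)) / c"
definition Cc :: "real \<Rightarrow> real" where "Cc x = \<delta> * w x * (rotJ (e x) \<bullet> g x) / c"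

lemma int_B: "integrable leb_I B" and int_Cc: "integrable leb_I Cc"
proof -
  have cp: "continuous_on dom_I (\<lambda>x. rotJ (\<eta> x) \<bullet> g x)" by (intro continuous_intros cont)
  have "integrable leb_I (\<lambda>x. (\<delta> / c) *\<^sub>R (w x *\<^sub>R (rotJ (\<eta> x) \<bullet> g x)))"
    by (intro integrable_scaleR_right int_w L2_cont cp)
  moreover have "integrable leb_I (\<lambda>x. (lam / c) *\<^sub>R (rotJ (\<eta> x) \<bullet> e x))"
    by (intro integrable_scaleR_right integrable_bilinear_cont(1)[OF bounded_bilinear_inner] continuous_intros cont
      L2_integrable[OF L2e])
  ultimately have "integrable leb_I (\<lambda>x. (\<delta> / c) *\<^sub>R (w x *\<^sub>R (rotJ (\<eta> x) \<bullet> g x)) + (lam / c) *\<^sub>R (rotJ (\<eta> x) \<bullet> e x))"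
    by (rule Bochner_Integration.integrable_add)
  then show "integrable leb_I B" by (simp add: B_def[abs_def] inner_commute mult_ac)
  have "L2_fun (\<lambda>x. rotJ (g x) \<bullet> e x)"
    by (intro L2_bilin_cont[OF bounded_bilinear_inner] continuous_intros cont L2e)
  then have "integrable leb_I (\<lambda>x. (- \<delta> / c) *\<^sub>R (w x *\<^sub>R (rotJ (g x) \<bullet> e x)))"
    by (intro integrable_scaleR_right int_w)
  moreover have "rotJ (e x) \<bullet> g x = - (rotJ (g x) \<bullet> e x)" for x by (simp add: inner2)
  ultimately show "integrable leb_I Cc" by (simp add: Cc_def[abs_def] mult_ac)
qed

lemma director_weak:
  assumes f: "ac f f1" and L2: "L2_fun f1" and p: "f 0 = f (2 * pi)"
    and i: "integrable leb_I (\<lambda>x. f1 x * B x)" "integrable leb_I (\<lambda>x. f x * Cc x)"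
  shows "(LINT x|leb_I. f1 x * B x) = - (LINT x|leb_I. f x * Cc x)"
proof -
  let ?\<psi>1 = "\<lambda>x. f x *\<^sub>R rotJ (e x) + f1 x *\<^sub>R rotJ (\<eta> x)"
  have 1: "ac (\<lambda>x. f x *\<^sub>R rotJ (\<eta> x)) ?\<psi>1" by (intro ac_scaleR f ac_rotJ ac\<eta>)
  have J: "L2_fun (\<lambda>x. rotJ (e x))" using L2e measurable_compose[OF L2_meas[OF L2e] measurable_rotJ]
    by (auto simp: L2_fun_def)
  have "L2_fun (\<lambda>x. (\<lambda>u v. v *\<^sub>R u) (rotJ (\<eta> x)) (f1 x))"
    by (rule L2_bilin_cont[OF bounded_bilinear.flip[OF bounded_bilinear_scaleR] _ L2]) (intro continuous_intros cont)
  then have 2: "L2_fun ?\<psi>1"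
    by (intro L2_add L2_bilin_cont[OF bounded_bilinear_scaleR ac_continuous[OF f] J]) simp
  have "(LINT x|leb_I. \<delta> * w x * (?\<psi>1 x \<bullet> g x) / c + lam * (e x \<bullet> ?\<psi>1 x) / c) = 0"
    by (rule EL_director[OF 1 2]) (simp_all add: p \<eta>per)
  also have "(LINT x|leb_I. \<delta> * w x * (?\<psi>1 x \<bullet> g x) / c + lam * (e x \<bullet> ?\<psi>1 x) / c) =
     (LINT x|leb_I. f1 x * B x + f x * Cc x)"
    by (intro Bochner_Integration.integral_cong)
      (auto simp: B_def Cc_def inner_add_left inner_add_right add_divide_distrib distrib_left mult_ac)
  finally show ?thesis using i by simp
qed

lemma weak_B: "has_weak_deriv B Cc"
  unfolding has_weak_deriv_def
proof (intro conjI allI impI int_B int_Cc)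
  fix f f' assume t: "test_fun f f'"
  show "(LINT x|leb_I. f' x *\<^sub>R B x) = - (LINT x|leb_I. f x *\<^sub>R Cc x)"
    using director_weak[OF test_fun_ac[OF t] L2_cont[OF test_fun_cont(2)[OF t]]]
      integrable_test_times(2)[OF t int_B] integrable_test_times(1)[OF t int_Cc]
    by (simp add: test_fun_ends[OF t])
qed

text \<open>The test function \<open>f = 1\<close> is an infinitesimal rotation of the director.
  Zero mean of \<open>Cc\<close> is exactly the periodicity of its primitive
  \<open>U\<close>.\<close>

lemma LINT_Cc: "(LINT x|leb_I. Cc x) = 0"
  using director_weak[OF ac_const[of 1] L2_cont[OF continuous_on_const]] int_Cc by simp

lemma AE_ortho:
  assumes f: "ac f f1" and n: "\<And>x. x \<in> dom_I \<Longrightarrow> norm (f x) = r"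
  shows "AE x in leb_I. f x \<bullet> f1 x = 0"
proof -
  have 1: "ac (\<lambda>x. f x \<bullet> f x) (\<lambda>x. f x \<bullet> f1 x + f1 x \<bullet> f x)" by (rule ac_inner[OF f f])
  have 2: "ac (\<lambda>x. f x \<bullet> f x) (\<lambda>x. 0)"
    by (rule ac_cong[OF ac_const[of "r\<^sup>2"]]) (use n in \<open>auto simp: power2_norm_eq_inner[symmetric]\<close>)
  from weak_unique[OF ac_imp_weak[OF 1] ac_imp_weak[OF 2]] show ?thesis
    by (simp add: inner_commute)
qed

text \<open>\<open>P\<close> and \<open>B\<close> have weak derivatives and thus absolutely
  continuous representatives \<open>Pc\<close> and \<open>U\<close>. Since \<open>\<eta>\<close> and
  \<open>\<tau>\<close> are unit vectors, \<open>W\<close>, \<open>S\<close> and \<open>k\<close>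
  are algebraic in \<open>Pc\<close>, \<open>U\<close> and the frames, hence continuous. Every
  density is then continuous, and absolute continuity becomes classical differentiability.\<close>

theorem ode_system:
  "\<exists>W U S k. elastic_ode \<gamma> (\<lambda>x. (1 / c) *\<^sub>R g x) \<eta> W U S k K c \<delta> lam a l \<and>
    (AE x in leb_I. w x = W x) \<and> (AE x in leb_I. kap x = k x) \<and>
    (AE x in leb_I. e x = (c * S x) *\<^sub>R rotJ (\<eta> x)) \<and>
    (AE x in leb_I. h x = (c\<^sup>2 * k x) *\<^sub>R rotJ ((1 / c) *\<^sub>R g x))"
proof -
  obtain Pc where Pc: "ac Pc (\<lambda>x. M x + K)" "AE x in leb_I. P x = Pc x" by (rule weak_imp_ac[OF weak_P])
  obtain U where U: "ac U Cc" "AE x in leb_I. B x = U x" by (rule weak_imp_ac[OF weak_B])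
  define \<tau> where "\<tau> x = (1 / c) *\<^sub>R g x" for x
  have g\<tau>: "g x = c *\<^sub>R \<tau> x" for x using c0 by (simp add: \<tau>_def)
  have \<tau>1: "norm (\<tau> x) = 1" if "x \<in> dom_I" for x using gc[OF that] c0 by (simp add: \<tau>_def)
  have c\<tau>: "continuous_on dom_I \<tau>" unfolding \<tau>_def by (intro continuous_intros cont)
  have \<tau>\<tau>: "\<tau> x \<bullet> \<tau> x = 1" if "x \<in> dom_I" for x using \<tau>1[OF that] by (simp add: power2_norm_eq_inner[symmetric])
  define W where "W x = Pc x \<bullet> rotJ (g x)" for x
  note cPc = ac_continuous[OF Pc(1)] and cU = ac_continuous[OF U(1)]
  have cW: "continuous_on dom_I W" unfolding W_def by (intro continuous_intros cPc cont)
  have wW: "AE x in leb_I. w x = W x"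
    using Pc(2) AE_dom
  proof eventually_elim
    case (elim x)
    have "P x \<bullet> rotJ (g x) = w x" unfolding P_def using c0 \<tau>\<tau>[OF elim(2)] by (simp add: g\<tau> rotJ_simps power2_eq_square)
    then show ?case using elim by (simp add: W_def)
  qed
  have PcW: "Pc x = (W x / c) *\<^sub>R rotJ (\<tau> x)" if "x \<in> dom_I" for x
  proof (rule cont_AE_eq[OF cPc _ _ that])
    show "continuous_on dom_I (\<lambda>x. (W x / c) *\<^sub>R rotJ (\<tau> x))" using c0 by (intro continuous_intros cW c\<tau>) auto
    show "AE x in leb_I. Pc x = (W x / c) *\<^sub>R rotJ (\<tau> x)"
      using Pc(2) wW by eventually_elim (use c0 in \<open>simp add: P_def g\<tau> rotJ_simps power2_eq_square\<close>)
  qed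
  have gh: "AE x in leb_I. g x \<bullet> h x = 0" by (rule AE_ortho[OF acg gc])
  have \<eta>e: "AE x in leb_I. \<eta> x \<bullet> e x = 0" by (rule AE_ortho[OF ac\<eta> \<eta>1])
  define p where "p x = rotJ (\<eta> x) \<bullet> \<tau> x" for x
  have cp: "continuous_on dom_I p" unfolding p_def by (intro continuous_intros c\<tau> cont)
  \<comment> \<open>The relations \<open>U = lam * S + \<delta> * W * p\<close> and
    \<open>W = k + \<delta> * S * p\<close> are solved for the rotation rate of the director and for
    the curvature.\<close>
  define S where "S x = (U x - \<delta> * W x * p x) / lam" for x
  define k where "k x = W x - \<delta> * S x * p x" for x
  have cS: "continuous_on dom_I S" unfolding S_def using lam0 by (intro continuous_intros cU cW cp) auto
  have ck: "continuous_on dom_I k" unfolding k_def by (intro continuous_intros cS cW cp)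
  have eS: "AE x in leb_I. e x = (c * S x) *\<^sub>R rotJ (\<eta> x)"
    using U(2) wW \<eta>e AE_dom
  proof eventually_elim
    case (elim x)
    have "lam * (e x \<bullet> rotJ (\<eta> x)) / c = U x - \<delta> * W x * p x"
      using elim(1,2) c0 by (simp add: B_def g\<tau> p_def)
    then have "e x \<bullet> rotJ (\<eta> x) = c * S x" using lam0 c0 by (simp add: S_def field_simps)
    moreover have "e x = (e x \<bullet> \<eta> x) *\<^sub>R \<eta> x + (e x \<bullet> rotJ (\<eta> x)) *\<^sub>R rotJ (\<eta> x)"
      by (rule frame_expand[OF \<eta>1[OF elim(4)]])
    moreover have "e x \<bullet> \<eta> x = 0" using elim(3) by (simp add: inner_commute)
    ultimately show ?case by simp
  qed
  have kk: "AE x in leb_I. kap x = k x"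
    using wW eS
  proof eventually_elim
    case (elim x)
    have "(e x \<bullet> g x) / c\<^sup>2 = S x * p x" unfolding elim(2) g\<tau> p_def using c0 by (simp add: power2_eq_square)
    moreover have "kap x = w x - \<delta> * ((e x \<bullet> g x) / c\<^sup>2)" by (simp add: w_def)
    ultimately show ?case using elim(1) by (simp add: k_def)
  qed
  have hk: "AE x in leb_I. h x = (c\<^sup>2 * k x) *\<^sub>R rotJ (\<tau> x)"
    using kk gh AE_dom
  proof eventually_elim
    case (elim x)
    have "h x \<bullet> rotJ (\<tau> x) = c\<^sup>2 * k x" using elim(1) c0 unfolding kap_def g\<tau>
      by (simp add: rotJ_simps field_simps eval_nat_numeral)
    moreover have "h x \<bullet> \<tau> x = 0" using elim(2) c0 by (simp add: g\<tau> inner_commute)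
    ultimately show ?case using frame_expand[OF \<tau>1[OF elim(3)], of "h x"] by simp
  qed
  \<comment> \<open>Inserting \<open>\<delta> * S * p = W - k\<close> cancels every term with
    \<open>k\<close>, so that \<open>Qc\<close>, and with it \<open>K\<close>, involves only
    \<open>W\<close>, \<open>S\<close> and the two unit vectors.\<close>
  define Qc where "Qc x = (- (3 / 2) * (W x)\<^sup>2 - lam / 2 * (S x)\<^sup>2) *\<^sub>R \<tau> x + (\<delta> * W x * S x) *\<^sub>R rotJ (\<eta> x)" for x
  have cQ: "continuous_on dom_I Qc" unfolding Qc_def by (intro continuous_intros cW cS c\<tau> cont)
  have QQ: "AE x in leb_I. Q x = Qc x"
    using wW kk eS hk AE_dom
  proof eventually_elim
    case (elim x)
    have n: "(norm (e x))\<^sup>2 = c\<^sup>2 * (S x)\<^sup>2" unfolding elim(3) using \<eta>1[OF elim(5)] c0 by (simp add: power_mult_distrib)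
    have eg: "e x \<bullet> g x = c\<^sup>2 * (S x * p x)" unfolding elim(3) g\<tau> p_def by (simp add: power2_eq_square)
    have Jh: "rotJ (h x) = - ((c\<^sup>2 * k x) *\<^sub>R \<tau> x)" unfolding elim(4) by (simp add: rotJ_simps)
    have dSp: "\<delta> * S x * p x = W x - k x" by (simp add: k_def)
    have "Q x = (W x * k x) *\<^sub>R \<tau> x + (\<delta> * W x * S x) *\<^sub>R rotJ (\<eta> x) +
      (- 3 * W x * k x - 2 * W x * (\<delta> * S x * p x) + (W x)\<^sup>2 / 2 - lam * (S x)\<^sup>2 / 2) *\<^sub>R \<tau> x"
    proof -
      have q1: "- ((w x / c\<^sup>2) *\<^sub>R rotJ (h x)) = (W x * k x) *\<^sub>R \<tau> x"
        unfolding Jh elim(1) using c0 by simp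
      have q2: "(\<delta> * w x / c) *\<^sub>R e x = (\<delta> * W x * S x) *\<^sub>R rotJ (\<eta> x)"
        unfolding elim(1,3) using c0 by simp
      have q3: "(- (3 * w x * kap x / c) - 2 * \<delta> * w x * (e x \<bullet> g x) / c ^ 3 + (w x)\<^sup>2 / (2 * c)
        - lam * (norm (e x))\<^sup>2 / (2 * c ^ 3)) * c =
        (- 3 * W x * k x - 2 * W x * (\<delta> * S x * p x) + (W x)\<^sup>2 / 2 - lam * (S x)\<^sup>2 / 2)"
        unfolding n eg elim(1,2) using c0 by (simp add: field_simps eval_nat_numeral)
      show ?thesis unfolding Q_def q1 q2 unfolding g\<tau>[of x] scaleR_scaleR using q3[unfolded g\<tau>[of x]] by simp
    qed
    also have "\<dots> = Qc x"
    proof -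
      have s: "- (3 / 2) * (W x)\<^sup>2 - lam / 2 * (S x)\<^sup>2 = W x * k x +
        (- 3 * W x * k x - 2 * W x * (W x - k x) + (W x)\<^sup>2 / 2 - lam * (S x)\<^sup>2 / 2)"
        by (simp add: field_simps power2_eq_square)
      show ?thesis unfolding dSp Qc_def s scaleR_add_left[of "W x * k x"] by (simp only: add_ac)
    qed
    finally show ?case .
  qed
  define Mc where "Mc x = Qc x + l *\<^sub>R \<tau> x + a *\<^sub>R rotJ (\<gamma> x) + K" for x
  have MM: "AE x in leb_I. M x + K = Mc x"
    using QQ by eventually_elim (use c0 in \<open>simp add: M_def Mc_def g\<tau>\<close>)
  have cM: "continuous_on dom_I Mc" unfolding Mc_def by (intro continuous_intros cQ c\<tau> cont)
  have acPc: "ac Pc Mc" by (rule ac_cong[OF Pc(1) _ MM cont_measurable[OF cM]]) simp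
  have acg': "ac g (\<lambda>x. (c\<^sup>2 * k x) *\<^sub>R rotJ (\<tau> x))"
    by (rule ac_cong[OF acg _ hk]) (auto intro!: cont_measurable continuous_intros ck c\<tau>)
  have ac\<tau>: "ac \<tau> (\<lambda>x. (c * k x) *\<^sub>R rotJ (\<tau> x))"
  proof -
    have eq: "(\<lambda>x. (1 / c) *\<^sub>R ((c\<^sup>2 * k x) *\<^sub>R rotJ (\<tau> x))) = (\<lambda>x. (c * k x) *\<^sub>R rotJ (\<tau> x))"
      using c0 by (simp add: fun_eq_iff power2_eq_square)
    have "\<tau> = (\<lambda>x. (1 / c) *\<^sub>R g x)" by (simp add: fun_eq_iff \<tau>_def)
    with ac_cmult[OF acg', of "1 / c"] show ?thesis unfolding eq by (simp only:)
  qed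
  have ac\<eta>': "ac \<eta> (\<lambda>x. (c * S x) *\<^sub>R rotJ (\<eta> x))"
    by (rule ac_cong[OF ac\<eta> _ eS]) (auto intro!: cont_measurable continuous_intros cS cont)
  have acW: "ac W (\<lambda>x. c * (Mc x \<bullet> rotJ (\<tau> x)))"
  proof (rule ac_cong)
    show "ac W (\<lambda>x. Pc x \<bullet> rotJ ((c\<^sup>2 * k x) *\<^sub>R rotJ (\<tau> x)) + Mc x \<bullet> rotJ (g x))"
      unfolding W_def by (intro ac_inner acPc ac_rotJ acg')
    show "AE x in leb_I. Pc x \<bullet> rotJ ((c\<^sup>2 * k x) *\<^sub>R rotJ (\<tau> x)) + Mc x \<bullet> rotJ (g x) = c * (Mc x \<bullet> rotJ (\<tau> x))"
      using AE_dom by eventually_elim (simp add: PcW g\<tau> rotJ_simps)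
    show "(\<lambda>x. c * (Mc x \<bullet> rotJ (\<tau> x))) \<in> borel_measurable leb_I"
      by (intro cont_measurable continuous_intros cM c\<tau>)
  qed simp
  have acU: "ac U (\<lambda>x. - (c * \<delta> * W x * S x * (\<eta> x \<bullet> \<tau> x)))"
  proof (rule ac_cong[OF U(1)])
    show "AE x in leb_I. Cc x = - (c * \<delta> * W x * S x * (\<eta> x \<bullet> \<tau> x))"
      using wW eS by eventually_elim (use c0 in \<open>simp add: Cc_def g\<tau> rotJ_simps\<close>)
    show "(\<lambda>x. - (c * \<delta> * W x * S x * (\<eta> x \<bullet> \<tau> x))) \<in> borel_measurable leb_I"
      by (intro cont_measurable continuous_intros cW cS cont c\<tau>)
  qed simp
  \<comment> \<open>\<open>Pc\<close> is normal to the curve. Differentiating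
    \<open>Pc x \<bullet> g x = 0\<close> gives this identity, the tangential part of the curve
    equation and the source of the first integral.\<close>
  have fi: "W x * k x + Mc x \<bullet> \<tau> x = 0" if x: "x \<in> dom_I" for x
  proof -
    have 1: "ac (\<lambda>x. Pc x \<bullet> g x) (\<lambda>x. Pc x \<bullet> ((c\<^sup>2 * k x) *\<^sub>R rotJ (\<tau> x)) + Mc x \<bullet> g x)"
      by (rule ac_inner[OF acPc acg'])
    have 2: "ac (\<lambda>x. Pc x \<bullet> g x) (\<lambda>x. 0)"
      by (rule ac_cong[OF ac_const[of 0]]) (auto simp: PcW g\<tau>)
    have "AE x in leb_I. W x * k x + Mc x \<bullet> \<tau> x = 0"
      using weak_unique[OF ac_imp_weak[OF 1] ac_imp_weak[OF 2]] AE_dom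
    proof eventually_elim
      case (elim x)
      have "c * (W x * k x + Mc x \<bullet> \<tau> x) = Pc x \<bullet> ((c\<^sup>2 * k x) *\<^sub>R rotJ (\<tau> x)) + Mc x \<bullet> g x"
        using \<tau>\<tau>[OF elim(2)] c0 by (simp add: PcW[OF elim(2)] g\<tau>[of x] algebra_simps power2_eq_square)
      then show ?case using elim(1) c0 by simp
    qed
    then show ?thesis
      by (intro cont_AE_eq[OF _ _ _ x, of "\<lambda>x. W x * k x + Mc x \<bullet> \<tau> x" "\<lambda>_. 0"])
        (auto intro!: continuous_intros cW ck cM c\<tau>)
  qed
  have "elastic_ode \<gamma> \<tau> \<eta> W U S k K c \<delta> lam a l"
  proof
    fix x assume x: "x \<in> dom_I"
    have "ac \<gamma> (\<lambda>x. c *\<^sub>R \<tau> x)" using ac\<gamma> by (simp add: g\<tau>[abs_def])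
    then show "(\<gamma> has_vector_derivative c *\<^sub>R \<tau> x) (at x within dom_I)"
      by (rule ac_vderiv[OF _ _ x]) (intro continuous_intros c\<tau>)
    show "(\<tau> has_vector_derivative (c * k x) *\<^sub>R rotJ (\<tau> x)) (at x within dom_I)"
      by (rule ac_vderiv[OF ac\<tau> _ x]) (intro continuous_intros c\<tau> ck)
    show "(\<eta> has_vector_derivative (c * S x) *\<^sub>R rotJ (\<eta> x)) (at x within dom_I)"
      by (rule ac_vderiv[OF ac\<eta>' _ x]) (intro continuous_intros cont cS)
    have "(W has_vector_derivative c * (Mc x \<bullet> rotJ (\<tau> x))) (at x within dom_I)"
      by (rule ac_vderiv[OF acW _ x]) (intro continuous_intros cM c\<tau>)
    moreover have "Mc x \<bullet> rotJ (\<tau> x) = \<delta> * W x * S x * (\<eta> x \<bullet> \<tau> x) + a * (\<gamma> x \<bullet> \<tau> x) + K \<bullet> rotJ (\<tau> x)"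
      by (simp add: Mc_def Qc_def inner_add_left)
    ultimately show "(W has_vector_derivative
      c * (\<delta> * W x * S x * (\<eta> x \<bullet> \<tau> x) + a * (\<gamma> x \<bullet> \<tau> x) + K \<bullet> rotJ (\<tau> x))) (at x within dom_I)" by simp
    show "(U has_vector_derivative - (c * \<delta> * W x * S x * (\<eta> x \<bullet> \<tau> x))) (at x within dom_I)"
      by (rule ac_vderiv[OF acU _ x]) (intro continuous_intros cW cS cont c\<tau>)
    show "k x = W x - \<delta> * S x * (rotJ (\<eta> x) \<bullet> \<tau> x)" by (simp add: k_def p_def)
    show "lam * S x = U x - \<delta> * W x * (rotJ (\<eta> x) \<bullet> \<tau> x)" using lam0 by (simp add: S_def p_def)
    show "norm (\<tau> x) = 1" by (rule \<tau>1[OF x])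
    show "norm (\<eta> x) = 1" by (rule \<eta>1[OF x])
    have dp: "\<delta> * S x * p x = W x - k x" by (simp add: k_def)
    have "Mc x \<bullet> \<tau> x = (- (3 / 2) * (W x)\<^sup>2 - lam / 2 * (S x)\<^sup>2) + W x * (\<delta> * S x * p x) + l
       + a * (rotJ (\<gamma> x) \<bullet> \<tau> x) + K \<bullet> \<tau> x"
      using \<tau>\<tau>[OF x] by (simp add: Mc_def Qc_def p_def inner_add_left)
    then have "Mc x \<bullet> \<tau> x = - (W x)\<^sup>2 / 2 - lam * (S x)\<^sup>2 / 2 - W x * k x + l + a * (rotJ (\<gamma> x) \<bullet> \<tau> x) + K \<bullet> \<tau> x"
      unfolding dp by (simp add: algebra_simps power2_eq_square)
    then show "(W x)\<^sup>2 / 2 + lam * (S x)\<^sup>2 / 2 = l + a * (rotJ (\<gamma> x) \<bullet> \<tau> x) + K \<bullet> \<tau> x"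
      using fi[OF x] by simp
  next
    show "c > 0" "lam > 0" by (rule c0 lam0)+
    show "\<gamma> 0 = \<gamma> (2 * pi)" "\<eta> 0 = \<eta> (2 * pi)" by (rule \<gamma>per \<eta>per)+
    show "\<tau> 0 = \<tau> (2 * pi)" using gper by (simp add: \<tau>_def)
    have "(LINT x|leb_I. M x + K) = 0"
    proof -
      have "(LINT x|leb_I. K) = (2 * pi) *\<^sub>R K" by (rule LINT_const)
      then show ?thesis using int_M cont_integrable[of "\<lambda>_. K"] LINT_M by simp
    qed
    then have "Pc (2 * pi) = Pc 0" using ac_total[OF Pc(1)] by simp
    then show "W 0 = W (2 * pi)" using gper by (simp add: W_def)
    show "U 0 = U (2 * pi)" using ac_total[OF U(1)] LINT_Cc by simp
    show "integral dom_I \<gamma> = 0" using mean0 LINT_eq_integral[OF int_g(2)] by simp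
    have "(LINT x|leb_I. Q x) = (LINT x|leb_I. Qc x)"
      by (rule integral_cong_AE[OF borel_measurable_integrable[OF int_Q] cont_measurable[OF cQ] QQ])
    also have "\<dots> = integral dom_I Qc" by (rule LINT_eq_integral[OF cont_integrable[OF cQ]])
    finally show "K = - (1 / (2 * pi)) *\<^sub>R integral dom_I
      (\<lambda>x. (- (3 / 2) * (W x)\<^sup>2 - lam / 2 * (S x)\<^sup>2) *\<^sub>R \<tau> x + (\<delta> * W x * S x) *\<^sub>R rotJ (\<eta> x))"
      unfolding K_def Qc_def[abs_def] by simp
  qed
  then show ?thesis using wW kk eS hk unfolding \<tau>_def by blast
qed

end

section \<open>Smoothness and derivative bounds\<close>

text \<open>One tower \<open>F\<close> of successive derivatives serves both notions: by induction
  the iterates of \<open>cderiv\<close> and of \<open>wderiv\<close> agree with \<open>F n\<close>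
  on the interval, so smoothness and Sobolev norms are read off the same functions.\<close>

lemma smooth_chain:
  fixes f :: "real \<Rightarrow> 'a::euclidean_space" and F :: "nat \<Rightarrow> real \<Rightarrow> 'a"
  assumes f: "\<And>x. x \<in> dom_I \<Longrightarrow> f x = F 0 x"
    and d: "\<And>n x. x \<in> dom_I \<Longrightarrow> (F n has_vector_derivative F (Suc n) x) (at x within dom_I)"
    and p: "\<And>n. F n 0 = F n (2 * pi)"
  shows "f \<in> C_inf_per" "x \<in> dom_I \<Longrightarrow> (wderiv ^^ n) f x = F n x"
proof -
  have c: "continuous_on dom_I (F n)" for n
    using d by (meson continuous_on_vector_derivative)
  have tr: "(g has_vector_derivative F (Suc n) x) (at x within dom_I)"
    if "x \<in> dom_I" "\<And>x. x \<in> dom_I \<Longrightarrow> g x = F n x" for g n x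
    by (rule has_vector_derivative_transform[OF that(1) _ d[OF that(1), of n]]) (rule that(2))
  have cd: "\<forall>x\<in>dom_I. (cderiv ^^ n) f x = F n x" for n
  proof (induction n)
    case 0 then show ?case using f by simp
  next
    case (Suc n)
    show ?case
    proof
      fix x assume x: "x \<in> dom_I"
      have "((cderiv ^^ n) f has_vector_derivative F (Suc n) x) (at x within dom_I)"
        by (rule tr[OF x]) (use Suc in blast)
      then have "vector_derivative ((cderiv ^^ n) f) (at x within dom_I) = F (Suc n) x"
        using x by (intro vector_derivative_within_cbox[of 0 "2 * pi", unfolded box_real]) auto
      then show "(cderiv ^^ Suc n) f x = F (Suc n) x" by (simp add: cderiv_def)
    qed
  qed
  show "f \<in> C_inf_per" unfolding C_inf_per_def
  proof (intro CollectI allI conjI ballI)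
    fix n x assume x: "x \<in> dom_I"
    have "((cderiv ^^ n) f has_vector_derivative F (Suc n) x) (at x within dom_I)"
      by (rule tr[OF x]) (use cd in blast)
    then show "(cderiv ^^ n) f differentiable (at x within dom_I)"
      by (auto simp: has_vector_derivative_def differentiable_def)
  next
    fix n show "(cderiv ^^ n) f 0 = (cderiv ^^ n) f (2 * pi)"
      using cd[of n] p[of n] by simp
  qed
  have "\<forall>x\<in>dom_I. (wderiv ^^ n) f x = F n x" for n
  proof (induction n)
    case 0 then show ?case using f by simp
  next
    case (Suc n)
    show ?case
    proof
      fix x assume x: "x \<in> dom_I"
      have "ac ((wderiv ^^ n) f) (F (Suc n))"
        by (rule ac_C1[OF tr c]) (use Suc in auto)
      from ac_wderiv_cont[OF this c x] show "(wderiv ^^ Suc n) f x = F (Suc n) x" by simp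
    qed
  qed
  then show "x \<in> dom_I \<Longrightarrow> (wderiv ^^ n) f x = F n x" by blast
qed

lemma W_inf_norm_le:
  fixes f :: "real \<Rightarrow> 'a::euclidean_space"
  assumes f: "\<And>x. x \<in> dom_I \<Longrightarrow> f x = F 0 x"
    and d: "\<And>n x. x \<in> dom_I \<Longrightarrow> (F n has_vector_derivative F (Suc n) x) (at x within dom_I)"
    and p: "\<And>n. F n 0 = F n (2 * pi)"
    and b: "\<And>n x. x \<in> dom_I \<Longrightarrow> norm (F n x) \<le> B n"
  shows "W_inf_norm k f \<le> ereal (\<Sum>n\<le>k. B n)"
proof -
  have "W_inf_norm k f \<le> (\<Sum>n\<le>k. ereal (B n))"
    unfolding W_inf_norm_def
  proof (intro sum_mono esssup_I)
    fix n
    have e: "(wderiv ^^ n) f x = F n x" if "x \<in> dom_I" for x by (rule smooth_chain(2)[OF f d p that])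
    have c: "continuous_on dom_I (F n)" using d by (meson continuous_on_vector_derivative)
    have "continuous_on dom_I ((wderiv ^^ n) f) = continuous_on dom_I (F n)"
      by (rule continuous_on_cong) (auto simp: e)
    with c have "(wderiv ^^ n) f \<in> borel_measurable leb_I" by (intro cont_measurable) simp
    then show "(\<lambda>x. ereal (norm ((wderiv ^^ n) f x))) \<in> borel_measurable leb_I" by measurable
    show "AE x in leb_I. ereal (norm ((wderiv ^^ n) f x)) \<le> ereal (B n)"
      by (intro AE_I2) (use e b in auto)
  qed
  then show ?thesis by simp
qed

text \<open>All derivatives of a solution of a polynomial system are polynomials in the state, obtained by
  formal differentiation; thus bounds on the state bound every derivative.\<close>

datatype 'v pexp = PVar 'v | PNum real | PAdd "'v pexp" "'v pexp" | PMul "'v pexp" "'v pexp"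

primrec peval :: "('v \<Rightarrow> real) \<Rightarrow> 'v pexp \<Rightarrow> real" where
  "peval v (PVar i) = v i"
| "peval v (PNum r) = r"
| "peval v (PAdd p q) = peval v p + peval v q"
| "peval v (PMul p q) = peval v p * peval v q"

primrec pderiv :: "('v \<Rightarrow> 'v pexp) \<Rightarrow> 'v pexp \<Rightarrow> 'v pexp" where
  "pderiv d (PVar i) = d i"
| "pderiv d (PNum r) = PNum 0"
| "pderiv d (PAdd p q) = PAdd (pderiv d p) (pderiv d q)"
| "pderiv d (PMul p q) = PAdd (PMul (pderiv d p) q) (PMul p (pderiv d q))"

primrec pbound :: "real \<Rightarrow> 'v pexp \<Rightarrow> real" where
  "pbound M (PVar i) = M"
| "pbound M (PNum r) = \<bar>r\<bar>"
| "pbound M (PAdd p q) = pbound M p + pbound M q"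
| "pbound M (PMul p q) = pbound M p * pbound M q"

lemma peval_le_pbound:
  assumes "\<And>i. \<bar>v i\<bar> \<le> M"
  shows "\<bar>peval v p\<bar> \<le> pbound M p"
proof (induction p)
  case (PAdd p q)
  then show ?case using abs_triangle_ineq[of "peval v p" "peval v q"] by simp
next
  case (PMul p q)
  have "\<bar>peval v p\<bar> * \<bar>peval v q\<bar> \<le> pbound M p * pbound M q"
    using PMul order_trans[OF abs_ge_zero PMul(1)] by (intro mult_mono) auto
  then show ?case by (simp add: abs_mult)
qed (use assms in simp_all)

lemma DERIV_peval:
  assumes "\<And>i. ((\<lambda>x. v x i) has_real_derivative peval (v x) (d i)) (at x within A)"
  shows "((\<lambda>x. peval (v x) p) has_real_derivative peval (v x) (pderiv d p)) (at x within A)"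
proof (induction p)
  case (PVar i) then show ?case using assms by simp
next
  case (PNum r) then show ?case by simp
next
  case (PAdd p q) then show ?case by (auto intro!: derivative_eq_intros)
next
  case (PMul p q) then show ?case by (auto intro!: derivative_eq_intros)
qed

text \<open>\<open>VC\<close>, \<open>VA\<close>, \<open>K1\<close> and \<open>K2\<close> stand for
  \<open>c\<close>, \<open>a\<close> and the components of \<open>K\<close>. They are constant along
  a solution but vary with it; as variables with derivative zero they enter the bounds only through
  the common bound \<open>M\<close>. The data \<open>\<delta>\<close> and \<open>lam\<close> are
  fixed and occur as coefficients.\<close>

datatype evar = G1 | G2 | T1 | T2 | E1 | E2 | VW | VU | VC | VA | K1 | K2

text \<open>Expressions for \<open>\<langle>J\<eta>,\<tau>\<rangle>\<close>, \<open>\<langle>\<eta>,\<tau>\<rangle>\<close>, \<open>S\<close>, \<open>k\<close> and \<open>\<delta> W S \<langle>\<eta>,\<tau>\<rangle>\<close>.\<close>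

definition ep :: "evar pexp" where "ep = PAdd (PMul (PVar E1) (PVar T2)) (PMul (PNum (-1)) (PMul (PVar E2) (PVar T1)))"
definition en :: "evar pexp" where "en = PAdd (PMul (PVar E1) (PVar T1)) (PMul (PVar E2) (PVar T2))"
definition eS :: "real \<Rightarrow> real \<Rightarrow> evar pexp" where
  "eS \<delta> lam = PMul (PNum (1 / lam)) (PAdd (PVar VU) (PMul (PNum (- \<delta>)) (PMul (PVar VW) ep)))"
definition ek :: "real \<Rightarrow> real \<Rightarrow> evar pexp" where
  "ek \<delta> lam = PAdd (PVar VW) (PMul (PNum (- \<delta>)) (PMul (eS \<delta> lam) ep))"
definition eN :: "real \<Rightarrow> real \<Rightarrow> evar pexp" where
  "eN \<delta> lam = PMul (PNum \<delta>) (PMul (PMul (PVar VW) (eS \<delta> lam)) en)"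

primrec edv :: "real \<Rightarrow> real \<Rightarrow> evar \<Rightarrow> evar pexp" where
  "edv \<delta> lam G1 = PMul (PVar VC) (PVar T1)"
| "edv \<delta> lam G2 = PMul (PVar VC) (PVar T2)"
| "edv \<delta> lam T1 = PMul (PNum (-1)) (PMul (PMul (PVar VC) (ek \<delta> lam)) (PVar T2))"
| "edv \<delta> lam T2 = PMul (PMul (PVar VC) (ek \<delta> lam)) (PVar T1)"
| "edv \<delta> lam E1 = PMul (PNum (-1)) (PMul (PMul (PVar VC) (eS \<delta> lam)) (PVar E2))"
| "edv \<delta> lam E2 = PMul (PMul (PVar VC) (eS \<delta> lam)) (PVar E1)"
| "edv \<delta> lam VW = PMul (PVar VC) (PAdd (eN \<delta> lam)
     (PAdd (PMul (PVar VA) (PAdd (PMul (PVar G1) (PVar T1)) (PMul (PVar G2) (PVar T2))))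
       (PAdd (PMul (PVar K2) (PVar T1)) (PMul (PNum (-1)) (PMul (PVar K1) (PVar T2))))))"
| "edv \<delta> lam VU = PMul (PNum (-1)) (PMul (PVar VC) (eN \<delta> lam))"
| "edv \<delta> lam VC = PNum 0"
| "edv \<delta> lam VA = PNum 0"
| "edv \<delta> lam K1 = PNum 0"
| "edv \<delta> lam K2 = PNum 0"

definition psi0_exp :: "real \<Rightarrow> real \<Rightarrow> evar pexp" where
  "psi0_exp \<delta> lam = PMul (PNum (- (1 / 2))) (PAdd (PMul (PNum \<delta>) (PMul (PMul (PVar VW) (eS \<delta> lam)) ep))
     (PMul (PNum lam) (PMul (eS \<delta> lam) (eS \<delta> lam))))"
definition psi1_exp :: "real \<Rightarrow> real \<Rightarrow> evar pexp" where
  "psi1_exp \<delta> lam = PMul (PNum (\<delta> / 2)) (PMul (PVar VW) en)"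

definition jet_bound :: "real \<Rightarrow> real \<Rightarrow> real \<Rightarrow> evar pexp \<Rightarrow> nat \<Rightarrow> real" where
  "jet_bound \<delta> lam M p n = pbound M ((pderiv (edv \<delta> lam) ^^ n) p)"

definition smooth_bound :: "real \<Rightarrow> real \<Rightarrow> real \<Rightarrow> nat \<Rightarrow> real" where
  "smooth_bound \<delta> lam M k =
    (\<Sum>n\<le>k + 2. jet_bound \<delta> lam M (PVar G1) n + jet_bound \<delta> lam M (PVar G2) n) +
    (\<Sum>n\<le>k + 1. jet_bound \<delta> lam M (PVar E1) n + jet_bound \<delta> lam M (PVar E2) n) +
    (\<Sum>n\<le>k. jet_bound \<delta> lam M (psi0_exp \<delta> lam) n) + (\<Sum>n\<le>k. jet_bound \<delta> lam M (psi1_exp \<delta> lam) n)"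

section \<open>Jets of a solution\<close>

context elastic_ode begin

primrec env :: "real \<Rightarrow> evar \<Rightarrow> real" where
  "env x G1 = \<gamma> x $ 1" | "env x G2 = \<gamma> x $ 2" | "env x T1 = \<tau> x $ 1" | "env x T2 = \<tau> x $ 2"
| "env x E1 = \<eta> x $ 1" | "env x E2 = \<eta> x $ 2" | "env x VW = W x" | "env x VU = U x"
| "env x VC = c" | "env x VA = a" | "env x K1 = K $ 1" | "env x K2 = K $ 2"

lemma env_S: "x \<in> dom_I \<Longrightarrow> peval (env x) (eS \<delta> lam) = S x"
  using S_eq[of x] lam0 by (simp add: eS_def ep_def inner2 field_simps)

lemma env_p: "peval (env x) ep = rotJ (\<eta> x) \<bullet> \<tau> x"
  by (simp add: ep_def inner2)

lemma env_n: "peval (env x) en = \<eta> x \<bullet> \<tau> x"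
  by (simp add: en_def inner2)

lemma env_k: "x \<in> dom_I \<Longrightarrow> peval (env x) (ek \<delta> lam) = k x"
  using k_eq[of x] by (simp add: ek_def env_S env_p)

lemma DERIV_env:
  assumes x: "x \<in> dom_I"
  shows "((\<lambda>x. env x i) has_real_derivative peval (env x) (edv \<delta> lam i)) (at x within dom_I)"
proof -
  note cmp = bounded_linear.has_vector_derivative[OF bounded_linear_vec_nth]
  show ?thesis
    using cmp[OF D\<gamma>[OF x], of 1] cmp[OF D\<gamma>[OF x], of 2] cmp[OF D\<tau>[OF x], of 1] cmp[OF D\<tau>[OF x], of 2]
      cmp[OF D\<eta>[OF x], of 1] cmp[OF D\<eta>[OF x], of 2] DW[OF x] DU[OF x]
    by (cases i) (simp_all add: has_real_derivative_iff_has_vector_derivative env_S[OF x] env_k[OF x] eN_def env_n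
      inner2 algebra_simps)
qed

lemma env_per: "env 0 = env (2 * pi)"
proof
  fix i show "env 0 i = env (2 * pi) i" by (cases i) (simp_all add: per)
qed

definition jet :: "evar pexp \<Rightarrow> nat \<Rightarrow> real \<Rightarrow> real" where
  "jet p n x = peval (env x) ((pderiv (edv \<delta> lam) ^^ n) p)"

lemma jet_deriv: "x \<in> dom_I \<Longrightarrow> (jet p n has_vector_derivative jet p (Suc n) x) (at x within dom_I)"
  unfolding jet_def[abs_def] has_real_derivative_iff_has_vector_derivative[symmetric]
  using DERIV_peval[OF DERIV_env] by simp

lemma jet_per: "jet p n 0 = jet p n (2 * pi)"
  by (simp add: jet_def env_per)

definition jet2 :: "evar pexp \<Rightarrow> evar pexp \<Rightarrow> nat \<Rightarrow> real \<Rightarrow> real^2" where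
  "jet2 p q n x = jet p n x *\<^sub>R axis 1 1 + jet q n x *\<^sub>R axis 2 1"

lemma jet2_nth: "jet2 p q n x $ 1 = jet p n x" "jet2 p q n x $ 2 = jet q n x"
  by (simp_all add: jet2_def axis_def)

lemma jet2_deriv: "x \<in> dom_I \<Longrightarrow> (jet2 p q n has_vector_derivative jet2 p q (Suc n) x) (at x within dom_I)"
  unfolding jet2_def[abs_def]
  by (intro has_vector_derivative_add bounded_linear.has_vector_derivative[OF bounded_linear_scaleR_left] jet_deriv)

lemma jet2_per: "jet2 p q n 0 = jet2 p q n (2 * pi)"
  unfolding jet2_def jet_per[of _ _] by (simp add: jet_per)

text \<open>\<open>psi0\<close> and \<open>psi1\<close> come from testing the director equation with
  \<open>(f x / 2) *\<^sub>R \<eta> x\<close>, for which \<open>S_deriv\<close> returns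
  \<open>f\<close> because \<open>\<eta>\<close> is a unit vector.\<close>

definition psi0 :: "real \<Rightarrow> real" where
  "psi0 x = - (1 / 2) * (\<delta> * W x * S x * (rotJ (\<eta> x) \<bullet> \<tau> x) + lam * (S x)\<^sup>2)"
definition psi1 :: "real \<Rightarrow> real" where
  "psi1 x = \<delta> / 2 * (W x * (\<eta> x \<bullet> \<tau> x))"

lemma jet_0: "\<gamma> x = jet2 (PVar G1) (PVar G2) 0 x" "\<eta> x = jet2 (PVar E1) (PVar E2) 0 x"
  "x \<in> dom_I \<Longrightarrow> psi0 x = jet (psi0_exp \<delta> lam) 0 x" "psi1 x = jet (psi1_exp \<delta> lam) 0 x"
  by (simp_all add: vec2_eq jet2_nth jet_def psi0_exp_def psi1_exp_def env_S env_p env_n psi0_def psi1_def power2_eq_square)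

theorem smooth: "\<gamma> \<in> C_inf_per" "\<eta> \<in> C_inf_per" "psi0 \<in> C_inf_per" "psi1 \<in> C_inf_per"
  by (rule smooth_chain(1)[OF jet_0(1) jet2_deriv jet2_per] smooth_chain(1)[OF jet_0(2) jet2_deriv jet2_per]
      smooth_chain(1)[OF jet_0(3) jet_deriv jet_per] smooth_chain(1)[OF jet_0(4) jet_deriv jet_per]; assumption?)+

theorem smooth_le:
  assumes M: "1 \<le> M" "c \<le> M" "\<bar>a\<bar> \<le> M" "norm K \<le> M"
    "\<And>x. x \<in> dom_I \<Longrightarrow> norm (\<gamma> x) \<le> M" "\<And>x. x \<in> dom_I \<Longrightarrow> \<bar>W x\<bar> \<le> M" "\<And>x. x \<in> dom_I \<Longrightarrow> \<bar>U x\<bar> \<le> M"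
  shows "W_inf_norm (m + 2) \<gamma> + W_inf_norm (m + 1) \<eta> + W_inf_norm m psi0 + W_inf_norm m psi1
    \<le> ereal (smooth_bound \<delta> lam M m)"
proof -
  have eb: "\<bar>env x i\<bar> \<le> M" if x: "x \<in> dom_I" for x i
  proof -
    have n: "\<bar>\<tau> x $ j\<bar> \<le> M" "\<bar>\<eta> x $ j\<bar> \<le> M" "\<bar>\<gamma> x $ j\<bar> \<le> M" "\<bar>K $ j\<bar> \<le> M" for j
      using component_le_norm_cart[of "\<tau> x" j] component_le_norm_cart[of "\<eta> x" j]
        component_le_norm_cart[of "\<gamma> x" j] component_le_norm_cart[of K j] M(1,4,5) \<tau>1[OF x] \<eta>1[OF x] x
      by (auto intro: order_trans)
    show ?thesis using n M c0 x by (cases i) auto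
  qed
  have jb: "norm (jet p n x) \<le> jet_bound \<delta> lam M p n" if "x \<in> dom_I" for p n x
    unfolding jet_def jet_bound_def real_norm_def by (rule peval_le_pbound[OF eb[OF that]])
  have jb2: "norm (jet2 p q n x) \<le> jet_bound \<delta> lam M p n + jet_bound \<delta> lam M q n" if "x \<in> dom_I" for p q n x
    using norm_le_l1_cart[of "jet2 p q n x"] jb[OF that, of p n] jb[OF that, of q n] by (simp add: sum_2 jet2_nth)
  have 1: "W_inf_norm (m + 2) \<gamma> \<le> ereal (\<Sum>n\<le>m + 2. jet_bound \<delta> lam M (PVar G1) n + jet_bound \<delta> lam M (PVar G2) n)"
    by (rule W_inf_norm_le[OF jet_0(1) jet2_deriv jet2_per jb2])
  have 2: "W_inf_norm (m + 1) \<eta> \<le> ereal (\<Sum>n\<le>m + 1. jet_bound \<delta> lam M (PVar E1) n + jet_bound \<delta> lam M (PVar E2) n)"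
    by (rule W_inf_norm_le[OF jet_0(2) jet2_deriv jet2_per jb2])
  have 3: "W_inf_norm m psi0 \<le> ereal (\<Sum>n\<le>m. jet_bound \<delta> lam M (psi0_exp \<delta> lam) n)"
    by (rule W_inf_norm_le[OF jet_0(3) jet_deriv jet_per jb])
  have 4: "W_inf_norm m psi1 \<le> ereal (\<Sum>n\<le>m. jet_bound \<delta> lam M (psi1_exp \<delta> lam) n)"
    by (rule W_inf_norm_le[OF jet_0(4) jet_deriv jet_per jb])
  show ?thesis using add_mono[OF add_mono[OF add_mono[OF 1 2] 3] 4] by (simp add: smooth_bound_def)
qed

end

section \<open>Integral estimates\<close>

lemma vderiv_cont:
  assumes "\<And>x. x \<in> dom_I \<Longrightarrow> (f has_vector_derivative f' x) (at x within dom_I)"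
  shows "continuous_on dom_I f"
  using assms by (rule continuous_on_vector_derivative)

lemma rderiv_cont:
  fixes f :: "real \<Rightarrow> real"
  assumes "\<And>x. x \<in> dom_I \<Longrightarrow> (f has_real_derivative f' x) (at x within dom_I)"
  shows "continuous_on dom_I f"
  using assms by (meson DERIV_continuous continuous_on_eq_continuous_within)

lemma int_add: "continuous_on dom_I f \<Longrightarrow> continuous_on dom_I g \<Longrightarrow>
    integral dom_I (\<lambda>x. f x + g x :: 'a::euclidean_space) = integral dom_I f + integral dom_I g"
  by (intro Henstock_Kurzweil_Integration.integral_add integrable_continuous_interval)

lemma int_diff: "continuous_on dom_I f \<Longrightarrow> continuous_on dom_I g \<Longrightarrow>
    integral dom_I (\<lambda>x. f x - g x :: 'a::euclidean_space) = integral dom_I f - integral dom_I g"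
  by (intro Henstock_Kurzweil_Integration.integral_diff integrable_continuous_interval)

lemma int_mono:
  fixes f g :: "real \<Rightarrow> real"
  assumes "continuous_on dom_I f" "continuous_on dom_I g" "\<And>x. x \<in> dom_I \<Longrightarrow> f x \<le> g x"
  shows "integral dom_I f \<le> integral dom_I g"
  using assms by (intro integral_le integrable_continuous_interval)

lemma int_nonneg:
  fixes f :: "real \<Rightarrow> real"
  assumes "continuous_on dom_I f" "\<And>x. x \<in> dom_I \<Longrightarrow> 0 \<le> f x"
  shows "0 \<le> integral dom_I f"
  using assms by (intro integral_nonneg integrable_continuous_interval)

lemma int_abs_le:
  fixes f g :: "real \<Rightarrow> real"
  assumes "continuous_on dom_I f" "continuous_on dom_I g" "\<And>x. x \<in> dom_I \<Longrightarrow> \<bar>f x\<bar> \<le> g x"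
  shows "\<bar>integral dom_I f\<bar> \<le> integral dom_I g"
  using integral_norm_bound_integral[of f dom_I g] assms by (auto intro: integrable_continuous_interval)

lemma int_cong: "(\<And>x. x \<in> dom_I \<Longrightarrow> f x = g x) \<Longrightarrow> integral dom_I f = integral dom_I (g :: real \<Rightarrow> 'a::euclidean_space)"
  by (rule Henstock_Kurzweil_Integration.integral_cong)

lemma int_deriv:
  assumes "\<And>x. x \<in> dom_I \<Longrightarrow> (f has_vector_derivative f' x) (at x within dom_I)"
  shows "integral dom_I f' = f (2 * pi) - (f 0 :: 'a::euclidean_space)"
  using fundamental_theorem_of_calculus[of 0 "2 * pi" f f'] assms by (auto intro: integral_unique)

lemma int_rderiv:
  assumes "\<And>x. x \<in> dom_I \<Longrightarrow> (f has_real_derivative f' x) (at x within dom_I)"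
  shows "integral dom_I f' = f (2 * pi) - (f 0 :: real)"
  using int_deriv[of f f'] assms by (simp add: has_real_derivative_iff_has_vector_derivative)

lemma int_parts:
  fixes f g :: "real \<Rightarrow> real"
  assumes f: "\<And>x. x \<in> dom_I \<Longrightarrow> (f has_real_derivative f' x) (at x within dom_I)" "continuous_on dom_I f'" "f 0 = f (2 * pi)"
    and g: "\<And>x. x \<in> dom_I \<Longrightarrow> (g has_real_derivative g' x) (at x within dom_I)" "continuous_on dom_I g'" "g 0 = g (2 * pi)"
  shows "integral dom_I (\<lambda>x. f x * g' x) = - integral dom_I (\<lambda>x. f' x * g x)"
proof -
  have "integral dom_I (\<lambda>x. f' x * g x + g' x * f x) = f (2 * pi) * g (2 * pi) - f 0 * g 0"
    by (rule int_rderiv) (rule DERIV_mult[OF f(1) g(1)])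
  moreover have "integral dom_I (\<lambda>x. f' x * g x + g' x * f x) = integral dom_I (\<lambda>x. f' x * g x) + integral dom_I (\<lambda>x. g' x * f x)"
    by (intro int_add continuous_intros f g rderiv_cont[OF f(1)] rderiv_cont[OF g(1)])
  ultimately show ?thesis using f(3) g(3) by (simp add: mult.commute)
qed

lemma osc_le:
  fixes f :: "real \<Rightarrow> real"
  assumes f: "\<And>x. x \<in> dom_I \<Longrightarrow> (f has_real_derivative f' x) (at x within dom_I)" "continuous_on dom_I f'"
    and xy: "x \<in> dom_I" "y \<in> dom_I"
  shows "\<bar>f x - f y\<bar> \<le> integral dom_I (\<lambda>x. \<bar>f' x\<bar>)"
proof -
  have a: "ac f f'" using f by (intro ac_C1) (auto simp: has_real_derivative_iff_has_vector_derivative)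
  have i: "integrable leb_I f'" "integrable leb_I (\<lambda>x. \<bar>f' x\<bar>)"
    using f(2) by (auto intro!: cont_integrable continuous_intros)
  have *: "\<bar>f v - f u\<bar> \<le> integral dom_I (\<lambda>x. \<bar>f' x\<bar>)" if "0 \<le> u" "u \<le> v" "v \<le> 2 * pi" for u v
  proof -
    have "norm (f v - f u) \<le> integral {u..v} (\<lambda>x. \<bar>f' x\<bar>)"
      unfolding ac_diff[OF a that] by (rule norm_integral_le[OF i]) (use that in auto)
    also have "\<dots> \<le> integral dom_I (\<lambda>x. \<bar>f' x\<bar>)"
      using that by (intro integral_subset_le integrable_on_subI[OF i(2)]) auto
    finally show ?thesis by simp
  qed
  show ?thesis using *[of x y] *[of y x] xy by (cases "x \<le> y") (auto simp: abs_minus_commute)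
qed

lemma sup_le_mean:
  fixes f :: "real \<Rightarrow> real"
  assumes f: "\<And>x. x \<in> dom_I \<Longrightarrow> (f has_real_derivative f' x) (at x within dom_I)" "continuous_on dom_I f'"
    and x: "x \<in> dom_I"
  shows "\<bar>f x\<bar> \<le> integral dom_I (\<lambda>x. \<bar>f x\<bar>) + integral dom_I (\<lambda>x. \<bar>f' x\<bar>)"
proof -
  note c = rderiv_cont[OF f(1)]
  have "integral dom_I (\<lambda>y. \<bar>f x\<bar>) \<le> integral dom_I (\<lambda>y. \<bar>f y\<bar> + integral dom_I (\<lambda>x. \<bar>f' x\<bar>))"
  proof (intro int_mono continuous_intros c)
    fix y assume "y \<in> dom_I"
    from osc_le[OF f x this] show "\<bar>f x\<bar> \<le> \<bar>f y\<bar> + integral dom_I (\<lambda>x. \<bar>f' x\<bar>)" by linarith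
  qed
  also have "\<dots> = integral dom_I (\<lambda>x. \<bar>f x\<bar>) + 2 * pi * integral dom_I (\<lambda>x. \<bar>f' x\<bar>)"
    by (subst int_add) (auto intro!: continuous_intros c)
  finally have "2 * pi * \<bar>f x\<bar> \<le> integral dom_I (\<lambda>x. \<bar>f x\<bar>) + 2 * pi * integral dom_I (\<lambda>x. \<bar>f' x\<bar>)" by simp
  moreover have "integral dom_I (\<lambda>x. \<bar>f x\<bar>) \<le> 2 * pi * integral dom_I (\<lambda>x. \<bar>f x\<bar>)"
  proof -
    have "0 \<le> integral dom_I (\<lambda>x. \<bar>f x\<bar>)" by (intro int_nonneg continuous_intros c) auto
    then show ?thesis using pi_gt3 mult_right_mono[of 1 "2 * pi" "integral dom_I (\<lambda>x. \<bar>f x\<bar>)"] by simp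
  qed
  ultimately have "2 * pi * \<bar>f x\<bar> \<le> 2 * pi * (integral dom_I (\<lambda>x. \<bar>f x\<bar>) + integral dom_I (\<lambda>x. \<bar>f' x\<bar>))"
    by (simp add: distrib_left)
  then show ?thesis using pi_gt_zero by simp
qed

text \<open>This is the mean estimate \<open>sup_le_mean\<close> for the square of \<open>f\<close>,
  with Young's inequality of weight \<open>e\<close> on \<open>2 * f * f'\<close>. A small mean
  square of \<open>f\<close> and a bounded mean square of \<open>f'\<close> thus make
  \<open>f\<close> uniformly small.\<close>

lemma sup_sq_le:
  fixes f :: "real \<Rightarrow> real"
  assumes f: "\<And>x. x \<in> dom_I \<Longrightarrow> (f has_real_derivative f' x) (at x within dom_I)" "continuous_on dom_I f'"
    and x: "x \<in> dom_I" and e: "e > 0"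
  shows "(f x)\<^sup>2 \<le> (1 + 1 / e) * integral dom_I (\<lambda>x. (f x)\<^sup>2) + e * integral dom_I (\<lambda>x. (f' x)\<^sup>2)"
proof -
  note c = rderiv_cont[OF f(1)]
  have "\<bar>(f x)\<^sup>2\<bar> \<le> integral dom_I (\<lambda>x. \<bar>(f x)\<^sup>2\<bar>) + integral dom_I (\<lambda>x. \<bar>2 * f x * f' x\<bar>)"
    by (rule sup_le_mean[where f = "\<lambda>x. (f x)\<^sup>2", OF _ _ x])
      (auto intro!: derivative_eq_intros f continuous_intros c)
  moreover have "integral dom_I (\<lambda>x. \<bar>2 * f x * f' x\<bar>) \<le> integral dom_I (\<lambda>x. (1 / e) * (f x)\<^sup>2 + e * (f' x)\<^sup>2)"
  proof (intro int_mono continuous_intros c f)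
    fix x
    have "2 * \<bar>f x\<bar> * (e * \<bar>f' x\<bar>) \<le> \<bar>f x\<bar>\<^sup>2 + (e * \<bar>f' x\<bar>)\<^sup>2" by (rule sum_squares_bound)
    then have "e * \<bar>2 * f x * f' x\<bar> \<le> (f x)\<^sup>2 + e * (e * (f' x)\<^sup>2)"
      by (simp add: abs_mult power_mult_distrib power2_eq_square mult_ac)
    then have "e * \<bar>2 * f x * f' x\<bar> \<le> e * ((1 / e) * (f x)\<^sup>2 + e * (f' x)\<^sup>2)" using e by (simp add: distrib_left)
    then show "\<bar>2 * f x * f' x\<bar> \<le> (1 / e) * (f x)\<^sup>2 + e * (f' x)\<^sup>2" using e by simp
  qed
  moreover have "integral dom_I (\<lambda>x. (1 / e) * (f x)\<^sup>2 + e * (f' x)\<^sup>2) = (1 / e) * integral dom_I (\<lambda>x. (f x)\<^sup>2) + e * integral dom_I (\<lambda>x. (f' x)\<^sup>2)"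
    using e by (subst int_add) (auto intro!: continuous_intros c f)
  ultimately show ?thesis by (simp add: distrib_right)
qed

section \<open>Position and director in the moving frame\<close>

context elastic_ode begin

definition hh :: "real \<Rightarrow> real" where "hh x = rotJ (\<gamma> x) \<bullet> \<tau> x"
definition qq :: "real \<Rightarrow> real" where "qq x = \<gamma> x \<bullet> \<tau> x"
definition pp :: "real \<Rightarrow> real" where "pp x = rotJ (\<eta> x) \<bullet> \<tau> x"
definition nn :: "real \<Rightarrow> real" where "nn x = \<eta> x \<bullet> \<tau> x"
text \<open>The part of the derivative of \<open>W\<close>, divided by \<open>c\<close>, that does
  not contain \<open>a\<close>; its integral is controlled by the data alone.\<close>

definition gg :: "real \<Rightarrow> real" where "gg x = \<delta> * W x * S x * nn x + K \<bullet> rotJ (\<tau> x)"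

lemma c\<gamma>: "continuous_on dom_I \<gamma>" by (rule vderiv_cont) (rule D\<gamma>)
lemma c\<tau>: "continuous_on dom_I \<tau>" by (rule vderiv_cont) (rule D\<tau>)
lemma c\<eta>: "continuous_on dom_I \<eta>" by (rule vderiv_cont) (rule D\<eta>)
lemma cW: "continuous_on dom_I W" by (rule vderiv_cont) (rule DW)
lemma cU: "continuous_on dom_I U" by (rule vderiv_cont) (rule DU)

lemma S_eq': "x \<in> dom_I \<Longrightarrow> S x = (U x - \<delta> * W x * pp x) / lam"
  using S_eq[of x] lam0 by (simp add: pp_def field_simps)

lemma k_eq': "x \<in> dom_I \<Longrightarrow> k x = W x - \<delta> * S x * pp x"
  using k_eq[of x] by (simp add: pp_def)

lemma cp: "continuous_on dom_I pp" unfolding pp_def[abs_def] by (intro continuous_intros c\<eta> c\<tau>)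
lemma cn: "continuous_on dom_I nn" unfolding nn_def[abs_def] by (intro continuous_intros c\<eta> c\<tau>)
lemma ch: "continuous_on dom_I hh" unfolding hh_def[abs_def] by (intro continuous_intros c\<gamma> c\<tau>)
lemma cq: "continuous_on dom_I qq" unfolding qq_def[abs_def] by (intro continuous_intros c\<gamma> c\<tau>)

lemma cS: "continuous_on dom_I S"
proof -
  have "continuous_on dom_I (\<lambda>x. (U x - \<delta> * W x * pp x) / lam)"
    using lam0 by (intro continuous_intros cU cW cp) auto
  moreover have "continuous_on dom_I S = continuous_on dom_I (\<lambda>x. (U x - \<delta> * W x * pp x) / lam)"
    by (rule continuous_on_cong) (auto simp: S_eq')
  ultimately show ?thesis by simp
qed

lemma ck: "continuous_on dom_I k"
proof -
  have "continuous_on dom_I (\<lambda>x. W x - \<delta> * S x * pp x)" by (intro continuous_intros cS cW cp)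
  moreover have "continuous_on dom_I k = continuous_on dom_I (\<lambda>x. W x - \<delta> * S x * pp x)"
    by (rule continuous_on_cong) (auto simp: k_eq')
  ultimately show ?thesis by simp
qed

lemma cg: "continuous_on dom_I gg" unfolding gg_def[abs_def] by (intro continuous_intros cW cS cn c\<tau>)

lemmas conts = c\<gamma> c\<tau> c\<eta> cW cU cp cn ch cq cS ck cg

lemma \<tau>\<tau>: "x \<in> dom_I \<Longrightarrow> \<tau> x \<bullet> \<tau> x = 1" using \<tau>1[of x] by (simp add: power2_norm_eq_inner[symmetric])

lemma Dh: "x \<in> dom_I \<Longrightarrow> (hh has_real_derivative c * k x * qq x) (at x within dom_I)"
  unfolding has_real_derivative_iff_has_vector_derivative hh_def[abs_def] qq_def
  using bounded_bilinear.has_vector_derivative[OF bounded_bilinear_inner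
      bounded_linear.has_vector_derivative[OF rotJ_bl D\<gamma>[of x]] D\<tau>[of x]]
  by (simp add: rotJ_simps)

lemma Dq: "x \<in> dom_I \<Longrightarrow> (qq has_real_derivative c * (1 - k x * hh x)) (at x within dom_I)"
  unfolding has_real_derivative_iff_has_vector_derivative hh_def qq_def[abs_def]
  using bounded_bilinear.has_vector_derivative[OF bounded_bilinear_inner D\<gamma>[of x] D\<tau>[of x]] \<tau>\<tau>[of x]
  by (simp add: rotJ_swap[of "\<gamma> x"] algebra_simps)

lemma Dp: "x \<in> dom_I \<Longrightarrow> (pp has_real_derivative c * (k x - S x) * nn x) (at x within dom_I)"
  unfolding has_real_derivative_iff_has_vector_derivative nn_def pp_def[abs_def]
  using bounded_bilinear.has_vector_derivative[OF bounded_bilinear_inner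
      bounded_linear.has_vector_derivative[OF rotJ_bl D\<eta>[of x]] D\<tau>[of x]]
  by (simp add: rotJ_simps algebra_simps)

lemma DW': "x \<in> dom_I \<Longrightarrow> (W has_real_derivative c * (a * qq x + gg x)) (at x within dom_I)"
  unfolding has_real_derivative_iff_has_vector_derivative
  using DW[of x] by (simp add: gg_def nn_def qq_def algebra_simps)

lemma DU': "x \<in> dom_I \<Longrightarrow> (U has_real_derivative - (c * \<delta> * W x * S x * nn x)) (at x within dom_I)"
  unfolding has_real_derivative_iff_has_vector_derivative using DU[of x] by (simp add: nn_def)

lemma perh: "hh 0 = hh (2 * pi)" "qq 0 = qq (2 * pi)" "pp 0 = pp (2 * pi)"
  by (simp_all add: hh_def qq_def pp_def per)

lemma fi: "x \<in> dom_I \<Longrightarrow> (W x)\<^sup>2 / 2 + lam * (S x)\<^sup>2 / 2 - K \<bullet> \<tau> x = l + a * hh x"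
  using first_integral[of x] by (simp add: hh_def)

lemma pn1: "x \<in> dom_I \<Longrightarrow> \<bar>pp x\<bar> \<le> 1" "x \<in> dom_I \<Longrightarrow> \<bar>nn x\<bar> \<le> 1"
  using Cauchy_Schwarz_ineq2[of "rotJ (\<eta> x)" "\<tau> x"] Cauchy_Schwarz_ineq2[of "\<eta> x" "\<tau> x"]
  by (simp_all add: pp_def nn_def \<tau>1 \<eta>1)

text \<open>With mean zero, \<open>\<gamma> x\<close> is the average of
  \<open>\<gamma> x - \<gamma> y\<close> over \<open>y\<close>, and two points of the curve are at
  most \<open>2 * pi * c\<close> apart.\<close>

lemma \<gamma>_le: assumes x: "x \<in> dom_I" shows "norm (\<gamma> x) \<le> 2 * pi * c"
proof -
  have d: "norm (\<gamma> x - \<gamma> y) \<le> 2 * pi * c" if y: "y \<in> dom_I" for y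
  proof -
    have "norm (\<gamma> x - \<gamma> y) \<le> c * norm (x - y)"
    proof (rule differentiable_bound[of dom_I \<gamma> "\<lambda>z h. h *\<^sub>R (c *\<^sub>R \<tau> z)"])
      fix z assume z: "z \<in> dom_I"
      show "(\<gamma> has_derivative (\<lambda>h. h *\<^sub>R c *\<^sub>R \<tau> z)) (at z within dom_I)"
        using D\<gamma>[OF z] by (simp add: has_vector_derivative_def)
      show "onorm (\<lambda>h. h *\<^sub>R c *\<^sub>R \<tau> z) \<le> c"
        using c0 \<tau>1[OF z] by (intro onorm_le) (simp add: abs_mult)
    qed (use x y in auto)
    also have "\<dots> \<le> c * (2 * pi)" using x y c0 by (intro mult_left_mono) auto
    finally show ?thesis by (simp add: mult_ac)
  qed
  have "(2 * pi) *\<^sub>R \<gamma> x = integral dom_I (\<lambda>y. \<gamma> x - \<gamma> y)"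
    by (subst int_diff) (auto intro!: continuous_intros c\<gamma> simp: mean0)
  also have "norm \<dots> \<le> integral dom_I (\<lambda>y. 2 * pi * c)"
    by (intro integral_norm_bound_integral integrable_continuous_interval continuous_intros c\<gamma> d)
  finally show ?thesis using pi_gt_zero by simp
qed

lemma hq_le: assumes x: "x \<in> dom_I" shows "\<bar>hh x\<bar> \<le> 2 * pi * c" "\<bar>qq x\<bar> \<le> 2 * pi * c"
  using Cauchy_Schwarz_ineq2[of "rotJ (\<gamma> x)" "\<tau> x"] Cauchy_Schwarz_ineq2[of "\<gamma> x" "\<tau> x"] \<gamma>_le[OF x]
  by (simp_all add: hh_def qq_def \<tau>1[OF x])

text \<open>Minkowski's formula: the derivative \<open>c * (1 - k x * hh x)\<close> of the periodic
  function \<open>qq\<close> has integral zero.\<close>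

lemma int_kh: "integral dom_I (\<lambda>x. k x * hh x) = 2 * pi"
proof -
  have "integral dom_I (\<lambda>x. c * (1 - k x * hh x)) = 0" using int_rderiv[OF Dq] perh by simp
  moreover have "integral dom_I (\<lambda>x. c * (1 - k x * hh x)) = c * (integral dom_I (\<lambda>x. 1) - integral dom_I (\<lambda>x. k x * hh x))"
    by (subst int_diff[symmetric]) (auto intro!: continuous_intros conts)
  ultimately show ?thesis using c0 by simp
qed

lemma int_\<tau>: "integral dom_I \<tau> = 0"
  using int_deriv[OF D\<gamma>] per c0 by simp

lemma int_K\<tau>: "integral dom_I (\<lambda>x. K \<bullet> \<tau> x) = 0"
  using integral_linear[OF integrable_continuous_interval[OF c\<tau>] bounded_linear_inner_right[of K]] int_\<tau>
  by (simp add: o_def)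

lemma W_sq_le: "x \<in> dom_I \<Longrightarrow> (W x)\<^sup>2 \<le> 2 * (k x)\<^sup>2 + 2 * \<delta>\<^sup>2 * (S x)\<^sup>2"
proof -
  assume x: "x \<in> dom_I"
  have "(\<delta> * S x * pp x)\<^sup>2 \<le> (\<delta> * S x)\<^sup>2"
    using pn1(1)[OF x] mult_left_mono[of "(pp x)\<^sup>2" 1 "(\<delta> * S x)\<^sup>2"] by (simp add: power_mult_distrib abs_square_le_1)
  moreover have "W x = k x + \<delta> * S x * pp x" using k_eq'[OF x] by simp
  moreover have "(k x + \<delta> * S x * pp x)\<^sup>2 \<le> 2 * (k x)\<^sup>2 + 2 * (\<delta> * S x * pp x)\<^sup>2"
    using sum_squares_bound[of "k x" "\<delta> * S x * pp x"] by (simp add: power2_sum)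
  ultimately show ?thesis by (simp add: power_mult_distrib)
qed

lemma k_sq_le: "x \<in> dom_I \<Longrightarrow> (k x)\<^sup>2 \<le> 2 * (W x)\<^sup>2 + 2 * \<delta>\<^sup>2 * (S x)\<^sup>2"
proof -
  assume x: "x \<in> dom_I"
  have "(\<delta> * S x * pp x)\<^sup>2 \<le> (\<delta> * S x)\<^sup>2"
    using pn1(1)[OF x] mult_left_mono[of "(pp x)\<^sup>2" 1 "(\<delta> * S x)\<^sup>2"] by (simp add: power_mult_distrib abs_square_le_1)
  moreover have "(W x - \<delta> * S x * pp x)\<^sup>2 \<le> 2 * (W x)\<^sup>2 + 2 * (\<delta> * S x * pp x)\<^sup>2"
    using sum_squares_bound[of "W x" "- (\<delta> * S x * pp x)"] by (simp add: power2_diff)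
  ultimately show ?thesis using k_eq'[OF x] by (simp add: power_mult_distrib)
qed

end

text \<open>A single number \<open>A \<ge> 1\<close> dominates all data, \<open>ciA\<close> being
  the bound on \<open>1 / c\<close>. Every estimate becomes a multiple of a power of
  \<open>A\<close>, and lower powers are absorbed into higher ones.\<close>

locale bounded_ode = elastic_ode +
  fixes A :: real
  assumes A1: "1 \<le> A" and cA: "c \<le> A" and ciA: "1 \<le> A * c"
    and kA: "integral dom_I (\<lambda>x. (k x)\<^sup>2) \<le> A" and SA: "integral dom_I (\<lambda>x. (S x)\<^sup>2) \<le> A"
    and \<delta>A: "\<bar>\<delta>\<bar> \<le> A" and lamA: "lam \<le> A" and liA: "1 / lam \<le> A"
begin

definition ee :: "real \<Rightarrow> real" where "ee x = \<bar>W x\<bar> + \<bar>S x\<bar> + \<bar>k x\<bar>"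

lemma ce: "continuous_on dom_I ee" unfolding ee_def[abs_def] by (intro continuous_intros conts)

lemma ee0: "0 \<le> ee x" "\<bar>W x\<bar> \<le> ee x" "\<bar>S x\<bar> \<le> ee x" "\<bar>k x\<bar> \<le> ee x" by (simp_all add: ee_def)

lemma Apow: "m \<le> n \<Longrightarrow> A ^ m \<le> A ^ n" using A1 by (rule power_increasing[rotated])

lemma A0: "0 \<le> A" "0 < A" "0 \<le> A ^ n" using A1 by auto

lemma twopi: "6 \<le> 2 * pi" "2 * pi \<le> 8" using pi_gt3 pi_less_4 by auto

text \<open>Integral estimates are read off pointwise bounds quadratic in \<open>ee\<close>, the
  common majorant of \<open>W\<close>, \<open>S\<close> and \<open>k\<close>. The 18 is 3, from the
  square of a sum of three terms, times the coefficients 2 + 2 + 1 + 1 of the mean squares; the 8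
  bounds \<open>2 * pi\<close>.\<close>

lemma int_le_const:
  fixes f :: "real \<Rightarrow> real"
  assumes "continuous_on dom_I f" "\<And>x. x \<in> dom_I \<Longrightarrow> f x \<le> u * (ee x)\<^sup>2 + v" "0 \<le> u" "0 \<le> v"
  shows "integral dom_I f \<le> u * (18 * A ^ 3) + 8 * v"
proof -
  have sq: "integral dom_I (\<lambda>x. (ee x)\<^sup>2) \<le> 18 * A ^ 3"
  proof -
    have "integral dom_I (\<lambda>x. (W x)\<^sup>2) \<le> integral dom_I (\<lambda>x. 2 * (k x)\<^sup>2 + 2 * \<delta>\<^sup>2 * (S x)\<^sup>2)"
      by (intro int_mono continuous_intros conts W_sq_le)
    also have "\<dots> = 2 * integral dom_I (\<lambda>x. (k x)\<^sup>2) + 2 * \<delta>\<^sup>2 * integral dom_I (\<lambda>x. (S x)\<^sup>2)"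
      by (subst int_add) (auto intro!: continuous_intros conts)
    also have "\<dots> \<le> 2 * A + 2 * A\<^sup>2 * A"
      using kA SA power_mono[OF \<delta>A, of 2] A0(1)
      by (intro add_mono mult_mono int_nonneg continuous_intros conts) auto
    finally have W: "integral dom_I (\<lambda>x. (W x)\<^sup>2) \<le> 2 * A + 2 * A ^ 3" by (simp add: power2_eq_square power3_eq_cube)
    have "integral dom_I (\<lambda>x. (ee x)\<^sup>2) \<le> integral dom_I (\<lambda>x. 3 * ((W x)\<^sup>2 + (S x)\<^sup>2 + (k x)\<^sup>2))"
    proof (intro int_mono continuous_intros conts ce)
      fix x
      have "(a + b + c)\<^sup>2 \<le> 3 * (a\<^sup>2 + b\<^sup>2 + c\<^sup>2)" for a b c :: real
        using sum_squares_bound[of a b] sum_squares_bound[of a c] sum_squares_bound[of b c]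
        by (simp add: power2_eq_square algebra_simps)
      from this[of "\<bar>W x\<bar>" "\<bar>S x\<bar>" "\<bar>k x\<bar>"] show "(ee x)\<^sup>2 \<le> 3 * ((W x)\<^sup>2 + (S x)\<^sup>2 + (k x)\<^sup>2)"
        by (simp add: ee_def)
    qed
    also have "\<dots> = 3 * (integral dom_I (\<lambda>x. (W x)\<^sup>2) + integral dom_I (\<lambda>x. (S x)\<^sup>2) + integral dom_I (\<lambda>x. (k x)\<^sup>2))"
      by (simp add: int_add continuous_intros conts)
    also have "\<dots> \<le> 3 * (2 * A + 2 * A ^ 3 + A + A)" using W SA kA by simp
    also have "\<dots> \<le> 18 * A ^ 3" using Apow[of 1 3] by simp
    finally show ?thesis .
  qed
  have "integral dom_I f \<le> integral dom_I (\<lambda>x. u * (ee x)\<^sup>2 + v)"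
    by (intro int_mono continuous_intros ce assms)
  also have "\<dots> = u * integral dom_I (\<lambda>x. (ee x)\<^sup>2) + 2 * pi * v"
    by (subst int_add) (auto intro!: continuous_intros ce)
  also have "\<dots> \<le> u * (18 * A ^ 3) + 8 * v"
    using sq assms(3,4) twopi by (intro add_mono mult_mono mult_left_mono) auto
  finally show ?thesis .
qed

lemma abs_int_le_const:
  fixes f :: "real \<Rightarrow> real"
  assumes "continuous_on dom_I f" "\<And>x. x \<in> dom_I \<Longrightarrow> \<bar>f x\<bar> \<le> u * (ee x)\<^sup>2 + v" "0 \<le> u" "0 \<le> v"
  shows "\<bar>integral dom_I f\<bar> \<le> u * (18 * A ^ 3) + 8 * v"
proof -
  have "\<bar>integral dom_I f\<bar> \<le> integral dom_I (\<lambda>x. \<bar>f x\<bar>)"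
    by (intro int_abs_le continuous_intros assms) auto
  also have "\<dots> \<le> u * (18 * A ^ 3) + 8 * v"
    by (intro int_le_const continuous_intros assms)
  finally show ?thesis .
qed

lemma abs_mult_le: "\<bar>x\<bar> \<le> X \<Longrightarrow> \<bar>y\<bar> \<le> Y \<Longrightarrow> \<bar>x * y\<bar> \<le> X * (Y :: real)"
  unfolding abs_mult by (intro mult_mono) auto

lemma ee_prod: "\<bar>x\<bar> \<le> ee z \<Longrightarrow> \<bar>y\<bar> \<le> ee z \<Longrightarrow> \<bar>x * y\<bar> \<le> (ee z)\<^sup>2"
  unfolding power2_eq_square by (rule abs_mult_le)

lemma WS_le: "x \<in> dom_I \<Longrightarrow> \<bar>\<delta> * W x * S x\<bar> \<le> A * (ee x)\<^sup>2"
  using abs_mult_le[OF \<delta>A ee_prod[OF ee0(2) ee0(3)]] by (simp add: mult.assoc)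

lemma K_le: "norm K \<le> 9 * A ^ 4"
proof -
  let ?Q = "\<lambda>x. (- (3 / 2) * (W x)\<^sup>2 - lam / 2 * (S x)\<^sup>2) *\<^sub>R \<tau> x + (\<delta> * W x * S x) *\<^sub>R rotJ (\<eta> x)"
  have "norm (integral dom_I ?Q) \<le> integral dom_I (\<lambda>x. 3 * A * (ee x)\<^sup>2)"
  proof (intro integral_norm_bound_integral integrable_continuous_interval continuous_intros conts ce)
    fix x assume x: "x \<in> dom_I"
    have "norm (?Q x) \<le> \<bar>- (3 / 2) * (W x)\<^sup>2 - lam / 2 * (S x)\<^sup>2\<bar> + \<bar>\<delta> * W x * S x\<bar>"
      using norm_triangle_ineq[of "(- (3 / 2) * (W x)\<^sup>2 - lam / 2 * (S x)\<^sup>2) *\<^sub>R \<tau> x" "(\<delta> * W x * S x) *\<^sub>R rotJ (\<eta> x)"]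
      by (simp add: \<tau>1[OF x] \<eta>1[OF x])
    also have "\<bar>- (3 / 2) * (W x)\<^sup>2 - lam / 2 * (S x)\<^sup>2\<bar> \<le> 3 / 2 * (ee x)\<^sup>2 + A / 2 * (ee x)\<^sup>2"
    proof -
      have "(W x)\<^sup>2 \<le> (ee x)\<^sup>2" "(S x)\<^sup>2 \<le> (ee x)\<^sup>2" using ee0[of x] by (auto intro: power2_le_iff_abs_le[THEN iffD2])
      then have "3 / 2 * (W x)\<^sup>2 \<le> 3 / 2 * (ee x)\<^sup>2" "lam / 2 * (S x)\<^sup>2 \<le> A / 2 * (ee x)\<^sup>2"
        using lamA lam0 by (auto intro!: mult_mono)
      moreover have "0 \<le> 3 / 2 * (W x)\<^sup>2" "0 \<le> lam / 2 * (S x)\<^sup>2" using lam0 by auto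
      ultimately show ?thesis unfolding abs_le_iff by (intro conjI; linarith)
    qed
    also have "3 / 2 * (ee x)\<^sup>2 + A / 2 * (ee x)\<^sup>2 + \<bar>\<delta> * W x * S x\<bar> \<le> 3 * A * (ee x)\<^sup>2"
      using WS_le[OF x] mult_right_mono[OF A1, of "(ee x)\<^sup>2"] by (simp add: algebra_simps)
    finally show "norm (?Q x) \<le> 3 * A * (ee x)\<^sup>2" by simp
  qed
  also have "\<dots> \<le> (3 * A) * (18 * A ^ 3) + 8 * 0"
    by (rule int_le_const) (auto intro!: continuous_intros ce simp: A0)
  also have "\<dots> = 54 * A ^ 4" by (simp add: eval_nat_numeral)
  finally have *: "norm (integral dom_I ?Q) \<le> 54 * A ^ 4" .
  have "norm K = (1 / (2 * pi)) * norm (integral dom_I ?Q)"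
    unfolding K_eq by simp
  also have "\<dots> \<le> (1 / 6) * (54 * A ^ 4)"
    using * twopi by (intro mult_mono) (auto intro!: divide_left_mono)
  finally show ?thesis by simp
qed

lemma gg_le: "x \<in> dom_I \<Longrightarrow> \<bar>gg x\<bar> \<le> A * (ee x)\<^sup>2 + 9 * A ^ 4"
proof -
  assume x: "x \<in> dom_I"
  have "\<bar>\<delta> * W x * S x * nn x\<bar> \<le> A * (ee x)\<^sup>2 * 1"
    by (rule abs_mult_le[OF WS_le[OF x] pn1(2)[OF x]])
  moreover have "\<bar>K \<bullet> rotJ (\<tau> x)\<bar> \<le> 9 * A ^ 4"
    using Cauchy_Schwarz_ineq2[of K "rotJ (\<tau> x)"] K_le \<tau>1[OF x] by simp
  ultimately show ?thesis unfolding gg_def by linarith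
qed

lemma hq_A: "x \<in> dom_I \<Longrightarrow> \<bar>hh x\<bar> \<le> 8 * A" "x \<in> dom_I \<Longrightarrow> \<bar>qq x\<bar> \<le> 8 * A" "x \<in> dom_I \<Longrightarrow> norm (\<gamma> x) \<le> 8 * A"
proof -
  have "2 * pi * c \<le> 8 * A" using twopi cA c0 A0 by (intro mult_mono) auto
  then show "x \<in> dom_I \<Longrightarrow> \<bar>hh x\<bar> \<le> 8 * A" "x \<in> dom_I \<Longrightarrow> \<bar>qq x\<bar> \<le> 8 * A" "x \<in> dom_I \<Longrightarrow> norm (\<gamma> x) \<le> 8 * A"
    using hq_le[of x] \<gamma>_le[of x] by linarith+
qed

text \<open>The first integral arranged so that its value is \<open>l + a * hh x\<close>, while
  \<open>Z\<close> itself is controlled in the mean without any knowledge of \<open>l\<close> and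
  \<open>a\<close>.\<close>

definition Z :: "real \<Rightarrow> real" where "Z x = (W x)\<^sup>2 / 2 + lam * (S x)\<^sup>2 / 2 - K \<bullet> \<tau> x"

lemma cZ: "continuous_on dom_I Z" unfolding Z_def[abs_def] by (intro continuous_intros conts) auto

lemma Z_eq: "x \<in> dom_I \<Longrightarrow> Z x = l + a * hh x" using fi[of x] by (simp add: Z_def)

lemma Z_le: "x \<in> dom_I \<Longrightarrow> \<bar>Z x\<bar> \<le> A * (ee x)\<^sup>2 + 9 * A ^ 4"
proof -
  assume x: "x \<in> dom_I"
  have "(W x)\<^sup>2 \<le> (ee x)\<^sup>2" "(S x)\<^sup>2 \<le> (ee x)\<^sup>2" using ee0[of x] by (auto intro: power2_le_iff_abs_le[THEN iffD2])
  then have "(W x)\<^sup>2 \<le> A * (ee x)\<^sup>2" "lam * (S x)\<^sup>2 \<le> A * (ee x)\<^sup>2"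
    using lamA lam0 mult_right_mono[OF A1, of "(ee x)\<^sup>2"] by (auto intro!: mult_mono)
  moreover have "0 \<le> (W x)\<^sup>2" "0 \<le> lam * (S x)\<^sup>2" using lam0 by auto
  moreover have "\<bar>K \<bullet> \<tau> x\<bar> \<le> 9 * A ^ 4"
    using Cauchy_Schwarz_ineq2[of K "\<tau> x"] K_le \<tau>1[OF x] by simp
  ultimately show ?thesis unfolding Z_def abs_le_iff by (intro conjI; linarith)
qed

lemma int_h_sq_ge: "1 \<le> A * integral dom_I (\<lambda>x. (hh x)\<^sup>2)"
proof -
  \<comment> \<open>Young's inequality with weight \<open>A\<close>: the mean square of
    \<open>k\<close> then contributes at most 1, well below the left hand side
    \<open>4 * pi\<close>.\<close>
  have "2 * integral dom_I (\<lambda>x. k x * hh x) \<le> integral dom_I (\<lambda>x. (1 / A) * (k x)\<^sup>2 + A * (hh x)\<^sup>2)"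
    unfolding integral_mult_right[symmetric]
  proof (intro int_mono continuous_intros conts)
    fix x
    have "2 * k x * (A * hh x) \<le> (k x)\<^sup>2 + (A * hh x)\<^sup>2" by (rule sum_squares_bound)
    then have "A * (2 * (k x * hh x)) \<le> A * ((1 / A) * (k x)\<^sup>2 + A * (hh x)\<^sup>2)"
      using A0(2) by (simp add: power_mult_distrib power2_eq_square algebra_simps)
    then show "2 * (k x * hh x) \<le> (1 / A) * (k x)\<^sup>2 + A * (hh x)\<^sup>2" using A0(2) by simp
  qed
  also have "\<dots> = (1 / A) * integral dom_I (\<lambda>x. (k x)\<^sup>2) + A * integral dom_I (\<lambda>x. (hh x)\<^sup>2)"
    by (subst int_add) (use A0(2) in \<open>auto intro!: continuous_intros conts\<close>)
  also have "(1 / A) * integral dom_I (\<lambda>x. (k x)\<^sup>2) \<le> 1" using kA A0(2) by (simp add: field_simps)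
  finally show ?thesis using int_kh twopi by simp
qed

text \<open>The first integral \<open>Z = l + a hh\<close> is multiplied by \<open>hh\<close>, whose mean square is bounded below
  because \<open>k hh\<close> has mean one.\<close>

lemma a_bound_of_l: "\<bar>a\<bar> \<le> 720 * A ^ 6 + 64 * A\<^sup>2 * \<bar>l\<bar>"
proof -
  have "a * integral dom_I (\<lambda>x. (hh x)\<^sup>2) = integral dom_I (\<lambda>x. (Z x - l) * hh x)"
    unfolding integral_mult_right[symmetric]
    by (rule int_cong) (simp add: Z_eq power2_eq_square)
  moreover have "\<bar>integral dom_I (\<lambda>x. (Z x - l) * hh x)\<bar> \<le> 8 * A\<^sup>2 * (18 * A ^ 3) + 8 * (72 * A ^ 5 + 8 * A * \<bar>l\<bar>)"
  proof (rule abs_int_le_const)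
    fix x assume x: "x \<in> dom_I"
    have "\<bar>Z x - l\<bar> \<le> A * (ee x)\<^sup>2 + 9 * A ^ 4 + \<bar>l\<bar>" using Z_le[OF x] by linarith
    from abs_mult_le[OF this hq_A(1)[OF x]]
    show "\<bar>(Z x - l) * hh x\<bar> \<le> 8 * A\<^sup>2 * (ee x)\<^sup>2 + (72 * A ^ 5 + 8 * A * \<bar>l\<bar>)"
      by (simp add: algebra_simps eval_nat_numeral)
  qed (use A0 in \<open>auto intro!: continuous_intros conts cZ\<close>)
  ultimately have "\<bar>a\<bar> * integral dom_I (\<lambda>x. (hh x)\<^sup>2) \<le> 720 * A ^ 5 + 64 * A * \<bar>l\<bar>"
  proof -
    have nn: "0 \<le> integral dom_I (\<lambda>x. (hh x)\<^sup>2)" by (intro int_nonneg continuous_intros conts) auto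
    assume "a * integral dom_I (\<lambda>x. (hh x)\<^sup>2) = integral dom_I (\<lambda>x. (Z x - l) * hh x)"
      "\<bar>integral dom_I (\<lambda>x. (Z x - l) * hh x)\<bar> \<le> 8 * A\<^sup>2 * (18 * A ^ 3) + 8 * (72 * A ^ 5 + 8 * A * \<bar>l\<bar>)"
    then have "\<bar>a * integral dom_I (\<lambda>x. (hh x)\<^sup>2)\<bar> \<le> 144 * A ^ 5 + 8 * (72 * A ^ 5 + 8 * A * \<bar>l\<bar>)"
      by (simp add: power_add[symmetric])
    then show ?thesis using nn by (simp add: abs_mult)
  qed
  from mult_left_mono[OF this A0(1)]
  have "\<bar>a\<bar> * (A * integral dom_I (\<lambda>x. (hh x)\<^sup>2)) \<le> 720 * A ^ 6 + 64 * A\<^sup>2 * \<bar>l\<bar>"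
    by (simp add: algebra_simps eval_nat_numeral)
  moreover have "\<bar>a\<bar> * 1 \<le> \<bar>a\<bar> * (A * integral dom_I (\<lambda>x. (hh x)\<^sup>2))"
    by (intro mult_left_mono int_h_sq_ge) simp
  ultimately show ?thesis by simp
qed

end

text \<open>\<open>R\<close> will be \<open>A0 / (pi * c)\<close>; it is signed, so that orientation
  is taken into account. A circle about the origin, traversed any number of times, has constant
  \<open>hh = R\<close>.\<close>

locale bounded_ode_mean = bounded_ode +
  fixes R :: real
  assumes hR: "integral dom_I (\<lambda>x. rotJ (\<gamma> x) \<bullet> \<tau> x) = 2 * pi * R"
begin

lemma int_h: "integral dom_I hh = 2 * pi * R"
  using hR by (simp add: hh_def[abs_def])

lemma int_hR: "integral dom_I (\<lambda>x. hh x - R) = 0"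
  by (subst int_diff) (auto intro!: conts simp: int_h)

lemma int_Z: "integral dom_I Z = 2 * pi * (l + a * R)"
proof -
  have "integral dom_I Z = integral dom_I (\<lambda>x. l + a * hh x)" by (rule int_cong) (simp add: Z_eq)
  also have "\<dots> = 2 * pi * (l + a * R)"
  proof -
    have "integral dom_I (\<lambda>x. l + a * hh x) = integral dom_I (\<lambda>x. l) + integral dom_I (\<lambda>x. a * hh x)"
      by (rule int_add) (intro continuous_intros conts)+
    then show ?thesis by (simp add: int_h distrib_left)
  qed
  finally show ?thesis .
qed

text \<open>The mean of \<open>Z\<close> is \<open>l + a * R\<close>, so it is this combination that
  is bounded; \<open>l\<close> and \<open>a\<close> may still both be large and compensate each
  other.\<close>

lemma lR_le: "\<bar>l + a * R\<bar> \<le> 15 * A ^ 4"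
proof -
  have "\<bar>integral dom_I Z\<bar> \<le> A * (18 * A ^ 3) + 8 * (9 * A ^ 4)"
    by (rule abs_int_le_const[OF cZ Z_le]) (use A0 in auto)
  moreover have "A * (18 * A ^ 3) + 8 * (9 * A ^ 4) = 90 * A ^ 4" by (simp add: eval_nat_numeral)
  ultimately have "2 * pi * \<bar>l + a * R\<bar> \<le> 90 * A ^ 4"
    unfolding int_Z by (simp add: abs_mult)
  moreover have "6 * \<bar>l + a * R\<bar> \<le> 2 * pi * \<bar>l + a * R\<bar>" using twopi by (intro mult_right_mono) auto
  ultimately have "6 * \<bar>l + a * R\<bar> \<le> 90 * A ^ 4" by (rule order_trans[rotated])
  then show ?thesis by simp
qed

lemma a_bound_zero_mean: "R = 0 \<Longrightarrow> \<bar>a\<bar> \<le> 1680 * A ^ 6"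
proof -
  assume "R = 0"
  then have "\<bar>l\<bar> \<le> 15 * A ^ 4" using lR_le by simp
  then have "64 * A\<^sup>2 * \<bar>l\<bar> \<le> 64 * A\<^sup>2 * (15 * A ^ 4)" using A0 by (intro mult_left_mono) auto
  also have "\<dots> = 960 * A ^ 6" by (simp add: eval_nat_numeral)
  finally show ?thesis using a_bound_of_l by linarith
qed

lemma R_le: "\<bar>R\<bar> \<le> 8 * A"
proof -
  have "\<bar>integral dom_I hh\<bar> \<le> integral dom_I (\<lambda>x. 8 * A)"
    by (intro int_abs_le conts continuous_intros hq_A)
  then have "2 * pi * \<bar>R\<bar> \<le> 2 * pi * (8 * A)" unfolding int_h by (simp add: abs_mult)
  then show ?thesis using pi_gt_zero by simp
qed

definition D1 :: real where "D1 = integral dom_I (\<lambda>x. (hh x - R)\<^sup>2)"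
definition D2 :: real where "D2 = integral dom_I (\<lambda>x. (qq x)\<^sup>2)"

lemma D_nonneg: "0 \<le> D1" "0 \<le> D2"
  unfolding D1_def D2_def by (intro int_nonneg continuous_intros conts; simp)+

text \<open>Subtracting its mean removes \<open>l\<close> from the first integral and leaves
  \<open>a * (hh - R)\<close>, which is multiplied by \<open>hh - R\<close>. The sup bound
  \<open>s\<close> is a parameter because the estimate is used twice: with the crude value
  \<open>16 * A\<close>, and again with a small \<open>t\<close>, where the right hand side gains
  the factor \<open>t\<close>.\<close>

lemma a_D1:
  assumes s: "\<And>x. x \<in> dom_I \<Longrightarrow> \<bar>hh x - R\<bar> \<le> s"
  shows "\<bar>a\<bar> * D1 \<le> 210 * A ^ 4 * s"
proof -
  have s0: "0 \<le> s" using s[of 0] by simp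
  have "a * D1 = integral dom_I (\<lambda>x. (Z x - (l + a * R)) * (hh x - R))"
    unfolding D1_def integral_mult_right[symmetric]
    by (rule int_cong) (simp add: Z_eq power2_eq_square algebra_simps)
  moreover have "\<bar>integral dom_I (\<lambda>x. (Z x - (l + a * R)) * (hh x - R))\<bar> \<le> (A * s) * (18 * A ^ 3) + 8 * (24 * A ^ 4 * s)"
  proof (rule abs_int_le_const)
    fix x assume x: "x \<in> dom_I"
    have "\<bar>Z x - (l + a * R)\<bar> \<le> A * (ee x)\<^sup>2 + 24 * A ^ 4" using Z_le[OF x] lR_le by linarith
    from abs_mult_le[OF this s[OF x]]
    show "\<bar>(Z x - (l + a * R)) * (hh x - R)\<bar> \<le> (A * s) * (ee x)\<^sup>2 + 24 * A ^ 4 * s"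
      by (simp add: algebra_simps)
  qed (use A0 s0 in \<open>auto intro!: continuous_intros conts cZ\<close>)
  ultimately have "\<bar>a * D1\<bar> \<le> 210 * A ^ 4 * s" by (simp add: eval_nat_numeral algebra_simps)
  then show ?thesis using D_nonneg by (simp add: abs_mult)
qed

lemma a_D1': "\<bar>a\<bar> * D1 \<le> 3360 * A ^ 5"
proof -
  have "\<bar>hh x - R\<bar> \<le> 16 * A" if "x \<in> dom_I" for x using hq_A(1)[OF that] R_le by linarith
  from a_D1[OF this] show ?thesis by (simp add: eval_nat_numeral)
qed

lemma ckh: "continuous_on dom_I (\<lambda>x. c * (1 - k x * hh x))" "continuous_on dom_I (\<lambda>x. c * (a * qq x + gg x))"
  by (intro continuous_intros conts)+

text \<open>Multiplying the derivative \<open>c * (a * qq + gg)\<close> of \<open>W\<close> by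
  \<open>qq\<close> and integrating by parts leaves \<open>a * D2\<close> and terms without
  \<open>a\<close>. In contrast to \<open>a_D1\<close>, the bound carries no factor that becomes
  small near a circle; \<open>D2_le\<close> supplies one later.\<close>

lemma a_D2: "\<bar>a\<bar> * D2 \<le> 3360 * A ^ 5"
proof -
  have "integral dom_I (\<lambda>x. qq x * (c * (a * qq x + gg x))) = - integral dom_I (\<lambda>x. c * (1 - k x * hh x) * W x)"
    by (rule int_parts[OF Dq ckh(1) perh(2) DW' ckh(2) per(4)])
  moreover have "integral dom_I (\<lambda>x. qq x * (c * (a * qq x + gg x))) = c * (a * D2 + integral dom_I (\<lambda>x. qq x * gg x))"
  proof -
    have "integral dom_I (\<lambda>x. qq x * (c * (a * qq x + gg x))) = integral dom_I (\<lambda>x. c * (a * (qq x)\<^sup>2 + qq x * gg x))"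
      by (rule int_cong) (simp add: power2_eq_square algebra_simps)
    then show ?thesis unfolding D2_def by (simp add: int_add continuous_intros conts)
  qed
  moreover have "integral dom_I (\<lambda>x. c * (1 - k x * hh x) * W x) = c * integral dom_I (\<lambda>x. (1 - k x * hh x) * W x)"
    by (simp add: mult.assoc)
  ultimately have "c * (a * D2 + integral dom_I (\<lambda>x. qq x * gg x)) = c * (- integral dom_I (\<lambda>x. (1 - k x * hh x) * W x))"
    by simp
  then have "a * D2 + integral dom_I (\<lambda>x. qq x * gg x) = - integral dom_I (\<lambda>x. (1 - k x * hh x) * W x)"
    by (rule mult_left_cancel[THEN iffD1, rotated]) (use c0 in simp)
  then have e: "a * D2 = - (integral dom_I (\<lambda>x. (1 - k x * hh x) * W x) + integral dom_I (\<lambda>x. qq x * gg x))"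
    by linarith
  have "\<bar>integral dom_I (\<lambda>x. (1 - k x * hh x) * W x)\<bar> \<le> (9 * A) * (18 * A ^ 3) + 8 * 1"
  proof (rule abs_int_le_const)
    fix x assume x: "x \<in> dom_I"
    have "\<bar>(k x * W x) * hh x\<bar> \<le> (ee x)\<^sup>2 * (8 * A)"
      by (rule abs_mult_le[OF ee_prod[OF ee0(4) ee0(2)] hq_A(1)[OF x]])
    moreover have "\<bar>W x\<bar> \<le> 1 + (ee x)\<^sup>2"
      using ee0(2)[of x] sum_squares_bound[of 1 "ee x"] ee0(1)[of x] by simp
    moreover have "(1 - k x * hh x) * W x = W x - (k x * W x) * hh x" by (simp add: algebra_simps)
    moreover have "(ee x)\<^sup>2 \<le> A * (ee x)\<^sup>2" using mult_right_mono[OF A1, of "(ee x)\<^sup>2"] by simp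
    ultimately show "\<bar>(1 - k x * hh x) * W x\<bar> \<le> 9 * A * (ee x)\<^sup>2 + 1" by (simp add: algebra_simps)
  qed (use A0 in \<open>auto intro!: continuous_intros conts\<close>)
  moreover have "\<bar>integral dom_I (\<lambda>x. qq x * gg x)\<bar> \<le> (8 * A\<^sup>2) * (18 * A ^ 3) + 8 * (72 * A ^ 5)"
  proof (rule abs_int_le_const)
    fix x assume x: "x \<in> dom_I"
    from abs_mult_le[OF hq_A(2)[OF x] gg_le[OF x]]
    show "\<bar>qq x * gg x\<bar> \<le> 8 * A\<^sup>2 * (ee x)\<^sup>2 + 72 * A ^ 5" by (simp add: eval_nat_numeral algebra_simps)
  qed (use A0 in \<open>auto intro!: continuous_intros conts\<close>)
  ultimately have "\<bar>a * D2\<bar> \<le> (9 * A) * (18 * A ^ 3) + 8 * 1 + ((8 * A\<^sup>2) * (18 * A ^ 3) + 8 * (72 * A ^ 5))"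
    unfolding e by linarith
  also have "\<dots> = 162 * A ^ 4 + 8 + 720 * A ^ 5" by (simp add: eval_nat_numeral)
  also have "\<dots> \<le> 3360 * A ^ 5" using Apow[of 4 5] Apow[of 0 5] by simp
  finally show ?thesis using D_nonneg by (simp add: abs_mult)
qed

lemma int_h'_sq: "integral dom_I (\<lambda>x. (c * k x * qq x)\<^sup>2) \<le> 2320 * A ^ 7"
proof -
  have "integral dom_I (\<lambda>x. (c * k x * qq x)\<^sup>2) \<le> (64 * A ^ 4) * (18 * A ^ 3) + 8 * 0"
  proof (rule int_le_const)
    fix x assume x: "x \<in> dom_I"
    have "\<bar>c * k x * qq x\<bar> \<le> (A * ee x) * (8 * A)"
      by (intro abs_mult_le ee0 hq_A x) (use cA c0 in simp)
    from power_mono[OF this, of 2]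
    show "(c * k x * qq x)\<^sup>2 \<le> 64 * A ^ 4 * (ee x)\<^sup>2 + 0"
      by (simp add: power_mult_distrib eval_nat_numeral algebra_simps)
  qed (use A0 in \<open>auto intro!: continuous_intros conts\<close>)
  also have "\<dots> = 1152 * A ^ 7" by (simp add: power_add[symmetric])
  \<comment> \<open>The constant of \<open>int_q'_sq\<close> is adopted so that
    \<open>sup_small\<close> can treat \<open>hh - R\<close> and \<open>qq\<close> with the same
    \<open>\<epsilon>\<close>.\<close>
  also have "\<dots> \<le> 2320 * A ^ 7" using A0(3)[of 7] by simp
  finally show ?thesis .
qed

lemma int_q'_sq: "integral dom_I (\<lambda>x. (c * (1 - k x * hh x))\<^sup>2) \<le> 2320 * A ^ 7"
proof -
  have "integral dom_I (\<lambda>x. (c * (1 - k x * hh x))\<^sup>2) \<le> (128 * A ^ 4) * (18 * A ^ 3) + 8 * (2 * A\<^sup>2)"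
  proof (rule int_le_const)
    fix x assume x: "x \<in> dom_I"
    have 1: "\<bar>c * (k x * hh x)\<bar> \<le> A * (ee x * (8 * A))"
      by (intro abs_mult_le ee0 hq_A x) (use cA c0 in simp)
    have 2: "(c * (k x * hh x))\<^sup>2 \<le> 64 * A ^ 4 * (ee x)\<^sup>2"
      using power_mono[OF 1, of 2] by (simp add: power_mult_distrib eval_nat_numeral algebra_simps)
    have 3: "c\<^sup>2 \<le> A\<^sup>2" using cA c0 by (intro power_mono) auto
    have "(c - c * (k x * hh x))\<^sup>2 \<le> 2 * c\<^sup>2 + 2 * (c * (k x * hh x))\<^sup>2"
      using sum_squares_bound[of c "- (c * (k x * hh x))"] by (simp add: power2_diff)
    then show "(c * (1 - k x * hh x))\<^sup>2 \<le> 128 * A ^ 4 * (ee x)\<^sup>2 + 2 * A\<^sup>2"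
      using 2 3 by (simp add: right_diff_distrib)
  qed (use A0 in \<open>auto intro!: continuous_intros conts\<close>)
  also have "\<dots> = 2304 * A ^ 7 + 16 * A\<^sup>2" by (simp add: power_add[symmetric])
  also have "\<dots> \<le> 2320 * A ^ 7" using Apow[of 2 7] by simp
  finally show ?thesis .
qed

text \<open>Interpolation by \<open>sup_sq_le\<close>: the choice of \<open>\<epsilon>\<close> makes
  the derivative term at most \<open>t\<^sup>2 / 2\<close>, and the threshold on \<open>a\<close>
  makes the mean squares, which are at most \<open>3360 * A ^ 5 / \<bar>a\<bar>\<close>, contribute
  at most the other half. Hence 4640 and 6720 are twice 2320 and 3360.\<close>

lemma sup_small:
  assumes t: "t > 0" and big: "\<bar>a\<bar> \<ge> (1 + 4640 * A ^ 7 / t\<^sup>2) * (6720 * A ^ 5) / t\<^sup>2" and x: "x \<in> dom_I"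
  shows "\<bar>hh x - R\<bar> \<le> t" "\<bar>qq x\<bar> \<le> t"
proof -
  define \<epsilon> where "\<epsilon> = t\<^sup>2 / (4640 * A ^ 7)"
  have e: "\<epsilon> > 0" using t A0(2) by (simp add: \<epsilon>_def)
  have e1: "1 / \<epsilon> = 4640 * A ^ 7 / t\<^sup>2" by (simp add: \<epsilon>_def)
  have e2: "\<epsilon> * (2320 * A ^ 7) = t\<^sup>2 / 2" using A0(2) by (simp add: \<epsilon>_def)
  define m where "m = (1 + 1 / \<epsilon>) * (6720 * A ^ 5) / t\<^sup>2"
  have m: "m > 0" unfolding m_def using e A0(2) t by (intro divide_pos_pos mult_pos_pos) (auto intro: add_pos_pos)
  have ma: "m \<le> \<bar>a\<bar>" using big by (simp add: m_def e1)
  have key: "(1 + 1 / \<epsilon>) * D \<le> t\<^sup>2 / 2" if D: "0 \<le> D" "\<bar>a\<bar> * D \<le> 3360 * A ^ 5" for D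
  proof -
    have "m * D \<le> 3360 * A ^ 5" using mult_right_mono[OF ma D(1)] D(2) by linarith
    then have "(1 + 1 / \<epsilon>) * (6720 * A ^ 5) * D \<le> 3360 * A ^ 5 * t\<^sup>2"
      using t by (simp add: m_def field_simps)
    then have "(6720 * A ^ 5) * ((1 + 1 / \<epsilon>) * D) \<le> (6720 * A ^ 5) * (t\<^sup>2 / 2)"
      by (simp add: algebra_simps)
    then show ?thesis by (rule mult_left_le_imp_le) (use A0(2) in simp)
  qed
  have fin: "\<bar>y\<bar> \<le> t" if "y\<^sup>2 \<le> t\<^sup>2" for y using that t by (simp add: power2_le_iff_abs_le)
  have "((hh x - R))\<^sup>2 \<le> (1 + 1 / \<epsilon>) * D1 + \<epsilon> * integral dom_I (\<lambda>x. (c * k x * qq x)\<^sup>2)"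
    unfolding D1_def
    by (rule sup_sq_le[where f = "\<lambda>x. hh x - R", OF _ _ x e]) (auto intro!: derivative_eq_intros Dh continuous_intros conts)
  also have "\<dots> \<le> t\<^sup>2 / 2 + \<epsilon> * (2320 * A ^ 7)"
    using e by (intro add_mono key D_nonneg a_D1' mult_left_mono int_h'_sq) auto
  finally show "\<bar>hh x - R\<bar> \<le> t" unfolding e2 by (intro fin) simp
  have "(qq x)\<^sup>2 \<le> (1 + 1 / \<epsilon>) * D2 + \<epsilon> * integral dom_I (\<lambda>x. (c * (1 - k x * hh x))\<^sup>2)"
    unfolding D2_def by (rule sup_sq_le[OF Dq ckh(1) x e])
  also have "\<dots> \<le> t\<^sup>2 / 2 + \<epsilon> * (2320 * A ^ 7)"
    using e by (intro add_mono key D_nonneg a_D2 mult_left_mono int_q'_sq) auto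
  finally show "\<bar>qq x\<bar> \<le> t" unfolding e2 by (intro fin) simp
qed

end

section \<open>The area multiplier under a length constraint\<close>

context elastic_ode begin

text \<open>\<open>X\<close> is the tangent turned back by the accumulated angle
  \<open>\<theta>\<close>, hence constant; periodicity of \<open>\<tau>\<close> then makes
  \<open>\<theta> (2 * pi)\<close> a multiple of \<open>2 * pi\<close>.\<close>

lemma turning: "\<exists>N::int. c * integral dom_I k = 2 * pi * N"
proof -
  define \<theta> where "\<theta> x = integral {0..x} (\<lambda>y. c * k y)" for x
  have d\<theta>: "(\<theta> has_real_derivative c * k x) (at x within dom_I)" if "x \<in> dom_I" for x
    unfolding \<theta>_def[abs_def] has_real_derivative_iff_has_vector_derivative
    using that by (intro integral_has_vector_derivative continuous_intros conts)
  define X where "X x = cos (\<theta> x) *\<^sub>R \<tau> x - sin (\<theta> x) *\<^sub>R rotJ (\<tau> x)" for x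
  have "(X has_vector_derivative 0) (at x within dom_I)" if x: "x \<in> dom_I" for x
  proof -
    have 1: "((\<lambda>x. cos (\<theta> x)) has_real_derivative - sin (\<theta> x) * (c * k x)) (at x within dom_I)"
      "((\<lambda>x. sin (\<theta> x)) has_real_derivative cos (\<theta> x) * (c * k x)) (at x within dom_I)"
      using d\<theta>[OF x] by (auto intro!: derivative_eq_intros)
    have "(X has_vector_derivative
      (cos (\<theta> x) *\<^sub>R ((c * k x) *\<^sub>R rotJ (\<tau> x)) + (- sin (\<theta> x) * (c * k x)) *\<^sub>R \<tau> x) -
      (sin (\<theta> x) *\<^sub>R rotJ ((c * k x) *\<^sub>R rotJ (\<tau> x)) + (cos (\<theta> x) * (c * k x)) *\<^sub>R rotJ (\<tau> x))) (at x within dom_I)"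
      unfolding X_def[abs_def]
      by (intro has_vector_derivative_diff has_vector_derivative_scaleR 1 D\<tau>[OF x]
        bounded_linear.has_vector_derivative[OF rotJ_bl])
    then show ?thesis by (simp add: rotJ_simps)
  qed
  from int_deriv[OF this] have "X (2 * pi) = X 0" by simp
  moreover have "X 0 = \<tau> 0" by (simp add: X_def \<theta>_def)
  ultimately have "X (2 * pi) \<bullet> \<tau> 0 = \<tau> 0 \<bullet> \<tau> 0" by simp
  then have "cos (\<theta> (2 * pi)) = 1" using \<tau>\<tau>[of 0] per(2) by (auto simp: X_def inner_diff_left)
  then obtain N :: int where "\<theta> (2 * pi) = N * 2 * pi" using cos_one_2pi_int by auto
  then show ?thesis by (intro exI[of _ N]) (simp add: \<theta>_def)
qed

text \<open>\<open>arctan (qq / hh)\<close> is the angle between the position vector and the normal; it is periodic when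
  \<open>hh\<close> has no zeros, so that the turning number is the winding number around the origin.\<close>

lemma int_k_winding:
  assumes nz: "\<And>x. x \<in> dom_I \<Longrightarrow> hh x \<noteq> 0"
  shows "integral dom_I k = integral dom_I (\<lambda>x. hh x / ((hh x)\<^sup>2 + (qq x)\<^sup>2))"
proof -
  have pos: "(hh x)\<^sup>2 + (qq x)\<^sup>2 \<noteq> 0" if "x \<in> dom_I" for x using nz[OF that] by simp
  have "((\<lambda>x. arctan (qq x / hh x)) has_real_derivative c * (hh x / ((hh x)\<^sup>2 + (qq x)\<^sup>2) - k x)) (at x within dom_I)"
    if x: "x \<in> dom_I" for x
  proof -
    have "((\<lambda>x. arctan (qq x / hh x)) has_real_derivative
      inverse (1 + (qq x / hh x)\<^sup>2) * ((c * (1 - k x * hh x) * hh x - qq x * (c * k x * qq x)) / (hh x * hh x))) (at x within dom_I)"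
      by (rule DERIV_chain2[OF DERIV_arctan]) (rule DERIV_divide[OF Dq[OF x] Dh[OF x] nz[OF x]])
    moreover have "inverse (1 + (qq x / hh x)\<^sup>2) * ((c * (1 - k x * hh x) * hh x - qq x * (c * k x * qq x)) / (hh x * hh x))
      = c * (hh x / ((hh x)\<^sup>2 + (qq x)\<^sup>2) - k x)"
    proof -
      have "1 + (qq x / hh x)\<^sup>2 = ((hh x)\<^sup>2 + (qq x)\<^sup>2) / (hh x * hh x)"
        using nz[OF x] by (simp add: power2_eq_square field_simps)
      then have "inverse (1 + (qq x / hh x)\<^sup>2) * ((c * (1 - k x * hh x) * hh x - qq x * (c * k x * qq x)) / (hh x * hh x))
        = (c * (1 - k x * hh x) * hh x - qq x * (c * k x * qq x)) / ((hh x)\<^sup>2 + (qq x)\<^sup>2)"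
        using nz[OF x] by simp
      also have "\<dots> = (c * hh x - c * k x * ((hh x)\<^sup>2 + (qq x)\<^sup>2)) / ((hh x)\<^sup>2 + (qq x)\<^sup>2)"
        by (simp add: power2_eq_square algebra_simps)
      also have "\<dots> = c * (hh x / ((hh x)\<^sup>2 + (qq x)\<^sup>2) - k x)"
        using pos[OF x] by (simp add: diff_divide_distrib right_diff_distrib)
      finally show ?thesis .
    qed
    ultimately show ?thesis by simp
  qed
  from int_rderiv[OF this] perh
  have "c * integral dom_I (\<lambda>x. hh x / ((hh x)\<^sup>2 + (qq x)\<^sup>2) - k x) = 0" by simp
  then show ?thesis using c0 pos by (subst (asm) int_diff) (auto intro!: continuous_intros conts)
qed

end

section \<open>Sup bounds for the state and the derivative of \<open>qq\<close>\<close>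

context bounded_ode_mean begin

lemma sup_W: assumes x: "x \<in> dom_I" shows "\<bar>W x\<bar> \<le> 116 * A ^ 5 + 64 * A\<^sup>2 * \<bar>a\<bar>"
proof -
  have 1: "integral dom_I (\<lambda>x. \<bar>W x\<bar>) \<le> 1 * (18 * A ^ 3) + 8 * 1"
  proof (rule int_le_const)
    fix x show "\<bar>W x\<bar> \<le> 1 * (ee x)\<^sup>2 + 1"
      using ee0(2)[of x] sum_squares_bound[of 1 "ee x"] ee0(1)[of x] by simp
  qed (auto intro!: continuous_intros conts)
  have 2: "integral dom_I (\<lambda>x. \<bar>c * (a * qq x + gg x)\<bar>) \<le> A\<^sup>2 * (18 * A ^ 3) + 8 * (8 * A\<^sup>2 * \<bar>a\<bar> + 9 * A ^ 5)"
  proof (rule int_le_const)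
    fix x assume x: "x \<in> dom_I"
    have "\<bar>a * qq x + gg x\<bar> \<le> \<bar>a\<bar> * (8 * A) + (A * (ee x)\<^sup>2 + 9 * A ^ 4)"
      using abs_mult_le[OF order_refl[of "\<bar>a\<bar>"] hq_A(2)[OF x]] gg_le[OF x] by linarith
    from abs_mult_le[OF _ this, of c A]
    have "\<bar>c * (a * qq x + gg x)\<bar> \<le> A * (\<bar>a\<bar> * (8 * A) + (A * (ee x)\<^sup>2 + 9 * A ^ 4))" using cA c0 by simp
    then show "\<bar>c * (a * qq x + gg x)\<bar> \<le> A\<^sup>2 * (ee x)\<^sup>2 + (8 * A\<^sup>2 * \<bar>a\<bar> + 9 * A ^ 5)"
      by (simp add: eval_nat_numeral algebra_simps)
  qed (use A0 in \<open>auto intro!: continuous_intros conts\<close>)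
  have "\<bar>W x\<bar> \<le> integral dom_I (\<lambda>x. \<bar>W x\<bar>) + integral dom_I (\<lambda>x. \<bar>c * (a * qq x + gg x)\<bar>)"
    by (rule sup_le_mean[OF DW' ckh(2) x])
  also have "\<dots> \<le> (18 * A ^ 3 + 8) + (A\<^sup>2 * (18 * A ^ 3) + 8 * (8 * A\<^sup>2 * \<bar>a\<bar> + 9 * A ^ 5))" using 1 2 by linarith
  also have "\<dots> = 18 * A ^ 3 + 8 + 90 * A ^ 5 + 64 * A\<^sup>2 * \<bar>a\<bar>" by (simp add: power_add[symmetric])
  also have "\<dots> \<le> 116 * A ^ 5 + 64 * A\<^sup>2 * \<bar>a\<bar>" using Apow[of 3 5] Apow[of 0 5] by simp
  finally show ?thesis .
qed

lemma U_le: "x \<in> dom_I \<Longrightarrow> \<bar>U x\<bar> \<le> 2 * A * ee x"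
proof -
  assume x: "x \<in> dom_I"
  have "U x = lam * S x + (\<delta> * W x) * pp x" using S_eq[OF x] by (simp add: pp_def)
  moreover have "\<bar>lam * S x\<bar> \<le> A * ee x" using lamA lam0 by (intro abs_mult_le ee0) simp
  moreover have "\<bar>(\<delta> * W x) * pp x\<bar> \<le> (A * ee x) * 1" by (intro abs_mult_le ee0 \<delta>A pn1 x)
  ultimately show ?thesis by linarith
qed

lemma U'_le: "x \<in> dom_I \<Longrightarrow> \<bar>- (c * \<delta> * W x * S x * nn x)\<bar> \<le> A\<^sup>2 * (ee x)\<^sup>2"
proof -
  assume x: "x \<in> dom_I"
  have "\<bar>c * ((\<delta> * W x * S x) * nn x)\<bar> \<le> A * ((A * (ee x)\<^sup>2) * 1)"
    by (intro abs_mult_le WS_le pn1 x) (use cA c0 in simp)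
  then show ?thesis by (simp add: power2_eq_square mult_ac)
qed

text \<open>The derivative of \<open>U\<close> does not contain \<open>a\<close>, so in contrast to
  \<open>sup_W\<close> the bound is free of it.\<close>

lemma sup_U: assumes x: "x \<in> dom_I" shows "\<bar>U x\<bar> \<le> 70 * A ^ 5"
proof -
  have 1: "integral dom_I (\<lambda>x. \<bar>U x\<bar>) \<le> (2 * A) * (18 * A ^ 3) + 8 * (2 * A)"
  proof (rule int_le_const)
    fix x assume "x \<in> dom_I"
    have "ee x \<le> (ee x)\<^sup>2 + 1" using sum_squares_bound[of 1 "ee x"] ee0(1)[of x] by simp
    from mult_left_mono[OF this, of "2 * A"] A0(1) U_le[OF \<open>x \<in> dom_I\<close>]
    show "\<bar>U x\<bar> \<le> 2 * A * (ee x)\<^sup>2 + 2 * A" by (simp add: algebra_simps)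
  qed (use A0 in \<open>auto intro!: continuous_intros conts\<close>)
  have cU': "continuous_on dom_I (\<lambda>x. - (c * \<delta> * W x * S x * nn x))" by (intro continuous_intros conts)
  have 2: "integral dom_I (\<lambda>x. \<bar>- (c * \<delta> * W x * S x * nn x)\<bar>) \<le> A\<^sup>2 * (18 * A ^ 3) + 8 * 0"
    by (rule int_le_const) (use U'_le A0 in \<open>auto intro!: continuous_intros cU' conts\<close>)
  have "\<bar>U x\<bar> \<le> integral dom_I (\<lambda>x. \<bar>U x\<bar>) + integral dom_I (\<lambda>x. \<bar>- (c * \<delta> * W x * S x * nn x)\<bar>)"
    by (rule sup_le_mean[OF DU' cU' x])
  also have "\<dots> \<le> ((2 * A) * (18 * A ^ 3) + 8 * (2 * A)) + (A\<^sup>2 * (18 * A ^ 3) + 8 * 0)" using 1 2 by linarith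
  also have "\<dots> = 36 * A ^ 4 + 16 * A ^ 1 + 18 * A ^ 5" by (simp add: eval_nat_numeral)
  also have "\<dots> \<le> 70 * A ^ 5" using Apow[of 4 5] Apow[of 1 5] by simp
  finally show ?thesis .
qed

text \<open>Eliminating \<open>S\<close> from its two linear relations with \<open>W\<close>,
  \<open>U\<close> and \<open>k\<close> gives \<open>k = W * bb - (\<delta> / lam) * U * pp\<close>.
  Below, \<open>pp'\<close> is the derivative of \<open>pp\<close>, and \<open>rest\<close> is what
  remains of the derivative of \<open>k * hh\<close> after the term with \<open>a\<close> is
  removed.\<close>

definition bb :: "real \<Rightarrow> real" where "bb x = 1 + (\<delta>\<^sup>2 / lam) * (pp x)\<^sup>2"
definition pp' :: "real \<Rightarrow> real" where "pp' x = c * (k x - S x) * nn x"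
definition rest :: "real \<Rightarrow> real" where
  "rest x = c * (gg x * (hh x * bb x)) + W x * ((c * k x * qq x) * bb x + hh x * ((\<delta>\<^sup>2 / lam) * (2 * pp x * pp' x)))
    - (\<delta> / lam) * (- (c * \<delta> * W x * S x * nn x) * (pp x * hh x) + U x * (pp' x * hh x) + U x * (pp x * (c * k x * qq x)))"

text \<open>Writing \<open>k hh\<close> as \<open>W hh bb\<close> plus lower order terms isolates the contribution of \<open>a\<close> to its
  derivative, which integrates against \<open>qq\<close> to a quantity of definite sign.\<close>

lemma kh_eq: "x \<in> dom_I \<Longrightarrow> k x * hh x = W x * (hh x * bb x) - (\<delta> / lam) * (U x * (pp x * hh x))"
proof -
  assume x: "x \<in> dom_I"
  have "k x = W x * bb x - (\<delta> / lam) * (U x * pp x)"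
    unfolding k_eq'[OF x] S_eq'[OF x] bb_def using lam0 by (simp add: power2_eq_square field_simps)
  note k = this
  show ?thesis unfolding k by (simp add: algebra_simps)
qed

lemma D_kh: "x \<in> dom_I \<Longrightarrow> ((\<lambda>x. W x * (hh x * bb x) - (\<delta> / lam) * (U x * (pp x * hh x))) has_real_derivative
    c * a * (qq x * (hh x * bb x)) + rest x) (at x within dom_I)"
proof -
  assume x: "x \<in> dom_I"
  note Dp' = Dp[OF x, folded pp'_def]
  have Db: "(bb has_real_derivative (\<delta>\<^sup>2 / lam) * (2 * pp x * pp' x)) (at x within dom_I)"
    unfolding bb_def[abs_def] using lam0 by (auto intro!: derivative_eq_intros Dp')
  show ?thesis
    by (rule derivative_eq_intros Db Dp' DW'[OF x] DU'[OF x] Dh[OF x] refl)+ (simp add: rest_def algebra_simps)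
qed

lemma bb_le: "x \<in> dom_I \<Longrightarrow> \<bar>bb x\<bar> \<le> 2 * A ^ 3"
proof -
  assume x: "x \<in> dom_I"
  have "\<delta>\<^sup>2 \<le> A\<^sup>2" using power_mono[OF \<delta>A, of 2] by simp
  then have "\<bar>\<delta>\<^sup>2 * (1 / lam)\<bar> \<le> A\<^sup>2 * A" using liA lam0 by (intro abs_mult_le) auto
  moreover have "\<bar>(pp x)\<^sup>2\<bar> \<le> 1" using pn1(1)[OF x] by (simp add: abs_square_le_1)
  ultimately have "\<bar>(\<delta>\<^sup>2 * (1 / lam)) * (pp x)\<^sup>2\<bar> \<le> A\<^sup>2 * A * 1" by (rule abs_mult_le)
  then have "\<bar>(\<delta>\<^sup>2 / lam) * (pp x)\<^sup>2\<bar> \<le> A ^ 3" by (simp add: eval_nat_numeral)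
  moreover have "1 \<le> A ^ 3" using Apow[of 0 3] by simp
  ultimately show ?thesis unfolding bb_def by linarith
qed

lemma \<delta>lam: "\<bar>\<delta>\<^sup>2 / lam\<bar> \<le> A ^ 3" "\<bar>\<delta> / lam\<bar> \<le> A\<^sup>2"
proof -
  have "\<delta>\<^sup>2 \<le> A\<^sup>2" using power_mono[OF \<delta>A, of 2] by simp
  then have "\<bar>\<delta>\<^sup>2 * (1 / lam)\<bar> \<le> A\<^sup>2 * A" using liA lam0 by (intro abs_mult_le) auto
  then show "\<bar>\<delta>\<^sup>2 / lam\<bar> \<le> A ^ 3" by (simp add: eval_nat_numeral)
  have "\<bar>\<delta> * (1 / lam)\<bar> \<le> A * A" using \<delta>A liA lam0 by (intro abs_mult_le) auto
  then show "\<bar>\<delta> / lam\<bar> \<le> A\<^sup>2" by (simp add: power2_eq_square)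
qed

lemma rest_le: assumes x: "x \<in> dom_I" shows "\<bar>rest x\<bar> \<le> 120 * A ^ 6 * (ee x)\<^sup>2 + 144 * A ^ 9"
proof -
  define e where "e = ee x"
  have e: "0 \<le> e" by (simp add: e_def ee0)
  have cc: "\<bar>c\<bar> \<le> A" using cA c0 by simp
  have p': "\<bar>pp' x\<bar> \<le> A * (2 * e) * 1" unfolding pp'_def
    using ee0[of x] by (intro abs_mult_le cc pn1 x) (auto simp: e_def ee_def)
  have b': "\<bar>(\<delta>\<^sup>2 / lam) * (2 * pp x * pp' x)\<bar> \<le> A ^ 3 * (2 * 1 * (A * (2 * e) * 1))"
    by (intro abs_mult_le \<delta>lam pn1 x p') simp
  have h': "\<bar>c * k x * qq x\<bar> \<le> A * e * (8 * A)" unfolding e_def by (intro abs_mult_le cc ee0 hq_A x)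
  note h = hq_A(1)[OF x] and b = bb_le[OF x] and U = U_le[OF x, folded e_def] and U' = U'_le[OF x, folded e_def]
  have W: "\<bar>W x\<bar> \<le> e" by (simp add: e_def ee0)
  have t1: "\<bar>c * (gg x * (hh x * bb x))\<bar> \<le> A * ((A * e\<^sup>2 + 9 * A ^ 4) * (8 * A * (2 * A ^ 3)))"
    unfolding e_def by (intro abs_mult_le cc gg_le h b x)
  have t2: "\<bar>W x * ((c * k x * qq x) * bb x + hh x * ((\<delta>\<^sup>2 / lam) * (2 * pp x * pp' x)))\<bar>
    \<le> e * (A * e * (8 * A) * (2 * A ^ 3) + 8 * A * (A ^ 3 * (2 * 1 * (A * (2 * e) * 1))))"
    by (intro abs_mult_le W order_trans[OF abs_triangle_ineq] add_mono h' b h b')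
  have t3: "\<bar>(\<delta> / lam) * (- (c * \<delta> * W x * S x * nn x) * (pp x * hh x) + U x * (pp' x * hh x) + U x * (pp x * (c * k x * qq x)))\<bar>
    \<le> A\<^sup>2 * (A\<^sup>2 * e\<^sup>2 * (1 * (8 * A)) + 2 * A * e * ((A * (2 * e) * 1) * (8 * A)) + 2 * A * e * (1 * (A * e * (8 * A))))"
    by (intro abs_mult_le \<delta>lam order_trans[OF abs_triangle_ineq] add_mono U U' pn1 x h h' p')
  have s1: "A * ((A * e\<^sup>2 + 9 * A ^ 4) * (8 * A * (2 * A ^ 3))) = 16 * (A ^ 6 * e\<^sup>2) + 144 * A ^ 9"
    by (simp add: eval_nat_numeral algebra_simps)
  have s2: "e * (A * e * (8 * A) * (2 * A ^ 3) + 8 * A * (A ^ 3 * (2 * 1 * (A * (2 * e) * 1)))) = 48 * (A ^ 5 * e\<^sup>2)"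
    by (simp add: eval_nat_numeral algebra_simps)
  have s3: "A\<^sup>2 * (A\<^sup>2 * e\<^sup>2 * (1 * (8 * A)) + 2 * A * e * ((A * (2 * e) * 1) * (8 * A)) + 2 * A * e * (1 * (A * e * (8 * A))))
     = 56 * (A ^ 5 * e\<^sup>2)"
    by (simp add: eval_nat_numeral algebra_simps)
  have "A ^ 5 * e\<^sup>2 \<le> A ^ 6 * e\<^sup>2" by (intro mult_right_mono Apow) auto
  moreover have tri: "\<bar>u + v - w\<bar> \<le> \<bar>u\<bar> + \<bar>v\<bar> + \<bar>w\<bar>" for u v w :: real by linarith
  have "\<bar>rest x\<bar> \<le> (16 * (A ^ 6 * e\<^sup>2) + 144 * A ^ 9) + 48 * (A ^ 5 * e\<^sup>2) + 56 * (A ^ 5 * e\<^sup>2)"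
    unfolding rest_def
    by (rule order_trans[OF tri]) (intro add_mono t1[unfolded s1] t2[unfolded s2] t3[unfolded s3])
  ultimately have "\<bar>rest x\<bar> \<le> 120 * (A ^ 6 * e\<^sup>2) + 144 * A ^ 9" by linarith
  then show ?thesis by (simp add: e_def)
qed

lemma c_rest: "continuous_on dom_I rest" and c_bb: "continuous_on dom_I bb" and c_pp': "continuous_on dom_I pp'"
proof -
  show bb: "continuous_on dom_I bb" unfolding bb_def[abs_def] using lam0 by (intro continuous_intros conts) auto
  show pp': "continuous_on dom_I pp'" unfolding pp'_def[abs_def] by (intro continuous_intros conts)
  show "continuous_on dom_I rest" unfolding rest_def[abs_def] by (intro continuous_intros conts bb pp') (use lam0 in auto)
qed

text \<open>The derivative \<open>c * (1 - k * hh)\<close> of \<open>qq\<close> has mean zero, so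
  its mean square is \<open>- c\<close> times the integral of its product with
  \<open>k * hh\<close>. Integration by parts puts the derivative on \<open>k * hh\<close>: the
  result is \<open>qq\<close> times a multiple of \<open>a * qq\<close>, which gives
  \<open>\<bar>a\<bar> * D2\<close>, and \<open>qq\<close> times \<open>rest\<close>, which gives
  the factor \<open>t\<close>.\<close>

lemma int_q'_small:
  assumes t: "\<And>x. x \<in> dom_I \<Longrightarrow> \<bar>qq x\<bar> \<le> t"
  shows "integral dom_I (\<lambda>x. (c * (1 - k x * hh x))\<^sup>2) \<le> 16 * A ^ 6 * (\<bar>a\<bar> * D2) + 3312 * A ^ 10 * t"
proof -
  let ?q' = "\<lambda>x. c * (1 - k x * hh x)"
  let ?F = "\<lambda>x. W x * (hh x * bb x) - (\<delta> / lam) * (U x * (pp x * hh x))"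
  let ?F' = "\<lambda>x. c * a * (qq x * (hh x * bb x)) + rest x"
  have t0: "0 \<le> t" using t[of 0] by simp
  have cF': "continuous_on dom_I ?F'" by (intro continuous_intros conts c_bb c_rest)
  have pF: "?F 0 = ?F (2 * pi)" by (simp add: bb_def perh per)
  have ip: "integral dom_I (\<lambda>x. qq x * ?F' x) = - integral dom_I (\<lambda>x. ?q' x * ?F x)"
    by (rule int_parts[OF Dq ckh(1) perh(2) D_kh cF' pF])
  have q0: "integral dom_I ?q' = 0" using int_rderiv[OF Dq] perh by simp
  have "integral dom_I (\<lambda>x. (?q' x)\<^sup>2) = integral dom_I (\<lambda>x. c * ?q' x - c * (?q' x * ?F x))"
  proof (rule int_cong)
    fix x assume x: "x \<in> dom_I"
    show "(?q' x)\<^sup>2 = c * ?q' x - c * (?q' x * ?F x)"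
      unfolding kh_eq[OF x, symmetric] by (simp add: power2_eq_square algebra_simps)
  qed
  also have "\<dots> = c * integral dom_I ?q' - c * integral dom_I (\<lambda>x. ?q' x * ?F x)"
    by (subst int_diff) (use lam0 in \<open>auto intro!: continuous_intros conts c_bb simp: mult.assoc\<close>)
  also have "\<dots> = c * integral dom_I (\<lambda>x. qq x * ?F' x)" unfolding q0 ip by simp
  finally have e: "integral dom_I (\<lambda>x. (?q' x)\<^sup>2) = c * integral dom_I (\<lambda>x. qq x * ?F' x)" .
  have "integral dom_I (\<lambda>x. qq x * ?F' x) \<le> integral dom_I (\<lambda>x. (16 * A ^ 5 * \<bar>a\<bar>) * (qq x)\<^sup>2 + t * (120 * A ^ 6 * (ee x)\<^sup>2 + 144 * A ^ 9))"
  proof (intro int_mono continuous_intros conts ce c_bb c_rest)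
    fix x assume x: "x \<in> dom_I"
    have "\<bar>c * \<bar>a\<bar> * (hh x * bb x)\<bar> \<le> A * \<bar>a\<bar> * (8 * A * (2 * A ^ 3))"
      by (intro abs_mult_le hq_A bb_le x) (use cA c0 in auto)
    then have "\<bar>c * a * (hh x * bb x)\<bar> \<le> 16 * A ^ 5 * \<bar>a\<bar>"
      by (simp add: abs_mult eval_nat_numeral mult_ac)
    from mult_right_mono[OF this, of "(qq x)\<^sup>2"]
    have "\<bar>(c * a * (hh x * bb x)) * (qq x)\<^sup>2\<bar> \<le> (16 * A ^ 5 * \<bar>a\<bar>) * (qq x)\<^sup>2" by (simp add: abs_mult)
    moreover have "\<bar>qq x * rest x\<bar> \<le> t * (120 * A ^ 6 * (ee x)\<^sup>2 + 144 * A ^ 9)"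
      by (rule abs_mult_le[OF t[OF x] rest_le[OF x]])
    moreover have "qq x * ?F' x = (c * a * (hh x * bb x)) * (qq x)\<^sup>2 + qq x * rest x"
      by (simp add: power2_eq_square algebra_simps)
    ultimately show "qq x * ?F' x \<le> (16 * A ^ 5 * \<bar>a\<bar>) * (qq x)\<^sup>2 + t * (120 * A ^ 6 * (ee x)\<^sup>2 + 144 * A ^ 9)" by linarith
  qed
  also have "\<dots> = (16 * A ^ 5 * \<bar>a\<bar>) * D2 + t * integral dom_I (\<lambda>x. 120 * A ^ 6 * (ee x)\<^sup>2 + 144 * A ^ 9)"
    unfolding D2_def integral_mult_right[symmetric] by (rule int_add; intro continuous_intros conts ce)
  also have "\<dots> \<le> (16 * A ^ 5 * \<bar>a\<bar>) * D2 + t * ((120 * A ^ 6) * (18 * A ^ 3) + 8 * (144 * A ^ 9))"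
    using t0 A0 by (intro add_left_mono mult_left_mono int_le_const) (auto intro!: continuous_intros ce)
  also have "(120 * A ^ 6) * (18 * A ^ 3) + 8 * (144 * A ^ 9) = 3312 * A ^ 9" by (simp add: power_add[symmetric])
  finally have b: "integral dom_I (\<lambda>x. qq x * ?F' x) \<le> (16 * A ^ 5 * \<bar>a\<bar>) * D2 + t * (3312 * A ^ 9)" .
  have "integral dom_I (\<lambda>x. (?q' x)\<^sup>2) \<le> c * ((16 * A ^ 5 * \<bar>a\<bar>) * D2 + t * (3312 * A ^ 9))"
    unfolding e using b c0 by (intro mult_left_mono) auto
  also have "\<dots> \<le> A * ((16 * A ^ 5 * \<bar>a\<bar>) * D2 + t * (3312 * A ^ 9))"
    using cA A0 t0 D_nonneg by (intro mult_right_mono) auto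
  also have "\<dots> = 16 * A ^ 6 * (\<bar>a\<bar> * D2) + 3312 * A ^ 10 * t" by (simp add: eval_nat_numeral algebra_simps)
  finally show ?thesis .
qed

end

lemma int_sq_zero:
  fixes f :: "real \<Rightarrow> real"
  assumes "continuous_on dom_I f" "integral dom_I (\<lambda>x. (f x)\<^sup>2) \<le> 0" "x \<in> dom_I"
  shows "f x = 0"
proof -
  have c: "continuous_on dom_I (\<lambda>x. (f x)\<^sup>2)" by (intro continuous_intros assms)
  have "0 \<le> integral dom_I (\<lambda>x. (f x)\<^sup>2)" by (rule int_nonneg[OF c]) simp
  then have "((\<lambda>x. (f x)\<^sup>2) has_integral 0) dom_I"
    using integrable_integral[OF integrable_continuous_interval[OF c]] assms(2) by simp
  then have "(f x)\<^sup>2 = 0"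
    using assms(3) c pi_gt_zero by (intro has_integral_0_cbox_imp_0[of 0 "2 * pi" "\<lambda>x. (f x)\<^sup>2"]) (auto simp del: pi_gt_zero)
  then show ?thesis by simp
qed

text \<open>The witness is the distance from \<open>y\<close> to the nearest multiple of
  \<open>2 * pi\<close> other than \<open>y\<close>. In the application \<open>y\<close> is
  \<open>2 * pi * c / R\<close>, so the gap depends on the data and is chosen before any
  curve.\<close>

lemma integer_gap: "\<exists>d>0. \<forall>N::int. \<bar>2 * pi * N - y\<bar> < d \<longrightarrow> 2 * pi * N = y"
proof -
  define z where "z = y / (2 * pi)"
  have y: "y = 2 * pi * z" by (simp add: z_def)
  define d where "d = (if z = of_int \<lfloor>z\<rfloor> then 1 else min (z - of_int \<lfloor>z\<rfloor>) (of_int \<lfloor>z\<rfloor> + 1 - z))"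
  have d: "d > 0"
  proof (cases "z = of_int \<lfloor>z\<rfloor>")
    case False
    moreover have "of_int \<lfloor>z\<rfloor> \<le> z" "z < of_int \<lfloor>z\<rfloor> + 1" by linarith+
    ultimately show ?thesis unfolding d_def by (simp add: less_le)
  qed (simp add: d_def)
  have key: "real_of_int N = z" if N: "\<bar>N - z\<bar> < d" for N :: int
  proof (cases "z = of_int \<lfloor>z\<rfloor>")
    case True
    then have "\<bar>real_of_int N - of_int \<lfloor>z\<rfloor>\<bar> < 1" using N by (simp add: d_def)
    then have "N = \<lfloor>z\<rfloor>" by linarith
    then show ?thesis using True by simp
  next
    case False
    then have *: "\<bar>real_of_int N - z\<bar> < z - of_int \<lfloor>z\<rfloor>" "\<bar>real_of_int N - z\<bar> < of_int \<lfloor>z\<rfloor> + 1 - z" using N by (auto simp: d_def)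
    have "N \<le> \<lfloor>z\<rfloor> \<or> \<lfloor>z\<rfloor> + 1 \<le> N" by linarith
    then show ?thesis
    proof
      assume "N \<le> \<lfloor>z\<rfloor>"
      then have "real_of_int N \<le> of_int \<lfloor>z\<rfloor>" by simp
      then show ?thesis using *(1) by linarith
    next
      assume "\<lfloor>z\<rfloor> + 1 \<le> N"
      then have "real_of_int (\<lfloor>z\<rfloor> + 1) \<le> of_int N" by (simp only: of_int_le_iff)
      then show ?thesis using *(2) by simp
    qed
  qed
  show ?thesis
  proof (intro exI[of _ "2 * pi * d"] conjI allI impI)
    show "0 < 2 * pi * d" using d by simp
    fix N :: int assume "\<bar>2 * pi * N - y\<bar> < 2 * pi * d"
    then have "\<bar>2 * pi * (N - z)\<bar> < 2 * pi * d" by (simp add: y right_diff_distrib)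
    then have "\<bar>real_of_int N - z\<bar> < d" by (simp add: abs_mult)
    from key[OF this] show "2 * pi * N = y" by (simp add: y)
  qed
qed

text \<open>The factor of \<open>t\<close> in \<open>deficit_le\<close>. The 16 comes from
  \<open>D1\<close> and \<open>D2\<close> with \<open>8 * t\<close> each; the rest is
  \<open>A ^ 4\<close> times the bound on the mean square of \<open>k - 1 / R\<close>. Its innermost
  product combines the constants of \<open>D2_le\<close> and \<open>a_D1\<close>, and is then
  inserted into \<open>int_q'_small\<close>.\<close>

definition gap_const :: "real \<Rightarrow> real \<Rightarrow> real" where
  "gap_const A R = 16 + A ^ 4 * ((2 * A + 2 * A\<^sup>2 * (16 * A ^ 6 * (2048 * A ^ 3 / \<bar>R\<bar> ^ 3 * (210 * A ^ 4)) + 3312 * A ^ 10)) / R\<^sup>2)"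

section \<open>Curves close to a circle\<close>

context bounded_ode_mean begin

context
  fixes t d :: real
  assumes t: "0 < t" "t \<le> 1" "2 * t \<le> \<bar>R\<bar>"
    and sm: "\<And>x. x \<in> dom_I \<Longrightarrow> \<bar>hh x - R\<bar> \<le> t" "\<And>x. x \<in> dom_I \<Longrightarrow> \<bar>qq x\<bar> \<le> t"
    and d: "\<And>N::int. \<bar>2 * pi * N - 2 * pi * c / R\<bar> < d \<Longrightarrow> 2 * pi * N = 2 * pi * c / R"
    and td: "32 * A * t < d * R\<^sup>2"
begin

lemma Rnz: "R \<noteq> 0" "0 < \<bar>R\<bar>" "0 < R\<^sup>2" using t by auto

lemma Rh: assumes x: "x \<in> dom_I" shows "R\<^sup>2 / 2 \<le> R * hh x" "\<bar>R\<bar> / 2 \<le> \<bar>hh x\<bar>" "hh x \<noteq> 0"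
proof -
  have "\<bar>R * (R - hh x)\<bar> \<le> \<bar>R\<bar> * (\<bar>R\<bar> / 2)"
  proof -
    have "\<bar>R - hh x\<bar> \<le> \<bar>R\<bar> / 2" using sm(1)[OF x] t by linarith
    then show ?thesis unfolding abs_mult by (rule mult_left_mono) simp
  qed
  also have "\<dots> = R\<^sup>2 / 2" by (simp add: power2_eq_square)
  finally have "R * (R - hh x) \<le> R\<^sup>2 / 2" by (rule order_trans[OF abs_ge_self])
  moreover have "R * (R - hh x) = R\<^sup>2 - R * hh x" by (simp add: right_diff_distrib power2_eq_square)
  ultimately show 1: "R\<^sup>2 / 2 \<le> R * hh x" by linarith
  show 2: "\<bar>R\<bar> / 2 \<le> \<bar>hh x\<bar>" using sm(1)[OF x] t by linarith
  show "hh x \<noteq> 0" using 2 Rnz by auto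
qed

lemma rpos: assumes x: "x \<in> dom_I" shows "0 < (hh x)\<^sup>2 + (qq x)\<^sup>2"
  using Rh(3)[OF x] by (simp add: add_pos_nonneg)

text \<open>Near a circle the winding integrand differs from \<open>1 / R\<close> by at most
  \<open>4 * t / R\<^sup>2\<close>, so \<open>c\<close> times the total curvature is within
  \<open>32 * A * t / R\<^sup>2 < d\<close> of \<open>2 * pi * c / R\<close>. Being a multiple of
  \<open>2 * pi\<close>, it must equal that value.\<close>

lemma turning_eq: "integral dom_I k = 2 * pi / R"
proof -
  have c: "continuous_on dom_I (\<lambda>x. hh x / ((hh x)\<^sup>2 + (qq x)\<^sup>2))"
    using rpos by (intro continuous_intros conts) force
  have "\<bar>integral dom_I (\<lambda>x. hh x / ((hh x)\<^sup>2 + (qq x)\<^sup>2) - 1 / R)\<bar> \<le> integral dom_I (\<lambda>x. 4 * t / R\<^sup>2)"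
  proof (rule int_abs_le)
    fix x assume x: "x \<in> dom_I"
    define r where "r = (hh x)\<^sup>2 + (qq x)\<^sup>2"
    have r: "r > 0" "(hh x)\<^sup>2 \<le> r" using rpos[OF x] by (auto simp: r_def)
    \<comment> \<open>This bounds \<open>qq x * qq x\<close> by \<open>\<bar>hh x\<bar> * t\<close>,
      so that a factor \<open>\<bar>hh x\<bar>\<close> can be cancelled from the whole
      quotient.\<close>
    have th: "t \<le> \<bar>hh x\<bar>" using Rh(2)[OF x] t by linarith
    have "hh x / r - 1 / R = (hh x * (R - hh x) - qq x * qq x) / (r * R)"
      using r Rnz by (simp add: field_simps) (simp add: r_def power2_eq_square)
    also have "\<bar>\<dots>\<bar> = \<bar>hh x * (R - hh x) - qq x * qq x\<bar> / (r * \<bar>R\<bar>)" using r by (simp add: abs_mult)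
    also have "\<dots> \<le> (2 * t * \<bar>hh x\<bar>) / ((hh x)\<^sup>2 * \<bar>R\<bar>)"
    proof (rule frac_le)
      have "\<bar>hh x * (R - hh x)\<bar> \<le> \<bar>hh x\<bar> * t" unfolding abs_mult using sm(1)[OF x] by (intro mult_left_mono) auto
      moreover have "\<bar>qq x * qq x\<bar> \<le> \<bar>hh x\<bar> * t"
        unfolding abs_mult using sm(2)[OF x] th by (intro mult_mono) auto
      ultimately have "\<bar>hh x * (R - hh x) - qq x * qq x\<bar> \<le> \<bar>hh x\<bar> * t + \<bar>hh x\<bar> * t"
        by (intro order_trans[OF abs_triangle_ineq4] add_mono)
      then show "\<bar>hh x * (R - hh x) - qq x * qq x\<bar> \<le> 2 * t * \<bar>hh x\<bar>" by (simp add: mult_ac)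
      show "0 < (hh x)\<^sup>2 * \<bar>R\<bar>" using Rh(3)[OF x] Rnz by simp
      show "(hh x)\<^sup>2 * \<bar>R\<bar> \<le> r * \<bar>R\<bar>" using r by (intro mult_right_mono) auto
    qed (use t in auto)
    also have "\<dots> = (2 * t) / (\<bar>hh x\<bar> * \<bar>R\<bar>)"
    proof -
      have *: "(2 * t * u) / (u * u * v) = (2 * t) / (u * v)" if "u \<noteq> 0" for u v :: real using that by simp
      have "(hh x)\<^sup>2 = \<bar>hh x\<bar> * \<bar>hh x\<bar>" by (simp add: power2_eq_square)
      then show ?thesis using *[of "\<bar>hh x\<bar>" "\<bar>R\<bar>"] Rh(3)[OF x] by (simp only: abs_eq_0_iff simp_thms)
    qed
    also have "\<dots> \<le> (2 * t) / (\<bar>R\<bar> / 2 * \<bar>R\<bar>)"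
      using Rh(2)[OF x] Rnz t by (intro divide_left_mono mult_right_mono mult_pos_pos) auto
    also have "\<dots> = 4 * t / R\<^sup>2" by (simp add: power2_eq_square)
    finally show "\<bar>hh x / ((hh x)\<^sup>2 + (qq x)\<^sup>2) - 1 / R\<bar> \<le> 4 * t / R\<^sup>2" unfolding r_def .
  qed (intro continuous_intros c; use Rnz in auto)+
  moreover have "integral dom_I (\<lambda>x. hh x / ((hh x)\<^sup>2 + (qq x)\<^sup>2) - 1 / R) = integral dom_I k - 2 * pi / R"
  proof -
    have "integral dom_I (\<lambda>x. hh x / ((hh x)\<^sup>2 + (qq x)\<^sup>2) - 1 / R) =
      integral dom_I (\<lambda>x. hh x / ((hh x)\<^sup>2 + (qq x)\<^sup>2)) - integral dom_I (\<lambda>x. 1 / R)"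
      by (rule int_diff[OF c]) (use Rnz in \<open>auto intro!: continuous_intros\<close>)
    also have "integral dom_I (\<lambda>x. hh x / ((hh x)\<^sup>2 + (qq x)\<^sup>2)) = integral dom_I k"
      by (rule int_k_winding[OF Rh(3), symmetric])
    finally show ?thesis by simp
  qed
  ultimately have "\<bar>integral dom_I k - 2 * pi / R\<bar> \<le> 2 * pi * (4 * t / R\<^sup>2)" by simp
  also have "\<dots> \<le> 8 * (4 * t / R\<^sup>2)" using twopi t by (intro mult_right_mono) auto
  finally have "\<bar>integral dom_I k - 2 * pi / R\<bar> \<le> 8 * (4 * t / R\<^sup>2)" .
  from abs_mult_le[OF _ this, of c A] have "\<bar>c * (integral dom_I k - 2 * pi / R)\<bar> \<le> A * (8 * (4 * t / R\<^sup>2))"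
    using cA c0 by simp
  also have "\<dots> = 32 * A * t / R\<^sup>2" by simp
  also have "\<dots> < d" using td Rnz by (simp add: divide_less_eq)
  finally have l: "\<bar>c * integral dom_I k - 2 * pi * c / R\<bar> < d" by (simp add: right_diff_distrib mult_ac)
  obtain N :: int where N: "c * integral dom_I k = 2 * pi * N" using turning by blast
  have "2 * pi * N = 2 * pi * c / R" by (rule d) (use l N in simp)
  then have "c * integral dom_I k = c * (2 * pi / R)" using N by simp
  then show ?thesis using c0 by (simp only: mult_left_cancel[OF less_imp_neq[OF c0, symmetric]])
qed

text \<open>By the exact equality in \<open>turning_eq\<close> the function
  \<open>1 - R * hh / (hh\<^sup>2 + qq\<^sup>2)\<close> has mean zero, and so has
  \<open>hh - R\<close>. Their combination is \<open>?u - ?v\<close>, where \<open>?u\<close> is a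
  positive weight times the square of \<open>qq\<close> and \<open>?v\<close> one times the square
  of \<open>hh - R\<close>. Thus \<open>\<bar>a\<bar> * D2\<close> inherits the small factor from
  \<open>\<bar>a\<bar> * D1\<close>.\<close>

lemma D2_le: "D2 \<le> 2048 * A ^ 3 / \<bar>R\<bar> ^ 3 * D1"
proof -
  let ?u = "\<lambda>x. R\<^sup>2 * (qq x)\<^sup>2 / ((R * hh x) * ((hh x)\<^sup>2 + (qq x)\<^sup>2))"
  let ?v = "\<lambda>x. (hh x - R)\<^sup>2 / (R * hh x)"
  have nz: "R * hh x \<noteq> 0" "(hh x)\<^sup>2 + (qq x)\<^sup>2 \<noteq> 0" if "x \<in> dom_I" for x
    using Rh(3)[OF that] Rnz rpos[OF that] by auto
  have cu: "continuous_on dom_I ?u" using nz by (intro continuous_intros conts) auto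
  have cv: "continuous_on dom_I ?v" using nz by (intro continuous_intros conts) auto
  have cr: "continuous_on dom_I (\<lambda>x. hh x / ((hh x)\<^sup>2 + (qq x)\<^sup>2))" using nz by (intro continuous_intros conts) auto
  have "integral dom_I (\<lambda>x. ?u x - ?v x) = integral dom_I (\<lambda>x. (1 - R * (hh x / ((hh x)\<^sup>2 + (qq x)\<^sup>2))) - (1 / R) * (hh x - R))"
  proof (rule int_cong)
    fix x assume x: "x \<in> dom_I"
    define r where "r = (hh x)\<^sup>2 + (qq x)\<^sup>2"
    have r: "r \<noteq> 0" using nz[OF x] by (simp add: r_def)
    have "?u x = R\<^sup>2 * (r - (hh x)\<^sup>2) / ((R * hh x) * r)" by (simp add: r_def)
    also have "\<dots> = R / hh x - R * (hh x / r)"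
      using r Rh(3)[OF x] Rnz(1) by (simp add: field_simps power2_eq_square)
    finally have u: "?u x = R / hh x - R * (hh x / r)" .
    have v: "?v x = R / hh x - 2 + hh x / R"
      using Rh(3)[OF x] Rnz by (simp add: field_simps power2_eq_square)
    show "?u x - ?v x = (1 - R * (hh x / ((hh x)\<^sup>2 + (qq x)\<^sup>2))) - (1 / R) * (hh x - R)"
      unfolding u v unfolding r_def[symmetric] using Rnz by (simp add: right_diff_distrib)
  qed
  also have "\<dots> = integral dom_I (\<lambda>x. 1 - R * (hh x / ((hh x)\<^sup>2 + (qq x)\<^sup>2))) - (1 / R) * integral dom_I (\<lambda>x. hh x - R)"
    unfolding integral_mult_right[symmetric] by (rule int_diff; intro continuous_intros conts cr; use Rnz nz in auto)
  also have "\<dots> = 0"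
  proof -
    have "integral dom_I (\<lambda>x. 1 - R * (hh x / ((hh x)\<^sup>2 + (qq x)\<^sup>2))) = 2 * pi - R * integral dom_I (\<lambda>x. hh x / ((hh x)\<^sup>2 + (qq x)\<^sup>2))"
      unfolding integral_mult_right[symmetric] by (subst int_diff) (use cr nz in \<open>auto intro!: continuous_intros conts\<close>)
    moreover have "integral dom_I (\<lambda>x. hh x / ((hh x)\<^sup>2 + (qq x)\<^sup>2)) = 2 * pi / R"
      using int_k_winding[OF Rh(3)] turning_eq by (rule trans[OF sym])
    ultimately show ?thesis unfolding int_hR using Rnz by (simp only:) simp
  qed
  finally have uv: "integral dom_I ?u = integral dom_I ?v" using int_diff[OF cu cv] by simp
  \<comment> \<open>The denominator of \<open>?u\<close> is at most
    \<open>(\<bar>R\<bar> * (8 * A)) * (128 * A\<^sup>2)\<close>, whence 1024.\<close>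
  have "(\<bar>R\<bar> / (1024 * A ^ 3)) * D2 \<le> integral dom_I ?u"
    unfolding D2_def integral_mult_right[symmetric]
  proof (rule int_mono)
    fix x assume x: "x \<in> dom_I"
    have Rhp: "0 < R * hh x" using Rh(1)[OF x] Rnz by linarith
    have 1: "R * hh x \<le> \<bar>R\<bar> * (8 * A)" using abs_mult_le[OF order_refl[of "\<bar>R\<bar>"] hq_A(1)[OF x]] by linarith
    have "(hh x)\<^sup>2 \<le> (8 * A)\<^sup>2" "(qq x)\<^sup>2 \<le> (8 * A)\<^sup>2" 
      by (subst power2_le_iff_abs_le; use hq_A[OF x] A0 in simp)+
    then have 2: "(hh x)\<^sup>2 + (qq x)\<^sup>2 \<le> 128 * A\<^sup>2" by (simp add: power_mult_distrib)
    have "R\<^sup>2 * (qq x)\<^sup>2 / ((\<bar>R\<bar> * (8 * A)) * (128 * A\<^sup>2)) \<le> ?u x"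
    proof (rule divide_left_mono)
      show "(R * hh x) * ((hh x)\<^sup>2 + (qq x)\<^sup>2) \<le> (\<bar>R\<bar> * (8 * A)) * (128 * A\<^sup>2)"
        by (rule mult_mono[OF 1 2]) (use A0 rpos[OF x] in auto)
      have "0 < (R * hh x) * ((hh x)\<^sup>2 + (qq x)\<^sup>2)" by (rule mult_pos_pos[OF Rhp rpos[OF x]])
      moreover have "0 < (\<bar>R\<bar> * (8 * A)) * (128 * A\<^sup>2)" using Rnz A0 by simp
      ultimately show "0 < (\<bar>R\<bar> * (8 * A)) * (128 * A\<^sup>2) * ((R * hh x) * ((hh x)\<^sup>2 + (qq x)\<^sup>2))"
        by (rule mult_pos_pos[rotated])
    qed simp
    moreover have "R\<^sup>2 * (qq x)\<^sup>2 / ((\<bar>R\<bar> * (8 * A)) * (128 * A\<^sup>2)) = (\<bar>R\<bar> / (1024 * A ^ 3)) * (qq x)\<^sup>2"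
      using Rnz A0(2) by (simp add: field_simps power2_eq_square power3_eq_cube)
    ultimately show "(\<bar>R\<bar> / (1024 * A ^ 3)) * (qq x)\<^sup>2 \<le> ?u x" by simp
  qed (intro continuous_intros conts cu; use A0 in auto)+
  also have "\<dots> \<le> (2 / R\<^sup>2) * D1"
    unfolding uv D1_def integral_mult_right[symmetric]
  proof (rule int_mono[OF cv])
    fix x assume x: "x \<in> dom_I"
    have "?v x \<le> (hh x - R)\<^sup>2 / (R\<^sup>2 / 2)"
    proof (rule divide_left_mono[OF Rh(1)[OF x]])
      have 1: "0 < R\<^sup>2 / 2" using Rnz by simp
      then have "0 < R * hh x" using Rh(1)[OF x] by linarith
      from mult_pos_pos[OF this 1] show "0 < R * hh x * (R\<^sup>2 / 2)" .
    qed simp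
    then show "?v x \<le> (2 / R\<^sup>2) * (hh x - R)\<^sup>2" by (simp add: mult.commute)
  qed (intro continuous_intros conts; use Rnz in auto)
  finally have "(\<bar>R\<bar> / (1024 * A ^ 3)) * D2 \<le> (2 / R\<^sup>2) * D1" .
  then have "(1024 * A ^ 3 / \<bar>R\<bar>) * ((\<bar>R\<bar> / (1024 * A ^ 3)) * D2) \<le> (1024 * A ^ 3 / \<bar>R\<bar>) * ((2 / R\<^sup>2) * D1)"
    using A0 by (intro mult_left_mono) auto
  moreover have "(1024 * A ^ 3 / \<bar>R\<bar>) * ((\<bar>R\<bar> / (1024 * A ^ 3)) * D2) = D2" using Rnz A0(2) by simp
  moreover have "(1024 * A ^ 3 / \<bar>R\<bar>) * ((2 / R\<^sup>2) * D1) = 2048 * A ^ 3 / \<bar>R\<bar> ^ 3 * D1"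
    by (simp add: power3_eq_cube power2_eq_square field_simps)
  ultimately show ?thesis by simp
qed

text \<open>The left hand side is fixed by the data, whereas the right hand side tends to zero as \<open>a\<close>
  grows: so it would have to vanish, which forces constant curvature.\<close>

lemma deficit_eq:
  "integral dom_I (\<lambda>x. (norm (\<gamma> x))\<^sup>2) + c ^ 4 * integral dom_I (\<lambda>x. (k x)\<^sup>2) - (2 * pi * R\<^sup>2 + c ^ 4 * (2 * pi / R\<^sup>2))
    = D1 + D2 + c ^ 4 * integral dom_I (\<lambda>x. (k x - 1 / R)\<^sup>2)"
proof -
  have "integral dom_I (\<lambda>x. (norm (\<gamma> x))\<^sup>2) = integral dom_I (\<lambda>x. ((hh x - R)\<^sup>2 + (qq x)\<^sup>2) + (2 * R * hh x - R\<^sup>2))"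
  proof (rule int_cong)
    fix x assume x: "x \<in> dom_I"
    have "(norm (\<gamma> x))\<^sup>2 = (qq x)\<^sup>2 + (hh x)\<^sup>2"
      unfolding power2_norm_eq_inner frame_inner[OF \<tau>1[OF x], of "\<gamma> x" "\<gamma> x"]
      by (simp add: qq_def hh_def rotJ_swap[of "\<gamma> x"] power2_eq_square)
    then show "(norm (\<gamma> x))\<^sup>2 = ((hh x - R)\<^sup>2 + (qq x)\<^sup>2) + (2 * R * hh x - R\<^sup>2)"
      by (simp add: power2_eq_square algebra_simps)
  qed
  also have "\<dots> = (D1 + D2) + (2 * R * integral dom_I hh - 2 * pi * R\<^sup>2)"
    unfolding D1_def D2_def by (simp add: int_add int_diff continuous_intros conts)
  finally have 1: "integral dom_I (\<lambda>x. (norm (\<gamma> x))\<^sup>2) = D1 + D2 + 2 * pi * R\<^sup>2"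
    by (simp add: int_h power2_eq_square)
  have "integral dom_I (\<lambda>x. (k x)\<^sup>2) = integral dom_I (\<lambda>x. (k x - 1 / R)\<^sup>2 + ((2 / R) * k x - 1 / R\<^sup>2))"
    by (rule int_cong) (use Rnz in \<open>simp add: field_simps power2_eq_square\<close>)
  also have "\<dots> = integral dom_I (\<lambda>x. (k x - 1 / R)\<^sup>2) + ((2 / R) * integral dom_I k - 2 * pi * (1 / R\<^sup>2))"
  proof -
    have "continuous_on dom_I (\<lambda>x. (k x - 1 / R)\<^sup>2)" "continuous_on dom_I (\<lambda>x. (2 / R) * k x - 1 / R\<^sup>2)"
      "continuous_on dom_I (\<lambda>x. (2 / R) * k x)" "continuous_on dom_I (\<lambda>x. 1 / R\<^sup>2)"
      using Rnz by (intro continuous_intros conts; simp)+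
    then show ?thesis by (simp add: int_add int_diff)
  qed
  finally have 2: "integral dom_I (\<lambda>x. (k x)\<^sup>2) = integral dom_I (\<lambda>x. (k x - 1 / R)\<^sup>2) + 2 * pi / R\<^sup>2"
    unfolding turning_eq by (simp add: power2_eq_square)
  show ?thesis unfolding 1 2 by (simp add: distrib_left)
qed

text \<open>\<open>R * (k - 1 / R)\<close> equals \<open>k * (R - hh) - (1 - k * hh)\<close>. The
  first term is small because \<open>hh\<close> is close to \<open>R\<close>; the second is the
  derivative of \<open>qq\<close> divided by \<open>c\<close>, whose mean square is small by
  \<open>int_q'_small\<close> combined with \<open>D2_le\<close> and \<open>a_D1\<close>.\<close>

lemma deficit_le: "D1 + D2 + c ^ 4 * integral dom_I (\<lambda>x. (k x - 1 / R)\<^sup>2) \<le> gap_const A R * t"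
proof -
  define C2 where "C2 = 2048 * A ^ 3 / \<bar>R\<bar> ^ 3 * (210 * A ^ 4)"
  define Cq where "Cq = 16 * A ^ 6 * C2 + 3312 * A ^ 10"
  have tt: "t\<^sup>2 \<le> t" using t by (simp add: power2_eq_square)
  have D: "D \<le> 8 * t" if "D = integral dom_I f" "continuous_on dom_I f" "\<And>x. x \<in> dom_I \<Longrightarrow> f x \<le> t\<^sup>2" for D f
  proof -
    have "D \<le> integral dom_I (\<lambda>x. t\<^sup>2)" unfolding that(1) by (intro int_mono that continuous_intros)
    also have "\<dots> = 2 * pi * t\<^sup>2" by simp
    also have "\<dots> \<le> 8 * t" using twopi tt t by (intro mult_mono) auto
    finally show ?thesis .
  qed
  have d1: "D1 \<le> 8 * t" by (rule D[OF D1_def]) (use sm(1) t in \<open>auto intro!: continuous_intros conts simp: power2_le_iff_abs_le\<close>)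
  have d2: "D2 \<le> 8 * t" by (rule D[OF D2_def]) (use sm(2) t in \<open>auto intro!: continuous_intros conts simp: power2_le_iff_abs_le\<close>)
  have "\<bar>a\<bar> * D2 \<le> 2048 * A ^ 3 / \<bar>R\<bar> ^ 3 * (\<bar>a\<bar> * D1)"
    using mult_left_mono[OF D2_le, of "\<bar>a\<bar>"] by (simp add: mult_ac)
  also have "\<dots> \<le> 2048 * A ^ 3 / \<bar>R\<bar> ^ 3 * (210 * A ^ 4 * t)"
    using A0 by (intro mult_left_mono a_D1 sm(1)) auto
  also have "\<dots> = C2 * t" by (simp add: C2_def)
  finally have aD2: "\<bar>a\<bar> * D2 \<le> C2 * t" .
  have q': "integral dom_I (\<lambda>x. (c * (1 - k x * hh x))\<^sup>2) \<le> Cq * t"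
  proof -
    have "integral dom_I (\<lambda>x. (c * (1 - k x * hh x))\<^sup>2) \<le> 16 * A ^ 6 * (\<bar>a\<bar> * D2) + 3312 * A ^ 10 * t"
      by (rule int_q'_small[OF sm(2)])
    also have "\<dots> \<le> 16 * A ^ 6 * (C2 * t) + 3312 * A ^ 10 * t"
      using aD2 A0 by (intro add_right_mono mult_left_mono) auto
    finally show ?thesis by (simp add: Cq_def algebra_simps)
  qed
  have ci: "1 / c \<le> A" using ciA c0 by (simp add: divide_le_eq mult.commute)
  have "R\<^sup>2 * integral dom_I (\<lambda>x. (k x - 1 / R)\<^sup>2) \<le> integral dom_I (\<lambda>x. (2 * t) * (k x)\<^sup>2 + (2 * A\<^sup>2) * (c * (1 - k x * hh x))\<^sup>2)"
    unfolding integral_mult_right[symmetric]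
  proof (rule int_mono)
    fix x assume x: "x \<in> dom_I"
    define u where "u = k x * (R - hh x)"
    define v where "v = 1 - k x * hh x"
    have "R\<^sup>2 * (k x - 1 / R)\<^sup>2 = (u - v)\<^sup>2"
      unfolding power_mult_distrib[symmetric] u_def v_def using Rnz by (intro arg_cong[of _ _ "\<lambda>z. z\<^sup>2"]) (simp add: field_simps)
    also have "\<dots> \<le> 2 * u\<^sup>2 + 2 * v\<^sup>2" using sum_squares_bound[of u "- v"] by (simp add: power2_diff)
    also have "u\<^sup>2 \<le> t * (k x)\<^sup>2"
    proof -
      have "(R - hh x)\<^sup>2 \<le> t\<^sup>2" using sm(1)[OF x] t by (simp add: power2_le_iff_abs_le abs_minus_commute)
      then have "(R - hh x)\<^sup>2 * (k x)\<^sup>2 \<le> t * (k x)\<^sup>2" using tt by (intro mult_right_mono) auto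
      then show ?thesis by (simp add: u_def power_mult_distrib mult.commute)
    qed
    also have "v\<^sup>2 \<le> A\<^sup>2 * (c * v)\<^sup>2"
    proof -
      have "1 \<le> (A * c)\<^sup>2" using ciA by simp
      from mult_right_mono[OF this, of "v\<^sup>2"] show ?thesis by (simp add: power_mult_distrib mult_ac)
    qed
    finally show "R\<^sup>2 * (k x - 1 / R)\<^sup>2 \<le> (2 * t) * (k x)\<^sup>2 + (2 * A\<^sup>2) * (c * (1 - k x * hh x))\<^sup>2"
      by (simp add: v_def)
  qed (intro continuous_intros conts; use Rnz in simp)+
  also have "\<dots> = (2 * t) * integral dom_I (\<lambda>x. (k x)\<^sup>2) + (2 * A\<^sup>2) * integral dom_I (\<lambda>x. (c * (1 - k x * hh x))\<^sup>2)"
    unfolding integral_mult_right[symmetric] by (rule int_add; intro continuous_intros conts)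
  also have "\<dots> \<le> (2 * t) * A + (2 * A\<^sup>2) * (Cq * t)"
    using kA q' t by (intro add_mono mult_left_mono) auto
  also have "\<dots> = (2 * A + 2 * A\<^sup>2 * Cq) * t" by (simp add: algebra_simps)
  finally have ik: "integral dom_I (\<lambda>x. (k x - 1 / R)\<^sup>2) \<le> (2 * A + 2 * A\<^sup>2 * Cq) * t / R\<^sup>2"
    using Rnz by (simp add: le_divide_eq mult.commute)
  have nn: "0 \<le> integral dom_I (\<lambda>x. (k x - 1 / R)\<^sup>2)" by (rule int_nonneg) (use Rnz in \<open>auto intro!: continuous_intros conts\<close>)
  have "c ^ 4 * integral dom_I (\<lambda>x. (k x - 1 / R)\<^sup>2) \<le> A ^ 4 * ((2 * A + 2 * A\<^sup>2 * Cq) * t / R\<^sup>2)"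
    using cA c0 ik nn A0 by (intro mult_mono power_mono) auto
  moreover have "A ^ 4 * (X * t / R\<^sup>2) = A ^ 4 * (X / R\<^sup>2) * t" for X by simp
  ultimately have "D1 + D2 + c ^ 4 * integral dom_I (\<lambda>x. (k x - 1 / R)\<^sup>2) \<le>
      8 * t + 8 * t + A ^ 4 * ((2 * A + 2 * A\<^sup>2 * Cq) / R\<^sup>2) * t"
    using d1 d2 by (intro add_mono) simp_all
  also have "\<dots> = gap_const A R * t"
    unfolding gap_const_def Cq_def[symmetric] C2_def[symmetric] distrib_right by simp
  finally show ?thesis .
qed

end

end

text \<open>\<open>H\<close> fixes the deficit \<open>\<epsilon>\<close> before any curve is chosen.
  If \<open>\<epsilon> > 0\<close>, a curve violating the bound would have deficit at most
  \<open>\<epsilon> / 2\<close>. If \<open>\<epsilon> \<le> 0\<close>, the deficit, a sum of mean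
  squares, vanishes and the curvature is constant.\<close>

theorem length_multiplier_bound:
  assumes A: "1 \<le> A" and R: "R \<noteq> 0"
  shows "\<exists>Bd. \<forall>\<gamma> \<tau> \<eta> W U S k K a l. bounded_ode_mean \<gamma> \<tau> \<eta> W U S k K c \<delta> lam a l A R \<longrightarrow>
    integral dom_I (\<lambda>x. (norm (\<gamma> x))\<^sup>2) + c ^ 4 * integral dom_I (\<lambda>x. (k x)\<^sup>2) = H \<longrightarrow>
    \<not> (\<exists>\<kappa>. \<forall>x\<in>dom_I. k x = \<kappa>) \<longrightarrow> \<bar>a\<bar> \<le> Bd"
proof -
  obtain d where d: "d > 0" "\<And>N::int. \<bar>2 * pi * N - 2 * pi * c / R\<bar> < d \<Longrightarrow> 2 * pi * N = 2 * pi * c / R"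
    using integer_gap[of "2 * pi * c / R"] by blast
  define \<epsilon> where "\<epsilon> = H - (2 * pi * R\<^sup>2 + c ^ 4 * (2 * pi / R\<^sup>2))"
  have g: "0 < gap_const A R"
  proof -
    have "0 \<le> 2 * A + 2 * A\<^sup>2 * (16 * A ^ 6 * (2048 * A ^ 3 / \<bar>R\<bar> ^ 3 * (210 * A ^ 4)) + 3312 * A ^ 10)"
      using A by (intro add_nonneg_nonneg mult_nonneg_nonneg divide_nonneg_nonneg zero_le_power) auto
    then have "0 \<le> A ^ 4 * ((2 * A + 2 * A\<^sup>2 * (16 * A ^ 6 * (2048 * A ^ 3 / \<bar>R\<bar> ^ 3 * (210 * A ^ 4)) + 3312 * A ^ 10)) / R\<^sup>2)"
      using A by simp
    then show ?thesis unfolding gap_const_def by linarith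
  qed
  \<comment> \<open>The entries serve in turn the condition \<open>t \<le> 1\<close>, the absence of
    zeros of \<open>hh\<close>, the integer gap (64 in place of 32 for a strict inequality), and the
    contradiction with the deficit.\<close>
  define t where "t = min (min 1 (\<bar>R\<bar> / 2)) (min (d * R\<^sup>2 / (64 * A)) (if \<epsilon> > 0 then \<epsilon> / (2 * gap_const A R) else 1))"
  have t: "0 < t" "t \<le> 1" "2 * t \<le> \<bar>R\<bar>" "t \<le> d * R\<^sup>2 / (64 * A)" "\<epsilon> > 0 \<Longrightarrow> t \<le> \<epsilon> / (2 * gap_const A R)"
  proof -
    show "0 < t" unfolding t_def using R d(1) A g by auto
    show "t \<le> 1" by (simp add: t_def min_le_iff_disj)
    have "t \<le> \<bar>R\<bar> / 2" by (simp add: t_def min_le_iff_disj)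
    then show "2 * t \<le> \<bar>R\<bar>" by simp
    show "t \<le> d * R\<^sup>2 / (64 * A)" unfolding t_def by (intro min.coboundedI2 min.cobounded1)
    show "t \<le> \<epsilon> / (2 * gap_const A R)" if "\<epsilon> > 0" using that by (simp add: t_def min_le_iff_disj)
  qed
  have td: "32 * A * t < d * R\<^sup>2"
  proof -
    have "64 * A * t \<le> d * R\<^sup>2" using t(4) A by (simp add: le_divide_eq mult_ac)
    moreover have "0 < 32 * A * t" using A t by simp
    ultimately show ?thesis by linarith
  qed
  define Bd where "Bd = (1 + 4640 * A ^ 7 / t\<^sup>2) * (6720 * A ^ 5) / t\<^sup>2"
  show ?thesis
  proof (intro exI[of _ Bd] allI impI)
    fix \<gamma> \<tau> \<eta> W U S k K a l
    assume b: "bounded_ode_mean \<gamma> \<tau> \<eta> W U S k K c \<delta> lam a l A R"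
      and H: "integral dom_I (\<lambda>x. (norm (\<gamma> x))\<^sup>2) + c ^ 4 * integral dom_I (\<lambda>x. (k x)\<^sup>2) = H"
      and nc: "\<not> (\<exists>\<kappa>. \<forall>x\<in>dom_I. k x = \<kappa>)"
    interpret bounded_ode_mean \<gamma> \<tau> \<eta> W U S k K c \<delta> lam a l A R by (rule b)
    show "\<bar>a\<bar> \<le> Bd"
    proof (rule ccontr)
      assume "\<not> \<bar>a\<bar> \<le> Bd"
      then have big: "\<bar>a\<bar> \<ge> (1 + 4640 * A ^ 7 / t\<^sup>2) * (6720 * A ^ 5) / t\<^sup>2" by (simp add: Bd_def)
      note sm = sup_small[OF t(1) big]
      note de = deficit_eq[OF t(1-3) sm d(2) td] and dl = deficit_le[OF t(1-3) sm d(2) td]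
      have e: "\<epsilon> = D1 + D2 + c ^ 4 * integral dom_I (\<lambda>x. (k x - 1 / R)\<^sup>2)"
        using de H by (simp add: \<epsilon>_def)
      have ck': "continuous_on dom_I (\<lambda>x. k x - 1 / R)" using R by (intro continuous_intros ck) auto
      have nn: "0 \<le> integral dom_I (\<lambda>x. (k x - 1 / R)\<^sup>2)" by (rule int_nonneg) (use ck' in \<open>auto intro!: continuous_intros\<close>)
      show False
      proof (cases "\<epsilon> > 0")
        case True
        have "gap_const A R * t \<le> \<epsilon> / 2" using t(5)[OF True] g by (simp add: le_divide_eq mult_ac)
        then show False using e dl True by linarith
      next
        case False
        have p: "0 \<le> c ^ 4 * integral dom_I (\<lambda>x. (k x - 1 / R)\<^sup>2)" using nn c0 by simp
        then have "c ^ 4 * integral dom_I (\<lambda>x. (k x - 1 / R)\<^sup>2) \<le> 0" using e False D_nonneg by linarith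
        then have "integral dom_I (\<lambda>x. (k x - 1 / R)\<^sup>2) \<le> 0" using c0 by (simp add: mult_le_0_iff)
        from int_sq_zero[OF ck' this] have "\<forall>x\<in>dom_I. k x = 1 / R" by auto
        then show False using nc by blast
      qed
    qed
  qed
qed

section \<open>Critical points\<close>

text \<open>Without a length constraint the curve cannot be arbitrarily short: for \<open>A0 \<noteq> 0\<close> by a crude
  isoperimetric inequality, and for \<open>A0 = 0\<close> because the mean of the first integral (with \<open>l = 1\<close>)
  bounds the curvature energy.\<close>

definition c_min :: "real \<Rightarrow> real \<Rightarrow> real \<Rightarrow> real" where
  "c_min \<delta> lam A0 = (if A0 = 0 then 1 / (pi + 4 * pi * (1 + \<delta>\<^sup>2 / lam)) else sqrt (\<bar>A0\<bar> / (2 * pi\<^sup>2)))"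

lemma c_min_pos: "lam > 0 \<Longrightarrow> 0 < c_min \<delta> lam A0"
  by (auto simp: c_min_def add_pos_nonneg intro!: divide_pos_pos add_pos_pos mult_pos_pos)

lemma (in elastic_ode) c_min_le:
  assumes l: "l = 1" and area: "c / 2 * integral dom_I hh = A0"
  shows "c_min \<delta> lam A0 \<le> c"
proof (cases "A0 = 0")
  case False
  have "\<bar>integral dom_I hh\<bar> \<le> integral dom_I (\<lambda>x. 2 * pi * c)"
    by (intro int_abs_le conts continuous_intros hq_le)
  then have "c / 2 * \<bar>integral dom_I hh\<bar> \<le> c / 2 * (2 * pi * (2 * pi * c))" using c0 by (intro mult_left_mono) auto
  moreover have "\<bar>A0\<bar> = c / 2 * \<bar>integral dom_I hh\<bar>" using c0 by (simp add: area[symmetric] abs_mult)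
  moreover have "c / 2 * (2 * pi * (2 * pi * c)) = 2 * pi\<^sup>2 * c\<^sup>2" by (simp add: power2_eq_square)
  ultimately have "\<bar>A0\<bar> \<le> 2 * pi\<^sup>2 * c\<^sup>2" by simp
  then have "\<bar>A0\<bar> / (2 * pi\<^sup>2) \<le> c\<^sup>2" by (simp add: divide_le_eq mult_ac)
  then have "sqrt (\<bar>A0\<bar> / (2 * pi\<^sup>2)) \<le> c" using c0 by (intro real_le_lsqrt) auto
  then show ?thesis using False by (simp add: c_min_def)
next
  case True
  then have h0: "integral dom_I hh = 0" using area c0 by simp
  have cc: "continuous_on dom_I (\<lambda>x. (W x)\<^sup>2 / 2)" "continuous_on dom_I (\<lambda>x. lam * (S x)\<^sup>2 / 2)" "continuous_on dom_I (\<lambda>x. K \<bullet> \<tau> x)"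
    by (intro continuous_intros conts; simp)+
  \<comment> \<open>With zero area \<open>hh\<close> has mean zero, so \<open>a\<close> drops out of
    the mean of the first integral, and the mean squares of \<open>W\<close> and \<open>S\<close>
    are bounded by \<open>\<delta>\<close> and \<open>lam\<close> alone.\<close>
  have "integral dom_I (\<lambda>x. (W x)\<^sup>2 / 2 + lam * (S x)\<^sup>2 / 2 - K \<bullet> \<tau> x) = integral dom_I (\<lambda>x. l + a * hh x)"
    by (rule int_cong) (rule fi)
  also have "\<dots> = 2 * pi"
    using int_add[of "\<lambda>_. l" "\<lambda>x. a * hh x"] l h0 by (simp add: continuous_intros conts)
  finally have E: "integral dom_I (\<lambda>x. (W x)\<^sup>2) / 2 + lam * integral dom_I (\<lambda>x. (S x)\<^sup>2) / 2 = 2 * pi"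
    using cc by (simp add: int_add int_diff continuous_intros int_K\<tau>)
  have nW: "0 \<le> integral dom_I (\<lambda>x. (W x)\<^sup>2)" and nS: "0 \<le> integral dom_I (\<lambda>x. (S x)\<^sup>2)"
    by (intro int_nonneg continuous_intros conts; simp)+
  have W: "integral dom_I (\<lambda>x. (W x)\<^sup>2) \<le> 4 * pi"
  proof -
    have "0 \<le> lam * integral dom_I (\<lambda>x. (S x)\<^sup>2)" using nS lam0 by simp
    then show ?thesis using E by linarith
  qed
  have S: "integral dom_I (\<lambda>x. (S x)\<^sup>2) \<le> 4 * pi / lam"
  proof -
    have "lam * integral dom_I (\<lambda>x. (S x)\<^sup>2) \<le> 4 * pi" using E nW by linarith
    then show ?thesis using lam0 by (simp add: le_divide_eq mult.commute)
  qed
  have "integral dom_I (\<lambda>x. (k x)\<^sup>2) \<le> integral dom_I (\<lambda>x. 2 * (W x)\<^sup>2 + 2 * \<delta>\<^sup>2 * (S x)\<^sup>2)"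
    by (intro int_mono continuous_intros conts k_sq_le)
  also have "\<dots> = 2 * integral dom_I (\<lambda>x. (W x)\<^sup>2) + 2 * \<delta>\<^sup>2 * integral dom_I (\<lambda>x. (S x)\<^sup>2)"
    by (subst int_add) (auto intro!: continuous_intros conts)
  also have "\<dots> \<le> 2 * (4 * pi) + 2 * \<delta>\<^sup>2 * (4 * pi / lam)" using W S by (intro add_mono mult_left_mono) auto
  finally have k2: "integral dom_I (\<lambda>x. (k x)\<^sup>2) \<le> 8 * pi * (1 + \<delta>\<^sup>2 / lam)" by (simp add: algebra_simps)
  \<comment> \<open>Minkowski's formula excludes very short curves:
    \<open>\<bar>hh x\<bar> \<le> 2 * pi * c\<close>, while the mean square of \<open>k\<close> is
    bounded.\<close>
  have "2 * pi = integral dom_I (\<lambda>x. k x * hh x)" by (rule int_kh[symmetric])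
  also have "\<dots> \<le> integral dom_I (\<lambda>x. (pi * c) * (1 + (k x)\<^sup>2))"
  proof (intro int_mono continuous_intros conts)
    fix x assume x: "x \<in> dom_I"
    have "k x * hh x \<le> \<bar>k x\<bar> * \<bar>hh x\<bar>" by (simp add: abs_mult[symmetric])
    also have "\<dots> \<le> ((1 + (k x)\<^sup>2) / 2) * (2 * pi * c)"
      using sum_squares_bound[of 1 "\<bar>k x\<bar>"] hq_le[OF x] by (intro mult_mono) auto
    also have "\<dots> = (pi * c) * (1 + (k x)\<^sup>2)" by (simp add: field_simps)
    finally show "k x * hh x \<le> (pi * c) * (1 + (k x)\<^sup>2)" .
  qed
  also have "\<dots> = (pi * c) * (2 * pi + integral dom_I (\<lambda>x. (k x)\<^sup>2))"
    using int_add[of "\<lambda>_. 1" "\<lambda>x. (k x)\<^sup>2"] by (simp add: continuous_intros conts)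
  also have "\<dots> \<le> (pi * c) * (2 * pi + 8 * pi * (1 + \<delta>\<^sup>2 / lam))" using k2 c0 by (intro mult_left_mono) auto
  also have "(pi * c) * (2 * pi + 8 * pi * Y) = (2 * pi) * (c * (pi + 4 * pi * Y))" for Y by (simp add: algebra_simps)
  finally have "(2 * pi) * 1 \<le> (2 * pi) * (c * (pi + 4 * pi * (1 + \<delta>\<^sup>2 / lam)))" by simp
  then have "1 \<le> c * (pi + 4 * pi * (1 + \<delta>\<^sup>2 / lam))" by (rule mult_left_le_imp_le) simp
  moreover have "0 < pi + 4 * pi * (1 + \<delta>\<^sup>2 / lam)" using lam0 by (intro add_pos_nonneg) auto
  ultimately show ?thesis using True by (simp add: c_min_def divide_le_eq)
qed

text \<open>Elements of \<open>H_neg1_per\<close> act on total functions. Boundedness by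
  \<open>H_norm\<close>, which sees the interval only, is what makes their values independent of the
  arguments outside it.\<close>

lemma Psi_zero:
  assumes \<Psi>: "\<Psi> \<in> H_neg1_per" and f: "\<And>x. x \<in> dom_I \<Longrightarrow> f x = (0::real)"
  shows "f \<in> H_per 1" "\<Psi> f = 0"
proof -
  have ac: "ac f (\<lambda>x. 0)" by (rule ac_cong[OF ac_const[of 0]]) (auto simp: f)
  show f1: "f \<in> H_per 1" by (rule H_per1I[OF ac L2_cont]) (auto simp: f)
  obtain C where C: "\<bar>\<Psi> f\<bar> \<le> C * H_norm 1 f" using \<Psi> f1 by (auto simp: H_neg1_per_def)
  have 1: "(LINT x|leb_I. (norm (f x))\<^sup>2) = 0"
    by (rule integral_eq_zero_AE) (intro AE_I2, simp add: f)
  have 2: "(LINT x|leb_I. (norm (wderiv f x))\<^sup>2) = 0"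
    by (rule integral_eq_zero_AE) (use ac_wderiv_AE[OF ac] in \<open>eventually_elim, simp\<close>)
  have "H_norm 1 f = 0" unfolding H_norm_def using 1 2 by simp
  then show "\<Psi> f = 0" using C by simp
qed

lemma Psi_cong:
  assumes \<Psi>: "\<Psi> \<in> H_neg1_per" and f: "f \<in> H_per 1" "g \<in> H_per 1" "\<And>x. x \<in> dom_I \<Longrightarrow> f x = g x"
  shows "\<Psi> f = \<Psi> g"
proof -
  have z: "(\<lambda>x. f x - g x) \<in> H_per 1" "\<Psi> (\<lambda>x. f x - g x) = 0"
    by (rule Psi_zero[OF \<Psi>]; simp add: f)+
  have "\<forall>f\<in>H_per 1. \<forall>g\<in>H_per 1. \<Psi> (\<lambda>x. f x + g x) = \<Psi> f + \<Psi> g"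
    using \<Psi> by (simp add: H_neg1_per_def)
  from bspec[OF bspec[OF this f(2)] z(1)]
  have "\<Psi> (\<lambda>x. g x + (f x - g x)) = \<Psi> g + \<Psi> (\<lambda>x. f x - g x)" .
  then show ?thesis using z(2) by simp
qed

section \<open>From critical points to the differential system\<close>

lemma dir_deriv_zero: "dir_deriv F u (\<lambda>x. 0) = 0"
  by (simp add: dir_deriv_def)

lemma H_norm_1_sq: "(H_norm 1 f)\<^sup>2 = (LINT x|leb_I. (norm (f x))\<^sup>2) + (LINT x|leb_I. (norm (wderiv f x))\<^sup>2)"
  unfolding H_norm_def by simp

lemma H_norm_2_sq: "(H_norm 2 f)\<^sup>2 = (LINT x|leb_I. (norm (f x))\<^sup>2) + (LINT x|leb_I. (norm (wderiv f x))\<^sup>2) +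
    (LINT x|leb_I. (norm (wderiv (wderiv f) x))\<^sup>2)"
  unfolding H_norm_def by (simp add: numeral_2_eq_2)

text \<open>Both variational problems are covered: \<open>m = 1\<close> and \<open>l = 0\<close> for
  the energy with length, \<open>m = 0\<close> for the length constraint. Testing with one of the
  two variations equal to zero separates the equations. The last three identities translate norms
  and area into integrals along the system.\<close>

theorem critical_ode:
  fixes \<gamma> \<eta> :: "real \<Rightarrow> real^2"
  assumes lam: "lam > 0" and \<gamma>: "\<gamma> \<in> H2_imm" and \<eta>: "\<eta> \<in> H_per 1"
    and speed: "\<And>x. x \<in> dom_I \<Longrightarrow> norm (wderiv \<gamma> x) = c" and mean: "(LINT x|leb_I. \<gamma> x) = 0"
    and unit: "\<And>x. x \<in> dom_I \<Longrightarrow> S_constr \<eta> x = 0" and \<Psi>: "\<Psi> \<in> H_neg1_per"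
    and crit: "\<And>\<phi> \<psi>. \<phi> \<in> H_per 2 \<Longrightarrow> \<psi> \<in> H_per 1 \<Longrightarrow>
      dir_deriv (\<lambda>g. energy \<delta> lam g \<eta> + m * curve_length g) \<gamma> \<phi> +
      dir_deriv (\<lambda>e. energy \<delta> lam \<gamma> e + m * curve_length \<gamma>) \<eta> \<psi> +
      l * dir_deriv curve_length \<gamma> \<phi> + a * dir_deriv signed_area \<gamma> \<phi> + \<Psi> (S_deriv \<eta> \<psi>) = 0"
  shows "\<exists>\<tau> W U S k K. elastic_ode \<gamma> \<tau> \<eta> W U S k K c \<delta> lam a (m + l) \<and>
    (AE x in leb_I. curvature \<gamma> x = k x) \<and>
    (\<forall>f\<in>H_per 1. \<Psi> f = dual_repr \<gamma>
      (\<lambda>x. - (1 / 2) * (\<delta> * W x * S x * (rotJ (\<eta> x) \<bullet> \<tau> x) + lam * (S x)\<^sup>2))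
      (\<lambda>x. \<delta> / 2 * (W x * (\<eta> x \<bullet> \<tau> x))) f) \<and>
    (H_norm 2 \<gamma>)\<^sup>2 = integral dom_I (\<lambda>x. (norm (\<gamma> x))\<^sup>2) + 2 * pi * c\<^sup>2 + c ^ 4 * integral dom_I (\<lambda>x. (k x)\<^sup>2) \<and>
    (H_norm 1 \<eta>)\<^sup>2 = 2 * pi + c\<^sup>2 * integral dom_I (\<lambda>x. (S x)\<^sup>2) \<and>
    signed_area \<gamma> = c / 2 * integral dom_I (\<lambda>x. rotJ (\<gamma> x) \<bullet> \<tau> x)"
proof -
  define g where "g = wderiv \<gamma>"
  define h where "h = wderiv g"
  define e where "e = wderiv \<eta>"
  have \<gamma>2: "\<gamma> \<in> H_per 2" and nz: "\<And>x. x \<in> dom_I \<Longrightarrow> wderiv \<gamma> x \<noteq> 0" using \<gamma> by (auto simp: H2_imm_def)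
  note d\<gamma> = H_per2D[OF \<gamma>2, folded g_def, folded h_def] and d\<eta> = H_per1D[OF \<eta>, folded e_def]
  have c0: "c > 0" using speed[of 0] nz[of 0] by auto
  have gc: "norm (g x) = c" if "x \<in> dom_I" for x using speed[OF that] by (simp add: g_def)
  have \<eta>1: "norm (\<eta> x) = 1" if "x \<in> dom_I" for x
  proof -
    have "(norm (\<eta> x))\<^sup>2 = 1" using unit[OF that] by (simp add: S_constr_def)
    then show ?thesis by (simp add: power2_eq_1_iff) (use norm_ge_zero[of "\<eta> x"] in linarith)
  qed
  interpret arc_curve \<gamma> g h \<eta> e c \<delta> lam
    by unfold_locales (use d\<gamma> d\<eta> c0 gc in auto)
  have z1: "(\<lambda>x. 0 :: real^2) \<in> H_per 1" by (rule H_per1I[OF ac_const L2_cont]) auto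
  have z2: "(\<lambda>x. 0 :: real^2) \<in> H_per 2" by (rule H_per2I[OF ac_const ac_const L2_cont]) auto
  have EL1: "(LINT x|leb_I. P x \<bullet> \<phi>2 x + Q x \<bullet> \<phi>1 x) + (m + l) * (LINT x|leb_I. (g x \<bullet> \<phi>1 x) / c) +
      a * (LINT x|leb_I. rotJ (\<gamma> x) \<bullet> \<phi>1 x) = 0"
    if \<phi>: "ac \<phi> \<phi>1" "ac \<phi>1 \<phi>2" "continuous_on dom_I \<phi>2" "\<phi> 0 = \<phi> (2 * pi)" "\<phi>1 0 = \<phi>1 (2 * pi)" for \<phi> \<phi>1 \<phi>2
  proof -
    interpret arc_variation \<gamma> g h \<eta> e c \<delta> lam \<phi> \<phi>1 \<phi>2
      by unfold_locales (use \<phi> in auto)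
    have "\<phi> \<in> H_per 2" by (rule H_per2I[OF \<phi>(1,2) L2_cont[OF \<phi>(3)] \<phi>(4,5)])
    from crit[OF this z1]
    have "dir_deriv (\<lambda>g. energy \<delta> lam g \<eta> + m * curve_length g) \<gamma> \<phi> +
        l * dir_deriv curve_length \<gamma> \<phi> + a * dir_deriv signed_area \<gamma> \<phi> = 0"
      using Psi_zero(2)[OF \<Psi>, of "S_deriv \<eta> (\<lambda>x. 0)"] by (simp add: dir_deriv_zero S_deriv_def)
    moreover have "dir_deriv (\<lambda>g. energy \<delta> lam g \<eta> + m * curve_length g) \<gamma> \<phi> =
        (LINT x|leb_I. P x \<bullet> \<phi>2 x + Q x \<bullet> \<phi>1 x) + m * (LINT x|leb_I. (g x \<bullet> \<phi>1 x) / c)"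
      unfolding dir_deriv_def
      by (intro DERIV_imp_deriv DERIV_add DERIV_cmult energy_variation length_variation)
    moreover have "dir_deriv curve_length \<gamma> \<phi> = (LINT x|leb_I. (g x \<bullet> \<phi>1 x) / c)"
      unfolding dir_deriv_def by (rule DERIV_imp_deriv[OF length_variation])
    moreover have "dir_deriv signed_area \<gamma> \<phi> = (LINT x|leb_I. rotJ (\<gamma> x) \<bullet> \<phi>1 x)"
      unfolding dir_deriv_def by (rule DERIV_imp_deriv[OF area_variation])
    ultimately show ?thesis by (simp add: distrib_right add_divide_distrib)
  qed
  have EL2: "(LINT x|leb_I. \<delta> * w x * (\<psi>1 x \<bullet> g x) / c + lam * (e x \<bullet> \<psi>1 x) / c) + \<Psi> (S_deriv \<eta> \<psi>) = 0"
    if \<psi>: "ac \<psi> \<psi>1" "L2_fun \<psi>1" "\<psi> 0 = \<psi> (2 * pi)" for \<psi> \<psi>1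
  proof -
    have "\<psi> \<in> H_per 1" by (rule H_per1I[OF \<psi>])
    from crit[OF z2 this]
    have "dir_deriv (\<lambda>e. energy \<delta> lam \<gamma> e + m * curve_length \<gamma>) \<eta> \<psi> + \<Psi> (S_deriv \<eta> \<psi>) = 0"
      by (simp add: dir_deriv_zero)
    moreover have "dir_deriv (\<lambda>e. energy \<delta> lam \<gamma> e + m * curve_length \<gamma>) \<eta> \<psi> =
        (LINT x|leb_I. \<delta> * w x * (\<psi>1 x \<bullet> g x) / c + lam * (e x \<bullet> \<psi>1 x) / c) + 0"
      unfolding dir_deriv_def
      by (intro DERIV_imp_deriv DERIV_add director_variation[OF \<psi>(1,2)] DERIV_const)
    ultimately show ?thesis by simp
  qed
  interpret arc_critical \<gamma> g h \<eta> e c \<delta> lam a "m + l"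
  proof
    show "(LINT x|leb_I. \<delta> * w x * (\<psi>1 x \<bullet> g x) / c + lam * (e x \<bullet> \<psi>1 x) / c) = 0"
      if "ac \<psi> \<psi>1" "L2_fun \<psi>1" "\<psi> 0 = \<psi> (2 * pi)" "\<And>x. x \<in> dom_I \<Longrightarrow> \<eta> x \<bullet> \<psi> x = 0" for \<psi> \<psi>1
      using EL2[OF that(1-3)] Psi_zero(2)[OF \<Psi>, of "S_deriv \<eta> \<psi>"] that(4) by (simp add: S_deriv_def)
  qed (use lam d\<gamma> d\<eta> \<eta>1 mean EL1 in auto)
  obtain W U S k where ode: "elastic_ode \<gamma> (\<lambda>x. (1 / c) *\<^sub>R g x) \<eta> W U S k K c \<delta> lam a (m + l)"
    and wW: "AE x in leb_I. w x = W x" and kk: "AE x in leb_I. kap x = k x"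
    and eS: "AE x in leb_I. e x = (c * S x) *\<^sub>R rotJ (\<eta> x)"
    and hk: "AE x in leb_I. h x = (c\<^sup>2 * k x) *\<^sub>R rotJ ((1 / c) *\<^sub>R g x)"
    using ode_system by blast
  define \<tau> where "\<tau> x = (1 / c) *\<^sub>R g x" for x
  have g\<tau>: "g x = c *\<^sub>R \<tau> x" for x using c0 by (simp add: \<tau>_def)
  have \<tau>_eq: "(\<lambda>x. (1 / c) *\<^sub>R g x) = \<tau>" by (simp add: fun_eq_iff \<tau>_def)
  interpret o: elastic_ode \<gamma> \<tau> \<eta> W U S k K c \<delta> lam a "m + l" using ode unfolding \<tau>_eq .
  have cv: "AE x in leb_I. curvature \<gamma> x = (h x \<bullet> rotJ (g x)) / norm (g x) ^ 3"
    by (rule curvature_AE(1)[OF ac\<gamma> acg]) (rule g_nz)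
  have curv: "AE x in leb_I. curvature \<gamma> x = k x"
    using cv kk AE_dom by eventually_elim (simp add: kap_def gc)
  have dual: "\<Psi> f = dual_repr \<gamma>
      (\<lambda>x. - (1 / 2) * (\<delta> * W x * S x * (rotJ (\<eta> x) \<bullet> \<tau> x) + lam * (S x)\<^sup>2))
      (\<lambda>x. \<delta> / 2 * (W x * (\<eta> x \<bullet> \<tau> x))) f" if f: "f \<in> H_per 1" for f
  proof -
    note df = H_per1D[OF f]
    \<comment> \<open>The direction \<open>?f x *\<^sub>R \<eta> x\<close> is normal to the
      constraint and has \<open>S_deriv\<close> equal to \<open>f\<close> on the interval, so the
      director equation evaluates the multiplier on an arbitrary \<open>f\<close>.\<close>
    let ?f = "\<lambda>x. (1 / 2) *\<^sub>R f x" and ?f' = "\<lambda>x. (1 / 2) *\<^sub>R wderiv f x"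
    let ?\<psi>1 = "\<lambda>x. ?f x *\<^sub>R e x + ?f' x *\<^sub>R \<eta> x"
    have acf: "ac ?f ?f'" by (rule ac_cmult[OF df(1)])
    have ac\<psi>: "ac (\<lambda>x. ?f x *\<^sub>R \<eta> x) ?\<psi>1" by (rule ac_scaleR[OF acf ac\<eta>])
    have "L2_fun (\<lambda>x. (\<lambda>u v. v *\<^sub>R u) (\<eta> x) (?f' x))"
      by (rule L2_bilin_cont[OF bounded_bilinear.flip[OF bounded_bilinear_scaleR] cont(3) L2_scaleR[OF df(2)]])
    then have L2\<psi>: "L2_fun ?\<psi>1"
      by (intro L2_add L2_bilin_cont[OF bounded_bilinear_scaleR ac_continuous[OF acf] L2e]) simp
    have "(LINT x|leb_I. \<delta> * w x * (?\<psi>1 x \<bullet> g x) / c + lam * (e x \<bullet> ?\<psi>1 x) / c) + \<Psi> (S_deriv \<eta> (\<lambda>x. ?f x *\<^sub>R \<eta> x)) = 0"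
      by (rule EL2[OF ac\<psi> L2\<psi>]) (simp add: df(3)[symmetric] \<eta>per[symmetric])
    moreover have "\<Psi> (S_deriv \<eta> (\<lambda>x. ?f x *\<^sub>R \<eta> x)) = \<Psi> f"
    proof (rule Psi_cong[OF \<Psi> _ f])
      have eq: "S_deriv \<eta> (\<lambda>x. ?f x *\<^sub>R \<eta> x) x = f x" if "x \<in> dom_I" for x
        using \<eta>1[OF that] by (simp add: S_deriv_def power2_norm_eq_inner[symmetric])
      then show "S_deriv \<eta> (\<lambda>x. ?f x *\<^sub>R \<eta> x) x = f x" if "x \<in> dom_I" for x using that by blast
      have "ac (S_deriv \<eta> (\<lambda>x. ?f x *\<^sub>R \<eta> x)) (wderiv f)"
        by (rule ac_cong[OF df(1)]) (use eq L2_meas[OF df(2)] in auto)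
      then show "S_deriv \<eta> (\<lambda>x. ?f x *\<^sub>R \<eta> x) \<in> H_per 1"
        by (rule H_per1I[OF _ df(2)]) (use eq[of 0] eq[of "2 * pi"] df(3) in simp)
    qed
    ultimately have 1: "\<Psi> f = - (LINT x|leb_I. \<delta> * w x * (?\<psi>1 x \<bullet> g x) / c + lam * (e x \<bullet> ?\<psi>1 x) / c)" by simp
    have mf: "wderiv f \<in> borel_measurable leb_I" "f \<in> borel_measurable leb_I"
      using L2_meas[OF df(2)] cont_measurable[OF df(4)] by auto
    have mm: "W \<in> borel_measurable leb_I" "S \<in> borel_measurable leb_I" "\<tau> \<in> borel_measurable leb_I"
      by (rule cont_measurable o.cW o.cS o.c\<tau>)+
    note [measurable] = mf mm meas L2_meas[OF L2_w]
    let ?D = "\<lambda>x. - (1 / 2) * (\<delta> * W x * S x * (rotJ (\<eta> x) \<bullet> \<tau> x) + lam * (S x)\<^sup>2) * f x -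
      \<delta> / 2 * (W x * (\<eta> x \<bullet> \<tau> x)) * ((1 / c) * wderiv f x)"
    have "dual_repr \<gamma>
      (\<lambda>x. - (1 / 2) * (\<delta> * W x * S x * (rotJ (\<eta> x) \<bullet> \<tau> x) + lam * (S x)\<^sup>2))
      (\<lambda>x. \<delta> / 2 * (W x * (\<eta> x \<bullet> \<tau> x))) f = (LINT x|leb_I. ?D x * c)"
      unfolding dual_repr_def line_int_def dds_def
      by (intro Bochner_Integration.integral_cong) (auto simp: speed)
    also have "\<dots> = (LINT x|leb_I. - (\<delta> * w x * (?\<psi>1 x \<bullet> g x) / c + lam * (e x \<bullet> ?\<psi>1 x) / c))"
    proof (rule integral_cong_AE)
      show "AE x in leb_I. ?D x * c = - (\<delta> * w x * (?\<psi>1 x \<bullet> g x) / c + lam * (e x \<bullet> ?\<psi>1 x) / c)"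
        using wW eS AE_dom
      proof eventually_elim
        case (elim x)
        have n: "\<eta> x \<bullet> \<eta> x = 1" using \<eta>1[OF elim(3)] by (simp add: power2_norm_eq_inner[symmetric])
        have p: "?\<psi>1 x \<bullet> g x = c * (f x / 2 * (c * S x) * (rotJ (\<eta> x) \<bullet> \<tau> x) + wderiv f x / 2 * (\<eta> x \<bullet> \<tau> x))"
          unfolding elim(2) g\<tau> by (simp add: inner_add_left algebra_simps)
        have r: "e x \<bullet> ?\<psi>1 x = f x / 2 * (c * S x)\<^sup>2"
          unfolding elim(2) using n by (simp add: inner_add_right power2_eq_square)
        show ?case unfolding p r elim(1) using c0 by (simp add: field_simps power2_eq_square)
      qed
    qed measurable
    also have "\<dots> = \<Psi> f" unfolding 1 by (rule Bochner_Integration.integral_minus)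
    finally show ?thesis by simp
  qed
  have i\<gamma>: "(LINT x|leb_I. (norm (\<gamma> x))\<^sup>2) = integral dom_I (\<lambda>x. (norm (\<gamma> x))\<^sup>2)"
    by (intro LINT_eq_integral cont_integrable continuous_intros cont)
  have ig: "(LINT x|leb_I. (norm (g x))\<^sup>2) = 2 * pi * c\<^sup>2"
  proof -
    have "(LINT x|leb_I. (norm (g x))\<^sup>2) = (LINT x|leb_I. c\<^sup>2)" by (intro Bochner_Integration.integral_cong) (auto simp: gc)
    then show ?thesis by (simp only: LINT_const real_scaleR_def)
  qed
  have ih: "(LINT x|leb_I. (norm (h x))\<^sup>2) = c ^ 4 * integral dom_I (\<lambda>x. (k x)\<^sup>2)"
  proof -
    have ck4: "continuous_on dom_I (\<lambda>x. c ^ 4 * (k x)\<^sup>2)" by (intro continuous_intros o.ck)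
    have "(LINT x|leb_I. (norm (h x))\<^sup>2) = (LINT x|leb_I. c ^ 4 * (k x)\<^sup>2)"
    proof (rule integral_cong_AE)
      show "AE x in leb_I. (norm (h x))\<^sup>2 = c ^ 4 * (k x)\<^sup>2"
        using hk AE_dom
        by eventually_elim (use c0 gc in \<open>simp add: rotJ_simps power_mult_distrib eval_nat_numeral\<close>)
    qed (use meas(3) cont_measurable[OF ck4] in auto)
    also have "\<dots> = integral dom_I (\<lambda>x. c ^ 4 * (k x)\<^sup>2)" by (rule LINT_eq_integral[OF cont_integrable[OF ck4]])
    finally show ?thesis by simp
  qed
  have i\<eta>: "(LINT x|leb_I. (norm (\<eta> x))\<^sup>2) = 2 * pi"
  proof -
    have "(LINT x|leb_I. (norm (\<eta> x))\<^sup>2) = (LINT x|leb_I. 1 :: real)" by (intro Bochner_Integration.integral_cong) (auto simp: \<eta>1)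
    then show ?thesis by (simp only: LINT_const real_scaleR_def mult_1_right)
  qed
  have ie: "(LINT x|leb_I. (norm (e x))\<^sup>2) = c\<^sup>2 * integral dom_I (\<lambda>x. (S x)\<^sup>2)"
  proof -
    have cS2: "continuous_on dom_I (\<lambda>x. c\<^sup>2 * (S x)\<^sup>2)" by (intro continuous_intros o.cS)
    have "(LINT x|leb_I. (norm (e x))\<^sup>2) = (LINT x|leb_I. c\<^sup>2 * (S x)\<^sup>2)"
    proof (rule integral_cong_AE)
      show "AE x in leb_I. (norm (e x))\<^sup>2 = c\<^sup>2 * (S x)\<^sup>2"
        using eS AE_dom
        by eventually_elim (use c0 \<eta>1 in \<open>simp add: power_mult_distrib\<close>)
    qed (use meas(5) cont_measurable[OF cS2] in auto)
    also have "\<dots> = integral dom_I (\<lambda>x. c\<^sup>2 * (S x)\<^sup>2)" by (rule LINT_eq_integral[OF cont_integrable[OF cS2]])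
    finally show ?thesis by simp
  qed
  have area: "signed_area \<gamma> = c / 2 * integral dom_I (\<lambda>x. rotJ (\<gamma> x) \<bullet> \<tau> x)"
  proof -
    have eq: "\<gamma> x \<bullet> rotJ (g x) = - c * (rotJ (\<gamma> x) \<bullet> \<tau> x)" for x by (simp add: g\<tau> rotJ_simps rotJ_swap)
    have cc: "continuous_on dom_I (\<lambda>x. - c * (rotJ (\<gamma> x) \<bullet> \<tau> x))" by (intro continuous_intros cont o.c\<tau>)
    show ?thesis unfolding signed_area_def g_def[symmetric] eq LINT_eq_integral[OF cont_integrable[OF cc]] by simp
  qed
  show ?thesis
    using o.elastic_ode_axioms curv dual area
      H_norm_2_sq[of \<gamma>, folded g_def, folded h_def, unfolded i\<gamma> ig ih]
      H_norm_1_sq[of \<eta>, folded e_def, unfolded i\<eta> ie] by blast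
qed

text \<open>The summands match the hypotheses of \<open>bounded_ode\<close>. \<open>cm\<close>
  bounds the speed from below, by \<open>c_min\<close> in the first problem and by
  \<open>L0 / (2 * pi)\<close> in the second. For the norms \<open>n1\<close> of
  \<open>\<gamma>\<close> and \<open>n2\<close> of \<open>\<eta>\<close>,
  \<open>\<bar>n1\<bar>\<close> bounds \<open>c\<close>, and the last two quotients bound the mean
  squares of \<open>k\<close> and \<open>S\<close>.\<close>

definition data_bound :: "real \<Rightarrow> real \<Rightarrow> real \<Rightarrow> real \<Rightarrow> real \<Rightarrow> real \<Rightarrow> real" where
  "data_bound \<delta> lam L0 A0 n1 n2 = (let cm = min (c_min \<delta> lam A0) (L0 / (2 * pi)) in
    1 + \<bar>\<delta>\<bar> + lam + 1 / lam + \<bar>n1\<bar> + 1 / cm + n1\<^sup>2 / cm ^ 4 + n2\<^sup>2 / cm\<^sup>2)"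

text \<open>Sum of the bounds in \<open>hq_A\<close>, \<open>K_le\<close>, \<open>sup_W\<close> and
  \<open>sup_U\<close> and of those for \<open>c\<close> and \<open>a\<close>; 186 is 116 +
  70.\<close>

definition sup_bound :: "real \<Rightarrow> real \<Rightarrow> real" where
  "sup_bound A B = 1 + 9 * A + 9 * A ^ 4 + 186 * A ^ 5 + 64 * A\<^sup>2 * B + B"

lemma (in bounded_ode_mean) smooth_le':
  assumes B: "\<bar>a\<bar> \<le> B"
  shows "W_inf_norm (j + 2) \<gamma> + W_inf_norm (j + 1) \<eta> + W_inf_norm j psi0 + W_inf_norm j psi1
    \<le> ereal (smooth_bound \<delta> lam (sup_bound A B) j)"
proof (rule smooth_le)
  have B0: "0 \<le> B" using B by linarith
  have p: "0 \<le> A ^ 4" "0 \<le> A ^ 5" "0 \<le> A\<^sup>2 * B" using A0 B0 by simp_all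
  have aB: "64 * A\<^sup>2 * \<bar>a\<bar> \<le> 64 * A\<^sup>2 * B" using B A0 by (intro mult_left_mono) auto
  show "1 \<le> sup_bound A B" "c \<le> sup_bound A B" "\<bar>a\<bar> \<le> sup_bound A B" "norm K \<le> sup_bound A B"
    using p B B0 A0 cA K_le unfolding sup_bound_def by linarith+
  fix x assume x: "x \<in> dom_I"
  show "norm (\<gamma> x) \<le> sup_bound A B" "\<bar>W x\<bar> \<le> sup_bound A B" "\<bar>U x\<bar> \<le> sup_bound A B"
    using p B0 A0 hq_A(3)[OF x] sup_W[OF x] sup_U[OF x] aB unfolding sup_bound_def by linarith+
qed

lemma bounded_ode_of_norms:
  fixes \<delta> lam L0 A0 n1 n2 :: real
  assumes ode: "elastic_ode \<gamma> \<tau> \<eta> W U S k K c \<delta> lam a l" and L0: "L0 > 0"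
    and n1: "n1\<^sup>2 = integral dom_I (\<lambda>x. (norm (\<gamma> x))\<^sup>2) + 2 * pi * c\<^sup>2 + c ^ 4 * integral dom_I (\<lambda>x. (k x)\<^sup>2)"
    and n2: "n2\<^sup>2 = 2 * pi + c\<^sup>2 * integral dom_I (\<lambda>x. (S x)\<^sup>2)"
    and cm: "min (c_min \<delta> lam A0) (L0 / (2 * pi)) \<le> c"
    and area: "A0 = c / 2 * integral dom_I (\<lambda>x. rotJ (\<gamma> x) \<bullet> \<tau> x)"
  shows "bounded_ode_mean \<gamma> \<tau> \<eta> W U S k K c \<delta> lam a l (data_bound \<delta> lam L0 A0 n1 n2) (A0 / (pi * c))"
proof -
  interpret elastic_ode \<gamma> \<tau> \<eta> W U S k K c \<delta> lam a l by (rule ode)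
  define cm where "cm = min (c_min \<delta> lam A0) (L0 / (2 * pi))"
  have cm0: "cm > 0" using c_min_pos[OF lam0] L0 by (simp add: cm_def)
  have cmc: "cm \<le> c" using cm by (simp add: cm_def)
  define A where "A = data_bound \<delta> lam L0 A0 n1 n2"
  have A: "A = 1 + \<bar>\<delta>\<bar> + lam + 1 / lam + \<bar>n1\<bar> + 1 / cm + n1\<^sup>2 / cm ^ 4 + n2\<^sup>2 / cm\<^sup>2"
    by (simp add: A_def data_bound_def cm_def Let_def)
  have nn: "0 \<le> integral dom_I (\<lambda>x. (norm (\<gamma> x))\<^sup>2)" "0 \<le> integral dom_I (\<lambda>x. (k x)\<^sup>2)" "0 \<le> integral dom_I (\<lambda>x. (S x)\<^sup>2)"
    by (intro int_nonneg continuous_intros conts; simp)+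
  have pos: "0 \<le> \<bar>\<delta>\<bar>" "0 < lam" "0 < 1 / lam" "0 \<le> \<bar>n1\<bar>" "0 < 1 / cm" "0 \<le> n1\<^sup>2 / cm ^ 4" "0 \<le> n2\<^sup>2 / cm\<^sup>2"
    using lam0 cm0 by simp_all
  have "bounded_ode_mean \<gamma> \<tau> \<eta> W U S k K c \<delta> lam a l A (A0 / (pi * c))"
  proof
    show "1 \<le> A" "\<bar>\<delta>\<bar> \<le> A" "lam \<le> A" "1 / lam \<le> A" unfolding A using pos by linarith+
    show "c \<le> A"
    proof -
      have "0 \<le> c ^ 4 * integral dom_I (\<lambda>x. (k x)\<^sup>2)" using nn c0 by simp
      moreover have "1 * c\<^sup>2 \<le> 2 * pi * c\<^sup>2" using pi_gt3 by (intro mult_right_mono) auto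
      ultimately have "c\<^sup>2 \<le> n1\<^sup>2" using n1 nn by linarith
      then have "c \<le> \<bar>n1\<bar>" using c0 by (metis abs_le_square_iff abs_of_pos)
      then show ?thesis unfolding A using pos by linarith
    qed
    show "1 \<le> A * c"
    proof -
      have "1 / cm \<le> A" and A0': "0 \<le> A" unfolding A using pos by linarith+
      then have "1 / cm * cm \<le> A * c" using cmc cm0 by (intro mult_mono) auto
      then show ?thesis using cm0 by simp
    qed
    show "integral dom_I (\<lambda>x. (k x)\<^sup>2) \<le> A"
    proof -
      have "cm ^ 4 * integral dom_I (\<lambda>x. (k x)\<^sup>2) \<le> c ^ 4 * integral dom_I (\<lambda>x. (k x)\<^sup>2)"
        using cmc cm0 nn by (intro mult_right_mono power_mono) auto
      also have "\<dots> \<le> n1\<^sup>2"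
      proof -
        have "0 \<le> 2 * pi * c\<^sup>2" by simp
        then show ?thesis using n1 nn by linarith
      qed
      finally have "integral dom_I (\<lambda>x. (k x)\<^sup>2) \<le> n1\<^sup>2 / cm ^ 4" using cm0 by (simp add: le_divide_eq mult.commute)
      then show ?thesis unfolding A using pos by linarith
    qed
    show "integral dom_I (\<lambda>x. (S x)\<^sup>2) \<le> A"
    proof -
      have "cm\<^sup>2 * integral dom_I (\<lambda>x. (S x)\<^sup>2) \<le> c\<^sup>2 * integral dom_I (\<lambda>x. (S x)\<^sup>2)"
        using cmc cm0 nn by (intro mult_right_mono power_mono) auto
      also have "\<dots> \<le> n2\<^sup>2" using n2 pi_gt_zero by linarith
      finally have "integral dom_I (\<lambda>x. (S x)\<^sup>2) \<le> n2\<^sup>2 / cm\<^sup>2" using cm0 by (simp add: le_divide_eq mult.commute)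
      then show ?thesis unfolding A using pos by linarith
    qed
    show "integral dom_I (\<lambda>x. rotJ (\<gamma> x) \<bullet> \<tau> x) = 2 * pi * (A0 / (pi * c))"
      unfolding area using c0 by simp
  qed
  then show ?thesis by (simp add: A_def)
qed

section \<open>Uniform constants for the two variational problems\<close>

definition regular_with_bound ::
  "real \<Rightarrow> real \<Rightarrow> real \<Rightarrow> (real \<Rightarrow> real^2) \<Rightarrow> (real \<Rightarrow> real^2) \<Rightarrow> ((real \<Rightarrow> real) \<Rightarrow> real) \<Rightarrow> bool"
  where "regular_with_bound \<delta> lam M \<gamma> \<eta> \<Psi> \<longleftrightarrow>
    \<gamma> \<in> C_inf_per \<and> \<eta> \<in> C_inf_per \<and>
    (\<exists>\<psi>0\<in>C_inf_per. \<exists>\<psi>1\<in>C_inf_per.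
      (\<forall>f\<in>H_per 1. \<Psi> f = dual_repr \<gamma> \<psi>0 \<psi>1 f) \<and>
      (\<forall>k\<ge>1. W_inf_norm (k + 2) \<gamma> + W_inf_norm (k + 1) \<eta> + W_inf_norm k \<psi>0 + W_inf_norm k \<psi>1
        \<le> ereal (smooth_bound \<delta> lam M k)))"

lemma (in bounded_ode_mean) regular:
  assumes "\<bar>a\<bar> \<le> B"
    and "\<forall>f\<in>H_per 1. \<Psi> f = dual_repr \<gamma>
      (\<lambda>x. - (1 / 2) * (\<delta> * W x * S x * (rotJ (\<eta> x) \<bullet> \<tau> x) + lam * (S x)\<^sup>2))
      (\<lambda>x. \<delta> / 2 * (W x * (\<eta> x \<bullet> \<tau> x))) f"
  shows "regular_with_bound \<delta> lam (sup_bound A B) \<gamma> \<eta> \<Psi>"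
  unfolding regular_with_bound_def
  using smooth smooth_le'[OF assms(1)] assms(2)[folded psi0_def[abs_def] psi1_def[abs_def]] by blast

lemma critical_LM_regular:
  fixes \<delta> lam L0 A0 n1 n2 :: real
  assumes lam: "lam > 0" and L0: "L0 > 0"
  shows "\<exists>M. \<forall>\<gamma> \<eta> \<Psi>. \<gamma> \<in> H2_imm \<longrightarrow> \<eta> \<in> H_per 1 \<longrightarrow>
    (\<forall>x\<in>dom_I. norm (wderiv \<gamma> x) = curve_length \<gamma> / (2 * pi)) \<longrightarrow> (LINT x|leb_I. \<gamma> x) = 0 \<longrightarrow>
    critical_LM \<delta> lam A0 \<gamma> \<eta> \<Psi> \<longrightarrow> H_norm 2 \<gamma> = n1 \<longrightarrow> H_norm 1 \<eta> = n2 \<longrightarrow>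
    regular_with_bound \<delta> lam M \<gamma> \<eta> \<Psi>"
proof -
  define A where "A = data_bound \<delta> lam L0 A0 n1 n2"
  \<comment> \<open>The bound \<open>a_bound_of_l\<close> with \<open>l = 1\<close>.\<close>
  define B where "B = 720 * A ^ 6 + 64 * A\<^sup>2"
  show ?thesis
  proof (intro exI[of _ "sup_bound A B"] allI impI)
    fix \<gamma> \<eta> :: "real \<Rightarrow> real^2" and \<Psi> :: "(real \<Rightarrow> real) \<Rightarrow> real"
    assume \<gamma>: "\<gamma> \<in> H2_imm" and \<eta>: "\<eta> \<in> H_per 1"
      and sp: "\<forall>x\<in>dom_I. norm (wderiv \<gamma> x) = curve_length \<gamma> / (2 * pi)" and mean: "(LINT x|leb_I. \<gamma> x) = 0"
      and cr: "critical_LM \<delta> lam A0 \<gamma> \<eta> \<Psi>" and n: "H_norm 2 \<gamma> = n1" "H_norm 1 \<eta> = n2"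
    define c where "c = curve_length \<gamma> / (2 * pi)"
    obtain a where a: "\<forall>\<phi>\<in>H_per 2. \<forall>\<psi>\<in>H_per 1.
      dir_deriv (\<lambda>g. energy_LM \<delta> lam g \<eta>) \<gamma> \<phi> + dir_deriv (energy_LM \<delta> lam \<gamma>) \<eta> \<psi> +
      a * dir_deriv signed_area \<gamma> \<phi> + \<Psi> (S_deriv \<eta> \<psi>) = 0"
      and ar: "signed_area \<gamma> = A0" and S0: "\<forall>x\<in>dom_I. S_constr \<eta> x = 0" and \<Psi>: "\<Psi> \<in> H_neg1_per"
      using cr by (auto simp: critical_LM_def)
    have E: "energy_LM \<delta> lam g = (\<lambda>e. energy \<delta> lam g e + 1 * curve_length g)" for g
      by (simp add: fun_eq_iff energy_LM_def)
    have crit: "dir_deriv (\<lambda>g. energy \<delta> lam g \<eta> + 1 * curve_length g) \<gamma> \<phi> +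
      dir_deriv (\<lambda>e. energy \<delta> lam \<gamma> e + 1 * curve_length \<gamma>) \<eta> \<psi> +
      0 * dir_deriv curve_length \<gamma> \<phi> + a * dir_deriv signed_area \<gamma> \<phi> + \<Psi> (S_deriv \<eta> \<psi>) = 0"
      if "\<phi> \<in> H_per 2" "\<psi> \<in> H_per 1" for \<phi> \<psi>
      using bspec[OF bspec[OF a that(1)] that(2)] unfolding E by simp
    from critical_ode[OF lam \<gamma> \<eta> _ mean _ \<Psi> crit, of c] sp S0
    obtain \<tau> W U S k K where ode: "elastic_ode \<gamma> \<tau> \<eta> W U S k K c \<delta> lam a (1 + 0)"
      and dual: "\<forall>f\<in>H_per 1. \<Psi> f = dual_repr \<gamma>
      (\<lambda>x. - (1 / 2) * (\<delta> * W x * S x * (rotJ (\<eta> x) \<bullet> \<tau> x) + lam * (S x)\<^sup>2))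
      (\<lambda>x. \<delta> / 2 * (W x * (\<eta> x \<bullet> \<tau> x))) f"
      and n1: "(H_norm 2 \<gamma>)\<^sup>2 = integral dom_I (\<lambda>x. (norm (\<gamma> x))\<^sup>2) + 2 * pi * c\<^sup>2 + c ^ 4 * integral dom_I (\<lambda>x. (k x)\<^sup>2)"
      and n2: "(H_norm 1 \<eta>)\<^sup>2 = 2 * pi + c\<^sup>2 * integral dom_I (\<lambda>x. (S x)\<^sup>2)"
      and area: "signed_area \<gamma> = c / 2 * integral dom_I (\<lambda>x. rotJ (\<gamma> x) \<bullet> \<tau> x)"
      unfolding c_def by blast
    interpret o: elastic_ode \<gamma> \<tau> \<eta> W U S k K c \<delta> lam a "1 + 0" by (rule ode)
    have "c_min \<delta> lam A0 \<le> c"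
      by (rule o.c_min_le) (use area ar in \<open>simp_all add: o.hh_def[abs_def]\<close>)
    then have cm: "min (c_min \<delta> lam A0) (L0 / (2 * pi)) \<le> c" by simp
    interpret b: bounded_ode_mean \<gamma> \<tau> \<eta> W U S k K c \<delta> lam a "1 + 0" A "A0 / (pi * c)"
      unfolding A_def
      by (rule bounded_ode_of_norms[OF ode L0 n1[unfolded n] n2[unfolded n] cm area[unfolded ar]])
    have "\<bar>a\<bar> \<le> B" using b.a_bound_of_l by (simp add: B_def)
    then show "regular_with_bound \<delta> lam (sup_bound A B) \<gamma> \<eta> \<Psi>" using dual by (rule b.regular)
  qed
qed

lemma critical_length_regular:
  fixes \<delta> lam L0 A0 n1 n2 :: real
  assumes lam: "lam > 0" and L0: "L0 > 0"
  shows "\<exists>M. \<forall>\<gamma> \<eta> \<Psi>. \<gamma> \<in> H2_imm \<longrightarrow> \<eta> \<in> H_per 1 \<longrightarrow>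
    (\<forall>x\<in>dom_I. norm (wderiv \<gamma> x) = curve_length \<gamma> / (2 * pi)) \<longrightarrow> (LINT x|leb_I. \<gamma> x) = 0 \<longrightarrow>
    critical_length \<delta> lam L0 A0 \<gamma> \<eta> \<Psi> \<longrightarrow> \<not> (\<exists>c. AE x in leb_I. curvature \<gamma> x = c) \<longrightarrow>
    H_norm 2 \<gamma> = n1 \<longrightarrow> H_norm 1 \<eta> = n2 \<longrightarrow>
    regular_with_bound \<delta> lam M \<gamma> \<eta> \<Psi>"
proof -
  \<comment> \<open>The maximum makes \<open>1 \<le> A\<close> available before a curve is given;
    once there is one, \<open>data_bound\<close> is itself at least 1 and equals
    \<open>A\<close>.\<close>
  define A where "A = max 1 (data_bound \<delta> lam L0 A0 n1 n2)"
  define c where "c = L0 / (2 * pi)"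
  define R where "R = A0 / (pi * c)"
  \<comment> \<open>The squared norm of \<open>\<gamma>\<close> without the constant contribution of
    its first derivative. \<open>length_multiplier_bound\<close> needs this number exactly, which is
    why the norms are fixed at \<open>n1\<close> and \<open>n2\<close> rather than bounded by
    them.\<close>
  define H where "H = n1\<^sup>2 - 2 * pi * c\<^sup>2"
  obtain B where B: "\<And>\<gamma> \<tau> \<eta> W U S k K a l. bounded_ode_mean \<gamma> \<tau> \<eta> W U S k K c \<delta> lam a l A R \<Longrightarrow>
    integral dom_I (\<lambda>x. (norm (\<gamma> x))\<^sup>2) + c ^ 4 * integral dom_I (\<lambda>x. (k x)\<^sup>2) = H \<Longrightarrow>
    \<not> (\<exists>\<kappa>. \<forall>x\<in>dom_I. k x = \<kappa>) \<Longrightarrow> \<bar>a\<bar> \<le> B"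
  proof (cases "R = 0")
    case True
    then show ?thesis using that[of "1680 * A ^ 6"] bounded_ode_mean.a_bound_zero_mean by blast
  next
    case False
    have "1 \<le> A" by (simp add: A_def)
    from length_multiplier_bound[OF this False, of c \<delta> lam H] show ?thesis using that by blast
  qed
  show ?thesis
  proof (intro exI[of _ "sup_bound A B"] allI impI)
    fix \<gamma> \<eta> :: "real \<Rightarrow> real^2" and \<Psi> :: "(real \<Rightarrow> real) \<Rightarrow> real"
    assume \<gamma>: "\<gamma> \<in> H2_imm" and \<eta>: "\<eta> \<in> H_per 1"
      and sp: "\<forall>x\<in>dom_I. norm (wderiv \<gamma> x) = curve_length \<gamma> / (2 * pi)" and mean: "(LINT x|leb_I. \<gamma> x) = 0"
      and cr: "critical_length \<delta> lam L0 A0 \<gamma> \<eta> \<Psi>" and nc: "\<not> (\<exists>c. AE x in leb_I. curvature \<gamma> x = c)"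
      and n: "H_norm 2 \<gamma> = n1" "H_norm 1 \<eta> = n2"
    obtain a l where al: "\<forall>\<phi>\<in>H_per 2. \<forall>\<psi>\<in>H_per 1.
      dir_deriv (\<lambda>g. energy \<delta> lam g \<eta>) \<gamma> \<phi> + dir_deriv (energy \<delta> lam \<gamma>) \<eta> \<psi> +
      l * dir_deriv curve_length \<gamma> \<phi> + a * dir_deriv signed_area \<gamma> \<phi> + \<Psi> (S_deriv \<eta> \<psi>) = 0"
      and len: "curve_length \<gamma> = L0"
      and ar: "signed_area \<gamma> = A0" and S0: "\<forall>x\<in>dom_I. S_constr \<eta> x = 0" and \<Psi>: "\<Psi> \<in> H_neg1_per"
      using cr by (auto simp: critical_length_def)
    have crit: "dir_deriv (\<lambda>g. energy \<delta> lam g \<eta> + 0 * curve_length g) \<gamma> \<phi> +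
      dir_deriv (\<lambda>e. energy \<delta> lam \<gamma> e + 0 * curve_length \<gamma>) \<eta> \<psi> +
      l * dir_deriv curve_length \<gamma> \<phi> + a * dir_deriv signed_area \<gamma> \<phi> + \<Psi> (S_deriv \<eta> \<psi>) = 0"
      if "\<phi> \<in> H_per 2" "\<psi> \<in> H_per 1" for \<phi> \<psi>
      using bspec[OF bspec[OF al that(1)] that(2)] by simp
    from critical_ode[OF lam \<gamma> \<eta> _ mean _ \<Psi> crit, of c] sp S0
    obtain \<tau> W U S k K where ode: "elastic_ode \<gamma> \<tau> \<eta> W U S k K c \<delta> lam a (0 + l)"
      and curv: "AE x in leb_I. curvature \<gamma> x = k x"
      and dual: "\<forall>f\<in>H_per 1. \<Psi> f = dual_repr \<gamma>
      (\<lambda>x. - (1 / 2) * (\<delta> * W x * S x * (rotJ (\<eta> x) \<bullet> \<tau> x) + lam * (S x)\<^sup>2))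
      (\<lambda>x. \<delta> / 2 * (W x * (\<eta> x \<bullet> \<tau> x))) f"
      and n1: "(H_norm 2 \<gamma>)\<^sup>2 = integral dom_I (\<lambda>x. (norm (\<gamma> x))\<^sup>2) + 2 * pi * c\<^sup>2 + c ^ 4 * integral dom_I (\<lambda>x. (k x)\<^sup>2)"
      and n2: "(H_norm 1 \<eta>)\<^sup>2 = 2 * pi + c\<^sup>2 * integral dom_I (\<lambda>x. (S x)\<^sup>2)"
      and area: "signed_area \<gamma> = c / 2 * integral dom_I (\<lambda>x. rotJ (\<gamma> x) \<bullet> \<tau> x)"
      unfolding c_def len by blast
    have cm: "min (c_min \<delta> lam A0) (L0 / (2 * pi)) \<le> c" by (simp add: c_def)
    have b0: "bounded_ode_mean \<gamma> \<tau> \<eta> W U S k K c \<delta> lam a (0 + l) (data_bound \<delta> lam L0 A0 n1 n2) R"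
      unfolding R_def
      by (rule bounded_ode_of_norms[OF ode L0 n1[unfolded n] n2[unfolded n] cm area[unfolded ar]])
    then have "1 \<le> data_bound \<delta> lam L0 A0 n1 n2"
      by (simp add: bounded_ode_mean_def bounded_ode_def bounded_ode_axioms_def)
    then have "A = data_bound \<delta> lam L0 A0 n1 n2" by (simp add: A_def)
    then interpret b: bounded_ode_mean \<gamma> \<tau> \<eta> W U S k K c \<delta> lam a "0 + l" A R using b0 by simp
    have "\<bar>a\<bar> \<le> B"
    proof (rule B[OF b.bounded_ode_mean_axioms])
      show "integral dom_I (\<lambda>x. (norm (\<gamma> x))\<^sup>2) + c ^ 4 * integral dom_I (\<lambda>x. (k x)\<^sup>2) = H"
        using n1 n by (simp add: H_def)
      show "\<not> (\<exists>\<kappa>. \<forall>x\<in>dom_I. k x = \<kappa>)"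
      proof
        assume "\<exists>\<kappa>. \<forall>x\<in>dom_I. k x = \<kappa>"
        then obtain \<kappa> where \<kappa>: "\<forall>x\<in>dom_I. k x = \<kappa>" by blast
        have "AE x in leb_I. x \<in> dom_I" by (intro AE_I2) simp
        then have "AE x in leb_I. curvature \<gamma> x = \<kappa>" using curv by eventually_elim (use \<kappa> in simp)
        then show False using nc by blast
      qed
    qed
    then show "regular_with_bound \<delta> lam (sup_bound A B) \<gamma> \<eta> \<Psi>" using dual by (rule b.regular)
  qed
qed

theorem theorem4p2:
  fixes \<delta> lam L0 A0 :: real
  assumes "lam > 0" and "L0 > 0"
  shows "\<exists>C :: nat \<Rightarrow> real \<Rightarrow> real \<Rightarrow> real \<Rightarrow> real.
    \<forall>(\<gamma> :: real \<Rightarrow> real^2) (\<eta> :: real \<Rightarrow> real^2) (\<Psi> :: (real \<Rightarrow> real) \<Rightarrow> real).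
      \<gamma> \<in> H2_imm \<and> \<eta> \<in> H_per 1 \<and>
      (\<forall>x\<in>dom_I. norm (wderiv \<gamma> x) = curve_length \<gamma> / (2 * pi)) \<and>
      (LINT x|leb_I. \<gamma> x) = 0 \<and>
      (critical_LM \<delta> lam A0 \<gamma> \<eta> \<Psi> \<or>
       critical_length \<delta> lam L0 A0 \<gamma> \<eta> \<Psi> \<and>
       A0 \<in> {- (L0\<^sup>2 / (4 * pi))..L0\<^sup>2 / (4 * pi)} \<and>
       \<not> (\<exists>c. AE x in leb_I. curvature \<gamma> x = c))
      \<longrightarrow>
      \<gamma> \<in> C_inf_per \<and> \<eta> \<in> C_inf_per \<and>
      (\<exists>\<psi>0\<in>C_inf_per. \<exists>\<psi>1\<in>C_inf_per.
        (\<forall>f\<in>H_per 1. \<Psi> f = dual_repr \<gamma> \<psi>0 \<psi>1 f) \<and>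
        (\<forall>k\<ge>1. W_inf_norm (k + 2) \<gamma> + W_inf_norm (k + 1) \<eta> +
                 W_inf_norm k \<psi>0 + W_inf_norm k \<psi>1
               \<le> ereal (C k (H_norm 2 \<gamma>) (H_norm 1 \<eta>) (H_neg1_norm \<Psi>))))"
proof -
  obtain M1 where M1: "\<And>n1 n2 \<gamma> \<eta> \<Psi>. \<gamma> \<in> H2_imm \<Longrightarrow> \<eta> \<in> H_per 1 \<Longrightarrow>
    (\<forall>x\<in>dom_I. norm (wderiv \<gamma> x) = curve_length \<gamma> / (2 * pi)) \<Longrightarrow> (LINT x|leb_I. \<gamma> x) = 0 \<Longrightarrow>
    critical_LM \<delta> lam A0 \<gamma> \<eta> \<Psi> \<Longrightarrow> H_norm 2 \<gamma> = n1 \<Longrightarrow> H_norm 1 \<eta> = n2 \<Longrightarrow>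
    regular_with_bound \<delta> lam (M1 n1 n2) \<gamma> \<eta> \<Psi>"
    using critical_LM_regular[OF assms, of \<delta> A0] by metis
  obtain M2 where M2: "\<And>n1 n2 \<gamma> \<eta> \<Psi>. \<gamma> \<in> H2_imm \<Longrightarrow> \<eta> \<in> H_per 1 \<Longrightarrow>
    (\<forall>x\<in>dom_I. norm (wderiv \<gamma> x) = curve_length \<gamma> / (2 * pi)) \<Longrightarrow> (LINT x|leb_I. \<gamma> x) = 0 \<Longrightarrow>
    critical_length \<delta> lam L0 A0 \<gamma> \<eta> \<Psi> \<Longrightarrow> \<not> (\<exists>c. AE x in leb_I. curvature \<gamma> x = c) \<Longrightarrow>
    H_norm 2 \<gamma> = n1 \<Longrightarrow> H_norm 1 \<eta> = n2 \<Longrightarrow> regular_with_bound \<delta> lam (M2 n1 n2) \<gamma> \<eta> \<Psi>"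
    using critical_length_regular[OF assms, of \<delta> A0] by metis
  \<comment> \<open>One function has to serve both problems, hence the maximum; \<open>M1\<close>
    and \<open>M2\<close> are already functions of the values of the norms.\<close>
  define C where "C k n1 n2 (n3::real) = max (smooth_bound \<delta> lam (M1 n1 n2) k) (smooth_bound \<delta> lam (M2 n1 n2) k)" for k n1 n2 n3
  have fin: "\<gamma> \<in> C_inf_per \<and> \<eta> \<in> C_inf_per \<and>
      (\<exists>\<psi>0\<in>C_inf_per. \<exists>\<psi>1\<in>C_inf_per.
        (\<forall>f\<in>H_per 1. \<Psi> f = dual_repr \<gamma> \<psi>0 \<psi>1 f) \<and>
        (\<forall>k\<ge>1. W_inf_norm (k + 2) \<gamma> + W_inf_norm (k + 1) \<eta> +
                 W_inf_norm k \<psi>0 + W_inf_norm k \<psi>1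
               \<le> ereal (C k (H_norm 2 \<gamma>) (H_norm 1 \<eta>) (H_neg1_norm \<Psi>))))"
    if r: "regular_with_bound \<delta> lam M \<gamma> \<eta> \<Psi>"
      and M: "M = M1 (H_norm 2 \<gamma>) (H_norm 1 \<eta>) \<or> M = M2 (H_norm 2 \<gamma>) (H_norm 1 \<eta>)" for M \<gamma> \<eta> \<Psi>
  proof -
    have "smooth_bound \<delta> lam M k \<le> C k (H_norm 2 \<gamma>) (H_norm 1 \<eta>) (H_neg1_norm \<Psi>)" for k
      using M by (auto simp: C_def)
    then have "x \<le> ereal (smooth_bound \<delta> lam M k) \<Longrightarrow>
        x \<le> ereal (C k (H_norm 2 \<gamma>) (H_norm 1 \<eta>) (H_neg1_norm \<Psi>))" for x k
      by (metis ereal_less_eq(3) order_trans)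
    then show ?thesis using r unfolding regular_with_bound_def by blast
  qed
  show ?thesis
  proof (intro exI[of _ C] allI impI)
    fix \<gamma> \<eta> :: "real \<Rightarrow> real^2" and \<Psi> :: "(real \<Rightarrow> real) \<Rightarrow> real"
    assume "\<gamma> \<in> H2_imm \<and> \<eta> \<in> H_per 1 \<and>
      (\<forall>x\<in>dom_I. norm (wderiv \<gamma> x) = curve_length \<gamma> / (2 * pi)) \<and>
      (LINT x|leb_I. \<gamma> x) = 0 \<and>
      (critical_LM \<delta> lam A0 \<gamma> \<eta> \<Psi> \<or>
       critical_length \<delta> lam L0 A0 \<gamma> \<eta> \<Psi> \<and>
       A0 \<in> {- (L0\<^sup>2 / (4 * pi))..L0\<^sup>2 / (4 * pi)} \<and>
       \<not> (\<exists>c. AE x in leb_I. curvature \<gamma> x = c))"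
    then have "regular_with_bound \<delta> lam (M1 (H_norm 2 \<gamma>) (H_norm 1 \<eta>)) \<gamma> \<eta> \<Psi> \<or>
      regular_with_bound \<delta> lam (M2 (H_norm 2 \<gamma>) (H_norm 1 \<eta>)) \<gamma> \<eta> \<Psi>"
      using M1[of \<gamma> \<eta> \<Psi>] M2[of \<gamma> \<eta> \<Psi>] by blast
    then show "\<gamma> \<in> C_inf_per \<and> \<eta> \<in> C_inf_per \<and>
      (\<exists>\<psi>0\<in>C_inf_per. \<exists>\<psi>1\<in>C_inf_per.
        (\<forall>f\<in>H_per 1. \<Psi> f = dual_repr \<gamma> \<psi>0 \<psi>1 f) \<and>
        (\<forall>k\<ge>1. W_inf_norm (k + 2) \<gamma> + W_inf_norm (k + 1) \<eta> +
                 W_inf_norm k \<psi>0 + W_inf_norm k \<psi>1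
               \<le> ereal (C k (H_norm 2 \<gamma>) (H_norm 1 \<eta>) (H_neg1_norm \<Psi>))))"
      using fin by blast
  qed
qed

end
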